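(* Let $\alpha\in\mathbb{R}\setminus\mathbb{Q}$, $\omega=(1,\alpha)$, let $\mathcal{A}\subset\mathbb{R}$ be open, let $g:\mathcal{A}\to\mathbb{R}$ be real analytic, and let $f:\mathbb{T}^2\to\mathbb{R}$ be real analytic, with an analytic extension to the strip $\Sigma_\xi$ for some $\xi>0$. Let $f_0$ be the average (zeroth Fourier coefficient) of $f$, and assume that there is $c\in\mathcal{A}$ which is a zero of odd order $\mathfrak{n}>1$ of the function $x\mapsto g(x)-f_0$. Consider the ordinary differential equation $$\varepsilon\ddot x+\dot x+\varepsilon g(x)=\varepsilon f(\omega t). \qquad ( * )$$ Let $p_n/q_n$ be the convergents of $\alpha$ and let $$C_0=\frac{\mathfrak{n}+1}{4(\mathfrak{n}^2+2\mathfrak{n}-1)}\,\xi .$$ Then there exists a constant $\eta_0>0$ such that, setting $a_0=\eta_0^{1/(\mathfrak{n}+1)}$, the following holds. Let $N\in\mathbb{N}$ be such that $$e^{-C_0x}\le\frac{a_0}{x^{\mathfrak{n}}}\qquad\text{for all real }x\ge q_N,$$ and set $$\mathfrak{I}_n=\Big[e^{-C_0q_{N+n}},\ \frac{a_0}{q_{N+n}^{\mathfrak{n}}}\Big],\qquad \mathfrak{J}=\mathrm{Cl}\Big(\bigcup_{n=0}^{\infty}\mathfrak{I}_n\Big),$$ where $\mathrm{Cl}$ denotes closure. Then for all $\varepsilon\in\mathfrak{J}$ there is at least one quasi-periodic solution $x(t,\varepsilon)=c+X(\omega t,\varepsilon)$ to $( * )$, such that $X(\psi,\varepsilon)$ is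 analytic in $\psi$ in the strip $\Sigma_{\xi'}$ for every $0<\xi'<\xi/4$, is continuous in $\varepsilon$ in the sense of Whitney on $\mathfrak{J}$, and goes to zero as $\varepsilon\to0$.
   Context: $\mathbb{T}=\mathbb{R}/2\pi\mathbb{Z}$. For $\xi>0$, $\Sigma_\xi=\{\psi=(\psi_1,\psi_2)\in\mathbb{C}^2:\ \mathrm{Re}\,\psi_i\in\mathbb{T},\ |\mathrm{Im}\,\psi_i|\le\xi,\ i=1,2\}$. A point $c$ is a zero of order $\mathfrak{n}$ of $g(x)-f_0$ if $g(c)=f_0$, $g^{(j)}(c)=0$ for $j=1,\dots,\mathfrak{n}-1$, and $g^{(\mathfrak{n})}(c)\ne0$. The convergents $p_n/q_n$ of $\alpha$ are those of its simple continued fraction $[a_0,a_1,a_2,\dots]$ (these partial quotients are unrelated to the constant $a_0$ of the claim): $q_0=1$, $q_1=a_1$, $q_k=a_kq_{k-1}+q_{k-2}$ for $k\ge2$, and $p_k/q_k=[a_0,\dots,a_k]$. Continuity in the sense of Whitney on a closed set $J\subset\mathbb{R}$ means being defined and continuous on $J$ (so that the function admits a continuous extension to all of $\mathbb{R}$). *)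

theory Defs
  imports "HOL-Analysis.Analysis"
begin

section \<open>Continued fractions\<close>

text \<open>Complete quotients of \<open>\<alpha>\<close>: \<open>\<alpha>\<^sub>0 = \<alpha>\<close> and \<open>\<alpha>\<^sub>k = \<lfloor>\<alpha>\<^sub>k\<rfloor> + 1 / \<alpha>\<^sub>k\<^sub>+\<^sub>1\<close>. For irrational
  \<open>\<alpha>\<close> the fractional part is never zero, so the division is harmless.\<close>

primrec cf_complete_quotient :: "real \<Rightarrow> nat \<Rightarrow> real" where
  "cf_complete_quotient \<alpha> 0 = \<alpha>"
| "cf_complete_quotient \<alpha> (Suc k) = 1 / frac (cf_complete_quotient \<alpha> k)"

definition cf_partial_quotient :: "real \<Rightarrow> nat \<Rightarrow> int" where
  "cf_partial_quotient \<alpha> k = \<lfloor>cf_complete_quotient \<alpha> k\<rfloor>"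

fun cf_denom :: "real \<Rightarrow> nat \<Rightarrow> int" where
  "cf_denom \<alpha> 0 = 1"
| "cf_denom \<alpha> (Suc 0) = cf_partial_quotient \<alpha> 1"
| "cf_denom \<alpha> (Suc (Suc k)) =
     cf_partial_quotient \<alpha> (Suc (Suc k)) * cf_denom \<alpha> (Suc k) + cf_denom \<alpha> k"

section \<open>Analyticity\<close>

text \<open>For open \<open>A\<close> (the only use) the values of \<open>g\<close> outside \<open>A\<close> are irrelevant, because
  \<open>has_fps_expansion\<close> only concerns a neighbourhood of \<open>0\<close>.\<close>

definition real_analytic_on :: "(real \<Rightarrow> real) \<Rightarrow> real set \<Rightarrow> bool" where
  "real_analytic_on g A \<longleftrightarrow> (\<forall>x\<in>A. \<exists>G. (\<lambda>h. g (x + h)) has_fps_expansion G)"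

text \<open>Joint analyticity of a function of two variables, for real as well as for complex
  variables: every point of \<open>S\<close> is the centre of a polydisc (not required to lie inside \<open>S\<close>)
  on which the function is the sum of a double power series. As for \<open>analytic_on\<close>,
  analyticity on a set that is not open is analyticity on a neighbourhood of that set.\<close>

definition analytic2_on ::
  "('a::real_normed_field \<times> 'a \<Rightarrow> 'a) \<Rightarrow> ('a \<times> 'a) set \<Rightarrow> bool" where
  "analytic2_on F S \<longleftrightarrow>
     (\<forall>(w1, w2)\<in>S. \<exists>r>0. \<exists>a :: nat \<Rightarrow> nat \<Rightarrow> 'a.
        \<forall>z1 z2. norm (z1 - w1) < r \<longrightarrow> norm (z2 - w2) < r \<longrightarrow>
          ((\<lambda>(j, k). a j k * (z1 - w1) ^ j * (z2 - w2) ^ k) has_sum F (z1, z2)) UNIV)"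

section \<open>Functions on the torus\<close>

text \<open>A function on the torus \<open>\<real>\<^sup>2 / (2\<pi>\<int>)\<^sup>2\<close>, or on a complex strip around it, is a function on
  \<open>\<real>\<^sup>2\<close>, or on the corresponding strip in \<open>\<complex>\<^sup>2\<close>, of period \<open>2\<pi>\<close> in each variable.\<close>

definition torus_periodic_on ::
  "('a::real_normed_field \<times> 'a) set \<Rightarrow> ('a \<times> 'a \<Rightarrow> 'a) \<Rightarrow> bool" where
  "torus_periodic_on S F \<longleftrightarrow>
     (\<forall>(z1, z2)\<in>S. F (z1 + of_real (2 * pi), z2) = F (z1, z2) \<and>
                   F (z1, z2 + of_real (2 * pi)) = F (z1, z2))"

definition strip :: "real \<Rightarrow> (complex \<times> complex) set" where
  "strip \<xi> = {(z1, z2). \<bar>Im z1\<bar> \<le> \<xi> \<and> \<bar>Im z2\<bar> \<le> \<xi>}"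

definition analytic_extension_to_strip ::
  "(real \<times> real \<Rightarrow> real) \<Rightarrow> real \<Rightarrow> (complex \<times> complex \<Rightarrow> complex) \<Rightarrow> bool" where
  "analytic_extension_to_strip f \<xi> F \<longleftrightarrow>
     torus_periodic_on (strip \<xi>) F \<and> analytic2_on F (strip \<xi>) \<and>
     (\<forall>s t. F (of_real s, of_real t) = of_real (f (s, t)))"

definition torus_average :: "(real \<times> real \<Rightarrow> real) \<Rightarrow> real" where
  "torus_average f = integral (cbox (0, 0) (2 * pi, 2 * pi)) f / (2 * pi) ^ 2"

section \<open>Zeros and solutions\<close>

definition zero_of_order :: "(real \<Rightarrow> real) \<Rightarrow> real \<Rightarrow> real \<Rightarrow> nat \<Rightarrow> bool" where
  "zero_of_order g f0 c n \<longleftrightarrow>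
     g c = f0 \<and> (\<forall>j\<in>{1..n - 1}. (deriv ^^ j) g c = 0) \<and> (deriv ^^ n) g c \<noteq> 0"

definition ode_solution ::
  "(real \<Rightarrow> real) \<Rightarrow> real set \<Rightarrow> (real \<times> real \<Rightarrow> real) \<Rightarrow> real \<times> real \<Rightarrow> real \<Rightarrow> (real \<Rightarrow> real) \<Rightarrow> bool"
  where
  "ode_solution g A f \<omega> \<epsilon> x \<longleftrightarrow>
     (\<exists>x' x''. \<forall>t. x t \<in> A \<and>
        (x has_real_derivative x' t) (at t) \<and> (x' has_real_derivative x'' t) (at t) \<and>
        \<epsilon> * x'' t + x' t + \<epsilon> * g (x t) = \<epsilon> * f (t *\<^sub>R \<omega>))"

end

theory Submission
  imports Defs "HOL-Complex_Analysis.Complex_Analysis"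
begin

text \<open>
  Put \<open>s = \<xi> / 4\<close>, \<open>L = \<epsilon> D\<^sup>2 + D\<close> with \<open>D\<close> the derivative along the flow, \<open>G(x) = g(c + x) - f0\<close> and let \<open>q\<close>
  be the denominator with \<open>\<epsilon> \<in> \<II>\<^sub>n\<close>. The equation \<open>L X + \<epsilon> G(X) = \<epsilon> (f - f0)\<close> is solved in the Banach algebra
  of absolutely convergent Fourier series on the strip of width \<open>s\<close>. Below the frequency \<open>q\<close> the
  divisors are at least \<open>1 / (2 q)\<close>, and the remaining modes of \<open>f\<close> have size \<open>exp (- 2 s q)\<close>, which the
  choice of \<open>C0\<close> makes small compared with \<open>\<epsilon> ^ (\<nn> + 1)\<close>. A first approximation \<open>v\<close> consists of the
  low modes of \<open>\<epsilon> L\<^sup>-\<^sup>1 f\<close> and a constant that makes the mean of \<open>G(v)\<close> vanish; since \<open>\<nn>\<close> is odd,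
  \<open>G\<close> is monotone and the mean \<open>\<beta>\<close> of \<open>G'(v)\<close> has size at least of order \<open>\<epsilon> ^ (\<nn> - 1)\<close>. The linearised operator
  \<open>L + \<epsilon> G'(v)\<close> is conjugated to \<open>L + \<epsilon> \<beta>\<close> up to small terms, and the dissipation bounds the inverse of
  \<open>L + \<epsilon> \<beta>\<close> by \<open>2 / (\<epsilon> \<bar>\<beta>\<bar>)\<close> at all frequencies, so that a contraction corrects \<open>v\<close> to a solution.

  By monotonicity of \<open>G\<close> small solutions are unique, and a bounded family of solutions is compact on
  every smaller strip; together this gives continuity in \<open>\<epsilon>\<close>.
\<close>

text \<open>The number \<alpha> is merely irrational, so nothing bounds the divisors at or above the
  frequency \<open>q\<close>; instead the two ends of the interval containing \<epsilon> are played
  against each other. With \<delta> of order \<open>\<epsilon> q\<close>, the upper end makes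
  \<open>\<delta> ^ n\<close> small compared with \<open>\<epsilon> ^ (n - 1)\<close>, hence with
  \<beta>, and the lower end makes the tail of high modes small compared with
  \<open>\<bar>\<beta>\<bar> * \<delta>\<^sup>2\<close>. The obstacle is that \<open>G'(v)\<close>
  is only known to be at most of order \<open>\<delta> ^ (n - 1)\<close> and \<beta> only to be at
  least of order \<open>\<epsilon> ^ (n - 1)\<close>, so the oscillating part of
  \<open>G'(v)\<close> is no perturbation of \<open>L + \<epsilon> \<beta>\<close>; one averaging
  step trades its low modes for errors of order \<open>\<delta> ^ n\<close>. The factor
  \<open>exp (- 2 s q)\<close> is gained by expanding on the width \<open>3 s < \<xi>\<close> and
  solving on the width \<open>s\<close>. Since \<open>C0 * (n + 2) \<le> \<xi> / 2\<close>, it is at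
  most \<open>exp (- C0 q) ^ (n + 2)\<close>; one factor is bounded by \<open>a0\<close>, the others
  by \<epsilon>. Finally \<open>\<eta>0\<close> is taken as an \<open>(n + 1)\<close>-st power, so
  that \<open>a0\<close> is the smallness threshold itself.\<close>

no_notation Infinite_Set_Sum.abs_summable_on (infix \<open>abs'_summable'_on\<close> 50)

section \<open>A Banach algebra of absolutely convergent Fourier series\<close>

definition conv :: "('i::ab_group_add \<Rightarrow> complex) \<Rightarrow> ('i \<Rightarrow> complex) \<Rightarrow> 'i \<Rightarrow> complex" where
  "conv u v n = (\<Sum>\<^sub>\<infinity>m. u m * v (n - m))"

lemma infsum_shift:
  fixes f :: "'i::ab_group_add \<Rightarrow> 'b::{comm_monoid_add,t2_space}"
  shows "(\<Sum>\<^sub>\<infinity>n. f (n - m)) = infsum f UNIV" "(\<lambda>n. f (n - m)) summable_on UNIV \<longleftrightarrow> f summable_on UNIV"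
proof -
  have bij: "bij_betw (\<lambda>n. n - m) UNIV UNIV"
    by (rule bij_betwI[of _ _ _ "\<lambda>n. n + m"]) auto
  show "(\<Sum>\<^sub>\<infinity>n. f (n - m)) = infsum f UNIV"
    by (rule infsum_reindex_bij_betw[OF bij])
  show "(\<lambda>n. f (n - m)) summable_on UNIV \<longleftrightarrow> f summable_on UNIV"
    by (rule summable_on_reindex_bij_betw[OF bij])
qed

lemma conv_pair_summable:
  fixes u v :: "'i::ab_group_add \<Rightarrow> 'b::{real_normed_div_algebra,banach}"
  assumes "u abs_summable_on UNIV" "v abs_summable_on UNIV"
  shows "(\<lambda>(m, n). u m * v (n - m)) abs_summable_on UNIV \<times> UNIV"
proof -
  have "(\<lambda>n. norm (u m) * norm (v (n - m))) summable_on UNIV" for m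
    using infsum_shift(2)[of "\<lambda>n. norm (v n)" m] assms(2) by (intro summable_on_cmult_right) simp
  moreover have "(\<Sum>\<^sub>\<infinity>n. norm (u m) * norm (v (n - m))) = norm (u m) * infsum (\<lambda>n. norm (v n)) UNIV" for m
    by (simp add: infsum_cmult_right' infsum_shift(1)[of "\<lambda>n. norm (v n)"])
  moreover have "(\<lambda>m. norm (u m) * infsum (\<lambda>n. norm (v n)) UNIV) summable_on UNIV"
    using assms(1) by (intro summable_on_cmult_left)
  moreover have "infsum (\<lambda>n. norm (v n)) UNIV \<ge> 0"
    by (intro infsum_nonneg) auto
  ultimately show ?thesis
    unfolding Infinite_Sum.abs_summable_on_Sigma_iff by (simp add: norm_mult)
qed

text \<open>The same Fubini argument is used twice: with real families, where it yields the
  submultiplicativity of the weighted norm, and with complex families, where it makes evaluation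
  multiplicative.\<close>

lemma conv_pair_infsum:
  fixes u v :: "'i::ab_group_add \<Rightarrow> 'b::{real_normed_field,banach}"
  assumes "u abs_summable_on UNIV" "v abs_summable_on UNIV"
  shows "(\<Sum>\<^sub>\<infinity>n. \<Sum>\<^sub>\<infinity>m. u m * v (n - m)) = infsum u UNIV * infsum v UNIV"
    and "(\<lambda>n. \<Sum>\<^sub>\<infinity>m. u m * v (n - m)) summable_on UNIV"
    and "(\<lambda>m. u m * v (n - m)) summable_on UNIV"
proof -
  have s: "(\<lambda>(m, n). u m * v (n - m)) summable_on UNIV \<times> UNIV"
    using conv_pair_summable[OF assms] abs_summable_summable by blast
  have s': "(\<lambda>(n, m). u m * v (n - m)) summable_on UNIV \<times> UNIV"
    using s by (subst summable_on_swap) (simp add: case_prod_unfold)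
  have "(\<Sum>\<^sub>\<infinity>n. \<Sum>\<^sub>\<infinity>m. u m * v (n - m)) = (\<Sum>\<^sub>\<infinity>m. \<Sum>\<^sub>\<infinity>n. u m * v (n - m))"
    by (rule infsum_swap_banach[symmetric]) (use s in simp)
  also have "\<dots> = (\<Sum>\<^sub>\<infinity>m. u m * infsum v UNIV)"
    by (simp add: infsum_cmult_right' infsum_shift(1)[of v])
  finally show "(\<Sum>\<^sub>\<infinity>n. \<Sum>\<^sub>\<infinity>m. u m * v (n - m)) = infsum u UNIV * infsum v UNIV"
    by (simp add: infsum_cmult_left')
  show "(\<lambda>n. \<Sum>\<^sub>\<infinity>m. u m * v (n - m)) summable_on UNIV"
    using summable_on_Sigma_banach[of "\<lambda>n m. u m * v (n - m)" UNIV "\<lambda>_. UNIV"] s' by simp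
  have "(\<lambda>(n, m). u m * v (n - m)) abs_summable_on UNIV \<times> UNIV"
    using conv_pair_summable[OF assms] by (subst summable_on_swap) (simp add: case_prod_unfold)
  then have "(\<lambda>m. u m * v (n - m)) abs_summable_on UNIV"
    unfolding Infinite_Sum.abs_summable_on_Sigma_iff by simp
  then show "(\<lambda>m. u m * v (n - m)) summable_on UNIV"
    by (rule abs_summable_summable)
qed

lemma conv_commute: "conv u v = conv v (u :: 'i::ab_group_add \<Rightarrow> complex)"
proof
  fix n :: 'i
  have "n - (n - m) = m" for m
    by simp
  then have bij: "bij_betw (\<lambda>m. n - m) UNIV UNIV"
    by (intro bij_betwI[of _ _ _ "\<lambda>m. n - m"]) auto
  show "conv u v n = conv v u n"
    unfolding conv_def using infsum_reindex_bij_betw[OF bij, of "\<lambda>m. u m * v (n - m)"]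
    by (simp add: mult.commute)
qed

lemma conv_assoc:
  assumes u: "u abs_summable_on UNIV" and v: "v abs_summable_on UNIV" and w: "w abs_summable_on UNIV"
  shows "conv (conv u v) w = conv u (conv v w)"
proof
  fix n
  \<comment> \<open>A summable family is bounded, and boundedness of \<open>w\<close> lets the
    double family behind \<open>conv u v\<close> dominate the triple product.\<close>
  have wb: "norm (w k) \<le> infsum (\<lambda>k. norm (w k)) UNIV" for k
    using finite_sum_le_infsum[OF w, of "{k}"] by simp
  have "(\<lambda>(l, m). u m * v (l - m)) abs_summable_on UNIV \<times> UNIV"
    using conv_pair_summable[OF u v] by (subst summable_on_swap) (simp add: case_prod_unfold)
  then have "(\<lambda>x. norm ((\<lambda>(l, m). u m * v (l - m)) x) * infsum (\<lambda>k. norm (w k)) UNIV) summable_on UNIV \<times> UNIV"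
    by (rule summable_on_cmult_left)
  then have "(\<lambda>(l, m). u m * v (l - m) * w (n - l)) abs_summable_on UNIV \<times> UNIV"
    by (rule Infinite_Sum.abs_summable_on_comparison_test')
      (auto simp: norm_mult intro!: mult_left_mono wb)
  then have s: "(\<lambda>(l, m). u m * v (l - m) * w (n - l)) summable_on UNIV \<times> UNIV"
    by (rule abs_summable_summable)
  have "conv (conv u v) w n = (\<Sum>\<^sub>\<infinity>l. \<Sum>\<^sub>\<infinity>m. u m * v (l - m) * w (n - l))"
    unfolding conv_def by (simp add: infsum_cmult_left')
  also have "\<dots> = (\<Sum>\<^sub>\<infinity>m. \<Sum>\<^sub>\<infinity>l. u m * v (l - m) * w (n - l))"
    by (rule infsum_swap_banach) (use s in simp)
  also have "\<dots> = (\<Sum>\<^sub>\<infinity>m. u m * (\<Sum>\<^sub>\<infinity>l. v (l - m) * w (n - l)))"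
    by (simp add: infsum_cmult_right' mult.assoc)
  also have "\<dots> = (\<Sum>\<^sub>\<infinity>m. u m * (\<Sum>\<^sub>\<infinity>l. v l * w (n - m - l)))"
  proof -
    have "(\<Sum>\<^sub>\<infinity>l. v (l - m) * w (n - l)) = (\<Sum>\<^sub>\<infinity>l. v l * w (n - m - l))" for m
      using infsum_shift(1)[of "\<lambda>l. v l * w (n - m - l)" m] by (simp add: algebra_simps)
    then show ?thesis by simp
  qed
  finally show "conv (conv u v) w n = conv u (conv v w) n"
    by (simp add: conv_def)
qed

text \<open>Frequencies are arbitrary pairs of reals, not integers: dilating the frequencies then changes
  the width of the strip of analyticity while the weight in the norm stays the same.\<close>

type_synonym freq = "real \<times> real"

section \<open>The weighted algebra and its completeness\<close>

definition fnorm :: "freq \<Rightarrow> real" where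
  "fnorm \<nu> = \<bar>fst \<nu>\<bar> + \<bar>snd \<nu>\<bar>"

text \<open>This is the largest modulus of the character of frequency \<nu> on the strip of
  half-width 1. Its submultiplicativity turns the weighted space into an algebra.\<close>

definition wt :: "freq \<Rightarrow> real" where
  "wt \<nu> = exp (fnorm \<nu>)"

lemma fnorm_nonneg [simp]: "fnorm \<nu> \<ge> 0" and fnorm_0 [simp]: "fnorm 0 = 0"
  and fnorm_minus [simp]: "fnorm (- \<nu>) = fnorm \<nu>"
  by (auto simp: fnorm_def)

lemma fnorm_add: "fnorm (\<mu> + \<nu>) \<le> fnorm \<mu> + fnorm \<nu>"
  by (auto simp: fnorm_def)

lemma fnorm_scaleR [simp]: "fnorm (c *\<^sub>R \<nu>) = \<bar>c\<bar> * fnorm \<nu>"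
  by (auto simp: fnorm_def abs_mult algebra_simps)

lemma wt_ge_1: "wt \<nu> \<ge> 1" and wt_pos [simp]: "wt \<nu> > 0" and wt_nonneg [simp]: "wt \<nu> \<ge> 0"
  and wt_0 [simp]: "wt 0 = 1"
  by (auto simp: wt_def)

lemma wt_submult: "wt \<nu> \<le> wt \<mu> * wt (\<nu> - \<mu>)"
  using fnorm_add[of \<mu> "\<nu> - \<mu>"] by (simp add: wt_def flip: exp_add)

text \<open>A Beurling-Wiener algebra on the discrete group of all frequencies. A function on the
  torus occupies only a lattice \<open>s * \<int>\<^sup>2\<close> in it; the mesh \<open>s\<close>
  is then the width of its strip of analyticity.\<close>

typedef wa = "{u :: freq \<Rightarrow> complex. (\<lambda>\<nu>. norm (u \<nu>) * wt \<nu>) summable_on UNIV}"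
  morphisms cf Wa
  by (rule exI[of _ "\<lambda>_. 0"]) simp

setup_lifting type_definition_wa

lemma wa_eqI: "(\<And>\<nu>. cf u \<nu> = cf v \<nu>) \<Longrightarrow> u = v"
  using cf_inject by blast

lemma cf_summable: "(\<lambda>\<nu>. norm (cf u \<nu>) * wt \<nu>) summable_on UNIV"
  using cf[of u] by simp

lemma weighted_imp_abs_summable:
  assumes "(\<lambda>\<nu>. norm (u \<nu>) * wt \<nu>) summable_on UNIV"
  shows "u abs_summable_on UNIV"
  by (rule summable_on_comparison_test[OF assms])
    (use wt_ge_1 in \<open>auto simp: mult_le_cancel_left1\<close>)

lemma cf_abs_summable: "cf u abs_summable_on UNIV"
  by (rule weighted_imp_abs_summable) (rule cf_summable)

text \<open>The weight is split over the two factors by \<open>wt_submult\<close>; what remains is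
  the total mass of a convolution of two nonnegative families, which is the product of their
  masses.\<close>

lemma conv_weighted:
  assumes u: "(\<lambda>\<nu>. norm (u \<nu>) * wt \<nu>) summable_on UNIV"
    and v: "(\<lambda>\<nu>. norm (v \<nu>) * wt \<nu>) summable_on UNIV"
  shows "(\<lambda>\<nu>. norm (conv u v \<nu>) * wt \<nu>) summable_on UNIV"
    and "(\<Sum>\<^sub>\<infinity>\<nu>. norm (conv u v \<nu>) * wt \<nu>)
       \<le> (\<Sum>\<^sub>\<infinity>\<nu>. norm (u \<nu>) * wt \<nu>) * (\<Sum>\<^sub>\<infinity>\<nu>. norm (v \<nu>) * wt \<nu>)"
proof -
  define U V where "U = (\<lambda>\<nu>. norm (u \<nu>) * wt \<nu>)" and "V = (\<lambda>\<nu>. norm (v \<nu>) * wt \<nu>)"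
  have U: "U abs_summable_on UNIV" and V: "V abs_summable_on UNIV"
    using u v by (simp_all add: U_def V_def)
  note p = conv_pair_infsum[OF U V]
  have le: "norm (conv u v \<nu>) * wt \<nu> \<le> (\<Sum>\<^sub>\<infinity>\<mu>. U \<mu> * V (\<nu> - \<mu>))" for \<nu>
  proof -
    have le0: "norm (u \<mu> * v (\<nu> - \<mu>)) * wt \<nu> \<le> norm (u \<mu>) * wt \<mu> * (norm (v (\<nu> - \<mu>)) * wt (\<nu> - \<mu>))" for \<mu>
      using mult_left_mono[OF wt_submult[of \<nu> \<mu>], of "norm (u \<mu>) * norm (v (\<nu> - \<mu>))"]
      by (simp add: norm_mult mult_ac)
    have ab: "(\<lambda>\<mu>. norm (u \<mu> * v (\<nu> - \<mu>)) * wt \<nu>) summable_on UNIV"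
      by (rule summable_on_comparison_test[OF p(3)[of \<nu>]])
        (use le0 in \<open>simp_all add: U_def V_def\<close>)
    then have ab': "(\<lambda>\<mu>. u \<mu> * v (\<nu> - \<mu>)) abs_summable_on UNIV"
      by (subst (asm) summable_on_cmult_left') (auto simp: wt_def)
    have "norm (conv u v \<nu>) * wt \<nu> \<le> (\<Sum>\<^sub>\<infinity>\<mu>. norm (u \<mu> * v (\<nu> - \<mu>))) * wt \<nu>"
      unfolding conv_def by (intro mult_right_mono norm_infsum_bound ab') auto
    also have "\<dots> = (\<Sum>\<^sub>\<infinity>\<mu>. norm (u \<mu> * v (\<nu> - \<mu>)) * wt \<nu>)"
      by (simp add: infsum_cmult_left')
    also have "\<dots> \<le> (\<Sum>\<^sub>\<infinity>\<mu>. U \<mu> * V (\<nu> - \<mu>))"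
      by (rule infsum_mono[OF ab p(3)])
        (use le0 in \<open>simp_all add: U_def V_def\<close>)
    finally show ?thesis .
  qed
  show s: "(\<lambda>\<nu>. norm (conv u v \<nu>) * wt \<nu>) summable_on UNIV"
    by (rule summable_on_comparison_test[OF p(2)]) (use le in auto)
  show "(\<Sum>\<^sub>\<infinity>\<nu>. norm (conv u v \<nu>) * wt \<nu>)
       \<le> (\<Sum>\<^sub>\<infinity>\<nu>. norm (u \<nu>) * wt \<nu>) * (\<Sum>\<^sub>\<infinity>\<nu>. norm (v \<nu>) * wt \<nu>)"
    using infsum_mono[OF s p(2) le] p(1) by (simp add: U_def V_def)
qed

instantiation wa :: real_vector
begin

lift_definition zero_wa :: wa is "\<lambda>_. 0" by simp

lift_definition plus_wa :: "wa \<Rightarrow> wa \<Rightarrow> wa" is "\<lambda>u v \<nu>. u \<nu> + v \<nu>"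
  subgoal for u v
    by (rule summable_on_comparison_test[OF summable_on_add[of "\<lambda>\<nu>. norm (u \<nu>) * wt \<nu>" UNIV "\<lambda>\<nu>. norm (v \<nu>) * wt \<nu>"]])
      (auto simp: norm_triangle_ineq mult_right_mono simp flip: distrib_right)
  done

lift_definition uminus_wa :: "wa \<Rightarrow> wa" is "\<lambda>u \<nu>. - u \<nu>" by simp

lift_definition minus_wa :: "wa \<Rightarrow> wa \<Rightarrow> wa" is "\<lambda>u v \<nu>. u \<nu> - v \<nu>"
  subgoal for u v
    by (rule summable_on_comparison_test[OF summable_on_add[of "\<lambda>\<nu>. norm (u \<nu>) * wt \<nu>" UNIV "\<lambda>\<nu>. norm (v \<nu>) * wt \<nu>"]])
      (auto simp: norm_triangle_ineq4 mult_right_mono simp flip: distrib_right)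
  done

lift_definition scaleR_wa :: "real \<Rightarrow> wa \<Rightarrow> wa" is "\<lambda>c u \<nu>. c *\<^sub>R u \<nu>"
  by (simp add: mult.assoc summable_on_cmult_right)

instance
proof
  fix u v w :: wa and a b :: real
  show "u + v + w = u + (v + w)" by transfer (simp add: add.assoc)
  show "u + v = v + u" by transfer (simp add: add.commute)
  show "0 + u = u" by transfer simp
  show "- u + u = 0" by transfer simp
  show "u - v = u + - v" by transfer simp
  show "a *\<^sub>R (u + v) = a *\<^sub>R u + a *\<^sub>R v" by transfer (simp add: scaleR_add_right)
  show "(a + b) *\<^sub>R u = a *\<^sub>R u + b *\<^sub>R u" by transfer (simp add: scaleR_add_left)
  show "a *\<^sub>R b *\<^sub>R u = (a * b) *\<^sub>R u" by transfer simp
  show "1 *\<^sub>R u = u" by transfer simp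
qed

end

lemmas cf_simps [simp] = zero_wa.rep_eq plus_wa.rep_eq uminus_wa.rep_eq minus_wa.rep_eq scaleR_wa.rep_eq

instantiation wa :: real_normed_vector
begin

definition norm_wa :: "wa \<Rightarrow> real" where "norm_wa u = (\<Sum>\<^sub>\<infinity>\<nu>. norm (cf u \<nu>) * wt \<nu>)"
definition dist_wa :: "wa \<Rightarrow> wa \<Rightarrow> real" where "dist_wa u v = norm (u - v)"
definition sgn_wa :: "wa \<Rightarrow> wa" where "sgn_wa u = scaleR (inverse (norm u)) u"
definition uniformity_wa :: "(wa \<times> wa) filter" where
  "uniformity_wa = (INF e\<in>{0 <..}. principal {(x, y). dist x y < e})"
definition open_wa :: "wa set \<Rightarrow> bool" where
  "open_wa U \<longleftrightarrow> (\<forall>x\<in>U. eventually (\<lambda>(x', y). x' = x \<longrightarrow> y \<in> U) uniformity)"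

instance
proof
  fix u v :: wa and a :: real
  show "dist u v = norm (u - v)" by (rule dist_wa_def)
  show "sgn u = u /\<^sub>R norm u" by (rule sgn_wa_def)
  show "(norm u = 0) = (u = 0)"
  proof
    assume "norm u = 0"
    then have "norm (cf u \<nu>) * wt \<nu> = 0" for \<nu>
      using nonneg_infsum_le_0D[OF _ cf_summable[of u], of \<nu>] by (auto simp: norm_wa_def)
    then show "u = 0"
      by (intro wa_eqI) (auto simp: zero_wa.rep_eq wt_def)
  qed (auto simp: norm_wa_def zero_wa.rep_eq)
  show "norm (u + v) \<le> norm u + norm v"
    unfolding norm_wa_def infsum_add[OF cf_summable cf_summable, symmetric]
    by (intro infsum_mono cf_summable summable_on_add)
      (auto simp: plus_wa.rep_eq norm_triangle_ineq mult_right_mono simp flip: distrib_right)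
  show "norm (a *\<^sub>R u) = \<bar>a\<bar> * norm u"
    by (simp add: norm_wa_def scaleR_wa.rep_eq mult.assoc infsum_cmult_right')
qed (simp_all add: uniformity_wa_def open_wa_def)

end

lemma finite_sum_le_norm: "finite S \<Longrightarrow> (\<Sum>\<nu>\<in>S. norm (cf u \<nu>) * wt \<nu>) \<le> norm u"
  unfolding norm_wa_def by (intro finite_sum_le_infsum cf_summable) auto

lemma norm_cf_wt_le: "norm (cf u \<nu>) * wt \<nu> \<le> norm u"
  using finite_sum_le_norm[of "{\<nu>}" u] by simp

lemma norm_cf_le: "norm (cf u \<nu>) \<le> norm u"
  using norm_cf_wt_le[of u \<nu>] wt_ge_1[of \<nu>] mult_left_mono[of 1 "wt \<nu>" "norm (cf u \<nu>)"] by simp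

lemma weighted_bounded_summable:
  assumes "\<And>S. finite S \<Longrightarrow> (\<Sum>\<nu>\<in>S. norm (u \<nu>) * wt \<nu>) \<le> M"
  shows "(\<lambda>\<nu>. norm (u \<nu>) * wt \<nu>) summable_on UNIV"
  using assms by (intro nonneg_bdd_above_summable_on bdd_aboveI[of _ M]) auto

lemma cf_Wa:
  assumes "\<And>S. finite S \<Longrightarrow> (\<Sum>\<nu>\<in>S. norm (u \<nu>) * wt \<nu>) \<le> M"
  shows "cf (Wa u) = u" "norm (Wa u) \<le> M"
proof -
  show c: "cf (Wa u) = u"
    using weighted_bounded_summable[OF assms] by (simp add: Wa_inverse)
  show "norm (Wa u) \<le> M"
    unfolding norm_wa_def c
    by (rule infsum_le_finite_sums[OF weighted_bounded_summable[OF assms]]) (use assms in auto)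
qed

lemma bounded_linear_cf: "bounded_linear (\<lambda>u. cf u \<nu>)"
  by (rule bounded_linear_intro[where K=1]) (auto intro: norm_cf_le)

text \<open>Fatou's lemma for a weighted sum: it suffices to pass to the limit in finite partial
  sums. It serves for completeness and later for the limit of a bounded family of solutions.\<close>

lemma pointwise_limit_norm_le:
  assumes "\<And>\<nu>. (\<lambda>k. cf (x k) \<nu>) \<longlonglongrightarrow> u \<nu>" "\<And>k. norm (x k) \<le> M"
  shows "cf (Wa u) = u" "norm (Wa u) \<le> M"
proof -
  have "(\<Sum>\<nu>\<in>S. norm (u \<nu>) * wt \<nu>) \<le> M" if "finite S" for S
  proof (rule LIMSEQ_le_const2)
    show "(\<lambda>k. \<Sum>\<nu>\<in>S. norm (cf (x k) \<nu>) * wt \<nu>) \<longlonglongrightarrow> (\<Sum>\<nu>\<in>S. norm (u \<nu>) * wt \<nu>)"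
      by (intro tendsto_intros assms)
    show "\<exists>N. \<forall>n\<ge>N. (\<Sum>\<nu>\<in>S. norm (cf (x n) \<nu>) * wt \<nu>) \<le> M"
      using finite_sum_le_norm[OF that] assms(2) order_trans by blast
  qed
  from cf_Wa[OF this] show "cf (Wa u) = u" "norm (Wa u) \<le> M" by auto
qed

instance wa :: banach
proof
  fix X :: "nat \<Rightarrow> wa" assume X: "Cauchy X"
  have "\<exists>l. (\<lambda>k. cf (X k) \<nu>) \<longlonglongrightarrow> l" for \<nu>
    using bounded_linear.Cauchy[OF bounded_linear_cf X, of \<nu>] by (simp add: Cauchy_convergent_iff convergent_def)
  then obtain u where u: "\<And>\<nu>. (\<lambda>k. cf (X k) \<nu>) \<longlonglongrightarrow> u \<nu>" by metis
  obtain M where "\<And>k. norm (X k) \<le> M"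
    using Cauchy_Bseq[OF X] by (auto simp: Bseq_def)
  from pointwise_limit_norm_le[OF u this] have c: "cf (Wa u) = u" by auto
  have "X \<longlonglongrightarrow> Wa u"
  proof (rule LIMSEQ_I)
    fix e :: real assume "e > 0"
    then obtain N where N: "\<And>m n. m \<ge> N \<Longrightarrow> n \<ge> N \<Longrightarrow> norm (X m - X n) < e / 2"
      using CauchyD[OF X, of "e/2"] by auto
    have "norm (X n - Wa u) < e" if "n \<ge> N" for n
    proof -
      \<comment> \<open>The second index is sent to infinity in the Cauchy estimate; coefficientwise
        convergence is enough for the bound \<open>e / 2\<close> to survive.\<close>
      have 1: "(\<lambda>k. cf (X n - X (k + N)) \<nu>) \<longlonglongrightarrow> cf (X n - Wa u) \<nu>" for \<nu>
        using LIMSEQ_ignore_initial_segment[OF u[of \<nu>], of N] by (auto simp: c intro!: tendsto_intros)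
      have "norm (Wa (cf (X n - Wa u))) \<le> e / 2"
        by (rule pointwise_limit_norm_le(2)[OF 1]) (use N that in \<open>auto intro: less_imp_le\<close>)
      then show ?thesis
        using \<open>e > 0\<close> by (metis cf_inverse field_sum_of_halves le_less_trans less_add_same_cancel1 half_gt_zero)
    qed
    then show "\<exists>no. \<forall>n\<ge>no. norm (X n - Wa u) < e" by blast
  qed
  then show "convergent X" by (auto simp: convergent_def)
qed

instantiation wa :: comm_ring_1
begin

lift_definition one_wa :: wa is "\<lambda>\<nu>. if \<nu> = 0 then 1 else 0"
  by (rule finite_nonzero_values_imp_summable_on) (auto intro: finite_subset[of _ "{0}"])

lift_definition times_wa :: "wa \<Rightarrow> wa \<Rightarrow> wa" is conv
  by (rule conv_weighted)

instance
proof
  fix u v w :: wa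
  show "u * v * w = u * (v * w)"
    by transfer (simp add: conv_assoc weighted_imp_abs_summable)
  show "u * v = v * u"
    by transfer (simp add: conv_commute)
  show "1 * u = u"
  proof (transfer, rule ext)
    fix u :: "freq \<Rightarrow> complex" and \<nu>
    have "conv (\<lambda>\<nu>. if \<nu> = 0 then 1 else 0) u \<nu> = (\<Sum>\<^sub>\<infinity>m\<in>{0}. (if m = 0 then 1 else 0) * u (\<nu> - m))"
      unfolding conv_def by (rule infsum_cong_neutral) auto
    then show "conv (\<lambda>\<nu>. if \<nu> = 0 then 1 else 0) u \<nu> = u \<nu>" by simp
  qed
  show "(u + v) * w = u * w + v * w"
  proof (intro wa_eqI)
    fix \<nu>
    have s: "(\<lambda>m. cf u m * cf w (\<nu> - m)) summable_on UNIV" for u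
      by (rule conv_pair_infsum(3)[OF cf_abs_summable cf_abs_summable])
    show "cf ((u + v) * w) \<nu> = cf (u * w + v * w) \<nu>"
      by (simp add: times_wa.rep_eq conv_def distrib_right infsum_add[OF s s])
  qed
  show "(0::wa) \<noteq> 1"
  proof
    assume "(0::wa) = 1"
    then have "cf 0 (0::freq) = cf 1 0" by simp
    then show False by (simp add: one_wa.rep_eq)
  qed
qed

end

lemma cf_one: "cf 1 \<nu> = (if \<nu> = 0 then 1 else 0)"
  by (simp add: one_wa.rep_eq)

lemma cf_mult: "cf (u * v) \<nu> = (\<Sum>\<^sub>\<infinity>\<mu>. cf u \<mu> * cf v (\<nu> - \<mu>))"
  by (simp add: times_wa.rep_eq conv_def)

lemma cf_mult_summable: "(\<lambda>\<mu>. cf u \<mu> * cf v (\<nu> - \<mu>)) summable_on UNIV"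
  by (rule conv_pair_infsum(3)[OF cf_abs_summable cf_abs_summable])

instance wa :: real_normed_algebra_1
proof
  fix a :: real and u v :: wa
  show "a *\<^sub>R u * v = a *\<^sub>R (u * v)"
    by (intro wa_eqI) (simp add: cf_mult mult.assoc scaleR_conv_of_real infsum_cmult_right')
  show "u * a *\<^sub>R v = a *\<^sub>R (u * v)"
    by (intro wa_eqI) (simp add: cf_mult mult.left_commute scaleR_conv_of_real infsum_cmult_right')
  show "norm (u * v) \<le> norm u * norm v"
    unfolding norm_wa_def times_wa.rep_eq by (rule conv_weighted(2)[OF cf_summable cf_summable])
  have "(\<Sum>\<^sub>\<infinity>\<nu>. norm (cf 1 \<nu>) * wt \<nu>) = (\<Sum>\<^sub>\<infinity>\<nu>\<in>{0}. norm (cf 1 \<nu>) * wt \<nu>)"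
    by (rule infsum_cong_neutral) (auto simp: cf_one)
  then show "norm (1::wa) = 1"
    by (simp add: norm_wa_def cf_one)
qed

declare split_paired_All [simp del] split_paired_Ex [simp del]

lemma cf_scaleR: "cf (c *\<^sub>R u) \<nu> = of_real c * cf u \<nu>"
  by (simp add: scaleR_wa.rep_eq scaleR_conv_of_real[where 'a=complex])

lemma sum_norm_wt_le:
  assumes "\<And>\<nu>. norm (v \<nu>) \<le> M * norm (cf u \<nu>)" "finite S"
  shows "(\<Sum>\<nu>\<in>S. norm (v \<nu>) * wt \<nu>) \<le> M * norm u"
proof -
  \<comment> \<open>A negative \<open>M\<close> is compatible with the hypothesis only when
    \<open>u\<close> vanishes.\<close>
  have M: "M \<ge> 0 \<or> norm u = 0"
  proof (rule disjCI)
    assume "norm u \<noteq> 0"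
    then obtain \<nu> where "cf u \<nu> \<noteq> 0" using wa_eqI[of u 0] by auto
    then show "M \<ge> 0"
      using order_trans[OF norm_ge_zero assms(1)[of \<nu>]] by (simp add: zero_le_mult_iff)
  qed
  have "(\<Sum>\<nu>\<in>S. norm (v \<nu>) * wt \<nu>) \<le> (\<Sum>\<nu>\<in>S. M * (norm (cf u \<nu>) * wt \<nu>))"
    using assms(1) by (intro sum_mono) (simp add: mult_right_mono flip: mult.assoc)
  also have "\<dots> = M * (\<Sum>\<nu>\<in>S. norm (cf u \<nu>) * wt \<nu>)"
    by (simp add: sum_distrib_left)
  also have "\<dots> \<le> M * norm u"
    using M finite_sum_le_norm[OF assms(2), of u]
    by (cases "norm u = 0") (auto intro!: mult_left_mono sum_nonneg)
  finally show ?thesis .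
qed

lemma cf_Wa_dominated:
  assumes "\<And>\<nu>. norm (v \<nu>) \<le> M * norm (cf u \<nu>)"
  shows "cf (Wa v) = v" "norm (Wa v) \<le> M * norm u"
  using cf_Wa[OF sum_norm_wt_le[OF assms]] by blast+

subsection \<open>Fourier multipliers and dilations\<close>

text \<open>\<open>Wa\<close> returns an unspecified element on families that are not summable,
  which is why the rules for \<open>mul\<close> ask for a bound on the multiplier.\<close>

definition mul :: "(freq \<Rightarrow> complex) \<Rightarrow> wa \<Rightarrow> wa" where
  "mul m u = Wa (\<lambda>\<nu>. m \<nu> * cf u \<nu>)"

lemma
  assumes "\<And>\<nu>. norm (m \<nu>) \<le> M"
  shows cf_mul: "cf (mul m u) \<nu> = m \<nu> * cf u \<nu>"
    and norm_mul: "norm (mul m u) \<le> M * norm u"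
proof -
  have *: "norm (m \<nu> * cf u \<nu>) \<le> M * norm (cf u \<nu>)" for \<nu>
    using assms[of \<nu>] by (simp add: norm_mult mult_right_mono)
  show "cf (mul m u) \<nu> = m \<nu> * cf u \<nu>" "norm (mul m u) \<le> M * norm u"
    using cf_Wa_dominated[OF *] by (simp_all add: mul_def)
qed

text \<open>As a function, \<open>dil l u\<close> is u(z / l). Its frequencies are those of
  \<open>u\<close> divided by \<open>l\<close>, so for \<open>l \<ge> 1\<close> its norm measures
  \<open>u\<close> on a strip that is narrower by the factor \<open>l\<close>.\<close>

definition dil :: "real \<Rightarrow> wa \<Rightarrow> wa" where
  "dil l u = Wa (\<lambda>\<nu>. cf u (l *\<^sub>R \<nu>))"

lemma bij_scaleR_freq: "l \<noteq> 0 \<Longrightarrow> bij_betw (\<lambda>\<nu>::freq. l *\<^sub>R \<nu>) UNIV UNIV"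
  by (rule bij_betwI[of _ _ _ "\<lambda>\<nu>. \<nu> /\<^sub>R l"]) auto

lemma
  assumes l: "l \<ge> 1"
  shows cf_dil [simp]: "cf (dil l u) \<nu> = cf u (l *\<^sub>R \<nu>)"
    and norm_dil: "norm (dil l u) \<le> norm u"
proof -
  have "(\<Sum>\<nu>\<in>S. norm (cf u (l *\<^sub>R \<nu>)) * wt \<nu>) \<le> norm u" if "finite S" for S
  proof -
    have "(\<Sum>\<nu>\<in>S. norm (cf u (l *\<^sub>R \<nu>)) * wt \<nu>) \<le> (\<Sum>\<nu>\<in>S. norm (cf u (l *\<^sub>R \<nu>)) * wt (l *\<^sub>R \<nu>))"
      using mult_right_mono[OF l fnorm_nonneg] l by (intro sum_mono mult_left_mono) (simp_all add: wt_def)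
    also have "\<dots> = (\<Sum>\<nu>\<in>(\<lambda>\<nu>. l *\<^sub>R \<nu>) ` S. norm (cf u \<nu>) * wt \<nu>)"
      using l by (subst sum.reindex) (auto simp: inj_on_def)
    also have "\<dots> \<le> norm u"
      using that by (intro finite_sum_le_norm) auto
    finally show ?thesis .
  qed
  from cf_Wa[OF this] show "cf (dil l u) \<nu> = cf u (l *\<^sub>R \<nu>)" "norm (dil l u) \<le> norm u"
    by (simp_all add: dil_def)
qed

text \<open>Scaling is an automorphism of the group of frequencies, so convolution is preserved by a
  change of the summation index.\<close>

lemma dil_mult:
  assumes l: "l \<ge> 1"
  shows "dil l (u * v) = dil l u * dil l v"
proof (rule wa_eqI)
  fix \<nu>
  have "cf (dil l (u * v)) \<nu> = (\<Sum>\<^sub>\<infinity>\<mu>. cf u \<mu> * cf v (l *\<^sub>R \<nu> - \<mu>))"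
    using l by (simp add: cf_mult)
  also have "\<dots> = (\<Sum>\<^sub>\<infinity>\<mu>. cf u (l *\<^sub>R \<mu>) * cf v (l *\<^sub>R \<nu> - l *\<^sub>R \<mu>))"
    using infsum_reindex_bij_betw[OF bij_scaleR_freq[of l], of "\<lambda>\<mu>. cf u \<mu> * cf v (l *\<^sub>R \<nu> - \<mu>)"] l by simp
  also have "\<dots> = cf (dil l u * dil l v) \<nu>"
    using l by (simp add: cf_mult scaleR_diff_right)
  finally show "cf (dil l (u * v)) \<nu> = cf (dil l u * dil l v) \<nu>" .
qed

lemma dil_one: "l \<ge> 1 \<Longrightarrow> dil l 1 = 1"
  by (rule wa_eqI) (auto simp: cf_one)

lemma dil_diff: "l \<ge> 1 \<Longrightarrow> dil l (u - v) = dil l u - dil l v"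
  by (rule wa_eqI) auto

lemma bounded_linear_dil: "l \<ge> 1 \<Longrightarrow> bounded_linear (dil l)"
  by (rule bounded_linear_intro[where K=1]) (auto intro!: wa_eqI norm_dil)

subsection \<open>Evaluation\<close>

definition chr :: "complex \<times> complex \<Rightarrow> freq \<Rightarrow> complex" where
  "chr z \<nu> = exp (\<i> * (of_real (fst \<nu>) * fst z + of_real (snd \<nu>) * snd z))"

lemma chr_add: "chr z (\<mu> + \<nu>) = chr z \<mu> * chr z \<nu>"
  by (simp add: chr_def algebra_simps flip: exp_add)

lemma chr_0 [simp]: "chr z 0 = 1"
  by (simp add: chr_def)

lemma norm_chr: "norm (chr z \<nu>) = exp (- (fst \<nu> * Im (fst z) + snd \<nu> * Im (snd z)))"
  by (simp add: chr_def)

lemma norm_chr_le: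
  assumes "\<bar>Im (fst z)\<bar> \<le> s" "\<bar>Im (snd z)\<bar> \<le> s"
  shows "norm (chr z \<nu>) \<le> exp (s * fnorm \<nu>)"
proof -
  have "\<bar>fst \<nu> * Im (fst z)\<bar> \<le> s * \<bar>fst \<nu>\<bar>" "\<bar>snd \<nu> * Im (snd z)\<bar> \<le> s * \<bar>snd \<nu>\<bar>"
    using assms by (simp_all add: abs_mult mult.commute[of "\<bar>fst \<nu>\<bar>"] mult.commute[of "\<bar>snd \<nu>\<bar>"] mult_right_mono)
  then show ?thesis
    by (simp add: norm_chr fnorm_def distrib_left abs_le_iff)
qed

definition ev :: "wa \<Rightarrow> complex \<times> complex \<Rightarrow> complex" where
  "ev u z = (\<Sum>\<^sub>\<infinity>\<nu>. cf u \<nu> * chr z \<nu>)"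

definition ustrip :: "(complex \<times> complex) set" where
  "ustrip = {z. \<bar>Im (fst z)\<bar> \<le> 1 \<and> \<bar>Im (snd z)\<bar> \<le> 1}"

lemma norm_chr_le_wt: "z \<in> ustrip \<Longrightarrow> norm (chr z \<nu>) \<le> wt \<nu>"
  using norm_chr_le[of z 1 \<nu>] by (auto simp: ustrip_def wt_def)

lemma ev_abs_summable:
  assumes "z \<in> ustrip"
  shows "(\<lambda>\<nu>. cf u \<nu> * chr z \<nu>) abs_summable_on UNIV"
  by (rule summable_on_comparison_test[OF cf_summable[of u]])
    (auto simp: norm_mult intro!: mult_left_mono norm_chr_le_wt assms)

lemma ev_summable: "z \<in> ustrip \<Longrightarrow> (\<lambda>\<nu>. cf u \<nu> * chr z \<nu>) summable_on UNIV"
  by (rule abs_summable_summable) (rule ev_abs_summable)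

lemma norm_ev: "z \<in> ustrip \<Longrightarrow> norm (ev u z) \<le> norm u"
  unfolding ev_def norm_wa_def
  by (rule order_trans[OF norm_infsum_bound[OF ev_abs_summable] infsum_mono[OF ev_abs_summable cf_summable]])
    (auto intro!: mult_left_mono norm_chr_le_wt simp: norm_mult)

lemma ev_add: "z \<in> ustrip \<Longrightarrow> ev (u + v) z = ev u z + ev v z"
  by (simp add: ev_def distrib_right infsum_add ev_summable)

lemma ev_scaleR: "ev (c *\<^sub>R u) z = c *\<^sub>R ev u z"
  by (simp add: ev_def cf_scaleR mult.assoc infsum_cmult_right' scaleR_conv_of_real[where 'a=complex] del: scaleR_wa.rep_eq)

lemma ev_uminus: "ev (- u) z = - ev u z"
  using ev_scaleR[of "-1" u z] by simp

lemma ev_diff: "z \<in> ustrip \<Longrightarrow> ev (u - v) z = ev u z - ev v z"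
  using ev_add[of z u "- v"] by (simp add: ev_uminus)

lemma ev_one: "ev 1 z = 1"
proof -
  have "ev 1 z = (\<Sum>\<^sub>\<infinity>\<nu>\<in>{0}. cf 1 \<nu> * chr z \<nu>)"
    unfolding ev_def by (rule infsum_cong_neutral) (auto simp: cf_one)
  then show ?thesis by (simp add: cf_one)
qed

lemma ev_mult:
  assumes "z \<in> ustrip"
  shows "ev (u * v) z = ev u z * ev v z"
proof -
  have "ev (u * v) z = (\<Sum>\<^sub>\<infinity>\<nu>. \<Sum>\<^sub>\<infinity>\<mu>. cf u \<mu> * chr z \<mu> * (cf v (\<nu> - \<mu>) * chr z (\<nu> - \<mu>)))"
    unfolding ev_def cf_mult infsum_cmult_left'[symmetric]
  proof (intro infsum_cong)
    fix \<nu> \<mu>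
    show "cf u \<mu> * cf v (\<nu> - \<mu>) * chr z \<nu> = cf u \<mu> * chr z \<mu> * (cf v (\<nu> - \<mu>) * chr z (\<nu> - \<mu>))"
      using chr_add[of z \<mu> "\<nu> - \<mu>"] by simp
  qed
  then show ?thesis
    using conv_pair_infsum(1)[OF ev_abs_summable[OF assms, of u] ev_abs_summable[OF assms, of v]]
    by (simp add: ev_def)
qed

lemma bounded_linear_ev: "z \<in> ustrip \<Longrightarrow> bounded_linear (\<lambda>u. ev u z)"
  by (rule bounded_linear_intro[where K=1]) (auto intro: ev_add ev_scaleR norm_ev)

lemma ev_dil:
  assumes "l \<ge> 1"
  shows "ev (dil l u) z = ev u (fst z / of_real l, snd z / of_real l)"
proof -
  have "ev u (fst z / of_real l, snd z / of_real l) =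
    (\<Sum>\<^sub>\<infinity>\<nu>. cf u (l *\<^sub>R \<nu>) * chr (fst z / of_real l, snd z / of_real l) (l *\<^sub>R \<nu>))"
    unfolding ev_def using assms
    by (subst infsum_reindex_bij_betw[OF bij_scaleR_freq[of l], symmetric]) auto
  also have "\<dots> = ev (dil l u) z"
    using assms by (simp add: ev_def chr_def)
  finally show ?thesis by simp
qed

subsection \<open>Real-valued elements and elements supported on a lattice\<close>

definition sym :: "wa \<Rightarrow> bool" where
  "sym u \<longleftrightarrow> (\<forall>\<nu>. cf u (- \<nu>) = cnj (cf u \<nu>))"

definition rlat :: "real \<Rightarrow> freq set" where
  "rlat s = range (\<lambda>(j::int, k::int). (s * of_int j, s * of_int k))"

text \<open>These are real-valued functions on the torus: an element \<open>u\<close> stands for the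
  function u(\<psi> / s), which has period \<open>2 * pi\<close> and lives on the strip of width
  \<open>s\<close>. They form a closed real subalgebra, so that power series and limits stay
  inside.\<close>

definition wlat :: "real \<Rightarrow> wa set" where
  "wlat s = {u. sym u \<and> (\<forall>\<nu>. \<nu> \<notin> rlat s \<longrightarrow> cf u \<nu> = 0)}"

lemma rlat_iff: "\<nu> \<in> rlat s \<longleftrightarrow> (\<exists>j k. \<nu> = (s * of_int j, s * of_int k))"
  by (auto simp: rlat_def image_iff split_paired_Ex)

lemma rlat_0 [simp]: "0 \<in> rlat s"
  unfolding rlat_def by (rule image_eqI[of _ _ "(0,0)"]) (auto simp: zero_prod_def)

lemma rlat_minus_iff [simp]: "- \<nu> \<in> rlat s \<longleftrightarrow> \<nu> \<in> rlat s"
proof -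
  have "- \<nu> \<in> rlat s" if m: "\<nu> \<in> rlat s" for \<nu>
  proof -
    obtain j k where "\<nu> = (s * of_int j, s * of_int k)" using m by (auto simp: rlat_iff)
    then show ?thesis unfolding rlat_iff by (intro exI[of _ "-j"] exI[of _ "-k"]) simp
  qed
  from this[of \<nu>] this[of "-\<nu>"] show ?thesis unfolding minus_minus by blast
qed

lemma rlat_add: "\<mu> \<in> rlat s \<Longrightarrow> \<nu> \<in> rlat s \<Longrightarrow> \<mu> + \<nu> \<in> rlat s"
  unfolding rlat_iff
proof (elim exE)
  fix j k j' k' assume "\<mu> = (s * of_int j, s * of_int k)" "\<nu> = (s * of_int j', s * of_int k')"
  then show "\<exists>j k. \<mu> + \<nu> = (s * of_int j, s * of_int k)"
    by (intro exI[of _ "j+j'"] exI[of _ "k+k'"]) (simp add: distrib_left)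
qed

lemma wlatI:
  "(\<And>\<nu>. cf u (- \<nu>) = cnj (cf u \<nu>)) \<Longrightarrow> (\<And>\<nu>. \<nu> \<notin> rlat s \<Longrightarrow> cf u \<nu> = 0) \<Longrightarrow> u \<in> wlat s"
  by (simp add: wlat_def sym_def)

lemma wlat_minus: "u \<in> wlat s \<Longrightarrow> cf u (- \<nu>) = cnj (cf u \<nu>)"
  by (simp add: wlat_def sym_def)

lemma wlat_notin: "u \<in> wlat s \<Longrightarrow> \<nu> \<notin> rlat s \<Longrightarrow> cf u \<nu> = 0"
  by (simp add: wlat_def)

lemma wlat_add [intro]: "u \<in> wlat s \<Longrightarrow> v \<in> wlat s \<Longrightarrow> u + v \<in> wlat s"
  and wlat_diff [intro]: "u \<in> wlat s \<Longrightarrow> v \<in> wlat s \<Longrightarrow> u - v \<in> wlat s"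
  and wlat_scaleR [intro]: "u \<in> wlat s \<Longrightarrow> c *\<^sub>R u \<in> wlat s"
  and wlat_0 [intro]: "0 \<in> wlat s" and wlat_1 [intro]: "1 \<in> wlat s"
  by (simp_all add: wlat_def sym_def cf_one)

lemma wlat_uminus [intro]: "u \<in> wlat s \<Longrightarrow> - u \<in> wlat s"
  using wlat_diff[OF wlat_0, of u s] by simp

lemma infsum_minus_freq: "(\<Sum>\<^sub>\<infinity>\<mu>. f (- \<mu>)) = infsum f (UNIV :: freq set)"
  using infsum_reindex_bij_betw[OF bij_scaleR_freq[of "-1"], of f] by simp

lemma wlat_mult [intro]:
  assumes "u \<in> wlat s" "v \<in> wlat s"
  shows "u * v \<in> wlat s"
proof (rule wlatI)
  fix \<nu>
  have "cf (u * v) (- \<nu>) = (\<Sum>\<^sub>\<infinity>\<mu>. cf u (- \<mu>) * cf v (- (\<nu> - \<mu>)))"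
    unfolding cf_mult by (subst infsum_minus_freq[symmetric]) simp
  also have "\<dots> = cnj (cf (u * v) \<nu>)"
    unfolding cf_mult infsum_cnj[symmetric]
    by (simp only: wlat_minus[OF assms(1)] wlat_minus[OF assms(2)] complex_cnj_mult)
  finally show "cf (u * v) (- \<nu>) = cnj (cf (u * v) \<nu>)" .
next
  fix \<nu> assume \<nu>: "\<nu> \<notin> rlat s"
  have "cf u \<mu> * cf v (\<nu> - \<mu>) = 0" for \<mu>
  proof (cases "\<mu> \<in> rlat s \<and> \<nu> - \<mu> \<in> rlat s")
    case True
    then have "\<mu> + (\<nu> - \<mu>) \<in> rlat s" by (intro rlat_add) auto
    with \<nu> show ?thesis by simp
  qed (metis assms wlat_notin mult_zero_left mult_zero_right)
  then show "cf (u * v) \<nu> = 0" unfolding cf_mult by (rule infsum_0)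
qed

lemma closed_wlat: "closed (wlat s)"
proof -
  have c: "continuous_on UNIV (\<lambda>u. cf u \<nu>)" for \<nu>
    using bounded_linear_cf linear_continuous_on by blast
  have "closed {u. cf u (- \<nu>) = cnj (cf u \<nu>)}" "closed {u. cf u \<nu> = 0}" for \<nu>
    by (intro closed_Collect_eq continuous_intros c)+
  then have "closed ((\<Inter>\<nu>. {u. cf u (- \<nu>) = cnj (cf u \<nu>)}) \<inter> (\<Inter>\<nu>\<in>- rlat s. {u. cf u \<nu> = 0}))"
    by blast
  also have "(\<Inter>\<nu>. {u. cf u (- \<nu>) = cnj (cf u \<nu>)}) \<inter> (\<Inter>\<nu>\<in>- rlat s. {u. cf u \<nu> = 0}) = wlat s"
    by (auto simp: wlat_def sym_def)
  finally show ?thesis .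
qed

lemma wlat_mul:
  assumes "\<And>\<nu>. norm (m \<nu>) \<le> M" "\<And>\<nu>. m (- \<nu>) = cnj (m \<nu>)" "u \<in> wlat s"
  shows "mul m u \<in> wlat s"
  using assms(2) wlat_minus[OF assms(3)] wlat_notin[OF assms(3)]
  by (intro wlatI) (simp_all add: cf_mul[OF assms(1)])

lemma rlat_scaleR: "l \<noteq> 0 \<Longrightarrow> l *\<^sub>R \<nu> \<in> rlat (l * s) \<longleftrightarrow> \<nu> \<in> rlat s"
  by (cases \<nu>) (simp add: rlat_iff)

lemma wlat_dil:
  assumes "l \<ge> 1" "u \<in> wlat (l * s)"
  shows "dil l u \<in> wlat s"
  using assms wlat_minus[OF assms(2)] wlat_notin[OF assms(2)]
  by (intro wlatI) (simp_all add: rlat_scaleR)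

definition evr :: "wa \<Rightarrow> real \<times> real \<Rightarrow> real" where
  "evr u \<psi> = Re (ev u (of_real (fst \<psi>), of_real (snd \<psi>)))"

lemma ustrip_real [simp]: "(of_real x, of_real y) \<in> ustrip"
  by (simp add: ustrip_def)

lemma ev_real:
  assumes "u \<in> wlat s"
  shows "ev u (of_real x, of_real y) = of_real (evr u (x, y))"
proof -
  have c: "chr (complex_of_real x, complex_of_real y) (- \<nu>) = cnj (chr (of_real x, of_real y) \<nu>)" for \<nu>
    by (simp add: chr_def exp_cnj algebra_simps)
  have "cnj (ev u (of_real x, of_real y)) = (\<Sum>\<^sub>\<infinity>\<nu>. cf u (- \<nu>) * chr (of_real x, of_real y) (- \<nu>))"
    unfolding ev_def infsum_cnj[symmetric] by (simp add: wlat_minus[OF assms] c)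
  also have "\<dots> = ev u (of_real x, of_real y)"
    unfolding ev_def by (rule infsum_minus_freq)
  finally show ?thesis
    by (simp add: evr_def complex_eq_iff)
qed

lemma
  shows evr_add: "evr (u + v) \<psi> = evr u \<psi> + evr v \<psi>"
    and evr_diff: "evr (u - v) \<psi> = evr u \<psi> - evr v \<psi>"
    and evr_scaleR: "evr (c *\<^sub>R u) \<psi> = c * evr u \<psi>"
    and evr_one: "evr 1 \<psi> = 1"
  by (simp_all add: evr_def ev_add ev_diff ev_scaleR ev_one)

lemma abs_evr: "\<bar>evr u \<psi>\<bar> \<le> norm u"
  unfolding evr_def by (rule order_trans[OF abs_Re_le_cmod norm_ev]) simp

lemma evr_mult:
  assumes "u \<in> wlat s" "v \<in> wlat s"
  shows "evr (u * v) \<psi> = evr u \<psi> * evr v \<psi>"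
proof -
  have "Im (ev u (of_real (fst \<psi>), of_real (snd \<psi>))) = 0"
    using ev_real[OF assms(1), of "fst \<psi>" "snd \<psi>"] by simp
  then show ?thesis
    by (simp add: evr_def ev_mult)
qed

subsection \<open>The mean value as an integral\<close>

lemma has_integral_exp_int:
  "((\<lambda>t. exp (\<i> * (of_int k * complex_of_real t))) has_integral (if k = 0 then 2 * of_real pi else 0)) {0..2 * pi}"
proof (cases "k = 0")
  case True
  then show ?thesis
    using has_integral_const_real[of "1::complex" 0 "2 * pi"] by (simp add: scaleR_conv_of_real)
next
  case False
  define F where "F = (\<lambda>t. exp (\<i> * (of_int k * complex_of_real t)) / (\<i> * of_int k))"
  have "((\<lambda>t. exp (\<i> * (of_int k * complex_of_real t))) has_integral F (2 * pi) - F 0) {0..2 * pi}"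
    unfolding F_def using False
    by (intro fundamental_theorem_of_calculus has_vector_derivative_real_field[where f="\<lambda>z. exp (\<i> * (of_int k * z)) / (\<i> * of_int k)"])
      (auto intro!: derivative_eq_intros simp: mult_ac)
  moreover have "exp (\<i> * (of_int k * complex_of_real (2 * pi))) = 1"
    using exp_integer_2pi[of "of_int k"] by (simp add: mult_ac)
  ultimately show ?thesis using False by (simp add: F_def)
qed

lemma has_integral_chr:
  assumes "s > 0" "\<nu> \<in> rlat s"
  shows "((\<lambda>\<psi>. chr (of_real (fst \<psi> / s), of_real (snd \<psi> / s)) \<nu>) has_integral
     (if \<nu> = 0 then (2 * of_real pi)\<^sup>2 else 0)) (cbox (0, 0) (2 * pi, 2 * pi))"
proof -
  obtain j k where \<nu>: "\<nu> = (s * of_int j, s * of_int k)" using assms by (auto simp: rlat_iff)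
  define e where "e = (\<lambda>k t. exp (\<i> * (of_int k * complex_of_real t)))"
  define c where "c = (\<lambda>k::int. if k = 0 then 2 * complex_of_real pi else 0)"
  have ci: "integral {0..2*pi} (e k) = c k" for k
    using has_integral_exp_int[of k] by (simp add: e_def c_def has_integral_iff)
  have eq: "chr (of_real (fst \<psi> / s), of_real (snd \<psi> / s)) \<nu> = e j (fst \<psi>) * e k (snd \<psi>)" for \<psi>
    using assms by (simp add: \<nu> chr_def e_def distrib_left flip: exp_add)
  have cont: "continuous_on X (\<lambda>\<psi>. e j (fst \<psi>) * e k (snd \<psi>))" for X
    unfolding e_def by (intro continuous_intros)
  have "integral (cbox (0, 0) (2 * pi, 2 * pi)) (\<lambda>\<psi>. e j (fst \<psi>) * e k (snd \<psi>)) = c j * c k"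
    by (simp add: integral_prod_continuous[OF cont] ci)
  then have "((\<lambda>\<psi>. e j (fst \<psi>) * e k (snd \<psi>)) has_integral c j * c k) (cbox (0, 0) (2 * pi, 2 * pi))"
    using integrable_continuous[OF cont] by (simp add: has_integral_iff)
  moreover have "c j * c k = (if \<nu> = 0 then (2 * of_real pi)\<^sup>2 else 0)"
    using assms by (auto simp: c_def \<nu> power2_eq_square zero_prod_def)
  ultimately show ?thesis unfolding eq by simp
qed

text \<open>The series converges uniformly for real arguments, so it is integrated term by term, and
  only the mode 0 has a nonzero integral. The partial integrals form a net over finite sets that is
  constant as soon as 0 belongs to the set.\<close>

lemma has_integral_ev:
  assumes s: "s > 0" and u: "u \<in> wlat s"
  shows "((\<lambda>\<psi>. ev u (of_real (fst \<psi> / s), of_real (snd \<psi> / s))) has_integral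
     (2 * of_real pi)\<^sup>2 * cf u 0) (cbox (0, 0) (2 * pi, 2 * pi))"
proof -
  let ?z = "\<lambda>\<psi>::real \<times> real. (complex_of_real (fst \<psi> / s), complex_of_real (snd \<psi> / s))"
  let ?Q = "cbox (0, 0) (2 * pi, 2 * pi) :: (real \<times> real) set"
  let ?f = "\<lambda>F \<psi>. \<Sum>\<nu>\<in>F. cf u \<nu> * chr (?z \<psi>) \<nu>"
  have "norm (chr (?z \<psi>) \<nu>) \<le> 1" for \<psi> \<nu>
    using norm_chr_le[of "?z \<psi>" 0 \<nu>] by simp
  then have "uniform_limit ?Q ?f (\<lambda>\<psi>. ev u (?z \<psi>)) (finite_subsets_at_top UNIV)"
    unfolding ev_def
    by (intro Weierstrass_m_test_general[where M="\<lambda>\<nu>. norm (cf u \<nu>)"])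
      (auto simp: cf_abs_summable norm_mult mult_left_le)
  moreover have "continuous_on ?Q (?f F)" for F
    using s unfolding chr_def by (intro continuous_intros) auto
  ultimately obtain I J where I: "\<And>F. (?f F has_integral I F) ?Q"
    and J: "((\<lambda>\<psi>. ev u (?z \<psi>)) has_integral J) ?Q" and IJ: "(I \<longlongrightarrow> J) (finite_subsets_at_top UNIV)"
    by (rule uniform_limit_integral_cbox) auto
  have I_eq: "I F = (if 0 \<in> F then (2 * of_real pi)\<^sup>2 * cf u 0 else 0)" if "finite F" for F
  proof -
    have "((\<lambda>\<psi>. cf u \<nu> * chr (?z \<psi>) \<nu>) has_integral (if \<nu> = 0 then (2 * of_real pi)\<^sup>2 * cf u 0 else 0)) ?Q" for \<nu>
    proof (cases "\<nu> \<in> rlat s")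
      case True
      show ?thesis
        using has_integral_mult_right[OF has_integral_chr[OF s True], of "cf u \<nu>"]
        by (auto simp: mult.commute)
    next
      case False
      then have "\<nu> \<noteq> 0" by auto
      then show ?thesis using wlat_notin[OF u False] by simp
    qed
    then have "(?f F has_integral (\<Sum>\<nu>\<in>F. if \<nu> = 0 then (2 * of_real pi)\<^sup>2 * cf u 0 else 0)) ?Q"
      using that by (intro has_integral_sum) auto
    then have "I F = (\<Sum>\<nu>\<in>F. if \<nu> = 0 then (2 * of_real pi)\<^sup>2 * cf u 0 else 0)"
      using I has_integral_unique by blast
    then show ?thesis using that by simp
  qed
  have "eventually (\<lambda>F. I F = (2 * of_real pi)\<^sup>2 * cf u 0) (finite_subsets_at_top UNIV)"
    unfolding eventually_finite_subsets_at_top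
    by (intro exI[of _ "{0}"]) (auto simp: I_eq)
  then have "(I \<longlongrightarrow> (2 * of_real pi)\<^sup>2 * cf u 0) (finite_subsets_at_top UNIV)"
    by (rule tendsto_eventually)
  with IJ have "J = (2 * of_real pi)\<^sup>2 * cf u 0"
    using tendsto_unique finite_subsets_at_top_neq_bot by blast
  with J show ?thesis by simp
qed

lemma wlat_cf_0_real: "u \<in> wlat s \<Longrightarrow> cf u 0 = of_real (Re (cf u 0))"
  using wlat_minus[of u s 0] by (simp add: complex_eq_iff)

text \<open>The bridge from pointwise inequalities at real arguments to inequalities between mean
  values; through it the sign of the nonlinearity reaches the zeroth coefficient.\<close>

lemma mean_nonneg:
  assumes s: "s > 0" and u: "u \<in> wlat s" and pos: "\<And>\<psi>. evr u \<psi> \<ge> 0"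
  shows "Re (cf u 0) \<ge> 0"
proof -
  have "((\<lambda>\<psi>. Re (ev u (of_real (fst \<psi> / s), of_real (snd \<psi> / s)))) has_integral
     Re ((2 * of_real pi)\<^sup>2 * cf u 0)) (cbox (0, 0) (2 * pi, 2 * pi))"
    using has_integral_linear[OF has_integral_ev[OF s u] bounded_linear_Re] by (simp add: o_def)
  moreover have "Re (ev u (of_real (fst \<psi> / s), of_real (snd \<psi> / s))) \<ge> 0" for \<psi> :: "real \<times> real"
    using pos[of "(fst \<psi> / s, snd \<psi> / s)"] by (simp add: evr_def)
  ultimately have "Re ((2 * of_real pi)\<^sup>2 * cf u 0) \<ge> 0"
    by (rule has_integral_nonneg) 
  moreover have "Re ((2 * of_real pi)\<^sup>2 * cf u 0) = (2 * pi)\<^sup>2 * Re (cf u 0)"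
    by (simp add: power2_eq_square)
  ultimately show ?thesis by (simp add: zero_le_mult_iff)
qed

text \<open>Parseval's identity; the reality of \<open>v\<close> turns the reflected coefficient
  into a conjugate.\<close>

lemma cf_mult_0:
  assumes "v \<in> wlat s"
  shows "cf (u * v) 0 = (\<Sum>\<^sub>\<infinity>\<mu>. cf u \<mu> * cnj (cf v \<mu>))"
    and "(\<lambda>\<mu>. cf u \<mu> * cnj (cf v \<mu>)) summable_on UNIV"
  using cf_mult_summable[of u v 0] by (simp_all add: cf_mult wlat_minus[OF assms])

subsection \<open>Power series in a commutative Banach algebra\<close>

text \<open>The algebra is left open so that one coefficient sequence acts on reals, on complex
  numbers and on \<open>wa\<close>; evaluation, dilation and the embedding of the reals then commute
  with it.\<close>

definition gser :: "(nat \<Rightarrow> real) \<Rightarrow> 'a::{real_normed_algebra_1,comm_ring_1,banach} \<Rightarrow> 'a" where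
  "gser a x = (\<Sum>k. a k *\<^sub>R x ^ k)"

definition gder :: "(nat \<Rightarrow> real) \<Rightarrow> 'a::{real_normed_algebra_1,comm_ring_1,banach} \<Rightarrow> 'a" where
  "gder a x = (\<Sum>k. (real k * a k) *\<^sub>R x ^ (k - 1))"

lemma norm_power_diff_le:
  fixes x y :: "'a::{real_normed_algebra_1,comm_ring_1}"
  assumes "norm x \<le> m" "norm y \<le> m"
  shows "norm (x ^ Suc k - y ^ Suc k) \<le> real (Suc k) * m ^ k * norm (x - y)"
proof (induction k)
  case (Suc k)
  have m: "m \<ge> 0" using assms(1) norm_ge_zero order_trans by blast
  have yk: "norm (y ^ Suc k) \<le> m ^ Suc k"
    using norm_power_ineq[of y "Suc k"] power_mono[OF assms(2), of "Suc k"] by simp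
  have "x ^ Suc (Suc k) - y ^ Suc (Suc k) = x * (x ^ Suc k - y ^ Suc k) + (x - y) * y ^ Suc k"
    by (simp add: algebra_simps)
  also have "norm \<dots> \<le> norm x * norm (x ^ Suc k - y ^ Suc k) + norm (x - y) * norm (y ^ Suc k)"
    by (intro norm_triangle_le add_mono norm_mult_ineq)
  also have "\<dots> \<le> m * (real (Suc k) * m ^ k * norm (x - y)) + norm (x - y) * m ^ Suc k"
    using assms m Suc yk by (intro add_mono mult_mono) auto
  finally show ?case by (simp add: algebra_simps)
qed auto

text \<open>The linearisation point \<open>v\<close> may differ from both \<open>x\<close> and
  \<open>y\<close>: the linear part has to stay fixed during an iteration in which \<open>x\<close>
  and \<open>y\<close> vary.\<close>

lemma norm_power_taylor_le:
  fixes x y v :: "'a::{real_normed_algebra_1,comm_ring_1}"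
  assumes "norm x \<le> m" "norm y \<le> m" "norm v \<le> m" "norm (x - v) \<le> d" "norm (y - v) \<le> d"
  shows "norm (x ^ Suc (Suc k) - y ^ Suc (Suc k) - real (Suc (Suc k)) *\<^sub>R (v ^ Suc k * (x - y)))
    \<le> (real (Suc (Suc k)))\<^sup>2 * m ^ k * d * norm (x - y)"
proof (induction k)
  case 0
  have d: "d \<ge> 0" using assms(4) norm_ge_zero order_trans by blast
  have "x ^ Suc (Suc 0) - y ^ Suc (Suc 0) - real (Suc (Suc 0)) *\<^sub>R (v ^ Suc 0 * (x - y)) = ((x - v) + (y - v)) * (x - y)"
    by (simp add: algebra_simps scaleR_2)
  also have "norm \<dots> \<le> (norm (x - v) + norm (y - v)) * norm (x - y)"
    by (intro order_trans[OF norm_mult_ineq] mult_right_mono norm_triangle_ineq) auto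
  also have "\<dots> \<le> (d + d) * norm (x - y)"
    using assms by (intro mult_right_mono add_mono) auto
  also have "\<dots> \<le> 4 * d * norm (x - y)"
    using d by (intro mult_right_mono) auto
  finally show ?case by simp
next
  case (Suc k)
  define K where "K = real (Suc (Suc k))"
  have m: "m \<ge> 0" using assms(1) norm_ge_zero order_trans by blast
  have d: "d \<ge> 0" using assms(4) norm_ge_zero order_trans by blast
  have vk: "norm (v ^ Suc k) \<le> m ^ Suc k"
    using norm_power_ineq[of v "Suc k"] power_mono[OF assms(3), of "Suc k"] by simp
  have yv: "norm (y ^ Suc (Suc k) - v ^ Suc (Suc k)) \<le> K * m ^ Suc k * d"
    unfolding K_def
    by (rule order_trans[OF norm_power_diff_le[OF assms(2,3)]]) (use assms m in \<open>intro mult_left_mono, auto\<close>)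
  have e: "real (Suc (Suc (Suc k))) = K + 1" by (simp add: K_def)
  have "x ^ Suc (Suc (Suc k)) - y ^ Suc (Suc (Suc k)) - real (Suc (Suc (Suc k))) *\<^sub>R (v ^ Suc (Suc k) * (x - y))
      = x * (x ^ Suc (Suc k) - y ^ Suc (Suc k) - K *\<^sub>R (v ^ Suc k * (x - y)))
        + (x - y) * (K *\<^sub>R (v ^ Suc k * (x - v)) + (y ^ Suc (Suc k) - v ^ Suc (Suc k)))"
    unfolding e by (simp add: algebra_simps)
  also have "norm \<dots> \<le> norm x * norm (x ^ Suc (Suc k) - y ^ Suc (Suc k) - K *\<^sub>R (v ^ Suc k * (x - y)))
      + norm (x - y) * norm (K *\<^sub>R (v ^ Suc k * (x - v)) + (y ^ Suc (Suc k) - v ^ Suc (Suc k)))"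
    by (intro norm_triangle_le add_mono norm_mult_ineq)
  also have "\<dots> \<le> m * (K\<^sup>2 * m ^ k * d * norm (x - y)) + norm (x - y) * (K * (m ^ Suc k * d) + K * m ^ Suc k * d)"
  proof (intro add_mono mult_mono)
    show "norm (K *\<^sub>R (v ^ Suc k * (x - v)) + (y ^ Suc (Suc k) - v ^ Suc (Suc k))) \<le> K * (m ^ Suc k * d) + K * m ^ Suc k * d"
    proof (intro norm_triangle_le add_mono yv)
      have "norm (v ^ Suc k * (x - v)) \<le> m ^ Suc k * d"
        using vk assms(4) m by (intro order_trans[OF norm_mult_ineq] mult_mono) auto
      then show "norm (K *\<^sub>R (v ^ Suc k * (x - v))) \<le> K * (m ^ Suc k * d)"
        by (simp add: K_def mult_left_mono del: power_Suc)
    qed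
  qed (use assms m Suc in \<open>auto simp: K_def\<close>)
  also have "\<dots> = (K\<^sup>2 + 2 * K) * m ^ Suc k * d * norm (x - y)"
    by (simp add: algebra_simps)
  also have "\<dots> \<le> (K + 1)\<^sup>2 * m ^ Suc k * d * norm (x - y)"
    using m d by (intro mult_right_mono) (auto simp: power2_sum)
  finally show ?case by (simp only: e)
qed

text \<open>The factor \<open>(real k)\<^sup>2\<close> pays for a second-order Taylor remainder. The
  exponent \<open>k - n\<close> in place of \<open>k\<close> normalises \<open>C\<close> in such a
  way that the zero of order \<open>n\<close> appears as explicit powers of the argument in all
  estimates.\<close>

definition gcoeffs :: "(nat \<Rightarrow> real) \<Rightarrow> nat \<Rightarrow> real \<Rightarrow> real \<Rightarrow> bool" where
  "gcoeffs a n \<rho> C \<longleftrightarrow> n \<ge> 2 \<and> \<rho> > 0 \<and> (\<forall>k<n. a k = 0) \<and>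
     summable (\<lambda>k. \<bar>a k\<bar> * (real k)\<^sup>2 * \<rho> ^ (k - n)) \<and> (\<Sum>k. \<bar>a k\<bar> * (real k)\<^sup>2 * \<rho> ^ (k - n)) \<le> C"

text \<open>The comparison test shared by the estimates below; \<open>M\<close> is the part of each
  bound that does not depend on \<open>k\<close>.\<close>

lemma gcoeffs_bound:
  fixes T :: "nat \<Rightarrow> 'a::banach"
  assumes g: "gcoeffs a n \<rho> C" and M: "M \<ge> 0"
    and T: "\<And>k. k \<ge> n \<Longrightarrow> norm (T k) \<le> \<bar>a k\<bar> * (real k)\<^sup>2 * \<rho> ^ (k - n) * M"
    and T0: "\<And>k. k < n \<Longrightarrow> T k = 0"
  shows "summable (\<lambda>k. norm (T k))" and "summable T" and "norm (suminf T) \<le> C * M"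
proof -
  let ?A = "\<lambda>k. \<bar>a k\<bar> * (real k)\<^sup>2 * \<rho> ^ (k - n)"
  have sA: "summable ?A" and C: "suminf ?A \<le> C" and \<rho>: "\<rho> > 0" using g by (auto simp: gcoeffs_def)
  have le: "norm (T k) \<le> ?A k * M" for k
    using T[of k] T0[of k] \<rho> M by (cases "k \<ge> n") auto
  show s: "summable (\<lambda>k. norm (T k))"
    by (rule summable_comparison_test'[OF summable_mult2[OF sA, of M], of 0]) (use le in auto)
  then show "summable T" by (rule summable_norm_cancel)
  have "norm (suminf T) \<le> (\<Sum>k. norm (T k))" by (rule summable_norm[OF s])
  also have "\<dots> \<le> (\<Sum>k. ?A k * M)" by (rule suminf_le[OF le s summable_mult2[OF sA]])
  also have "\<dots> = suminf ?A * M" by (rule suminf_mult2[OF sA, symmetric])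
  also have "\<dots> \<le> C * M" by (rule mult_right_mono[OF C M])
  finally show "norm (suminf T) \<le> C * M" .
qed

text \<open>Of the \<open>k - j\<close> factors, \<open>k - n\<close> are absorbed into the radius
  of convergence and \<open>n - j\<close> are kept as smallness.\<close>

lemma power_split_le:
  fixes m \<rho> :: real
  assumes "0 \<le> m" "m \<le> \<rho>" "n \<le> k" "j \<le> n"
  shows "m ^ (k - j) \<le> \<rho> ^ (k - n) * m ^ (n - j)"
proof -
  have "m ^ (k - j) = m ^ (k - n) * m ^ (n - j)"
    using assms by (simp flip: power_add)
  also have "\<dots> \<le> \<rho> ^ (k - n) * m ^ (n - j)"
    using assms by (intro mult_right_mono power_mono) auto
  finally show ?thesis .
qed

context
  fixes a n \<rho> C
  assumes g: "gcoeffs a n \<rho> C"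
begin

lemma n2: "n \<ge> 2" and \<rho>_pos: "\<rho> > 0" and a_low: "k < n \<Longrightarrow> a k = 0"
  using g by (auto simp: gcoeffs_def)

lemma C_nonneg: "C \<ge> 0"
proof -
  have "0 \<le> (\<Sum>k. \<bar>a k\<bar> * (real k)\<^sup>2 * \<rho> ^ (k - n))"
    using g by (intro suminf_nonneg) (auto simp: gcoeffs_def)
  with g show ?thesis by (auto simp: gcoeffs_def)
qed

lemma term_le:
  fixes m :: real
  assumes "0 \<le> m" "m \<le> \<rho>" "k \<ge> n" "j \<le> n" "c \<le> (real k)\<^sup>2" "0 \<le> c" "0 \<le> b"
  shows "\<bar>a k\<bar> * (c * (m ^ (k - j) * b)) \<le> \<bar>a k\<bar> * (real k)\<^sup>2 * \<rho> ^ (k - n) * (m ^ (n - j) * b)"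
proof -
  have "c * (m ^ (k - j) * b) \<le> (real k)\<^sup>2 * ((\<rho> ^ (k - n) * m ^ (n - j)) * b)"
    using assms \<rho>_pos by (intro mult_mono mult_right_mono power_split_le) auto
  then show ?thesis
    by (simp add: mult.assoc mult_left_mono)
qed

lemma k_le_k2: "k \<ge> n \<Longrightarrow> 1 \<le> (real k)\<^sup>2" "k \<ge> n \<Longrightarrow> real k \<le> (real k)\<^sup>2"
  using n2 by (auto intro!: one_le_power self_le_power)

lemma gser_summable:
  fixes x :: "'a::{real_normed_algebra_1,comm_ring_1,banach}"
  assumes "norm x \<le> m" "m \<le> \<rho>"
  shows "summable (\<lambda>k. a k *\<^sub>R x ^ k)" and "norm (gser a x) \<le> C * m ^ n"
proof -
  have m: "m \<ge> 0" using assms(1) norm_ge_zero order_trans by blast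
  have "norm (a k *\<^sub>R x ^ k) \<le> \<bar>a k\<bar> * (real k)\<^sup>2 * \<rho> ^ (k - n) * m ^ n" if "k \<ge> n" for k
  proof -
    have "norm (x ^ k) \<le> m ^ k"
      using norm_power_ineq[of x k] power_mono[OF assms(1), of k] by simp
    then have "norm (a k *\<^sub>R x ^ k) \<le> \<bar>a k\<bar> * (1 * (m ^ (k - 0) * 1))"
      by (simp add: mult_left_mono)
    also have "\<dots> \<le> \<bar>a k\<bar> * (real k)\<^sup>2 * \<rho> ^ (k - n) * (m ^ (n - 0) * 1)"
      using m assms that k_le_k2 by (intro term_le) auto
    finally show ?thesis by simp
  qed
  note * = gcoeffs_bound[OF g _ this]
  show "summable (\<lambda>k. a k *\<^sub>R x ^ k)"
    by (rule *(2)) (use m a_low in auto)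
  show "norm (gser a x) \<le> C * m ^ n"
    unfolding gser_def by (rule *(3)) (use m a_low in auto)
qed

lemma gder_summable:
  fixes x :: "'a::{real_normed_algebra_1,comm_ring_1,banach}"
  assumes "norm x \<le> m" "m \<le> \<rho>"
  shows "summable (\<lambda>k. (real k * a k) *\<^sub>R x ^ (k - 1))" and "norm (gder a x) \<le> C * m ^ (n - 1)"
proof -
  have m: "m \<ge> 0" using assms(1) norm_ge_zero order_trans by blast
  have "norm ((real k * a k) *\<^sub>R x ^ (k - 1)) \<le> \<bar>a k\<bar> * (real k)\<^sup>2 * \<rho> ^ (k - n) * m ^ (n - 1)" if "k \<ge> n" for k
  proof -
    have "norm (x ^ (k - 1)) \<le> m ^ (k - 1)"
      using norm_power_ineq[of x "k - 1"] power_mono[OF assms(1), of "k - 1"] by simp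
    then have "norm ((real k * a k) *\<^sub>R x ^ (k - 1)) \<le> \<bar>a k\<bar> * (real k * (m ^ (k - 1) * 1))"
      by (simp add: mult_left_mono abs_mult mult_ac)
    also have "\<dots> \<le> \<bar>a k\<bar> * (real k)\<^sup>2 * \<rho> ^ (k - n) * (m ^ (n - 1) * 1)"
      using m assms that k_le_k2 n2 by (intro term_le) auto
    finally show ?thesis by simp
  qed
  note * = gcoeffs_bound[OF g _ this]
  show "summable (\<lambda>k. (real k * a k) *\<^sub>R x ^ (k - 1))"
    by (rule *(2)) (use m a_low in auto)
  show "norm (gder a x) \<le> C * m ^ (n - 1)"
    unfolding gder_def by (rule *(3)) (use m a_low in auto)
qed

lemma gser_lipschitz:
  fixes x y :: "'a::{real_normed_algebra_1,comm_ring_1,banach}"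
  assumes "norm x \<le> m" "norm y \<le> m" "m \<le> \<rho>"
  shows "norm (gser a x - gser a y) \<le> C * (m ^ (n - 1) * norm (x - y))"
proof -
  have m: "m \<ge> 0" using assms(1) norm_ge_zero order_trans by blast
  have "norm (a k *\<^sub>R x ^ k - a k *\<^sub>R y ^ k) \<le> \<bar>a k\<bar> * (real k)\<^sup>2 * \<rho> ^ (k - n) * (m ^ (n - 1) * norm (x - y))"
    if "k \<ge> n" for k
  proof -
    obtain j where j: "k = Suc j" using \<open>k \<ge> n\<close> n2 by (cases k) auto
    have "norm (a k *\<^sub>R x ^ k - a k *\<^sub>R y ^ k) = \<bar>a k\<bar> * norm (x ^ k - y ^ k)"
      by (simp flip: scaleR_diff_right)
    also have "\<dots> \<le> \<bar>a k\<bar> * (real k * (m ^ (k - 1) * norm (x - y)))"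
      using norm_power_diff_le[OF assms(1,2), of j] by (intro mult_left_mono) (simp_all add: j mult.assoc)
    also have "\<dots> \<le> \<bar>a k\<bar> * (real k)\<^sup>2 * \<rho> ^ (k - n) * (m ^ (n - 1) * norm (x - y))"
      using m assms that k_le_k2 n2 by (intro term_le) auto
    finally show ?thesis .
  qed
  note * = gcoeffs_bound(3)[OF g _ this]
  have "gser a x - gser a y = (\<Sum>k. a k *\<^sub>R x ^ k - a k *\<^sub>R y ^ k)"
    unfolding gser_def using assms by (intro suminf_diff gser_summable(1)) auto
  also have "norm \<dots> \<le> C * (m ^ (n - 1) * norm (x - y))"
    by (rule *) (use m a_low in auto)
  finally show ?thesis .
qed

lemma gser_taylor:
  fixes x y v :: "'a::{real_normed_algebra_1,comm_ring_1,banach}"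
  assumes "norm x \<le> m" "norm y \<le> m" "norm v \<le> m" "norm (x - v) \<le> d" "norm (y - v) \<le> d" "m \<le> \<rho>"
  shows "norm (gser a x - gser a y - gder a v * (x - y)) \<le> C * (m ^ (n - 2) * (d * norm (x - y)))"
proof -
  have m: "m \<ge> 0" using assms(1) norm_ge_zero order_trans by blast
  have d: "d \<ge> 0" using assms(4) norm_ge_zero order_trans by blast
  let ?T = "\<lambda>k. a k *\<^sub>R x ^ k - a k *\<^sub>R y ^ k - (real k * a k) *\<^sub>R v ^ (k - 1) * (x - y)"
  have "norm (?T k) \<le> \<bar>a k\<bar> * (real k)\<^sup>2 * \<rho> ^ (k - n) * (m ^ (n - 2) * (d * norm (x - y)))"
    if "k \<ge> n" for k
  proof -
    define j where "j = k - 2"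
    have j: "k = Suc (Suc j)" using \<open>k \<ge> n\<close> n2 by (simp add: j_def)
    have "?T k = a k *\<^sub>R (x ^ k - y ^ k - real k *\<^sub>R (v ^ (k - 1) * (x - y)))"
      by (simp add: scaleR_diff_right mult.commute)
    then have "norm (?T k) = \<bar>a k\<bar> * norm (x ^ k - y ^ k - real k *\<^sub>R (v ^ (k - 1) * (x - y)))"
      by (simp only: norm_scaleR)
    also have "\<dots> \<le> \<bar>a k\<bar> * ((real k)\<^sup>2 * (m ^ (k - 2) * (d * norm (x - y))))"
      using norm_power_taylor_le[OF assms(1-5), of j]
      by (intro mult_left_mono) (simp_all add: j mult.assoc del: power_Suc of_nat_Suc)
    also have "\<dots> \<le> \<bar>a k\<bar> * (real k)\<^sup>2 * \<rho> ^ (k - n) * (m ^ (n - 2) * (d * norm (x - y)))"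
      using m d assms that n2 by (intro term_le) auto
    finally show ?thesis .
  qed
  note * = gcoeffs_bound(3)[OF g _ this]
  have sx: "summable (\<lambda>k. a k *\<^sub>R x ^ k)" and sy: "summable (\<lambda>k. a k *\<^sub>R y ^ k)"
    using assms by (auto intro: gser_summable(1))
  have sv: "summable (\<lambda>k. (real k * a k) *\<^sub>R v ^ (k - 1))"
    by (rule gder_summable(1)[OF assms(3,6)])
  have "gser a x - gser a y - gder a v * (x - y) = suminf ?T"
    unfolding gser_def gder_def
    by (simp only: suminf_diff[OF sx sy] suminf_mult2[OF sv] suminf_diff[OF summable_diff[OF sx sy] summable_mult2[OF sv]])
  also have "norm \<dots> \<le> C * (m ^ (n - 2) * (d * norm (x - y)))"
    by (rule *) (use m d a_low in auto)
  finally show ?thesis .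
qed

lemma gser_hom:
  fixes \<phi> :: "'a::{real_normed_algebra_1,comm_ring_1,banach} \<Rightarrow> 'b::{real_normed_algebra_1,comm_ring_1,banach}"
  assumes "bounded_linear \<phi>" "\<And>x y. \<phi> (x * y) = \<phi> x * \<phi> y" "\<phi> 1 = 1" "norm x \<le> \<rho>"
  shows "\<phi> (gser a x) = gser a (\<phi> x)" and "\<phi> (gder a x) = gder a (\<phi> x)"
proof -
  interpret \<phi>: bounded_linear \<phi> by fact
  have p: "\<phi> (x ^ k) = \<phi> x ^ k" for k by (induction k) (simp_all add: assms)
  show "\<phi> (gser a x) = gser a (\<phi> x)"
    unfolding gser_def using \<phi>.suminf[OF gser_summable(1)[OF assms(4) order_refl]] by (simp add: \<phi>.scaleR p)
  show "\<phi> (gder a x) = gder a (\<phi> x)"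
    unfolding gder_def using \<phi>.suminf[OF gder_summable(1)[OF assms(4) order_refl]] by (simp add: \<phi>.scaleR p)
qed

lemma gser_mem:
  fixes x :: "'a::{real_normed_algebra_1,comm_ring_1,banach}"
  assumes S: "closed S" "0 \<in> S" "1 \<in> S" "\<And>x y. x \<in> S \<Longrightarrow> y \<in> S \<Longrightarrow> x + y \<in> S"
    "\<And>x y. x \<in> S \<Longrightarrow> y \<in> S \<Longrightarrow> x * y \<in> S" "\<And>c x. x \<in> S \<Longrightarrow> c *\<^sub>R x \<in> S"
    and x: "x \<in> S" "norm x \<le> \<rho>"
  shows "gser a x \<in> S" and "gder a x \<in> S"
proof -
  have p: "x ^ k \<in> S" for k by (induction k) (auto intro: S x)
  have sum: "(\<Sum>k<N. c k *\<^sub>R x ^ e k) \<in> S" for N :: nat and c e by (induction N) (auto intro: S p)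
  have mem: "suminf (\<lambda>k. c k *\<^sub>R x ^ e k) \<in> S" if "summable (\<lambda>k. c k *\<^sub>R x ^ e k)" for c e
    by (rule closed_sequentially[OF S(1) _ summable_LIMSEQ[OF that]]) (rule sum)
  show "gser a x \<in> S" "gder a x \<in> S"
    unfolding gser_def gder_def
    by (rule mem, rule gser_summable(1)[OF x(2) order_refl] gder_summable(1)[OF x(2) order_refl])+
qed

text \<open>The Taylor bound with \<open>x\<close> itself as linearisation point leaves a quadratic
  error, hence a linear one for the difference quotient.\<close>

lemma gser_real_DERIV:
  fixes x :: real
  assumes "\<bar>x\<bar> < \<rho>"
  shows "(gser a has_real_derivative gder a x) (at x)"
proof -
  have "((\<lambda>y. (gser a y - gser a x) / (y - x) - gder a x) \<longlongrightarrow> 0) (at x)"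
  proof (rule tendsto_0_le[where K=1])
    show "((\<lambda>y. C * \<rho> ^ (n - 2) * \<bar>y - x\<bar>) \<longlongrightarrow> 0) (at x)"
      by (auto intro!: tendsto_eq_intros)
    have "eventually (\<lambda>y. y \<in> ball 0 \<rho> - {x}) (at x)"
      using assms by (intro eventually_at_in_open) auto
    then show "eventually (\<lambda>y. norm ((gser a y - gser a x) / (y - x) - gder a x) \<le> norm (C * \<rho> ^ (n - 2) * \<bar>y - x\<bar>) * 1) (at x)"
    proof eventually_elim
      case (elim y)
      then have y: "\<bar>y\<bar> \<le> \<rho>" "y - x \<noteq> 0" by auto
      have "\<bar>gser a y - gser a x - gder a x * (y - x)\<bar> \<le> C * (\<rho> ^ (n - 2) * (\<bar>y - x\<bar> * \<bar>y - x\<bar>))"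
        using gser_taylor[of y \<rho> x x "\<bar>y - x\<bar>"] y assms by auto
      moreover have "(gser a y - gser a x) / (y - x) - gder a x = (gser a y - gser a x - gder a x * (y - x)) / (y - x)"
        using y(2) by (simp add: field_simps)
      ultimately show ?case
        using y(2) C_nonneg \<rho>_pos by (simp add: abs_mult pos_divide_le_eq mult_ac)
    qed
  qed
  then show ?thesis
    unfolding has_field_derivative_iff using Lim_null by blast
qed

text \<open>Once the term \<open>k = n\<close> is removed, every remaining term has at least one
  more power of \<open>x\<close> to spare.\<close>

lemma gder_leading:
  fixes x :: real
  assumes "\<bar>x\<bar> \<le> \<rho>"
  shows "\<bar>gder a x - real n * a n * x ^ (n - 1)\<bar> \<le> C / \<rho> * \<bar>x\<bar> ^ n"
proof -
  let ?T = "\<lambda>k. (real k * a k) *\<^sub>R x ^ (k - 1) - (if k = n then real n * a n * x ^ (n - 1) else 0)"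
  have s1: "summable (\<lambda>k. (real k * a k) *\<^sub>R x ^ (k - 1))"
    using gder_summable(1)[of x \<rho>] assms by simp
  have s2: "summable (\<lambda>k. if k = n then real n * a n * x ^ (n - 1) else 0)" by simp
  have T: "norm (?T k) \<le> \<bar>a k\<bar> * (real k)\<^sup>2 * \<rho> ^ (k - n) * (\<bar>x\<bar> ^ n / \<rho>)" if "k \<ge> n" for k
  proof (cases "k = n")
    case True
    then show ?thesis using \<rho>_pos by simp
  next
    case False
    define j where "j = k - n - 1"
    have j: "k = n + Suc j" using that False by (simp add: j_def)
    have "\<bar>x\<bar> ^ (k - 1) = \<bar>x\<bar> ^ j * \<bar>x\<bar> ^ n" by (simp add: j power_add)
    also have "\<dots> \<le> \<rho> ^ j * \<bar>x\<bar> ^ n" using assms by (intro mult_right_mono power_mono) auto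
    also have "\<rho> ^ j * \<bar>x\<bar> ^ n = \<rho> ^ (k - n) * (\<bar>x\<bar> ^ n / \<rho>)"
      using \<rho>_pos by (simp add: j)
    finally have 1: "\<bar>x\<bar> ^ (k - 1) \<le> \<rho> ^ (k - n) * (\<bar>x\<bar> ^ n / \<rho>)" .
    have "norm (?T k) = \<bar>a k\<bar> * (real k * \<bar>x\<bar> ^ (k - 1))"
      using False by (simp add: abs_mult power_abs)
    also have "\<dots> \<le> \<bar>a k\<bar> * ((real k)\<^sup>2 * (\<rho> ^ (k - n) * (\<bar>x\<bar> ^ n / \<rho>)))"
      using 1 k_le_k2[OF that] \<rho>_pos by (intro mult_left_mono mult_mono) auto
    finally show ?thesis by (simp add: mult.assoc)
  qed
  have "gder a x - real n * a n * x ^ (n - 1) = suminf ?T"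
    unfolding gder_def suminf_diff[OF s1 s2, symmetric]
    using suminf_finite[of "{n}" "\<lambda>k. if k = n then real n * a n * x ^ (n - 1) else 0"] by simp
  also have "norm (suminf ?T) \<le> C * (\<bar>x\<bar> ^ n / \<rho>)"
    by (rule gcoeffs_bound(3)[OF g _ T]) (use a_low \<rho>_pos in auto)
  finally show ?thesis by simp
qed

end

section \<open>Sign and monotonicity near a zero of odd order\<close>

text \<open>Since \<open>n - 1\<close> is even, the leading term of the derivative has the sign of
  \<open>a n\<close> on both sides of 0, and near 0 the remainder consumes at most half of it. The
  second bound integrates the first.\<close>

lemma gser_real_sign:
  assumes g: "gcoeffs a n \<rho> C" and n: "odd n" and an: "a n \<noteq> 0"
  obtains \<rho>0 where "0 < \<rho>0" "\<rho>0 < \<rho>"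
    "\<And>x::real. \<bar>x\<bar> \<le> \<rho>0 \<Longrightarrow> sgn (a n) * gder a x \<ge> real n * \<bar>a n\<bar> / 2 * x ^ (n - 1)"
    "\<And>x y::real. \<bar>x\<bar> \<le> \<rho>0 \<Longrightarrow> \<bar>y\<bar> \<le> \<rho>0 \<Longrightarrow> x \<le> y \<Longrightarrow>
       sgn (a n) * (gser a y - gser a x) \<ge> \<bar>a n\<bar> / 2 * (y ^ n - x ^ n)"
proof -
  note n2 = n2[OF g] and \<rho> = \<rho>_pos[OF g] and C = C_nonneg[OF g]
  define c where "c = real n * \<bar>a n\<bar> / 2"
  have c: "c > 0" using n2 an by (simp add: c_def)
  \<comment> \<open>The second entry makes \<open>C / \<rho> * \<rho>0 \<le> c\<close>, so that the
    remainder takes at most \<open>c\<close> of the \<open>2 * c\<close> in the leading term;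
    \<open>C + 1\<close> covers the case \<open>C = 0\<close>.\<close>
  define \<rho>0 where "\<rho>0 = min (\<rho> / 2) (c * \<rho> / (C + 1))"
  have r: "0 < \<rho>0" "\<rho>0 < \<rho>" using \<rho> c C by (auto simp: \<rho>0_def)
  have small: "C / \<rho> * \<rho>0 \<le> c"
  proof -
    have "C / \<rho> * \<rho>0 \<le> C / \<rho> * (c * \<rho> / (C + 1))"
      using C \<rho> by (intro mult_left_mono) (auto simp: \<rho>0_def)
    also have "\<dots> \<le> c"
      using C \<rho> c by (simp add: field_simps)
    finally show ?thesis .
  qed
  have 1: "sgn (a n) * gder a x \<ge> c * x ^ (n - 1)" if x: "\<bar>x\<bar> \<le> \<rho>0" for x :: real
  proof -
    have xp: "x ^ (n - 1) \<ge> 0" using n n2 by (intro zero_le_even_power) simp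
    have xa: "\<bar>x\<bar> ^ n = \<bar>x\<bar> * x ^ (n - 1)"
      using n2 n by (cases n) (auto simp: power_even_abs)
    have "\<bar>gder a x - real n * a n * x ^ (n - 1)\<bar> \<le> C / \<rho> * (\<bar>x\<bar> * x ^ (n - 1))"
      using gder_leading[OF g, of x] x r by (simp add: xa)
    also have "\<dots> \<le> C / \<rho> * \<rho>0 * x ^ (n - 1)"
      using x xp C \<rho> by (simp add: mult.assoc mult_left_mono mult_right_mono divide_right_mono)
    also have "\<dots> \<le> c * x ^ (n - 1)" using small xp by (rule mult_right_mono)
    finally have *: "\<bar>gder a x - real n * a n * x ^ (n - 1)\<bar> \<le> c * x ^ (n - 1)" .
    have "sgn (a n) * gder a x = sgn (a n) * (gder a x - real n * a n * x ^ (n - 1)) + real n * \<bar>a n\<bar> * x ^ (n - 1)"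
      by (simp add: algebra_simps sgn_mult_abs abs_sgn)
    also have "\<dots> \<ge> - (c * x ^ (n - 1)) + 2 * c * x ^ (n - 1)"
    proof -
      have "\<bar>sgn (a n) * (gder a x - real n * a n * x ^ (n - 1))\<bar> \<le> c * x ^ (n - 1)"
        using * an by (simp add: abs_mult abs_sgn_eq)
      then show ?thesis by (simp add: abs_le_iff c_def)
    qed
    finally show ?thesis by simp
  qed
  have 2: "sgn (a n) * (gser a y - gser a x) \<ge> \<bar>a n\<bar> / 2 * (y ^ n - x ^ n)"
    if "\<bar>x\<bar> \<le> \<rho>0" "\<bar>y\<bar> \<le> \<rho>0" "x \<le> y" for x y :: real
  proof -
    define H where "H = (\<lambda>t. sgn (a n) * gser a t - \<bar>a n\<bar> / 2 * t ^ n)"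
    have "H x \<le> H y"
    proof (rule DERIV_nonneg_imp_nondecreasing[OF \<open>x \<le> y\<close>])
      fix t assume t: "x \<le> t" "t \<le> y"
      then have tr: "\<bar>t\<bar> \<le> \<rho>0" using that by auto
      have "(H has_real_derivative sgn (a n) * gder a t - c * t ^ (n - 1)) (at t)"
        unfolding H_def c_def
        by (rule derivative_eq_intros gser_real_DERIV[OF g] refl | use tr r in simp)+
      with 1[OF tr] show "\<exists>y. (H has_real_derivative y) (at t) \<and> 0 \<le> y" by auto
    qed
    then show ?thesis by (simp add: H_def algebra_simps diff_divide_distrib)
  qed
  show thesis using that[OF r] 1 2 by (auto simp: c_def)
qed

lemma contraction_fixpoint:
  fixes \<Phi> :: "'a::banach \<Rightarrow> 'a"
  assumes S: "closed S" "0 \<in> S" and r: "r \<ge> 0"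
    and maps: "\<And>w. w \<in> S \<Longrightarrow> norm w \<le> r \<Longrightarrow> \<Phi> w \<in> S"
    and lip: "\<And>w w'. w \<in> S \<Longrightarrow> norm w \<le> r \<Longrightarrow> w' \<in> S \<Longrightarrow> norm w' \<le> r \<Longrightarrow> norm (\<Phi> w - \<Phi> w') \<le> norm (w - w') / 2"
    and start: "norm (\<Phi> 0) \<le> r / 2"
  obtains w where "w \<in> S" "norm w \<le> r" "\<Phi> w = w"
proof -
  have "\<exists>!x\<in>S \<inter> cball 0 r. \<Phi> x = x"
  proof (rule Banach_fix[where c="1/2"])
    show "complete (S \<inter> cball 0 r)" using S by (simp add: complete_eq_closed closed_Int)
    show "S \<inter> cball 0 r \<noteq> {}" using S r by force
    show "\<Phi> ` (S \<inter> cball 0 r) \<subseteq> S \<inter> cball 0 r"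
    proof (rule image_subsetI)
      fix w assume "w \<in> S \<inter> cball 0 r"
      then have w: "w \<in> S" "norm w \<le> r" by auto
      have "norm (\<Phi> w) \<le> norm (\<Phi> w - \<Phi> 0) + norm (\<Phi> 0)"
        using norm_triangle_ineq[of "\<Phi> w - \<Phi> 0" "\<Phi> 0"] by simp
      also have "\<dots> \<le> r / 2 + r / 2"
        using lip[OF w S(2)] r start w by auto
      finally show "\<Phi> w \<in> S \<inter> cball 0 r" using maps[OF w] by simp
    qed
    show "\<And>x y. x \<in> S \<inter> cball 0 r \<Longrightarrow> y \<in> S \<inter> cball 0 r \<Longrightarrow> dist (\<Phi> x) (\<Phi> y) \<le> 1 / 2 * dist x y"
      using lip by (simp add: dist_norm)
  qed auto
  then show thesis using that by auto
qed

subsection \<open>Differentiation along the flow\<close>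

text \<open>The frequency of a mode along the flow that sends t to (t, \<alpha> t): for
  \<open>\<nu> = (s * j, s * k)\<close> it equals \<open>j + \<alpha> * k\<close>.\<close>

definition fr :: "real \<Rightarrow> real \<Rightarrow> freq \<Rightarrow> real" where
  "fr \<alpha> s \<nu> = (fst \<nu> + \<alpha> * snd \<nu>) / s"

lemma fr_0 [simp]: "fr \<alpha> s 0 = 0" and fr_minus [simp]: "fr \<alpha> s (- \<nu>) = - fr \<alpha> s \<nu>"
  and fr_add: "fr \<alpha> s (\<mu> + \<nu>) = fr \<alpha> s \<mu> + fr \<alpha> s \<nu>"
  by (simp_all add: fr_def add_divide_distrib diff_divide_distrib algebra_simps)

lemma fr_scale: "l \<noteq> 0 \<Longrightarrow> fr \<alpha> (l * s) (l *\<^sub>R \<nu>) = fr \<alpha> s \<nu>"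
  by (simp add: fr_def mult.left_commute[of \<alpha>] flip: distrib_left)

lemma abs_fr_le: "s > 0 \<Longrightarrow> \<bar>fr \<alpha> s \<nu>\<bar> \<le> (1 + \<bar>\<alpha>\<bar>) * (fnorm \<nu> / s)"
proof -
  assume s: "s > 0"
  have "\<bar>fst \<nu> + \<alpha> * snd \<nu>\<bar> \<le> \<bar>fst \<nu>\<bar> + \<bar>\<alpha>\<bar> * \<bar>snd \<nu>\<bar>"
    by (metis abs_mult abs_triangle_ineq)
  also have "\<dots> \<le> (1 + \<bar>\<alpha>\<bar>) * fnorm \<nu>"
    by (simp add: fnorm_def algebra_simps)
  finally show ?thesis using s by (simp add: fr_def divide_right_mono)
qed

text \<open>A relation instead of an operator, because differentiation along the flow is unbounded
  and does not map \<open>wa\<close> into itself.\<close>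

definition dd :: "real \<Rightarrow> real \<Rightarrow> wa \<Rightarrow> wa \<Rightarrow> bool" where
  "dd \<alpha> s u u' \<longleftrightarrow> (\<forall>\<nu>. cf u' \<nu> = \<i> * fr \<alpha> s \<nu> * cf u \<nu>)"

lemma dd_add: "dd \<alpha> s u u' \<Longrightarrow> dd \<alpha> s v v' \<Longrightarrow> dd \<alpha> s (u + v) (u' + v')"
  and dd_diff: "dd \<alpha> s u u' \<Longrightarrow> dd \<alpha> s v v' \<Longrightarrow> dd \<alpha> s (u - v) (u' - v')"
  and dd_scaleR: "dd \<alpha> s u u' \<Longrightarrow> dd \<alpha> s (c *\<^sub>R u) (c *\<^sub>R u')"
  by (simp_all add: dd_def algebra_simps)

text \<open>The Leibniz rule: the frequency along the flow is additive, so it splits over the two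
  factors of each term of the convolution.\<close>

lemma dd_mult:
  assumes "dd \<alpha> s u u'" "dd \<alpha> s v v'"
  shows "dd \<alpha> s (u * v) (u' * v + u * v')"
  unfolding dd_def
proof
  fix \<nu>
  have s: "(\<lambda>\<mu>. cf u' \<mu> * cf v (\<nu> - \<mu>)) summable_on UNIV" "(\<lambda>\<mu>. cf u \<mu> * cf v' (\<nu> - \<mu>)) summable_on UNIV"
    by (rule cf_mult_summable)+
  have "cf (u' * v + u * v') \<nu> = (\<Sum>\<^sub>\<infinity>\<mu>. cf u' \<mu> * cf v (\<nu> - \<mu>) + cf u \<mu> * cf v' (\<nu> - \<mu>))"
    by (simp add: cf_mult infsum_add[OF s])
  also have "\<dots> = (\<Sum>\<^sub>\<infinity>\<mu>. \<i> * fr \<alpha> s \<nu> * (cf u \<mu> * cf v (\<nu> - \<mu>)))"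
  proof (rule infsum_cong)
    fix \<mu>
    have "fr \<alpha> s \<nu> = fr \<alpha> s \<mu> + fr \<alpha> s (\<nu> - \<mu>)" using fr_add[of \<alpha> s \<mu> "\<nu> - \<mu>"] by simp
    then show "cf u' \<mu> * cf v (\<nu> - \<mu>) + cf u \<mu> * cf v' (\<nu> - \<mu>) = \<i> * fr \<alpha> s \<nu> * (cf u \<mu> * cf v (\<nu> - \<mu>))"
      using assms unfolding dd_def by (simp add: algebra_simps)
  qed
  also have "\<dots> = \<i> * fr \<alpha> s \<nu> * cf (u * v) \<nu>"
    by (simp add: infsum_cmult_right' cf_mult)
  finally show "cf (u' * v + u * v') \<nu> = \<i> * fr \<alpha> s \<nu> * cf (u * v) \<nu>" .
qed

subsection \<open>Low frequencies\<close>

definition low :: "real \<Rightarrow> real \<Rightarrow> freq set" where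
  "low s q = {\<nu> \<in> rlat s. \<nu> \<noteq> 0 \<and> fnorm \<nu> < s * q}"

definition nonresonant :: "real \<Rightarrow> real \<Rightarrow> bool" where
  "nonresonant \<alpha> q \<longleftrightarrow> (\<forall>j k::int. (j, k) \<noteq> (0, 0) \<longrightarrow> real_of_int (\<bar>j\<bar> + \<bar>k\<bar>) < q \<longrightarrow> 1 / (2 * q) \<le> \<bar>of_int j + \<alpha> * of_int k\<bar>)"

definition m_low :: "real \<Rightarrow> real \<Rightarrow> freq \<Rightarrow> complex" where
  "m_low s q \<nu> = (if \<nu> \<in> low s q then 1 else 0)"

definition m_high :: "real \<Rightarrow> real \<Rightarrow> freq \<Rightarrow> complex" where
  "m_high s q \<nu> = (if \<nu> \<in> low s q \<or> \<nu> = 0 then 0 else 1)"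

definition m_prim :: "real \<Rightarrow> real \<Rightarrow> real \<Rightarrow> freq \<Rightarrow> complex" where
  "m_prim \<alpha> s q \<nu> = (if \<nu> \<in> low s q then 1 / (\<i> * fr \<alpha> s \<nu>) else 0)"

definition m_deriv :: "real \<Rightarrow> real \<Rightarrow> real \<Rightarrow> freq \<Rightarrow> complex" where
  "m_deriv \<alpha> s q \<nu> = (if \<nu> \<in> low s q then \<i> * fr \<alpha> s \<nu> else 0)"

text \<open>The symbol of \<open>L = \<epsilon> D\<^sup>2 + D\<close>.\<close>

definition sym_L :: "real \<Rightarrow> real \<Rightarrow> real \<Rightarrow> freq \<Rightarrow> complex" where
  "sym_L \<alpha> s \<epsilon> \<nu> = \<i> * fr \<alpha> s \<nu> - of_real (\<epsilon> * (fr \<alpha> s \<nu>)\<^sup>2)"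

definition m_inv :: "real \<Rightarrow> real \<Rightarrow> real \<Rightarrow> real \<Rightarrow> freq \<Rightarrow> complex" where
  "m_inv \<alpha> s q \<epsilon> \<nu> = (if \<nu> \<in> low s q then of_real \<epsilon> / sym_L \<alpha> s \<epsilon> \<nu> else 0)"

definition m_res :: "real \<Rightarrow> real \<Rightarrow> real \<Rightarrow> real \<Rightarrow> freq \<Rightarrow> complex" where
  "m_res \<alpha> s \<epsilon> \<beta> \<nu> = 1 / (sym_L \<alpha> s \<epsilon> \<nu> + of_real (\<epsilon> * \<beta>))"

definition m_dres :: "real \<Rightarrow> real \<Rightarrow> real \<Rightarrow> real \<Rightarrow> freq \<Rightarrow> complex" where
  "m_dres \<alpha> s \<epsilon> \<beta> \<nu> = \<i> * fr \<alpha> s \<nu> * m_res \<alpha> s \<epsilon> \<beta> \<nu>"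

lemma low_minus [simp]: "- \<nu> \<in> low s q \<longleftrightarrow> \<nu> \<in> low s q"
  by (simp add: low_def)

lemma not_0_low [simp]: "0 \<notin> low s q"
  by (simp add: low_def)

lemma sym_L_minus: "sym_L \<alpha> s \<epsilon> (- \<nu>) = cnj (sym_L \<alpha> s \<epsilon> \<nu>)"
  by (simp add: sym_L_def)

lemma m_minus:
  "m_low s q (- \<nu>) = cnj (m_low s q \<nu>)" "m_high s q (- \<nu>) = cnj (m_high s q \<nu>)"
  "m_prim \<alpha> s q (- \<nu>) = cnj (m_prim \<alpha> s q \<nu>)" "m_deriv \<alpha> s q (- \<nu>) = cnj (m_deriv \<alpha> s q \<nu>)"
  "m_inv \<alpha> s q \<epsilon> (- \<nu>) = cnj (m_inv \<alpha> s q \<epsilon> \<nu>)"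
  "m_res \<alpha> s \<epsilon> \<beta> (- \<nu>) = cnj (m_res \<alpha> s \<epsilon> \<beta> \<nu>)" "m_dres \<alpha> s \<epsilon> \<beta> (- \<nu>) = cnj (m_dres \<alpha> s \<epsilon> \<beta> \<nu>)"
  by (simp_all add: m_low_def m_high_def m_prim_def m_deriv_def m_inv_def m_res_def m_dres_def sym_L_minus)

lemma norm_sym_L_ge: "\<bar>fr \<alpha> s \<nu>\<bar> \<le> norm (sym_L \<alpha> s \<epsilon> \<nu> + of_real c)"
  using abs_Im_le_cmod[of "sym_L \<alpha> s \<epsilon> \<nu> + of_real c"] by (simp add: sym_L_def)

lemma norm_m_low: "norm (m_low s q \<nu>) \<le> 1" and norm_m_high: "norm (m_high s q \<nu>) \<le> 1"
  by (simp_all add: m_low_def m_high_def)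

text \<open>The imaginary part of the denominator is the frequency itself, whatever \<epsilon> and
  \<beta> are. One derivative thus cancels the whole loss
  \<open>2 / (\<epsilon> * \<bar>\<beta>\<bar>)\<close> of the resolvent.\<close>

lemma norm_m_dres: "norm (m_dres \<alpha> s \<epsilon> \<beta> \<nu>) \<le> 1"
  using norm_sym_L_ge[of \<alpha> s \<nu> \<epsilon> "\<epsilon> * \<beta>"]
  by (auto simp: m_dres_def m_res_def norm_divide norm_mult divide_le_eq_1)

lemma fr_low_ge:
  assumes "s > 0" "nonresonant \<alpha> q" "\<nu> \<in> low s q"
  shows "1 / (2 * q) \<le> \<bar>fr \<alpha> s \<nu>\<bar>"
proof -
  obtain j k where \<nu>: "\<nu> = (s * of_int j, s * of_int k)" using assms by (auto simp: low_def rlat_iff)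
  have "s * (\<bar>of_int j\<bar> + \<bar>of_int k\<bar>) < s * q"
    using assms by (auto simp: low_def \<nu> fnorm_def abs_mult algebra_simps)
  then have "real_of_int (\<bar>j\<bar> + \<bar>k\<bar>) < q" using assms by simp
  moreover have "(j, k) \<noteq> (0, 0)" using assms by (auto simp: low_def \<nu> zero_prod_def)
  moreover have "fr \<alpha> s \<nu> = of_int j + \<alpha> * of_int k"
    using assms by (simp add: fr_def \<nu> add_divide_distrib)
  ultimately show ?thesis using assms(2) unfolding nonresonant_def by simp
qed

lemma
  assumes "s > 0" "nonresonant \<alpha> q" "q \<ge> 1"
  shows norm_m_prim: "norm (m_prim \<alpha> s q \<nu>) \<le> 2 * q"
    and norm_m_deriv: "norm (m_deriv \<alpha> s q \<nu>) \<le> (1 + \<bar>\<alpha>\<bar>) * q"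
    and norm_m_inv: "\<epsilon> \<ge> 0 \<Longrightarrow> norm (m_inv \<alpha> s q \<epsilon> \<nu>) \<le> 2 * \<epsilon> * q"
    and sym_L_low: "\<nu> \<in> low s q \<Longrightarrow> sym_L \<alpha> s \<epsilon> \<nu> \<noteq> 0"
    and fr_low: "\<nu> \<in> low s q \<Longrightarrow> fr \<alpha> s \<nu> \<noteq> 0"
proof -
  have ge: "1 / (2 * q) \<le> \<bar>fr \<alpha> s \<nu>\<bar>" "0 < \<bar>fr \<alpha> s \<nu>\<bar>" "1 / \<bar>fr \<alpha> s \<nu>\<bar> \<le> 2 * q" if "\<nu> \<in> low s q"
  proof -
    show 1: "1 / (2 * q) \<le> \<bar>fr \<alpha> s \<nu>\<bar>" by (rule fr_low_ge[OF assms(1,2) that])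
    show 2: "0 < \<bar>fr \<alpha> s \<nu>\<bar>" by (rule less_le_trans[OF _ 1]) (use assms(3) in simp)
    show "1 / \<bar>fr \<alpha> s \<nu>\<bar> \<le> 2 * q" using 1 2 assms(3) by (simp add: field_simps)
  qed
  show "norm (m_prim \<alpha> s q \<nu>) \<le> 2 * q"
    using ge(3) assms(3) by (auto simp: m_prim_def norm_divide norm_mult)
  show "norm (m_deriv \<alpha> s q \<nu>) \<le> (1 + \<bar>\<alpha>\<bar>) * q"
  proof (cases "\<nu> \<in> low s q")
    case True
    then have "fnorm \<nu> / s \<le> q" using assms by (simp add: low_def field_simps)
    then have "(1 + \<bar>\<alpha>\<bar>) * (fnorm \<nu> / s) \<le> (1 + \<bar>\<alpha>\<bar>) * q" by (intro mult_left_mono) auto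
    with abs_fr_le[OF assms(1), of \<alpha> \<nu>] True show ?thesis by (simp add: m_deriv_def norm_mult)
  qed (use assms in \<open>simp add: m_deriv_def\<close>)
  show "\<nu> \<in> low s q \<Longrightarrow> sym_L \<alpha> s \<epsilon> \<nu> \<noteq> 0" "\<nu> \<in> low s q \<Longrightarrow> fr \<alpha> s \<nu> \<noteq> 0"
    using ge(2) norm_sym_L_ge[of \<alpha> s \<nu> \<epsilon> 0] by auto
  show "norm (m_inv \<alpha> s q \<epsilon> \<nu>) \<le> 2 * \<epsilon> * q" if \<epsilon>: "\<epsilon> \<ge> 0"
  proof (cases "\<nu> \<in> low s q")
    case True
    have "norm (m_inv \<alpha> s q \<epsilon> \<nu>) = \<epsilon> / norm (sym_L \<alpha> s \<epsilon> \<nu>)"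
      using True \<epsilon> by (simp add: m_inv_def norm_divide)
    also have "\<dots> \<le> \<epsilon> * (1 / \<bar>fr \<alpha> s \<nu>\<bar>)"
      using ge(2)[OF True] norm_sym_L_ge[of \<alpha> s \<nu> \<epsilon> 0] \<epsilon> by (simp add: frac_le)
    also have "\<dots> \<le> \<epsilon> * (2 * q)"
      using ge(3)[OF True] \<epsilon> by (rule mult_left_mono)
    finally show ?thesis by simp
  qed (use assms \<epsilon> in \<open>simp add: m_inv_def\<close>)
qed

text \<open>The dissipation keeps the resolvent bounded at every frequency: either \<open>w\<^sup>2 \<le> \<bar>\<beta>\<bar> / 2\<close>, and the real
  part is at least \<open>\<epsilon> \<bar>\<beta>\<bar> / 2\<close>, or the imaginary part \<open>w\<close> is large enough.\<close>

lemma norm_m_res: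
  assumes "0 < \<epsilon>" "\<epsilon> \<le> 1" "\<beta> \<noteq> 0" "\<bar>\<beta>\<bar> \<le> 2"
  shows "norm (m_res \<alpha> s \<epsilon> \<beta> \<nu>) \<le> 2 / (\<epsilon> * \<bar>\<beta>\<bar>)" and "sym_L \<alpha> s \<epsilon> \<nu> + of_real (\<epsilon> * \<beta>) \<noteq> 0"
proof -
  let ?d = "sym_L \<alpha> s \<epsilon> \<nu> + of_real (\<epsilon> * \<beta>)"
  define w where "w = fr \<alpha> s \<nu>"
  have ge: "\<epsilon> * \<bar>\<beta>\<bar> / 2 \<le> norm ?d"
  proof (cases "w\<^sup>2 \<le> \<bar>\<beta>\<bar> / 2")
    case True
    have "\<bar>\<beta>\<bar> / 2 \<le> \<bar>\<beta> - w\<^sup>2\<bar>" using True zero_le_power2[of w] by linarith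
    then have "\<epsilon> * (\<bar>\<beta>\<bar> / 2) \<le> \<epsilon> * \<bar>\<beta> - w\<^sup>2\<bar>" using assms by (intro mult_left_mono) auto
    also have "\<dots> = \<bar>Re ?d\<bar>" using assms by (simp add: sym_L_def w_def abs_mult flip: right_diff_distrib)
    also have "\<dots> \<le> norm ?d" by (rule abs_Re_le_cmod)
    finally show ?thesis by simp
  next
    case False
    have "(\<bar>\<beta>\<bar> / 2)\<^sup>2 \<le> \<bar>\<beta>\<bar> / 2"
      using mult_right_mono[of "\<bar>\<beta>\<bar> / 2" 1 "\<bar>\<beta>\<bar> / 2"] assms(4) unfolding power2_eq_square by simp
    also have "\<dots> \<le> w\<^sup>2" using False by simp
    finally have "\<bar>\<beta>\<bar> / 2 \<le> \<bar>w\<bar>" by (simp add: abs_le_square_iff flip: abs_le_square_iff)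
    moreover have "\<epsilon> * \<bar>\<beta>\<bar> / 2 \<le> \<bar>\<beta>\<bar> / 2" using assms by (simp add: mult_le_cancel_right2)
    ultimately show ?thesis using norm_sym_L_ge[of \<alpha> s \<nu> \<epsilon> "\<epsilon> * \<beta>"] by (simp add: w_def)
  qed
  then have pos: "0 < norm ?d" using assms by (intro less_le_trans[OF _ ge]) auto
  then show "?d \<noteq> 0" by auto
  show "norm (m_res \<alpha> s \<epsilon> \<beta> \<nu>) \<le> 2 / (\<epsilon> * \<bar>\<beta>\<bar>)"
    using ge pos assms by (simp add: m_res_def norm_divide field_simps)
qed

lemma low_scale: "l > 0 \<Longrightarrow> l *\<^sub>R \<nu> \<in> low (l * s) q \<longleftrightarrow> \<nu> \<in> low s q"
  by (simp add: low_def rlat_scaleR mult.assoc)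

text \<open>On a high mode \<open>fnorm \<nu> \<ge> s * q\<close>, hence \<open>wt \<nu>\<close> is
  at most \<open>exp (- 2 * s * q)\<close> times \<open>wt (3 *\<^sub>R \<nu>)\<close>, the weight
  under which \<open>h\<close> is summed. The dilation by 3 is the passage from the width
  \<open>3 * s\<close> to the width \<open>s\<close>.\<close>

lemma norm_high_le:
  assumes "s > 0" "h \<in> wlat (3 * s)"
  shows "norm (mul (m_high s q) (dil 3 h)) \<le> exp (- 2 * s * q) * norm h"
proof -
  have cfm: "cf (mul (m_high s q) (dil 3 h)) \<nu> = m_high s q \<nu> * cf h (3 *\<^sub>R \<nu>)" for \<nu>
    using cf_mul[where m="m_high s q", OF norm_m_high, of "dil 3 h" \<nu>] by simp
  have le: "norm (m_high s q \<nu> * cf h (3 *\<^sub>R \<nu>)) * wt \<nu> \<le> exp (- 2 * s * q) * (norm (cf h (3 *\<^sub>R \<nu>)) * wt (3 *\<^sub>R \<nu>))" for \<nu>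
  proof (cases "m_high s q \<nu> = 0 \<or> cf h (3 *\<^sub>R \<nu>) = 0")
    case False
    then have "3 *\<^sub>R \<nu> \<in> rlat (3 * s)" using wlat_notin[OF assms(2)] by blast
    then have "\<nu> \<in> rlat s" by (simp add: rlat_scaleR)
    then have "s * q \<le> fnorm \<nu>" and m: "m_high s q \<nu> = 1"
      using False by (auto simp: m_high_def low_def split: if_splits)
    then have "wt \<nu> \<le> exp (- 2 * s * q) * wt (3 *\<^sub>R \<nu>)"
      by (simp add: wt_def flip: exp_add)
    then show ?thesis using m by (simp add: mult_left_mono mult.left_commute)
  qed auto
  have "(\<Sum>\<nu>\<in>S. norm (m_high s q \<nu> * cf h (3 *\<^sub>R \<nu>)) * wt \<nu>) \<le> exp (- 2 * s * q) * norm h" if "finite S" for S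
  proof -
    have "(\<Sum>\<nu>\<in>S. norm (m_high s q \<nu> * cf h (3 *\<^sub>R \<nu>)) * wt \<nu>)
        \<le> exp (- 2 * s * q) * (\<Sum>\<nu>\<in>S. norm (cf h (3 *\<^sub>R \<nu>)) * wt (3 *\<^sub>R \<nu>))"
      unfolding sum_distrib_left by (intro sum_mono le)
    also have "(\<Sum>\<nu>\<in>S. norm (cf h (3 *\<^sub>R \<nu>)) * wt (3 *\<^sub>R \<nu>)) = (\<Sum>\<nu>\<in>(\<lambda>\<nu>. 3 *\<^sub>R \<nu>) ` S. norm (cf h \<nu>) * wt \<nu>)"
      by (subst sum.reindex) (auto simp: inj_on_def)
    also have "\<dots> \<le> norm h" using that by (intro finite_sum_le_norm) auto
    finally show ?thesis by simp
  qed
  from cf_Wa(2)[OF this] show ?thesis by (simp add: mul_def)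
qed

section \<open>The equation in the algebra and its solution by a contraction\<close>

text \<open>In spite of the name this is an exact equation, namely
  \<open>L X + \<epsilon> G(X) = \<epsilon> f\<close>. Stating it for each coefficient avoids the
  question whether \<open>L X\<close> belongs to \<open>wa\<close>.\<close>

definition approx_ode :: "real \<Rightarrow> real \<Rightarrow> (nat \<Rightarrow> real) \<Rightarrow> wa \<Rightarrow> real \<Rightarrow> wa \<Rightarrow> bool" where
  "approx_ode \<alpha> s a f \<epsilon> X \<longleftrightarrow>
     (\<forall>\<nu>. sym_L \<alpha> s \<epsilon> \<nu> * cf X \<nu> + of_real \<epsilon> * cf (gser a X) \<nu> = of_real \<epsilon> * cf f \<nu>)"

lemma wlat_gser:
  assumes "gcoeffs a n \<rho> C" "x \<in> wlat s" "norm x \<le> \<rho>"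
  shows "gser a x \<in> wlat s" "gder a x \<in> wlat s"
  using assms by (auto intro!: gser_mem[OF assms(1)] closed_wlat)

lemma sym_L_dd:
  assumes "dd \<alpha> s y y'" "dd \<alpha> s y' y''"
  shows "sym_L \<alpha> s \<epsilon> \<nu> * cf y \<nu> = cf (\<epsilon> *\<^sub>R y'' + y') \<nu>"
  using assms by (simp add: dd_def sym_L_def cf_scaleR algebra_simps power2_eq_square scaleR_conv_of_real[where 'a=complex])

text \<open>Conjugating \<open>L + \<epsilon> b\<close> by the multiplication operator \<open>1 - \<epsilon> B\<close>, where \<open>D B = b\<^sub>l\<close>, removes the
  low frequencies \<open>b\<^sub>l\<close> of \<open>b\<close> up to terms that are small compared with the mean \<open>\<beta>\<close>.\<close>

lemma conjugation_identity:
  assumes z: "dd \<alpha> s z z1" "dd \<alpha> s z1 z2" and zw: "\<epsilon> *\<^sub>R z2 + z1 + (\<epsilon> * \<beta>) *\<^sub>R z = w"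
    and B: "dd \<alpha> s B bl" "dd \<alpha> s bl bl'" and b: "b = \<beta> *\<^sub>R 1 + bl + bh"
    and y: "y = z - \<epsilon> *\<^sub>R (B * z)"
  shows "sym_L \<alpha> s \<epsilon> \<nu> * cf y \<nu> = cf (w - \<epsilon> *\<^sub>R (B * w) + \<epsilon> *\<^sub>R (bh * z)
     - (\<epsilon>\<^sup>2) *\<^sub>R (bl' * z + (b - \<beta> *\<^sub>R 1) * B * z) - (2 * \<epsilon>\<^sup>2) *\<^sub>R (bl * z1) - \<epsilon> *\<^sub>R (b * y)) \<nu>"
proof -
  have y1: "dd \<alpha> s y (z1 - \<epsilon> *\<^sub>R (bl * z + B * z1))"
    unfolding y by (intro dd_diff dd_scaleR dd_mult z B)
  have y2: "dd \<alpha> s (z1 - \<epsilon> *\<^sub>R (bl * z + B * z1)) (z2 - \<epsilon> *\<^sub>R (bl' * z + bl * z1 + (bl * z1 + B * z2)))"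
    by (intro dd_diff dd_scaleR dd_mult dd_add z B)
  \<comment> \<open>Scalars are turned into elements of the algebra, which makes the claim an
    identity in a commutative ring.\<close>
  define e t :: wa where "e = of_real \<epsilon>" and "t = of_real \<beta>"
  have sc: "\<epsilon> *\<^sub>R x = e * x" "\<beta> *\<^sub>R x = t * x" "(\<epsilon>\<^sup>2) *\<^sub>R x = e * e * x" "(2 * \<epsilon>\<^sup>2) *\<^sub>R x = e * e * x + e * e * x"
    "(\<epsilon> * \<beta>) *\<^sub>R x = e * t * x" for x
    by (simp_all add: e_def t_def scaleR_conv_of_real power2_eq_square algebra_simps)
  have "\<epsilon> *\<^sub>R (z2 - \<epsilon> *\<^sub>R (bl' * z + bl * z1 + (bl * z1 + B * z2))) + (z1 - \<epsilon> *\<^sub>R (bl * z + B * z1))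
    = w - \<epsilon> *\<^sub>R (B * w) + \<epsilon> *\<^sub>R (bh * z)
     - (\<epsilon>\<^sup>2) *\<^sub>R (bl' * z + (b - \<beta> *\<^sub>R 1) * B * z) - (2 * \<epsilon>\<^sup>2) *\<^sub>R (bl * z1) - \<epsilon> *\<^sub>R (b * y)"
    unfolding y b zw[symmetric] sc by (simp add: algebra_simps)
  then show ?thesis
    unfolding sym_L_dd[OF y1 y2] by (rule arg_cong)
qed

lemma norm_mult_le: "norm x \<le> a \<Longrightarrow> norm y \<le> b \<Longrightarrow> norm (x * y) \<le> a * (b::real)" for x y :: "'a::real_normed_algebra"
  by (meson norm_mult_ineq mult_mono norm_ge_zero order_trans)

text \<open>How the loss \<open>2 / (e * b)\<close> of the resolvent, or twice that loss, cancels in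
  the shapes in which it occurs below.\<close>

lemma core_arith:
  fixes e b :: real
  assumes "e > 0" "b > 0"
  shows "e\<^sup>2 * ((2 * x * y) * (2 / (e * b) * w)) = (e * y) * (4 * x * w / b)"
    and "e\<^sup>2 * ((c * q * (d * x)) * (2 / (e * b) * w)) = (2 * e * q) * x * (c * d * w / b)"
    and "e * ((t * b * y * d) * (2 / (e * b) * w)) = 2 * d * t * w * y"
    and "e * (2 * d * (t * b) * (4 / (e * b) * w)) = 8 * d * t * w"
  using assms by (simp_all add: power2_eq_square)

text \<open>The residual of \<open>v\<close> is treated according to its modes. Its mean vanishes by
  hypothesis; its low modes are removed by \<open>y1\<close>, where inverting \<open>L\<close> alone
  costs only \<open>2 * \<epsilon> * q \<le> \<delta>\<close>; the resolvent, which costs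
  \<open>2 / (\<epsilon> * \<bar>\<beta>\<bar>)\<close>, is left with the high modes and the
  nonlinear remainder. The solution is \<open>v + y1 + y\<close>, with \<open>y\<close> found by the
  contraction.\<close>

lemma core:
  fixes a :: "nat \<Rightarrow> real"
  assumes g: "gcoeffs a n \<rho> C" and s: "s > 0" and \<epsilon>: "0 < \<epsilon>" "\<epsilon> \<le> \<delta>" and \<delta>: "\<delta> \<le> 1" "4 * \<delta> \<le> \<rho>"
    and q: "q \<ge> 1" "2 * \<epsilon> * q \<le> \<delta>" "nonresonant \<alpha> q"
    and v: "v \<in> wlat s" "norm v \<le> 2 * \<delta>"
    and D: "D \<ge> 1" "C * 4 ^ n \<le> D"
    and W: "W = 1 + \<bar>\<alpha>\<bar>" and F: "F \<ge> 0"
    and \<theta>: "\<theta> > 0" "36 * W * D\<^sup>2 * (F + 1) * \<theta> \<le> 1"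
    and r: "cf (gser a v) 0 = 0" and \<beta>: "\<beta> = Re (cf (gder a v) 0)" "\<beta> \<noteq> 0"
    and small: "\<delta> \<le> \<theta>" "\<delta> ^ n \<le> \<theta> * \<bar>\<beta>\<bar>"
    and fl: "\<And>\<nu>. sym_L \<alpha> s \<epsilon> \<nu> * cf v \<nu> = of_real \<epsilon> * cf fl \<nu>"
    and fh: "fh \<in> wlat s" "norm fh \<le> \<theta> * \<bar>\<beta>\<bar> * \<delta>\<^sup>2 * F"
    and rh: "norm (mul (m_high s q) (gser a v)) \<le> \<theta> * \<bar>\<beta>\<bar> * \<delta>\<^sup>2 * D"
    and bh: "norm (mul (m_high s q) (gder a v)) \<le> \<theta> * \<bar>\<beta>\<bar> * \<delta>\<^sup>2 * D"
  shows "\<exists>X\<in>wlat s. norm X \<le> 4 * \<delta> \<and> approx_ode \<alpha> s a (fl + fh) \<epsilon> X"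
proof -
  note n2 = n2[OF g] and \<rho> = \<rho>_pos[OF g] and C = C_nonneg[OF g]
  define b r bl rl bl' B y1 where "b = gder a v" and "r = gser a v"
    and "bl = mul (m_low s q) b" and "rl = mul (m_low s q) r"
    and "bl' = mul (m_deriv \<alpha> s q) b" and "B = mul (m_prim \<alpha> s q) b"
    and "y1 = - mul (m_inv \<alpha> s q \<epsilon>) r"
  define bh rh where "bh = mul (m_high s q) b" and "rh = mul (m_high s q) r"
  have \<delta>0: "\<delta> > 0" using \<epsilon> by simp
  have \<epsilon>1: "\<epsilon> \<le> 1" using \<epsilon> \<delta> by simp
  have \<epsilon>0: "\<epsilon> \<ge> 0" using \<epsilon> by simp
  have W1: "W \<ge> 1" using W by simp
  have v\<rho>: "norm v \<le> \<rho>" using v \<delta> \<delta>0 by simp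
  have m: "cf (mul (m_low s q) u) \<nu> = m_low s q \<nu> * cf u \<nu>"
    "cf (mul (m_high s q) u) \<nu> = m_high s q \<nu> * cf u \<nu>"
    "cf (mul (m_prim \<alpha> s q) u) \<nu> = m_prim \<alpha> s q \<nu> * cf u \<nu>"
    "cf (mul (m_deriv \<alpha> s q) u) \<nu> = m_deriv \<alpha> s q \<nu> * cf u \<nu>"
    "cf (mul (m_inv \<alpha> s q \<epsilon>) u) \<nu> = m_inv \<alpha> s q \<epsilon> \<nu> * cf u \<nu>" for u \<nu>
    by (rule cf_mul[OF norm_m_low] cf_mul[OF norm_m_high] cf_mul[OF norm_m_prim[OF s q(3,1)]]
      cf_mul[OF norm_m_deriv[OF s q(3,1)]] cf_mul[OF norm_m_inv[OF s q(3,1) \<epsilon>0]])+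
  have wl: "b \<in> wlat s" "r \<in> wlat s" unfolding b_def r_def by (rule wlat_gser[OF g v(1) v\<rho>])+
  have wl': "bl \<in> wlat s" "rl \<in> wlat s" "bh \<in> wlat s" "rh \<in> wlat s" "bl' \<in> wlat s" "B \<in> wlat s" "y1 \<in> wlat s"
    unfolding bl_def rl_def bh_def rh_def bl'_def B_def y1_def
    by (intro wlat_uminus wlat_mul[OF norm_m_low] wlat_mul[OF norm_m_high] wlat_mul[OF norm_m_prim[OF s q(3,1)]]
      wlat_mul[OF norm_m_deriv[OF s q(3,1)]] wlat_mul[OF norm_m_inv[OF s q(3,1) \<epsilon>0]] m_minus wl)+
  have split: "u = Re (cf u 0) *\<^sub>R 1 + mul (m_low s q) u + mul (m_high s q) u" if "u \<in> wlat s" for u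
  proof (rule wa_eqI)
    fix \<nu>
    show "cf u \<nu> = cf (Re (cf u 0) *\<^sub>R 1 + mul (m_low s q) u + mul (m_high s q) u) \<nu>"
      using wlat_cf_0_real[OF that] by (auto simp: m m_low_def m_high_def cf_one scaleR_conv_of_real[where 'a=complex])
  qed
  have b_split: "b = \<beta> *\<^sub>R 1 + bl + bh"
    using split[OF wl(1)] by (simp add: b_def bl_def bh_def \<beta>)
  have r_split: "r = rl + rh"
    using split[OF wl(2)] r by (simp add: r_def rl_def rh_def)

  have D4: "C * 4 ^ k \<le> D" if "k \<le> n" for k
    by (rule order_trans[OF mult_left_mono[OF power_increasing[OF that]] D(2)]) (use C in auto)
  have nb: "norm b \<le> D * \<delta> ^ (n - 1)"
  proof -
    have "norm b \<le> C * (2 * \<delta>) ^ (n - 1)"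
      unfolding b_def using v \<delta> \<delta>0 by (intro gder_summable(2)[OF g]) auto
    also have "\<dots> \<le> C * (4 * \<delta>) ^ (n - 1)" using C \<delta>0 by (intro mult_left_mono power_mono) auto
    also have "\<dots> = C * 4 ^ (n - 1) * \<delta> ^ (n - 1)" by (simp add: power_mult_distrib)
    also have "\<dots> \<le> D * \<delta> ^ (n - 1)" using D4[of "n - 1"] \<delta>0 by (intro mult_right_mono) auto
    finally show ?thesis .
  qed
  have nr: "norm r \<le> D * \<delta> ^ n"
  proof -
    have "norm r \<le> C * (2 * \<delta>) ^ n"
      unfolding r_def using v \<delta> \<delta>0 by (intro gser_summable(2)[OF g]) auto
    also have "\<dots> \<le> C * (4 * \<delta>) ^ n" using C \<delta>0 by (intro mult_left_mono power_mono) auto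
    also have "\<dots> = C * 4 ^ n * \<delta> ^ n" by (simp add: power_mult_distrib)
    also have "\<dots> \<le> D * \<delta> ^ n" using D4[of n] \<delta>0 by (intro mult_right_mono) auto
    finally show ?thesis .
  qed
  have lip: "norm (gser a x - gser a x') \<le> D * \<delta> ^ (n - 1) * norm (x - x')"
    if "norm x \<le> 4 * \<delta>" "norm x' \<le> 4 * \<delta>" for x x' :: wa
  proof -
    have "norm (gser a x - gser a x') \<le> C * ((4 * \<delta>) ^ (n - 1) * norm (x - x'))"
      using that \<delta> by (intro gser_lipschitz[OF g]) auto
    also have "\<dots> = C * 4 ^ (n - 1) * (\<delta> ^ (n - 1) * norm (x - x'))" by (simp add: power_mult_distrib)
    also have "\<dots> \<le> D * (\<delta> ^ (n - 1) * norm (x - x'))" using D4[of "n - 1"] \<delta>0 by (intro mult_right_mono) auto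
    finally show ?thesis by simp
  qed
  have taylor: "norm (gser a x - gser a x' - b * (x - x')) \<le> D * \<delta> ^ (n - 2) * (2 * \<delta>\<^sup>2) * norm (x - x')"
    if "norm x \<le> 4 * \<delta>" "norm x' \<le> 4 * \<delta>" "norm (x - v) \<le> 2 * \<delta>\<^sup>2" "norm (x' - v) \<le> 2 * \<delta>\<^sup>2" for x x' :: wa
  proof -
    have "norm (gser a x - gser a x' - b * (x - x')) \<le> C * ((4 * \<delta>) ^ (n - 2) * (2 * \<delta>\<^sup>2 * norm (x - x')))"
      unfolding b_def using that \<delta> \<delta>0 v by (intro gser_taylor[OF g]) auto
    also have "\<dots> = C * 4 ^ (n - 2) * (\<delta> ^ (n - 2) * (2 * \<delta>\<^sup>2 * norm (x - x')))" by (simp add: power_mult_distrib)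
    also have "\<dots> \<le> D * (\<delta> ^ (n - 2) * (2 * \<delta>\<^sup>2 * norm (x - x')))" using D4[of "n - 2"] \<delta>0 by (intro mult_right_mono) auto
    finally show ?thesis by simp
  qed

  have \<delta>n: "\<delta> ^ n \<le> \<delta>" using \<delta> \<delta>0 n2 power_decreasing[of 1 n \<delta>] by simp
  have \<delta>n2: "\<delta> ^ n \<le> \<delta>\<^sup>2" using \<delta> \<delta>0 n2 power_decreasing[of 2 n \<delta>] by simp
  have \<delta>S: "\<delta> * \<delta> ^ (n - 1) = \<delta> ^ n" using n2 by (cases n) auto
  have \<delta>SS: "\<delta> ^ (n - 2) * \<delta>\<^sup>2 = \<delta> ^ n" by (rule le_add_diff_inverse2[OF n2, THEN arg_cong, of "power \<delta>", unfolded power_add])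
  have D2: "D \<le> D\<^sup>2" using D by (simp add: power2_eq_square)
  have WD: "1 \<le> W * D\<^sup>2" "D\<^sup>2 \<le> W * D\<^sup>2" "W * D \<le> W * D\<^sup>2"
    using W1 D D2 mult_mono[of 1 W 1 "D\<^sup>2"] by auto
  have \<theta>D: "36 * (W * D\<^sup>2) * \<theta> \<le> 1" "36 * (D\<^sup>2 * (F + 1)) * \<theta> \<le> 1"
  proof -
    have "36 * (W * D\<^sup>2) * \<theta> \<le> (36 * W * D\<^sup>2 * \<theta>) * (F + 1)"
      using F W1 \<theta>(1) by (simp add: mult_le_cancel_left1 algebra_simps)
    then show "36 * (W * D\<^sup>2) * \<theta> \<le> 1" using \<theta>(2) by (simp add: mult_ac)
    have "36 * (D\<^sup>2 * (F + 1)) * \<theta> \<le> W * (36 * (D\<^sup>2 * (F + 1)) * \<theta>)"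
      using F W1 \<theta>(1) by (intro mult_right_mono[of 1 W "36 * (D\<^sup>2 * (F + 1)) * \<theta>", simplified mult_1_left]) auto
    then show "36 * (D\<^sup>2 * (F + 1)) * \<theta> \<le> 1" using \<theta>(2) by (simp add: mult_ac)
  qed
  have D\<theta>: "D * \<theta> \<le> 1" 
  proof -
    have "D * \<theta> \<le> (W * D\<^sup>2) * \<theta>" using WD D2 \<theta>(1) by (intro mult_right_mono) linarith+
    also have "\<dots> \<le> 1" using \<theta>D(1) \<theta>(1) WD by (simp add: mult.assoc)
    finally show ?thesis .
  qed
  have D\<delta>: "D * \<delta> \<le> 1" using D\<theta> mult_left_mono[OF small(1), of D] D by linarith
  have \<beta>2: "\<bar>\<beta>\<bar> \<le> 2"
  proof -
    have "\<bar>\<beta>\<bar> \<le> norm b"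
      unfolding \<beta> b_def by (rule order_trans[OF abs_Re_le_cmod norm_cf_le])
    also have "\<dots> \<le> D * \<delta>"
      using nb power_decreasing[of 1 "n - 1" \<delta>] \<delta>0 \<delta> n2 D
      by (intro order_trans[OF nb] mult_left_mono) auto
    finally show ?thesis using D\<delta> by simp
  qed
  \<comment> \<open>The primitive \<open>B\<close> costs a factor \<open>2 * q\<close>, and
    \<epsilon> turns it into a factor \<delta>; this makes the conjugation by
    \<open>1 - \<epsilon> B\<close> a small change.\<close>
  have \<epsilon>B: "\<epsilon> * norm B \<le> D * \<delta> ^ n"
  proof -
    have "norm B \<le> 2 * q * norm b" unfolding B_def by (rule norm_mul[OF norm_m_prim[OF s q(3,1)]])
    then have "\<epsilon> * norm B \<le> 2 * \<epsilon> * q * norm b" using \<epsilon>0 by (simp add: mult.left_commute mult_left_mono mult.assoc)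
    also have "\<dots> \<le> \<delta> * (D * \<delta> ^ (n - 1))" using q(2) nb \<delta>0 by (intro mult_mono) auto
    finally show ?thesis using \<delta>S by (simp add: mult.left_commute)
  qed
  have \<epsilon>B1: "\<epsilon> * norm B \<le> 1"
    using \<epsilon>B mult_left_mono[OF \<delta>n, of D] D D\<delta> by linarith
  have ny1: "norm y1 \<le> D * \<delta> * \<delta> ^ n"
  proof -
    have "norm y1 \<le> 2 * \<epsilon> * q * norm r"
      unfolding y1_def norm_minus_cancel by (rule norm_mul[OF norm_m_inv[OF s q(3,1) \<epsilon>0]])
    also have "\<dots> \<le> \<delta> * (D * \<delta> ^ n)" using q(2) nr \<delta>0 by (intro mult_mono) auto
    finally show ?thesis by (simp add: mult_ac)
  qed
  have ny1': "norm y1 \<le> \<delta>\<^sup>2"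
  proof -
    have "D * \<delta> * \<delta> ^ n \<le> 1 * \<delta>\<^sup>2" using D\<delta> \<delta>n2 \<delta>0 D by (intro mult_mono) auto
    with ny1 show ?thesis by simp
  qed

  define K K1 where "K = mul (m_res \<alpha> s \<epsilon> \<beta>)" and "K1 = mul (m_dres \<alpha> s \<epsilon> \<beta>)"
  note res = norm_m_res[OF \<epsilon>(1) \<epsilon>1 \<beta>(2) \<beta>2]
  have cfK: "cf (K w) \<nu> = m_res \<alpha> s \<epsilon> \<beta> \<nu> * cf w \<nu>" "cf (K1 w) \<nu> = m_dres \<alpha> s \<epsilon> \<beta> \<nu> * cf w \<nu>" for w \<nu>
    unfolding K_def K1_def by (rule cf_mul[OF res(1)] cf_mul[OF norm_m_dres])+
  have nK: "norm (K w) \<le> 2 / (\<epsilon> * \<bar>\<beta>\<bar>) * norm w" "norm (K1 w) \<le> norm w" for w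
    unfolding K_def K1_def using norm_mul[where m="m_res \<alpha> s \<epsilon> \<beta>" and u=w, OF res(1)]
      norm_mul[where m="m_dres \<alpha> s \<epsilon> \<beta>" and u=w, OF norm_m_dres] by auto
  have Kdiff: "K (w - w') = K w - K w'" "K1 (w - w') = K1 w - K1 w'" for w w'
    by (rule wa_eqI, simp add: cfK right_diff_distrib)+
  have K0: "K 0 = 0" "K1 0 = 0" using Kdiff[of 0 0] by auto
  have wlK: "K w \<in> wlat s" "K1 w \<in> wlat s" if "w \<in> wlat s" for w
    unfolding K_def K1_def 
    by (rule wlat_mul[where m="m_res \<alpha> s \<epsilon> \<beta>", OF res(1) m_minus(6) that]
      wlat_mul[where m="m_dres \<alpha> s \<epsilon> \<beta>", OF norm_m_dres m_minus(7) that])+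

  \<comment> \<open>The unknown is \<open>w = (L + \<epsilon> \<beta>) z\<close>, so that
    \<open>z = K w\<close> comes with both of its derivatives in the algebra. For
    \<open>y = Y w\<close> the conjugation turns \<open>L y + \<epsilon> b y\<close> into
    \<open>w - T w\<close>, and the equation for \<open>y\<close> into
    \<open>w = \<Phi> w\<close>.\<close>
  define Y where "Y = (\<lambda>w. K w - \<epsilon> *\<^sub>R (B * K w))"
  define Q where "Q = (\<lambda>y. gser a (v + y1 + y) - r - b * y)"
  define T where "T = (\<lambda>w. \<epsilon> *\<^sub>R (B * w) - \<epsilon> *\<^sub>R (bh * K w)
     + (\<epsilon>\<^sup>2) *\<^sub>R (bl' * K w + (b - \<beta> *\<^sub>R 1) * B * K w) + (2 * \<epsilon>\<^sup>2) *\<^sub>R (bl * K1 w))"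
  define \<Phi> where "\<Phi> = (\<lambda>w. \<epsilon> *\<^sub>R (fh - rh) - \<epsilon> *\<^sub>R Q (Y w) + T w)"
  \<comment> \<open>The radius for \<open>w\<close> at which the bound
    \<open>4 / (\<epsilon> * \<bar>\<beta>\<bar>)\<close> on \<open>Y\<close> gives exactly
    \<open>\<delta>\<^sup>2\<close>.\<close>
  define R where "R = \<epsilon> * \<bar>\<beta>\<bar> * \<delta>\<^sup>2 / 4"
  have Ydiff: "Y w - Y w' = Y (w - w')" and Tdiff: "T w - T w' = T (w - w')" for w w'
    unfolding Y_def T_def Kdiff by (simp_all add: algebra_simps)
  have \<epsilon>\<beta>: "\<epsilon> * \<bar>\<beta>\<bar> > 0" using \<epsilon> \<beta>(2) by simp
  have nY: "norm (Y w) \<le> 4 / (\<epsilon> * \<bar>\<beta>\<bar>) * norm w" for w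
  proof -
    have "norm (Y w) \<le> norm (K w) + \<epsilon> * (norm B * norm (K w))"
      unfolding Y_def using norm_triangle_ineq4[of "K w" "\<epsilon> *\<^sub>R (B * K w)"] \<epsilon>0 norm_mult_ineq[of B "K w"]
      by (smt (verit) mult_left_mono norm_scaleR)
    also have "\<dots> \<le> norm (K w) + 1 * norm (K w)"
      using \<epsilon>B1 by (intro add_left_mono) (simp only: mult.assoc[symmetric] mult_right_mono norm_ge_zero)
    finally show ?thesis using nK(1)[of w] by simp
  qed
  have nYR: "norm (Y w) \<le> \<delta>\<^sup>2" if "norm w \<le> R" for w
  proof -
    have "norm (Y w) \<le> 4 / (\<epsilon> * \<bar>\<beta>\<bar>) * R"
      using nY[of w] that \<epsilon>\<beta> by (smt (verit) divide_nonneg_pos mult_left_mono)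
    then show ?thesis using \<epsilon> \<beta>(2) by (simp add: R_def)
  qed
  have ball: "norm (v + y1 + y) \<le> 4 * \<delta>" "norm (v + y1 + y - v) \<le> 2 * \<delta>\<^sup>2" if "norm y \<le> \<delta>\<^sup>2" for y
  proof -
    have d2: "\<delta>\<^sup>2 \<le> \<delta>" using \<delta> \<delta>0 by (simp add: power2_eq_square mult_le_cancel_right2)
    show "norm (v + y1 + y) \<le> 4 * \<delta>"
      using norm_triangle_ineq[of "v + y1" y] norm_triangle_ineq[of v y1] v(2) ny1' that d2 by linarith
    show "norm (v + y1 + y - v) \<le> 2 * \<delta>\<^sup>2"
      using norm_triangle_ineq[of y1 y] ny1' that by simp
  qed
  have Qlip: "\<epsilon> * norm (Q (Y w) - Q (Y w')) \<le> 8 * D * \<theta> * norm (w - w')" if "norm w \<le> R" "norm w' \<le> R" for w w'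
  proof -
    have "Q (Y w) - Q (Y w') = gser a (v + y1 + Y w) - gser a (v + y1 + Y w') - b * ((v + y1 + Y w) - (v + y1 + Y w'))"
      by (simp add: Q_def algebra_simps)
    also have "norm \<dots> \<le> D * \<delta> ^ (n - 2) * (2 * \<delta>\<^sup>2) * norm ((v + y1 + Y w) - (v + y1 + Y w'))"
      by (intro taylor ball nYR that)
    also have "\<dots> = 2 * D * \<delta> ^ n * norm (Y (w - w'))"
      by (simp add: Ydiff flip: \<delta>SS)
    also have "\<dots> \<le> 2 * D * (\<theta> * \<bar>\<beta>\<bar>) * (4 / (\<epsilon> * \<bar>\<beta>\<bar>) * norm (w - w'))"
      using small(2) nY D \<theta>(1) \<delta>0 by (intro mult_mono) auto
    finally have "norm (Q (Y w) - Q (Y w')) \<le> 2 * D * (\<theta> * \<bar>\<beta>\<bar>) * (4 / (\<epsilon> * \<bar>\<beta>\<bar>) * norm (w - w'))" .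
    then have "\<epsilon> * norm (Q (Y w) - Q (Y w')) \<le> \<epsilon> * (2 * D * (\<theta> * \<bar>\<beta>\<bar>) * (4 / (\<epsilon> * \<bar>\<beta>\<bar>) * norm (w - w')))"
      using \<epsilon>0 by (rule mult_left_mono)
    also have "\<dots> = 8 * D * \<theta> * norm (w - w')" using \<epsilon> \<beta>(2) by (intro core_arith) auto
    finally show ?thesis .
  qed
  \<comment> \<open>Every term carries a factor \<theta>. The terms with the resolvent gain it from
    \<open>\<delta> ^ n \<le> \<theta> * \<bar>\<beta>\<bar>\<close> or from the size of
    \<open>bh\<close>, the other two from \<open>\<delta> \<le> \<theta>\<close>.\<close>
  have nT: "norm (T w) \<le> 10 * (W * D\<^sup>2) * \<theta> * norm w" for w
  proof -
    let ?k = "2 / (\<epsilon> * \<bar>\<beta>\<bar>)" and ?w = "norm w"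
    have k0: "?k > 0" using \<epsilon>\<beta> by simp
    have t1: "norm (\<epsilon> *\<^sub>R (B * w)) \<le> D * \<theta> * ?w"
    proof -
      have "norm (\<epsilon> *\<^sub>R (B * w)) \<le> (\<epsilon> * norm B) * ?w"
        using \<epsilon>0 norm_mult_ineq[of B w] by (simp add: mult.assoc mult_left_mono)
      also have "\<dots> \<le> D * \<theta> * ?w"
        using \<epsilon>B \<delta>n small(1) D by (intro mult_right_mono order_trans[OF \<epsilon>B] mult_left_mono) auto
      finally show ?thesis .
    qed
    have t2: "norm (\<epsilon> *\<^sub>R (bh * K w)) \<le> 2 * D * \<theta> * ?w"
    proof -
      have "norm (bh * K w) \<le> (\<theta> * \<bar>\<beta>\<bar> * \<delta>\<^sup>2 * D) * (?k * ?w)"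
        by (intro norm_mult_le nK) (use bh in \<open>simp add: bh_def b_def\<close>)
      then have "norm (\<epsilon> *\<^sub>R (bh * K w)) \<le> \<epsilon> * ((\<theta> * \<bar>\<beta>\<bar> * \<delta>\<^sup>2 * D) * (?k * ?w))"
        using \<epsilon>0 by (simp only: norm_scaleR abs_of_nonneg mult_left_mono)
      also have "\<dots> = 2 * D * \<theta> * ?w * \<delta>\<^sup>2" using \<epsilon> \<beta>(2) by (intro core_arith) auto
      also have "\<dots> \<le> 2 * D * \<theta> * ?w"
        using D \<theta>(1) \<delta> \<delta>0 by (intro mult_right_le_one_le) (auto simp: power_le_one)
      finally show ?thesis .
    qed
    have t3: "norm ((\<epsilon>\<^sup>2) *\<^sub>R (bl' * K w)) \<le> W * D * \<theta> * ?w"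
    proof -
      have nbl': "norm bl' \<le> W * q * norm b"
        unfolding bl'_def W by (rule norm_mul[OF norm_m_deriv[OF s q(3,1)]])
      have "norm (bl' * K w) \<le> (W * q * (D * \<delta> ^ (n - 1))) * (?k * ?w)"
        using W1 q by (intro norm_mult_le nK order_trans[OF nbl'] mult_left_mono nb) auto
      then have "norm ((\<epsilon>\<^sup>2) *\<^sub>R (bl' * K w)) \<le> \<epsilon>\<^sup>2 * ((W * q * (D * \<delta> ^ (n - 1))) * (?k * ?w))"
        by (simp only: norm_scaleR abs_of_nonneg zero_le_power2 mult_left_mono)
      also have "\<dots> = (2 * \<epsilon> * q) * \<delta> ^ (n - 1) * (W * D * ?w / \<bar>\<beta>\<bar>)"
        using \<epsilon> \<beta>(2) by (intro core_arith) auto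
      also have "\<dots> \<le> \<delta> * \<delta> ^ (n - 1) * (W * D * ?w / \<bar>\<beta>\<bar>)"
        using q(2) \<delta>0 W1 D by (intro mult_right_mono) auto
      also have "\<dots> \<le> (\<theta> * \<bar>\<beta>\<bar>) * (W * D * ?w / \<bar>\<beta>\<bar>)"
        unfolding \<delta>S using small(2) W1 D by (intro mult_right_mono) auto
      also have "\<dots> = W * D * \<theta> * ?w" using \<beta>(2) by simp
      finally show ?thesis .
    qed
    have t4: "norm ((\<epsilon>\<^sup>2) *\<^sub>R ((b - \<beta> *\<^sub>R 1) * B * K w)) \<le> 4 * D\<^sup>2 * \<theta> * ?w"
    proof -
      have "\<bar>\<beta>\<bar> \<le> norm b"
        unfolding \<beta> b_def by (rule order_trans[OF abs_Re_le_cmod norm_cf_le])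
      then have nbb: "norm (b - \<beta> *\<^sub>R 1) \<le> 2 * (D * \<delta> ^ (n - 1))"
        using norm_triangle_ineq4[of b "\<beta> *\<^sub>R 1"] nb by simp
      have "norm ((b - \<beta> *\<^sub>R 1) * B * K w) \<le> (2 * (D * \<delta> ^ (n - 1)) * norm B) * (?k * ?w)"
        by (intro norm_mult_le nK nbb) auto
      then have "norm ((\<epsilon>\<^sup>2) *\<^sub>R ((b - \<beta> *\<^sub>R 1) * B * K w)) \<le> \<epsilon>\<^sup>2 * ((2 * (D * \<delta> ^ (n - 1)) * norm B) * (?k * ?w))"
        by (simp only: norm_scaleR abs_of_nonneg zero_le_power2 mult_left_mono)
      also have "\<dots> = (\<epsilon> * norm B) * (4 * (D * \<delta> ^ (n - 1)) * ?w / \<bar>\<beta>\<bar>)"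
        using \<epsilon> \<beta>(2) by (intro core_arith) auto
      also have "\<dots> \<le> (D * \<delta> ^ n) * (4 * (D * \<delta> ^ (n - 1)) * ?w / \<bar>\<beta>\<bar>)"
        using \<epsilon>B D \<delta>0 by (intro mult_right_mono) auto
      also have "\<dots> = (4 * D\<^sup>2 * ?w / \<bar>\<beta>\<bar>) * \<delta> ^ n * \<delta> ^ (n - 1)" by (simp add: power2_eq_square)
      also have "\<dots> \<le> (4 * D\<^sup>2 * ?w / \<bar>\<beta>\<bar>) * (\<theta> * \<bar>\<beta>\<bar>) * 1"
        using small(2) \<delta> \<delta>0 \<theta>(1) by (intro mult_mono power_le_one) auto
      also have "\<dots> = 4 * D\<^sup>2 * \<theta> * ?w" using \<beta>(2) by simp
      finally show ?thesis .
    qed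
    have t5: "norm ((2 * \<epsilon>\<^sup>2) *\<^sub>R (bl * K1 w)) \<le> 2 * D * \<theta> * ?w"
    proof -
      have nbl: "norm bl \<le> D * 1"
      proof -
        have "norm bl \<le> 1 * norm b" unfolding bl_def by (rule norm_mul[OF norm_m_low])
        moreover have "D * \<delta> ^ (n - 1) \<le> D * 1"
          using \<delta> \<delta>0 D by (intro mult_left_mono power_le_one) auto
        ultimately show ?thesis using nb by linarith
      qed
      have "norm (bl * K1 w) \<le> D * 1 * ?w"
        by (intro norm_mult_le nK nbl)
      then have "norm ((2 * \<epsilon>\<^sup>2) *\<^sub>R (bl * K1 w)) \<le> 2 * \<epsilon>\<^sup>2 * (D * 1 * ?w)"
        using mult_left_mono[of "norm (bl * K1 w)" "D * 1 * ?w" "2 * \<epsilon>\<^sup>2"] by simp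
      also have "\<dots> = \<epsilon>\<^sup>2 * (2 * D * ?w)" by simp
      also have "\<dots> \<le> \<theta> * (2 * D * ?w)"
      proof (rule mult_right_mono)
        have "\<epsilon>\<^sup>2 \<le> \<epsilon>" using \<epsilon>0 \<epsilon>1 by (simp add: power2_eq_square mult_left_le)
        then show "\<epsilon>\<^sup>2 \<le> \<theta>" using \<epsilon>(2) small(1) by linarith
      qed (use D in auto)
      finally show ?thesis by (simp add: mult_ac)
    qed
    have "norm (T w) \<le> norm (\<epsilon> *\<^sub>R (B * w)) + norm (\<epsilon> *\<^sub>R (bh * K w)) + (norm ((\<epsilon>\<^sup>2) *\<^sub>R (bl' * K w))
        + norm ((\<epsilon>\<^sup>2) *\<^sub>R ((b - \<beta> *\<^sub>R 1) * B * K w))) + norm ((2 * \<epsilon>\<^sup>2) *\<^sub>R (bl * K1 w))"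
      unfolding T_def scaleR_add_right by (intro norm_triangle_le norm_triangle_le_diff add_mono order_refl)
    also have "\<dots> \<le> (5 * D + W * D + 4 * D\<^sup>2) * (\<theta> * ?w)"
      using t1 t2 t3 t4 t5 by (simp add: algebra_simps)
    also have "\<dots> \<le> (10 * (W * D\<^sup>2)) * (\<theta> * ?w)"
    proof (rule mult_right_mono)
      show "5 * D + W * D + 4 * D\<^sup>2 \<le> 10 * (W * D\<^sup>2)" using WD D2 by linarith
    qed (use \<theta>(1) in auto)
    finally show ?thesis by (simp add: mult_ac)
  qed
  obtain w where w: "w \<in> wlat s" "norm w \<le> R" "\<Phi> w = w"
  proof (rule contraction_fixpoint[OF closed_wlat wlat_0])
    show "0 \<le> R" using \<epsilon>0 by (simp add: R_def)
    show "\<Phi> w \<in> wlat s" if "w \<in> wlat s" "norm w \<le> R" for w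
    proof -
      have Yw: "Y w \<in> wlat s" unfolding Y_def using that wl' wlK by auto
      have "gser a (v + y1 + Y w) \<in> wlat s"
        using ball(1)[OF nYR[OF that(2)]] \<delta> by (intro wlat_gser(1)[OF g] wlat_add v wl' Yw) linarith
      then show ?thesis
        unfolding \<Phi>_def Q_def T_def using that wl wl' wlK v Yw fh(1) by (intro wlat_add wlat_diff wlat_scaleR wlat_mult wlat_1) auto
    qed
    show "norm (\<Phi> w - \<Phi> w') \<le> norm (w - w') / 2" if "norm w \<le> R" "norm w' \<le> R" for w w'
    proof -
      have "\<Phi> w - \<Phi> w' = T (w - w') - \<epsilon> *\<^sub>R (Q (Y w) - Q (Y w'))"
        unfolding \<Phi>_def Tdiff[symmetric] by (simp add: algebra_simps)
      also have "norm \<dots> \<le> 10 * (W * D\<^sup>2) * \<theta> * norm (w - w') + 8 * D * \<theta> * norm (w - w')"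
        using nT Qlip[OF that] \<epsilon>0 by (intro norm_triangle_le_diff add_mono) auto
      also have "\<dots> = (10 * (W * D\<^sup>2) + 8 * D) * (\<theta> * norm (w - w'))" by (simp add: algebra_simps)
      also have "\<dots> \<le> (18 * (W * D\<^sup>2)) * (\<theta> * norm (w - w'))"
        using WD D2 \<theta>(1) by (intro mult_right_mono) auto
      also have "\<dots> = (36 * (W * D\<^sup>2) * \<theta>) * (norm (w - w') / 2)" by simp
      also have "\<dots> \<le> 1 * (norm (w - w') / 2)" using \<theta>D(1) by (rule mult_right_mono) auto
      finally show ?thesis by simp
    qed
    show "norm (\<Phi> 0) \<le> R / 2"
    proof -
      have Y0: "Y 0 = 0" and T0: "T 0 = 0" by (simp_all add: Y_def T_def K0)
      have y1b: "norm (v + y1) \<le> 4 * \<delta>" using ball(1)[of 0] by simp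
      \<comment> \<open>The correction \<open>y1\<close> leaves a residual of order
        \<open>\<delta> ^ (2 * n)\<close>: one factor \<open>\<delta> ^ n\<close> is spent on
        \<open>\<theta> * \<bar>\<beta>\<bar>\<close>, the other on
        \<open>\<delta>\<^sup>2\<close>.\<close>
      have "norm (Q 0) \<le> D * \<delta> ^ (n - 1) * norm y1"
        using lip[OF y1b, of v] v(2) \<delta>0 by (simp add: Q_def r_def)
      also have "\<dots> \<le> D * \<delta> ^ (n - 1) * (D * \<delta> * \<delta> ^ n)" using ny1 D \<delta>0 by (intro mult_left_mono) auto
      also have "\<dots> = D\<^sup>2 * (\<delta> ^ n * \<delta> ^ n)"
        by (subst (2) \<delta>S[symmetric]) (simp add: power2_eq_square)
      also have "\<dots> \<le> D\<^sup>2 * ((\<theta> * \<bar>\<beta>\<bar>) * \<delta>\<^sup>2)"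
        using small(2) \<delta>n2 \<theta>(1) \<delta>0 by (intro mult_left_mono mult_mono) auto
      finally have nQ: "norm (Q 0) \<le> D\<^sup>2 * ((\<theta> * \<bar>\<beta>\<bar>) * \<delta>\<^sup>2)" .
      have "\<Phi> 0 = \<epsilon> *\<^sub>R (fh - rh - Q 0)"
        by (simp add: \<Phi>_def Y0 T0 algebra_simps)
      also have "norm \<dots> = \<epsilon> * norm (fh - rh - Q 0)" using \<epsilon>0 by simp
      also have "\<dots> \<le> \<epsilon> * (\<theta> * \<bar>\<beta>\<bar> * \<delta>\<^sup>2 * F + \<theta> * \<bar>\<beta>\<bar> * \<delta>\<^sup>2 * D + D\<^sup>2 * ((\<theta> * \<bar>\<beta>\<bar>) * \<delta>\<^sup>2))"
        using fh(2) rh nQ \<epsilon>0 by (intro mult_left_mono norm_triangle_le_diff add_mono) (auto simp: rh_def r_def)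
      also have "\<dots> = (F + D + D\<^sup>2) * (\<theta> * (\<epsilon> * \<bar>\<beta>\<bar> * \<delta>\<^sup>2))" by (simp add: algebra_simps)
      also have "\<dots> \<le> (2 * (D\<^sup>2 * (F + 1))) * (\<theta> * (\<epsilon> * \<bar>\<beta>\<bar> * \<delta>\<^sup>2))"
      proof (rule mult_right_mono)
        have "F \<le> D\<^sup>2 * F" using F D D2 by (simp add: mult_le_cancel_right1)
        then show "F + D + D\<^sup>2 \<le> 2 * (D\<^sup>2 * (F + 1))" using D2 F by (simp add: algebra_simps)
      qed (use \<theta>(1) \<epsilon>0 in auto)
      also have "\<dots> = (36 * (D\<^sup>2 * (F + 1)) * \<theta>) * ((\<epsilon> * \<bar>\<beta>\<bar> * \<delta>\<^sup>2) / 18)" by simp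
      also have "\<dots> \<le> 1 * ((\<epsilon> * \<bar>\<beta>\<bar> * \<delta>\<^sup>2) / 18)" using \<theta>D(2) \<epsilon>0 by (intro mult_right_mono) auto
      also have "\<dots> \<le> R / 2" using \<epsilon>0 by (simp add: R_def)
      finally show ?thesis .
    qed
  qed
  define z where "z = K w"
  define z1 where "z1 = K1 w"
  \<comment> \<open>Solved for from \<open>zw\<close>; that it is the derivative of
    \<open>z1\<close> is then the statement that \<open>m_res\<close> inverts the symbol.\<close>
  define z2 where "z2 = (1 / \<epsilon>) *\<^sub>R (w - z1 - (\<epsilon> * \<beta>) *\<^sub>R z)"
  have mr: "m_res \<alpha> s \<epsilon> \<beta> \<nu> * (\<i> * fr \<alpha> s \<nu> - of_real (\<epsilon> * (fr \<alpha> s \<nu>)\<^sup>2) + of_real (\<epsilon> * \<beta>)) = 1" for \<nu>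
    using res(2)[of \<alpha> s \<nu>] by (simp add: m_res_def sym_L_def)
  have dz: "dd \<alpha> s z z1" by (simp add: dd_def z_def z1_def cfK m_dres_def)
  have dz1: "dd \<alpha> s z1 z2"
    unfolding dd_def
  proof
    fix \<nu>
    have "of_real \<epsilon> * (\<i> * fr \<alpha> s \<nu> * cf z1 \<nu>) =
      cf w \<nu> * (m_res \<alpha> s \<epsilon> \<beta> \<nu> * (\<i> * fr \<alpha> s \<nu> - of_real (\<epsilon> * (fr \<alpha> s \<nu>)\<^sup>2) + of_real (\<epsilon> * \<beta>)))
        - cf z1 \<nu> - of_real (\<epsilon> * \<beta>) * cf z \<nu>"
      by (simp add: z_def z1_def cfK m_dres_def algebra_simps power2_eq_square)
    then have "of_real \<epsilon> * (\<i> * fr \<alpha> s \<nu> * cf z1 \<nu>) = cf w \<nu> - cf z1 \<nu> - of_real (\<epsilon> * \<beta>) * cf z \<nu>"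
      by (simp only: mr mult_1_right)
    then have "\<i> * fr \<alpha> s \<nu> * cf z1 \<nu> = of_real (1 / \<epsilon>) * (cf w \<nu> - cf z1 \<nu> - of_real (\<epsilon> * \<beta>) * cf z \<nu>)"
      using \<epsilon> by (simp add: field_simps)
    then show "cf z2 \<nu> = \<i> * fr \<alpha> s \<nu> * cf z1 \<nu>"
      by (simp only: z2_def cf_scaleR minus_wa.rep_eq)
  qed
  have zw: "\<epsilon> *\<^sub>R z2 + z1 + (\<epsilon> * \<beta>) *\<^sub>R z = w" using \<epsilon> by (simp add: z2_def)
  have dB: "dd \<alpha> s B bl" "dd \<alpha> s bl bl'"
    using fr_low[OF s q(3,1)]
    by (simp_all add: dd_def B_def bl_def bl'_def m m_prim_def m_low_def m_deriv_def)
  define y where "y = Y w"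
  have y: "y = z - \<epsilon> *\<^sub>R (B * z)" by (simp add: y_def Y_def z_def)
  have yw: "sym_L \<alpha> s \<epsilon> \<nu> * cf y \<nu> = of_real \<epsilon> * (cf fh \<nu> - cf rh \<nu> - cf (gser a (v + y1 + y)) \<nu> + cf r \<nu>)" for \<nu>
  proof -
    have "w - \<epsilon> *\<^sub>R (B * w) + \<epsilon> *\<^sub>R (bh * z)
     - (\<epsilon>\<^sup>2) *\<^sub>R (bl' * z + (b - \<beta> *\<^sub>R 1) * B * z) - (2 * \<epsilon>\<^sup>2) *\<^sub>R (bl * z1) = w - T w"
      by (simp add: T_def z_def z1_def algebra_simps)
    also have "\<dots> = \<epsilon> *\<^sub>R (fh - rh) - \<epsilon> *\<^sub>R Q y"
      using w(3) unfolding \<Phi>_def y_def by (metis add_diff_cancel_right')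
    finally have E: "w - \<epsilon> *\<^sub>R (B * w) + \<epsilon> *\<^sub>R (bh * z)
     - (\<epsilon>\<^sup>2) *\<^sub>R (bl' * z + (b - \<beta> *\<^sub>R 1) * B * z) - (2 * \<epsilon>\<^sup>2) *\<^sub>R (bl * z1)
     = \<epsilon> *\<^sub>R (fh - rh) - \<epsilon> *\<^sub>R Q y" .
    show ?thesis
      unfolding conjugation_identity[OF dz dz1 zw dB b_split y, of \<nu>] E
      by (simp add: Q_def cf_scaleR algebra_simps del: scaleR_wa.rep_eq)
  qed
  have y1w: "sym_L \<alpha> s \<epsilon> \<nu> * cf y1 \<nu> = - of_real \<epsilon> * cf rl \<nu>" for \<nu>
    using sym_L_low[OF s q(3,1), of \<nu> \<epsilon>] by (simp add: y1_def rl_def m m_inv_def m_low_def)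
  define X where "X = v + y1 + y"
  have "approx_ode \<alpha> s a (fl + fh) \<epsilon> X"
    unfolding approx_ode_def
  proof
    fix \<nu>
    have "cf r \<nu> = cf rl \<nu> + cf rh \<nu>" using r_split by (metis plus_wa.rep_eq)
    then show "sym_L \<alpha> s \<epsilon> \<nu> * cf X \<nu> + of_real \<epsilon> * cf (gser a X) \<nu> = of_real \<epsilon> * cf (fl + fh) \<nu>"
      using fl[of \<nu>] yw[of \<nu>] y1w[of \<nu>] by (simp add: X_def algebra_simps)
  qed
  moreover have "norm X \<le> 4 * \<delta>" unfolding X_def y_def by (rule ball(1)[OF nYR[OF w(2)]])
  moreover have "X \<in> wlat s"
    unfolding X_def y z_def by (intro wlat_add wlat_diff wlat_scaleR wlat_mult wlK wl' v(1) w(1))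
  ultimately show ?thesis by blast
qed

section \<open>Mean values of the nonlinearity and the first approximation\<close>

text \<open>Evaluation is a homomorphism into the complex numbers and the embedding of the reals is
  another one; both commute with the power series, and the real value is read off in
  between.\<close>

lemma evr_gser:
  assumes g: "gcoeffs a n \<rho> C" and x: "x \<in> wlat s" "norm x \<le> \<rho>"
  shows "evr (gser a x) \<psi> = gser a (evr x \<psi>)" and "evr (gder a x) \<psi> = gder a (evr x \<psi>)"
proof -
  let ?z = "(complex_of_real (fst \<psi>), complex_of_real (snd \<psi>))"
  have e: "ev x ?z = of_real (evr x \<psi>)" using ev_real[OF x(1), of "fst \<psi>" "snd \<psi>"] by simp
  have r: "norm (evr x \<psi>) \<le> \<rho>" using abs_evr[of x \<psi>] x(2) by simp
  note h1 = gser_hom[OF g bounded_linear_ev[OF ustrip_real] ev_mult[OF ustrip_real] ev_one x(2), of "fst \<psi>" "snd \<psi>"]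
  note h2 = gser_hom[OF g bounded_linear_of_real of_real_mult of_real_1 r, where 'b=complex]
  show "evr (gser a x) \<psi> = gser a (evr x \<psi>)"
    unfolding evr_def[of "gser a x"] h1(1) e h2(1)[symmetric] by (rule Re_complex_of_real)
  show "evr (gder a x) \<psi> = gder a (evr x \<psi>)"
    unfolding evr_def[of "gder a x"] h1(2) e h2(2)[symmetric] by (rule Re_complex_of_real)
qed

text \<open>On the left stands the tangent at \<open>t\<close> of a function that is convex on the
  half-line.\<close>

lemma power_tangent:
  fixes y t :: real
  assumes "y \<ge> 0" "t \<ge> 0"
  shows "real (Suc k) * t ^ k * y - real k * t ^ Suc k \<le> y ^ Suc k"
proof (induction k)
  case (Suc k)
  have "real (Suc (Suc k)) * t ^ Suc k * y - real (Suc k) * t ^ Suc (Suc k)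
     = y * (real (Suc k) * t ^ k * y - real k * t ^ Suc k) - real (Suc k) * t ^ k * (y - t)\<^sup>2"
    by (simp add: algebra_simps power2_eq_square)
  also have "\<dots> \<le> y * y ^ Suc k - 0"
    using assms Suc by (intro diff_mono mult_left_mono) auto
  finally show ?case by simp
qed simp

text \<open>Bessel's inequality for a single mode.\<close>

lemma cf_square_ge:
  assumes "v \<in> wlat s"
  shows "(norm (cf v \<nu>))\<^sup>2 \<le> Re (cf (v * v) 0)"
proof -
  have eq: "Re (cf v \<mu> * cnj (cf v \<mu>)) = (norm (cf v \<mu>))\<^sup>2" for \<mu>
    by (simp add: complex_mult_cnj cmod_power2)
  have "((\<lambda>\<mu>. cf v \<mu> * cnj (cf v \<mu>)) has_sum cf (v * v) 0) UNIV"
    unfolding cf_mult_0(1)[OF assms] by (rule has_sum_infsum[OF cf_mult_0(2)[OF assms]])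
  then have "((\<lambda>\<mu>. (norm (cf v \<mu>))\<^sup>2) has_sum Re (cf (v * v) 0)) UNIV"
    using has_sum_bounded_linear[OF bounded_linear_Re] by (simp only: eq[symmetric])
  from finite_sum_le_has_sum[OF this, of "{\<nu>}"] show ?thesis by simp
qed

text \<open>Jensen's inequality for \<open>y ^ Suc k\<close> at \<open>y = v\<^sup>2\<close>, where
  \<open>n - 1 = 2 * Suc k\<close>. A tangent at a fixed \<open>t\<close> keeps everything quadratic
  in \<open>v\<close>, so that only the mean of \<open>v * v\<close> enters, and Bessel's inequality
  bounds this mean from below by one coefficient.\<close>

lemma mean_gder_ge:
  assumes g: "gcoeffs a n \<rho> C" and n: "odd n" and s: "s > 0" and v: "v \<in> wlat s" "norm v \<le> \<rho>0" and \<rho>0: "\<rho>0 \<le> \<rho>"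
    and sg: "\<And>x::real. \<bar>x\<bar> \<le> \<rho>0 \<Longrightarrow> sgn (a n) * gder a x \<ge> real n * \<bar>a n\<bar> / 2 * x ^ (n - 1)"
  shows "\<bar>Re (cf (gder a v) 0)\<bar> \<ge> real n * \<bar>a n\<bar> / 2 * norm (cf v \<nu>) ^ (n - 1)"
proof -
  define k where "k = (n - 1) div 2 - 1"
  have k: "n - 1 = 2 * Suc k" using n n2[OF g] by (auto simp: k_def elim!: oddE)
  define c t where "c = real n * \<bar>a n\<bar> / 2" and "t = (norm (cf v \<nu>))\<^sup>2"
  have c0: "c \<ge> 0" and t0: "t \<ge> 0" by (simp_all add: c_def t_def)
  \<comment> \<open>The tangent inequality, written as the nonnegativity of one element. The point
    \<open>t\<close> is the lower bound available for the mean of \<open>v * v\<close>, so inserting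
    that bound gives back \<open>t ^ Suc k\<close> without loss.\<close>
  define h where "h = sgn (a n) *\<^sub>R gder a v - c *\<^sub>R ((real (Suc k) * t ^ k) *\<^sub>R (v * v) - (real k * t ^ Suc k) *\<^sub>R 1)"
  have v\<rho>: "norm v \<le> \<rho>" using v \<rho>0 by simp
  have "Re (cf h 0) \<ge> 0"
  proof (rule mean_nonneg[OF s])
    show "h \<in> wlat s"
      unfolding h_def by (intro wlat_diff wlat_scaleR wlat_mult wlat_1 v wlat_gser(2)[OF g v(1) v\<rho>])
    fix \<psi>
    have x: "\<bar>evr v \<psi>\<bar> \<le> \<rho>0" using abs_evr[of v \<psi>] v(2) by simp
    have "c * (real (Suc k) * t ^ k * (evr v \<psi>)\<^sup>2 - real k * t ^ Suc k) \<le> c * ((evr v \<psi>)\<^sup>2) ^ Suc k"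
      using power_tangent[OF zero_le_power2 t0, of k "evr v \<psi>"] c0 by (rule mult_left_mono)
    also have "\<dots> \<le> sgn (a n) * gder a (evr v \<psi>)"
    proof -
      have "((evr v \<psi>)\<^sup>2) ^ Suc k = evr v \<psi> ^ (n - 1)" unfolding k by (simp only: power_mult)
      then show ?thesis using sg[OF x] by (simp only: c_def)
    qed
    finally show "evr h \<psi> \<ge> 0"
      by (simp add: h_def evr_diff evr_scaleR evr_mult[OF v(1) v(1)] evr_one evr_gser(2)[OF g v(1) v\<rho>] power2_eq_square del: power_Suc)
  qed
  then have le: "c * (real (Suc k) * t ^ k * Re (cf (v * v) 0) - real k * t ^ Suc k) \<le> sgn (a n) * Re (cf (gder a v) 0)"
    by (simp add: h_def cf_one)
  have "c * norm (cf v \<nu>) ^ (n - 1) = c * t ^ Suc k"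
    unfolding k t_def by (simp only: power_mult)
  also have "\<dots> = c * (real (Suc k) * t ^ k * t - real k * t ^ Suc k)"
    by (simp add: algebra_simps)
  also have "\<dots> \<le> c * (real (Suc k) * t ^ k * Re (cf (v * v) 0) - real k * t ^ Suc k)"
    using cf_square_ge[OF v(1), of \<nu>] c0 t0 by (intro mult_left_mono diff_right_mono) (auto simp: t_def)
  also note le
  also have "sgn (a n) * Re (cf (gder a v) 0) \<le> \<bar>Re (cf (gder a v) 0)\<bar>"
    by (auto simp: sgn_if)
  finally show ?thesis unfolding c_def .
qed

text \<open>Shifted by \<open>d\<close>, the element is nonnegative at real arguments, and shifted
  by \<open>- d\<close> it is nonpositive. The nonlinearity has the sign of its argument up to
  \<open>sgn (a n)\<close>, so its mean changes sign in between and the intermediate value theorem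
  applies.\<close>

lemma exists_zero_mean_shift:
  assumes g: "gcoeffs a n \<rho> C" and n: "odd n" and an: "a n \<noteq> 0" and s: "s > 0"
    and u: "u \<in> wlat s" "norm u \<le> d" "2 * d \<le> \<rho>0" and \<rho>0: "\<rho>0 \<le> \<rho>"
    and mono: "\<And>x y::real. \<bar>x\<bar> \<le> \<rho>0 \<Longrightarrow> \<bar>y\<bar> \<le> \<rho>0 \<Longrightarrow> x \<le> y \<Longrightarrow>
       sgn (a n) * (gser a y - gser a x) \<ge> \<bar>a n\<bar> / 2 * (y ^ n - x ^ n)"
  shows "\<exists>\<zeta>. \<bar>\<zeta>\<bar> \<le> d \<and> cf (gser a (u + \<zeta> *\<^sub>R 1)) 0 = 0"
proof -
  define \<phi> where "\<phi> = (\<lambda>t. sgn (a n) * Re (cf (gser a (u + t *\<^sub>R 1)) 0))"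
  have d0: "d \<ge> 0" using u(2) norm_ge_zero order_trans by blast
  have nu: "norm (u + t *\<^sub>R 1) \<le> 2 * d" if "\<bar>t\<bar> \<le> d" for t
    using norm_triangle_ineq[of u "t *\<^sub>R 1"] that u(2) by simp
  have nu\<rho>: "norm (u + t *\<^sub>R 1) \<le> \<rho>" if "\<bar>t\<bar> \<le> d" for t
    using nu[OF that] u(3) \<rho>0 by simp
  have wl: "u + t *\<^sub>R 1 \<in> wlat s" for t using u(1) by auto
  have g0: "gser a (0::real) = 0"
    using gser_summable(2)[OF g, of "0::real" 0] \<rho>_pos[OF g] n by (simp add: zero_power odd_pos)
  have odd_sign: "0 \<le> x ^ n \<longleftrightarrow> 0 \<le> x" for x :: real using n by (simp add: zero_le_odd_power)
  have pos: "0 \<le> sgn (a n) * gser a x" if "0 \<le> x" "x \<le> \<rho>0" for x :: real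
  proof -
    have "0 \<le> \<bar>a n\<bar> / 2 * (x ^ n - 0 ^ n)"
      using that n by (simp add: odd_pos zero_power)
    also have "\<dots> \<le> sgn (a n) * (gser a x - gser a 0)"
      using that by (intro mono) auto
    finally show ?thesis using g0 by simp
  qed
  have neg: "sgn (a n) * gser a x \<le> 0" if "x \<le> 0" "- \<rho>0 \<le> x" for x :: real
  proof -
    have "0 \<le> \<bar>a n\<bar> / 2 * (0 ^ n - x ^ n)"
      using that n odd_sign[of "-x"] by (simp add: odd_pos zero_power mult_nonneg_nonpos)
    also have "\<dots> \<le> sgn (a n) * (gser a 0 - gser a x)"
      using that by (intro mono) auto
    finally show ?thesis using g0 by simp
  qed
  have "\<exists>t\<ge>- d. t \<le> d \<and> \<phi> t = 0"
  proof (rule IVT')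
    show "- d \<le> d" using d0 by simp
    have "Re (cf ((- sgn (a n)) *\<^sub>R gser a (u + (- d) *\<^sub>R 1)) 0) \<ge> 0"
    proof (rule mean_nonneg[OF s])
      show "(- sgn (a n)) *\<^sub>R gser a (u + (- d) *\<^sub>R 1) \<in> wlat s"
        using d0 by (intro wlat_scaleR wlat_gser(1)[OF g wl nu\<rho>]) simp
      fix \<psi>
      have "evr (u + (- d) *\<^sub>R 1) \<psi> \<le> 0" "- \<rho>0 \<le> evr (u + (- d) *\<^sub>R 1) \<psi>"
        using abs_evr[of u \<psi>] u(2,3) by (simp_all only: evr_add evr_scaleR evr_one)
      from neg[OF this] show "evr ((- sgn (a n)) *\<^sub>R gser a (u + (- d) *\<^sub>R 1)) \<psi> \<ge> 0"
        unfolding evr_scaleR by (subst evr_gser(1)[OF g wl nu\<rho>]) (use d0 in auto)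
    qed
    then show "\<phi> (- d) \<le> 0" by (simp add: \<phi>_def)
    have "Re (cf (sgn (a n) *\<^sub>R gser a (u + d *\<^sub>R 1)) 0) \<ge> 0"
    proof (rule mean_nonneg[OF s])
      show "sgn (a n) *\<^sub>R gser a (u + d *\<^sub>R 1) \<in> wlat s"
        using d0 by (intro wlat_scaleR wlat_gser(1)[OF g wl nu\<rho>]) simp
      fix \<psi>
      have "0 \<le> evr (u + d *\<^sub>R 1) \<psi>" "evr (u + d *\<^sub>R 1) \<psi> \<le> \<rho>0"
        using abs_evr[of u \<psi>] u(2,3) by (simp_all only: evr_add evr_scaleR evr_one)
      from pos[OF this] show "evr (sgn (a n) *\<^sub>R gser a (u + d *\<^sub>R 1)) \<psi> \<ge> 0"
        unfolding evr_scaleR by (subst evr_gser(1)[OF g wl nu\<rho>]) (use d0 in auto)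
    qed
    then show "0 \<le> \<phi> d" by (simp add: \<phi>_def)
    have "(C * \<rho> ^ (n - 1))-lipschitz_on {- d..d} (\<lambda>t. gser a (u + t *\<^sub>R 1))"
    proof (rule lipschitz_onI)
      fix x y assume "x \<in> {- d..d}" "y \<in> {- d..d}"
      then show "dist (gser a (u + x *\<^sub>R 1)) (gser a (u + y *\<^sub>R 1)) \<le> C * \<rho> ^ (n - 1) * dist x y"
        using gser_lipschitz[OF g nu\<rho>[of x] nu\<rho>[of y]]
        by (simp add: dist_norm mult.assoc abs_le_iff flip: scaleR_diff_left)
    qed (use C_nonneg[OF g] \<rho>_pos[OF g] in auto)
    then have "continuous_on {- d..d} (\<lambda>t. gser a (u + t *\<^sub>R 1))" by (rule lipschitz_on_continuous_on)
    then show "continuous_on {- d..d} \<phi>"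
      unfolding \<phi>_def by (intro continuous_intros bounded_linear.continuous_on[OF bounded_linear_cf])
  qed
  then obtain \<zeta> where z: "- d \<le> \<zeta>" "\<zeta> \<le> d" "\<phi> \<zeta> = 0" by auto
  then have "\<bar>\<zeta>\<bar> \<le> d" by auto
  moreover have "cf (gser a (u + \<zeta> *\<^sub>R 1)) 0 = 0"
    using z(3) an wlat_cf_0_real[OF wlat_gser(1)[OF g wl nu\<rho>[OF \<open>\<bar>\<zeta>\<bar> \<le> d\<close>]]]
    by (simp add: \<phi>_def sgn_zero_iff)
  ultimately show ?thesis by blast
qed

text \<open>A single nonzero mode \<open>\<nu>0\<close> of the forcing keeps \<beta> away from 0: it
  is a low mode once \<open>q\<close> is large, and there the first approximation has a coefficient
  of order \<epsilon>, which the constant shift does not touch.\<close>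

lemma existence:
  assumes g: "gcoeffs a n \<rho> C" and n: "odd n" and an: "a n \<noteq> 0" and s: "s > 0"
    and f: "f \<in> wlat (3 * s)" "cf f 0 = 0" "cf f \<nu>0 \<noteq> 0" and R: "R > 0"
  shows "\<exists>\<theta>0>0. \<exists>M. \<forall>\<epsilon> q. 0 < \<epsilon> \<longrightarrow> q \<ge> 1 \<longrightarrow> nonresonant \<alpha> q \<longrightarrow> \<epsilon> * q ^ n \<le> \<theta>0 \<longrightarrow>
     exp (- 2 * s * q) \<le> \<theta>0 * \<epsilon> ^ (n + 1) \<longrightarrow>
     (\<exists>X\<in>wlat s. norm X \<le> R \<and> norm X \<le> M * (\<epsilon> * q) \<and> approx_ode \<alpha> s a (dil 3 f) \<epsilon> X)"
proof -
  obtain \<rho>0 where \<rho>0: "0 < \<rho>0" "\<rho>0 < \<rho>"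
    and sg: "\<And>x::real. \<bar>x\<bar> \<le> \<rho>0 \<Longrightarrow> sgn (a n) * gder a x \<ge> real n * \<bar>a n\<bar> / 2 * x ^ (n - 1)"
    and mono: "\<And>x y::real. \<bar>x\<bar> \<le> \<rho>0 \<Longrightarrow> \<bar>y\<bar> \<le> \<rho>0 \<Longrightarrow> x \<le> y \<Longrightarrow>
       sgn (a n) * (gser a y - gser a x) \<ge> \<bar>a n\<bar> / 2 * (y ^ n - x ^ n)"
    using gser_real_sign[OF g n an] by blast
  note n2 = n2[OF g] and \<rho> = \<rho>_pos[OF g] and C = C_nonneg[OF g]
  have s3: "3 * s > 0" using s by simp
  define F D W where "F = max 1 (norm f)" and "D = max 1 (C * 4 ^ n)" and "W = 1 + \<bar>\<alpha>\<bar>"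
  have F: "F \<ge> 1" "norm f \<le> F" and D: "D \<ge> 1" "C * 4 ^ n \<le> D" and W: "W \<ge> 1"
    by (auto simp: F_def D_def W_def)
  define \<theta> where "\<theta> = 1 / (36 * W * D\<^sup>2 * (F + 1))"
  have den: "36 * W * D\<^sup>2 * (F + 1) > 0" using F D W by (intro mult_pos_pos) auto
  have \<theta>: "\<theta> > 0" "36 * W * D\<^sup>2 * (F + 1) * \<theta> \<le> 1" using den by (auto simp: \<theta>_def)
  define w0 where "w0 = \<bar>fr \<alpha> (3 * s) \<nu>0\<bar>"
  \<comment> \<open>Bounds \<open>sym_L\<close> at \<open>\<nu>0\<close> for all
    \<open>\<epsilon> \<le> 1\<close>; thereby \<open>c0\<close> becomes the constant in
    \<open>c0 * \<epsilon> ^ (n - 1) \<le> \<bar>\<beta>\<bar>\<close>.\<close>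
  define \<Lambda> where "\<Lambda> = 1 + w0 + w0\<^sup>2"
  have \<Lambda>: "\<Lambda> > 0" by (simp add: \<Lambda>_def w0_def add_pos_nonneg)
  define c0 where "c0 = real n * \<bar>a n\<bar> / 2 * (norm (cf f \<nu>0) / \<Lambda>) ^ (n - 1)"
  have c0: "c0 > 0" using n2 an f(3) \<Lambda> by (simp add: c0_def)
  define d where "d = min (min \<theta> 1) (min (\<rho>0 / 4) (R / 4))"
  have d: "d > 0" "d \<le> \<theta>" "d \<le> 1" "d \<le> \<rho>0 / 4" "d \<le> R / 4" using \<theta> \<rho>0 R by (auto simp: d_def)
  \<comment> \<open>The entries serve in turn for \<open>\<delta> \<le> d\<close>, for
    \<open>\<delta> ^ n \<le> \<theta> * c0 * \<epsilon> ^ (n - 1)\<close>, for the size of the tail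
    against \<open>\<bar>\<beta>\<bar> * \<delta>\<^sup>2\<close>, and for \<open>q\<close> to
    exceed the order of \<open>\<nu>0\<close>, which the smallness of
    \<open>exp (- 2 * s * q)\<close> enforces.\<close>
  define \<theta>0 where "\<theta>0 = min (min (d / (2 * F)) (\<theta> * c0 / (2 * F) ^ n)) (min (\<theta> * c0) (exp (- 2 * s * (fnorm \<nu>0 / (3 * s) + 1))))"
  have F2: "(2 * F) ^ n > 0" using F by simp
  have \<theta>0: "\<theta>0 > 0" "2 * F * \<theta>0 \<le> d" "(2 * F) ^ n * \<theta>0 \<le> \<theta> * c0" "\<theta>0 \<le> \<theta> * c0"
    "\<theta>0 \<le> exp (- 2 * s * (fnorm \<nu>0 / (3 * s) + 1))"
  proof -
    show "\<theta>0 > 0" using d F \<theta> c0 F2 by (auto simp: \<theta>0_def)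
    have "\<theta>0 \<le> d / (2 * F)" "\<theta>0 \<le> \<theta> * c0 / (2 * F) ^ n" by (auto simp: \<theta>0_def)
    then show "2 * F * \<theta>0 \<le> d" "(2 * F) ^ n * \<theta>0 \<le> \<theta> * c0" using F F2
      by (simp_all add: pos_le_divide_eq mult.commute)
  qed (auto simp: \<theta>0_def)
  have "\<exists>X\<in>wlat s. norm X \<le> R \<and> norm X \<le> 8 * F * (\<epsilon> * q) \<and> approx_ode \<alpha> s a (dil 3 f) \<epsilon> X"
    if \<epsilon>: "0 < \<epsilon>" and q: "q \<ge> 1" and nr: "nonresonant \<alpha> q" and \<epsilon>q: "\<epsilon> * q ^ n \<le> \<theta>0"
      and ex: "exp (- 2 * s * q) \<le> \<theta>0 * \<epsilon> ^ (n + 1)" for \<epsilon> q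
  proof -
    define \<delta> where "\<delta> = 2 * F * (\<epsilon> * q)"
    have \<epsilon>0: "\<epsilon> \<ge> 0" using \<epsilon> by simp
    have "q \<le> q ^ n" using q n2 by (intro self_le_power) auto
    then have "\<epsilon> * q \<le> \<theta>0" using \<epsilon>q \<epsilon> by (meson mult_left_mono less_imp_le order_trans)
    then have "\<delta> \<le> 2 * F * \<theta>0" using F by (simp add: \<delta>_def)
    then have \<delta>d: "\<delta> \<le> d" using \<theta>0(2) by simp
    have q2\<epsilon>: "2 * \<epsilon> * q \<le> \<delta>" using F \<epsilon> q mult_right_mono[OF F(1), of "2 * \<epsilon> * q"] by (simp add: \<delta>_def mult_ac)
    have "\<epsilon> \<le> 2 * \<epsilon> * q" using \<epsilon> q mult_left_mono[OF q, of "2 * \<epsilon>"] by simp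
    then have \<epsilon>\<delta>: "\<epsilon> \<le> \<delta>" using q2\<epsilon> by simp
    then have \<delta>0: "\<delta> > 0" and \<epsilon>1: "\<epsilon> \<le> 1" using \<epsilon> \<delta>d d by auto
    have \<delta>n: "\<delta> ^ n \<le> \<theta> * c0 * \<epsilon> ^ (n - 1)"
    proof -
      have "\<delta> ^ n = (2 * F) ^ n * (\<epsilon> * q ^ n) * \<epsilon> ^ (n - 1)"
        using n2 by (cases n) (simp_all add: \<delta>_def power_mult_distrib)
      also have "\<dots> \<le> (2 * F) ^ n * \<theta>0 * \<epsilon> ^ (n - 1)"
        using \<epsilon>q F2 \<epsilon>0 by (intro mult_right_mono mult_left_mono) auto
      also have "\<dots> \<le> \<theta> * c0 * \<epsilon> ^ (n - 1)" using \<theta>0(3) \<epsilon>0 by (intro mult_right_mono) auto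
      finally show ?thesis .
    qed
    \<comment> \<open>The approximation is built on the width \<open>3 * s\<close> and dilated only
      afterwards. Its images under \<open>gser a\<close> and \<open>gder a\<close> then live on the
      wide strip as well, and their high modes have the same exponential smallness as those of the
      forcing.\<close>
    define u v' where "u = mul (m_inv \<alpha> (3 * s) q \<epsilon>) f"
      and "v' = u + (SOME \<zeta>. \<bar>\<zeta>\<bar> \<le> \<delta> \<and> cf (gser a (u + \<zeta> *\<^sub>R 1)) 0 = 0) *\<^sub>R 1"
    note inv = norm_m_inv[OF s3 nr q \<epsilon>0]
    have u: "u \<in> wlat (3 * s)" "norm u \<le> \<delta>"
    proof -
      show "u \<in> wlat (3 * s)" unfolding u_def by (rule wlat_mul[where m="m_inv \<alpha> (3 * s) q \<epsilon>", OF inv m_minus(5) f(1)])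
      have "norm u \<le> 2 * \<epsilon> * q * norm f" unfolding u_def by (rule norm_mul[where m="m_inv \<alpha> (3 * s) q \<epsilon>", OF inv])
      also have "\<dots> \<le> 2 * \<epsilon> * q * F" using F \<epsilon> q by (intro mult_left_mono) auto
      finally show "norm u \<le> \<delta>" by (simp add: \<delta>_def mult_ac)
    qed
    have "\<exists>\<zeta>. \<bar>\<zeta>\<bar> \<le> \<delta> \<and> cf (gser a (u + \<zeta> *\<^sub>R 1)) 0 = 0"
      using \<delta>d d \<rho>0 \<delta>0 by (intro exists_zero_mean_shift[OF g n an s3 u, of \<rho>0] mono) auto
    from someI_ex[OF this] obtain \<zeta> where z: "\<bar>\<zeta>\<bar> \<le> \<delta>" "cf (gser a v') 0 = 0" and v'_eq: "v' = u + \<zeta> *\<^sub>R 1"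
      unfolding v'_def by blast
    have v': "v' \<in> wlat (3 * s)" "norm v' \<le> 2 * \<delta>"
      using u norm_triangle_ineq[of u "\<zeta> *\<^sub>R 1"] z(1) by (auto simp: v'_eq)
    have v'\<rho>: "norm v' \<le> \<rho>0" "norm v' \<le> \<rho>" using v' \<delta>d d \<rho>0 \<delta>0 by auto
    define v where "v = dil 3 v'"
    have v: "v \<in> wlat s" "norm v \<le> 2 * \<delta>"
      using wlat_dil[OF _ v'(1)] norm_dil[of 3 v'] v'(2) by (auto simp: v_def)
    note hom = gser_hom[OF g bounded_linear_dil dil_mult dil_one v'\<rho>(2), of 3, folded v_def, simplified]
    define \<beta> where "\<beta> = Re (cf (gder a v) 0)"
    have \<beta>_eq: "\<beta> = Re (cf (gder a v') 0)" by (simp add: \<beta>_def flip: hom(2))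
    have \<nu>0: "\<nu>0 \<in> low (3 * s) q"
    proof -
      have "exp (- 2 * s * q) \<le> \<theta>0 * 1"
        using \<theta>0(1) \<epsilon>0 \<epsilon>1 by (intro order_trans[OF ex] mult_left_mono power_le_one) auto
      then have "exp (- 2 * s * q) \<le> exp (- 2 * s * (fnorm \<nu>0 / (3 * s) + 1))"
        using \<theta>0(5) unfolding mult_1_right by (rule order_trans)
      then have "fnorm \<nu>0 / (3 * s) + 1 \<le> q" using s by (simp only: exp_le_cancel_iff) simp
      then have "fnorm \<nu>0 / (3 * s) < q" by simp
      then have "fnorm \<nu>0 < 3 * s * q" using s by (simp add: field_simps)
      moreover have "\<nu>0 \<noteq> 0" "\<nu>0 \<in> rlat (3 * s)"
        using f wlat_notin[OF f(1), of \<nu>0] by auto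
      ultimately show ?thesis by (simp add: low_def)
    qed
    have \<beta>_ge: "c0 * \<epsilon> ^ (n - 1) \<le> \<bar>\<beta>\<bar>"
    proof -
      have "norm (sym_L \<alpha> (3 * s) \<epsilon> \<nu>0) \<le> w0 + \<epsilon> * w0\<^sup>2"
        unfolding sym_L_def w0_def using \<epsilon>0 by (intro norm_triangle_le_diff) (simp add: norm_mult norm_power)
      also have "\<dots> \<le> w0 + 1 * w0\<^sup>2" using \<epsilon>1 by (intro add_left_mono mult_right_mono) auto
      finally have L: "norm (sym_L \<alpha> (3 * s) \<epsilon> \<nu>0) \<le> \<Lambda>" by (simp add: \<Lambda>_def)
      have L0: "norm (sym_L \<alpha> (3 * s) \<epsilon> \<nu>0) > 0" using sym_L_low[OF s3 nr q \<nu>0] by simp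
      have "cf v' \<nu>0 = of_real \<epsilon> * cf f \<nu>0 / sym_L \<alpha> (3 * s) \<epsilon> \<nu>0"
        using \<nu>0 by (simp add: v'_eq u_def cf_mul[where m="m_inv \<alpha> (3 * s) q \<epsilon>", OF inv] m_inv_def low_def cf_one)
      then have "norm (cf v' \<nu>0) = \<epsilon> * norm (cf f \<nu>0) / norm (sym_L \<alpha> (3 * s) \<epsilon> \<nu>0)"
        using \<epsilon>0 by (simp add: norm_mult norm_divide)
      then have "\<epsilon> * (norm (cf f \<nu>0) / \<Lambda>) \<le> norm (cf v' \<nu>0)"
        using L L0 \<epsilon>0 by (simp add: frac_le)
      then have "(\<epsilon> * (norm (cf f \<nu>0) / \<Lambda>)) ^ (n - 1) \<le> norm (cf v' \<nu>0) ^ (n - 1)"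
        using \<epsilon>0 \<Lambda> by (intro power_mono) auto
      then have "real n * \<bar>a n\<bar> / 2 * (\<epsilon> * (norm (cf f \<nu>0) / \<Lambda>)) ^ (n - 1) \<le> real n * \<bar>a n\<bar> / 2 * norm (cf v' \<nu>0) ^ (n - 1)"
        by (intro mult_left_mono) auto
      also have "\<dots> \<le> \<bar>\<beta>\<bar>"
        unfolding \<beta>_eq using \<rho>0 by (intro mean_gder_ge[OF g n s3 v'(1) v'\<rho>(1) _ sg]) auto
      finally show ?thesis unfolding c0_def power_mult_distrib by (simp only: mult_ac)
    qed
    have \<beta>0: "\<beta> \<noteq> 0" using \<beta>_ge c0 \<epsilon> by (smt (verit) mult_pos_pos zero_less_power)
    have \<delta>n\<beta>: "\<delta> ^ n \<le> \<theta> * \<bar>\<beta>\<bar>"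
      using \<theta>(1) by (intro order_trans[OF \<delta>n[unfolded mult.assoc] mult_left_mono[OF \<beta>_ge]]) simp
    \<comment> \<open>Here \<open>n + 1 = (n - 1) + 2\<close>: the exponent in the hypothesis covers
      the size of \<beta> and, because of \<open>\<epsilon> \<le> \<delta>\<close>, that of
      \<open>\<delta>\<^sup>2\<close>.\<close>
    have ex\<beta>: "exp (- 2 * s * q) \<le> \<theta> * \<bar>\<beta>\<bar> * \<delta>\<^sup>2"
    proof -
      have "exp (- 2 * s * q) \<le> (\<theta> * c0) * \<epsilon> ^ (n + 1)"
        using \<theta>0(4) \<epsilon>0 by (intro order_trans[OF ex] mult_right_mono) auto
      also have "\<epsilon> ^ (n + 1) = \<epsilon> ^ (n - 1) * \<epsilon>\<^sup>2"
        using n2 by (simp flip: power_add)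
      also have "(\<theta> * c0) * (\<epsilon> ^ (n - 1) * \<epsilon>\<^sup>2) = \<theta> * (c0 * \<epsilon> ^ (n - 1)) * \<epsilon>\<^sup>2" by simp
      also have "\<dots> \<le> \<theta> * \<bar>\<beta>\<bar> * \<delta>\<^sup>2"
        using \<beta>_ge \<epsilon>\<delta> \<epsilon>0 \<theta>(1) c0 by (intro mult_mono mult_left_mono power_mono) auto
      finally show ?thesis .
    qed
    have high: "norm (mul (m_high s q) (dil 3 h)) \<le> \<theta> * \<bar>\<beta>\<bar> * \<delta>\<^sup>2 * B"
      if "h \<in> wlat (3 * s)" "norm h \<le> B" for h B
    proof -
      have "norm (mul (m_high s q) (dil 3 h)) \<le> exp (- 2 * s * q) * norm h" by (rule norm_high_le[OF s that(1)])
      also have "\<dots> \<le> \<theta> * \<bar>\<beta>\<bar> * \<delta>\<^sup>2 * B" using ex\<beta> that(2) \<theta>(1) by (intro mult_mono) auto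
      finally show ?thesis .
    qed
    have DC: "C * (2 * \<delta>) ^ k \<le> D" if "k \<le> n" for k
    proof -
      have "C * (2 * \<delta>) ^ k \<le> C * 4 ^ k" using C \<delta>0 \<delta>d d by (intro mult_left_mono power_mono) auto
      also have "\<dots> \<le> C * 4 ^ n" using C that by (intro mult_left_mono power_increasing) auto
      finally show ?thesis using D(2) by simp
    qed
    have nb: "norm (gder a v') \<le> D" "norm (gser a v') \<le> D"
    proof -
      have \<delta>\<rho>: "2 * \<delta> \<le> \<rho>" using \<delta>d d \<rho>0 by simp
      show "norm (gder a v') \<le> D"
        by (rule order_trans[OF gder_summable(2)[OF g v'(2) \<delta>\<rho>] DC]) simp
      show "norm (gser a v') \<le> D"
        by (rule order_trans[OF gser_summable(2)[OF g v'(2) \<delta>\<rho>] DC]) simp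
    qed
    have wlv: "gser a v' \<in> wlat (3 * s)" "gder a v' \<in> wlat (3 * s)"
      by (rule wlat_gser[OF g v'(1) v'\<rho>(2)])+
    define fl fh where "fl = mul (m_low s q) (dil 3 f)" and "fh = mul (m_high s q) (dil 3 f)"
    have ffl: "sym_L \<alpha> s \<epsilon> \<nu> * cf v \<nu> = of_real \<epsilon> * cf fl \<nu>" for \<nu>
    proof (cases "\<nu> = 0")
      case True
      then show ?thesis by (simp add: sym_L_def fl_def cf_mul[where m="m_low s q", OF norm_m_low] f(2))
    next
      case False
      have e: "sym_L \<alpha> (3 * s) \<epsilon> (3 *\<^sub>R \<nu>) = sym_L \<alpha> s \<epsilon> \<nu>" by (simp add: sym_L_def fr_scale)
      have "cf v \<nu> = m_inv \<alpha> (3 * s) q \<epsilon> (3 *\<^sub>R \<nu>) * cf f (3 *\<^sub>R \<nu>)"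
        using False by (simp add: v_def v'_eq u_def cf_mul[where m="m_inv \<alpha> (3 * s) q \<epsilon>", OF inv] cf_one)
      then show ?thesis
        using sym_L_low[OF s nr q, of \<nu> \<epsilon>]
        by (simp add: m_inv_def low_scale e fl_def cf_mul[where m="m_low s q", OF norm_m_low] m_low_def)
    qed
    have fsum: "dil 3 f = fl + fh"
    proof (rule wa_eqI)
      fix \<nu> show "cf (dil 3 f) \<nu> = cf (fl + fh) \<nu>"
        by (auto simp: fl_def fh_def cf_mul[where m="m_low s q", OF norm_m_low]
          cf_mul[where m="m_high s q", OF norm_m_high] m_low_def m_high_def f(2))
    qed
    have "\<exists>X\<in>wlat s. norm X \<le> 4 * \<delta> \<and> approx_ode \<alpha> s a (fl + fh) \<epsilon> X"
    proof (rule core[OF g s \<epsilon> \<epsilon>\<delta> _ _ q q2\<epsilon> nr v D W_def _ \<theta> _ \<beta>_def \<beta>0 _ \<delta>n\<beta> ffl])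
      show "cf (gser a v) 0 = 0" using z(2) by (simp flip: hom(1))
      show "norm fh \<le> \<theta> * \<bar>\<beta>\<bar> * \<delta>\<^sup>2 * F" unfolding fh_def by (rule high[OF f(1) F(2)])
      show "fh \<in> wlat s"
        unfolding fh_def by (rule wlat_mul[where m="m_high s q", OF norm_m_high m_minus(2) wlat_dil[OF _ f(1)]]) simp
      show "norm (mul (m_high s q) (gser a v)) \<le> \<theta> * \<bar>\<beta>\<bar> * \<delta>\<^sup>2 * D"
        unfolding hom(1)[symmetric] by (rule high[OF wlv(1) nb(2)])
      show "norm (mul (m_high s q) (gder a v)) \<le> \<theta> * \<bar>\<beta>\<bar> * \<delta>\<^sup>2 * D"
        unfolding hom(2)[symmetric] by (rule high[OF wlv(2) nb(1)])
    qed (use \<delta>d d \<rho>0 F in auto)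
    then obtain X where "X \<in> wlat s" "norm X \<le> 4 * \<delta>" "approx_ode \<alpha> s a (dil 3 f) \<epsilon> X"
      unfolding fsum by blast
    then show ?thesis using \<delta>d d by (intro bexI[of _ X]) (auto simp: \<delta>_def)
  qed
  then show ?thesis using \<theta>0(1) by (intro exI[of _ \<theta>0] conjI exI[of _ "8 * F"]) auto
qed

section \<open>Uniqueness of small solutions\<close>

lemma fr_eq_0_iff:
  assumes "\<alpha> \<notin> \<rat>" "s \<noteq> 0" "\<nu> \<in> rlat s"
  shows "fr \<alpha> s \<nu> = 0 \<longleftrightarrow> \<nu> = 0"
proof
  obtain j k where \<nu>: "\<nu> = (s * of_int j, s * of_int k)" using assms(3) by (auto simp: rlat_iff)
  assume "fr \<alpha> s \<nu> = 0"
  then have "s * (of_int j + \<alpha> * of_int k) = 0" using assms(2) by (simp add: fr_def \<nu> algebra_simps)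
  then have e: "of_int j + \<alpha> * of_int k = 0" using assms(2) by simp
  have "k = 0"
  proof (rule ccontr)
    assume "k \<noteq> 0"
    then have "\<alpha> = - (of_int j / of_int k)" using e by (simp add: field_simps eq_neg_iff_add_eq_0)
    then show False using assms(1) by (metis Rats_divide Rats_minus_iff Rats_of_int)
  qed
  with e show "\<nu> = 0" by (simp add: \<nu> zero_prod_def)
qed simp

text \<open>With \<open>y = X - Y\<close> and \<open>h\<close> the difference of the nonlinear
  terms, monotonicity and the Lipschitz bound give
  \<open>h\<^sup>2 \<le> \<Lambda> * \<bar>h * y\<bar>\<close> pointwise, with \<open>h * y\<close>
  of one sign. The equation \<open>L y = - \<epsilon> h\<close> makes the mean of
  \<open>h * y\<close> the sum over all modes of the squared frequency times the squared modulus of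
  the coefficient of \<open>y\<close>, and the mean of \<open>h\<^sup>2\<close> at least
  \<open>1 / \<epsilon>\<^sup>2\<close> times that sum. So only the mode 0 of \<open>y\<close> can
  survive, and strict monotonicity excludes it.\<close>

lemma uniqueness:
  assumes g: "gcoeffs a n \<rho> C" and n: "odd n" and an: "a n \<noteq> 0" and s: "s > 0" and \<alpha>: "\<alpha> \<notin> \<rat>"
    and \<rho>0: "\<rho>0 \<le> \<rho>"
    and mono: "\<And>x y::real. \<bar>x\<bar> \<le> \<rho>0 \<Longrightarrow> \<bar>y\<bar> \<le> \<rho>0 \<Longrightarrow> x \<le> y \<Longrightarrow>
       sgn (a n) * (gser a y - gser a x) \<ge> \<bar>a n\<bar> / 2 * (y ^ n - x ^ n)"
    and X: "X \<in> wlat s" "norm X \<le> \<rho>0" "approx_ode \<alpha> s a f \<epsilon> X"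
    and Y: "Y \<in> wlat s" "norm Y \<le> \<rho>0" "approx_ode \<alpha> s a f \<epsilon> Y"
    and \<epsilon>: "0 < \<epsilon>" "C * \<rho> ^ (n - 1) * \<epsilon>\<^sup>2 < 1"
  shows "X = Y"
proof -
  define \<Lambda> where "\<Lambda> = C * \<rho> ^ (n - 1)"
  have \<Lambda>0: "\<Lambda> \<ge> 0" using C_nonneg[OF g] \<rho>_pos[OF g] by (simp add: \<Lambda>_def)
  have X\<rho>: "norm X \<le> \<rho>" and Y\<rho>: "norm Y \<le> \<rho>" using X Y \<rho>0 by auto
  define y h where "y = X - Y" and "h = gser a X - gser a Y"
  have yw: "y \<in> wlat s" and hw: "h \<in> wlat s"
    unfolding y_def h_def using X Y wlat_gser(1)[OF g X(1) X\<rho>] wlat_gser(1)[OF g Y(1) Y\<rho>] by auto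
  have mono': "sgn (a n) * (gser a y - gser a x) \<ge> 0" "gser a y = gser a x \<Longrightarrow> y \<le> x"
    if "\<bar>x\<bar> \<le> \<rho>0" "\<bar>y\<bar> \<le> \<rho>0" "x \<le> y" for x y :: real
  proof -
    have "x ^ n \<le> y ^ n" using n \<open>x \<le> y\<close> by (rule power_mono_odd)
    then have "0 \<le> \<bar>a n\<bar> / 2 * (y ^ n - x ^ n)" by simp
    with mono[OF that] show "sgn (a n) * (gser a y - gser a x) \<ge> 0" by simp
    assume "gser a y = gser a x"
    then have "\<bar>a n\<bar> / 2 * (y ^ n - x ^ n) \<le> 0" using mono[OF that] by simp
    then have "y ^ n \<le> x ^ n" using an by (simp add: mult_le_0_iff)
    then show "y \<le> x" using odd_real_root_power_cancel[OF n]
        by (metis real_root_le_iff odd_pos n)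
  qed
  \<comment> \<open>Pointwise nonnegative by the Lipschitz bound, while its mean is the sum of the
    terms \<open>T \<nu>\<close> below, all of which are nonpositive. Hence each of them
    vanishes.\<close>
  define H where "H = (\<Lambda> * sgn (a n)) *\<^sub>R (h * y) - h * h"
  have Hw: "H \<in> wlat s" unfolding H_def using yw hw by auto
  have "Re (cf H 0) \<ge> 0"
  proof (rule mean_nonneg[OF s Hw])
    fix \<psi>
    define p r where "p = evr X \<psi>" and "r = evr Y \<psi>"
    have pr: "\<bar>p\<bar> \<le> \<rho>0" "\<bar>r\<bar> \<le> \<rho>0"
      using abs_evr[of X \<psi>] abs_evr[of Y \<psi>] X(2) Y(2) by (auto simp: p_def r_def)
    have eh: "evr h \<psi> = gser a p - gser a r"
      by (simp add: h_def evr_diff evr_gser(1)[OF g X(1) X\<rho>] evr_gser(1)[OF g Y(1) Y\<rho>] p_def r_def)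
    have ey: "evr y \<psi> = p - r" by (simp add: y_def evr_diff p_def r_def)
    have sg: "sgn (a n) * ((gser a p - gser a r) * (p - r)) = \<bar>gser a p - gser a r\<bar> * \<bar>p - r\<bar>"
    proof (cases "r \<le> p")
      case True
      have "sgn (a n) * (gser a p - gser a r) \<ge> 0" by (rule mono'(1)[OF pr(2,1) True])
      moreover have "\<bar>sgn (a n) * (gser a p - gser a r)\<bar> = \<bar>gser a p - gser a r\<bar>" using an by (simp add: abs_mult abs_sgn_eq)
      ultimately have "sgn (a n) * (gser a p - gser a r) = \<bar>gser a p - gser a r\<bar>" by linarith
      then show ?thesis using True by (simp add: mult.assoc[symmetric])
    next
      case False
      have "sgn (a n) * (gser a r - gser a p) \<ge> 0" by (rule mono'(1)[OF pr]) (use False in simp)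
      moreover have "\<bar>sgn (a n) * (gser a r - gser a p)\<bar> = \<bar>gser a r - gser a p\<bar>" using an by (simp add: abs_mult abs_sgn_eq)
      ultimately have "sgn (a n) * (gser a r - gser a p) = \<bar>gser a p - gser a r\<bar>" by linarith
      moreover have "sgn (a n) * ((gser a p - gser a r) * (p - r)) = sgn (a n) * (gser a r - gser a p) * (r - p)"
        by (simp add: algebra_simps)
      ultimately show ?thesis using False by simp
    qed
    have "norm (gser a p - gser a r) \<le> C * (\<rho> ^ (n - 1) * norm (p - r))"
      using pr \<rho>0 by (intro gser_lipschitz[OF g]) auto
    then have lip: "\<bar>gser a p - gser a r\<bar> \<le> \<Lambda> * \<bar>p - r\<bar>" by (simp add: \<Lambda>_def mult.assoc)
    have "evr H \<psi> = \<Lambda> * (sgn (a n) * ((gser a p - gser a r) * (p - r))) - (gser a p - gser a r)\<^sup>2"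
      unfolding H_def evr_diff evr_scaleR evr_mult[OF hw yw] evr_mult[OF hw hw] eh ey
      by (simp add: power2_eq_square)
    also have "\<dots> = (\<Lambda> * \<bar>p - r\<bar> - \<bar>gser a p - gser a r\<bar>) * \<bar>gser a p - gser a r\<bar>"
      unfolding sg by (simp add: algebra_simps power2_eq_square flip: abs_mult_self_eq[of "gser a p - gser a r"])
    also have "\<dots> \<ge> 0" using lip by (intro mult_nonneg_nonneg) auto
    finally show "evr H \<psi> \<ge> 0" .
  qed
  define T where "T = (\<lambda>\<nu>. \<Lambda> * sgn (a n) * Re (cf h \<nu> * cnj (cf y \<nu>)) - (norm (cf h \<nu>))\<^sup>2)"
  have hy: "cf h \<nu> = - (sym_L \<alpha> s \<epsilon> \<nu> * cf y \<nu> / of_real \<epsilon>)" for \<nu>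
  proof -
    have "sym_L \<alpha> s \<epsilon> \<nu> * cf y \<nu> + of_real \<epsilon> * cf h \<nu> = 0"
      using X(3)[unfolded approx_ode_def, rule_format, of \<nu>] Y(3)[unfolded approx_ode_def, rule_format, of \<nu>]
      by (simp add: y_def h_def algebra_simps)
    then show ?thesis using \<epsilon> by (simp add: field_simps eq_neg_iff_add_eq_0)
  qed
  have T_le: "T \<nu> \<le> (\<Lambda> - 1 / \<epsilon>\<^sup>2) * ((fr \<alpha> s \<nu>)\<^sup>2 * (norm (cf y \<nu>))\<^sup>2)" for \<nu>
  proof -
    define w m where "w = fr \<alpha> s \<nu>" and "m = (norm (cf y \<nu>))\<^sup>2"
    have m0: "m \<ge> 0" by (simp add: m_def)
    have "cf h \<nu> * cnj (cf y \<nu>) = - (sym_L \<alpha> s \<epsilon> \<nu> / of_real \<epsilon>) * of_real m"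
      by (simp add: hy m_def complex_norm_square[symmetric])
    then have 1: "Re (cf h \<nu> * cnj (cf y \<nu>)) = w\<^sup>2 * m"
      using \<epsilon> by (simp add: sym_L_def w_def)
    have "(norm (sym_L \<alpha> s \<epsilon> \<nu>))\<^sup>2 = (\<epsilon> * w\<^sup>2)\<^sup>2 + w\<^sup>2"
      by (simp add: cmod_power2 sym_L_def w_def)
    then have "(norm (cf h \<nu>))\<^sup>2 = ((\<epsilon> * w\<^sup>2)\<^sup>2 + w\<^sup>2) * m / \<epsilon>\<^sup>2"
      using \<epsilon> by (simp add: hy norm_mult norm_divide power_mult_distrib power_divide m_def)
    also have "\<dots> = (w\<^sup>2)\<^sup>2 * m + w\<^sup>2 * m / \<epsilon>\<^sup>2" using \<epsilon> by (simp add: field_simps)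
    finally have 2: "w\<^sup>2 * m / \<epsilon>\<^sup>2 \<le> (norm (cf h \<nu>))\<^sup>2" using m0 by simp
    have "\<Lambda> * sgn (a n) * (w\<^sup>2 * m) \<le> \<Lambda> * 1 * (w\<^sup>2 * m)"
      using \<Lambda>0 m0 by (intro mult_right_mono mult_left_mono) (auto simp: sgn_if)
    then show ?thesis using 1 2 by (simp add: T_def w_def m_def left_diff_distrib)
  qed
  have neg: "\<Lambda> - 1 / \<epsilon>\<^sup>2 < 0" using \<epsilon> by (simp add: \<Lambda>_def field_simps)
  have T0: "T \<nu> \<le> 0" for \<nu>
    by (rule order_trans[OF T_le]) (use neg in \<open>auto intro: mult_nonpos_nonneg\<close>)
  have "((\<lambda>\<nu>. (\<Lambda> * sgn (a n)) *\<^sub>R (cf h \<nu> * cnj (cf y \<nu>)) - cf h \<nu> * cnj (cf h \<nu>)) has_sum cf H 0) UNIV"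
  proof -
    have A: "((\<lambda>\<nu>. (\<Lambda> * sgn (a n)) *\<^sub>R (cf h \<nu> * cnj (cf y \<nu>))) has_sum (\<Lambda> * sgn (a n)) *\<^sub>R cf (h * y) 0) UNIV"
      unfolding cf_mult_0(1)[OF yw]
      by (rule has_sum_bounded_linear[OF bounded_linear_scaleR_right has_sum_infsum[OF cf_mult_0(2)[OF yw]]])
    have "((\<lambda>\<nu>. - (cf h \<nu> * cnj (cf h \<nu>))) has_sum - cf (h * h) 0) UNIV"
      unfolding cf_mult_0(1)[OF hw] has_sum_uminus by (simp add: has_sum_infsum[OF cf_mult_0(2)[OF hw]])
    from has_sum_add[OF A this] show ?thesis by (simp add: H_def)
  qed
  then have "((\<lambda>\<nu>. Re ((\<Lambda> * sgn (a n)) *\<^sub>R (cf h \<nu> * cnj (cf y \<nu>)) - cf h \<nu> * cnj (cf h \<nu>))) has_sum Re (cf H 0)) UNIV"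
    by (rule has_sum_bounded_linear[OF bounded_linear_Re])
  moreover have "Re ((\<Lambda> * sgn (a n)) *\<^sub>R (cf h \<nu> * cnj (cf y \<nu>)) - cf h \<nu> * cnj (cf h \<nu>)) = T \<nu>" for \<nu>
    by (simp add: T_def complex_norm_square[symmetric] cmod_power2 power2_eq_square)
  ultimately have "(T has_sum Re (cf H 0)) UNIV" by simp
  then have "((\<lambda>\<nu>. - T \<nu>) has_sum - Re (cf H 0)) UNIV" by (simp add: has_sum_uminus)
  then have "- T \<nu> = 0" for \<nu>
    by (rule nonneg_has_sum_le_0D[where x=\<nu>]) (use \<open>Re (cf H 0) \<ge> 0\<close> T0 in auto)
  then have TZ: "T \<nu> = 0" for \<nu> by (metis neg_equal_0_iff_equal)
  have wz: "fr \<alpha> s \<nu> = 0 \<or> cf y \<nu> = 0" for \<nu>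
  proof -
    have "0 \<le> (\<Lambda> - 1 / \<epsilon>\<^sup>2) * ((fr \<alpha> s \<nu>)\<^sup>2 * (norm (cf y \<nu>))\<^sup>2)" using T_le[of \<nu>] TZ by simp
    then have "(fr \<alpha> s \<nu>)\<^sup>2 * (norm (cf y \<nu>))\<^sup>2 \<le> 0" using neg by (simp add: zero_le_mult_iff)
    then show ?thesis by (auto simp add: mult_le_0_iff)
  qed
  have y0: "cf y \<nu> = 0" if "\<nu> \<noteq> 0" for \<nu>
    using wz[of \<nu>] fr_eq_0_iff[OF \<alpha>, of s \<nu>] s that wlat_notin[OF yw, of \<nu>] by auto
  have "h = 0"
    using wz by (intro wa_eqI) (auto simp: hy sym_L_def)
  then have eq: "gser a (evr X 0) = gser a (evr Y 0)"
    using evr_gser(1)[OF g X(1) X\<rho>, of 0] evr_gser(1)[OF g Y(1) Y\<rho>, of 0] by (simp add: h_def)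
  have b: "\<bar>evr X 0\<bar> \<le> \<rho>0" "\<bar>evr Y 0\<bar> \<le> \<rho>0"
    by (rule order_trans[OF abs_evr X(2)], rule order_trans[OF abs_evr Y(2)])
  have "evr X 0 = evr Y 0"
  proof (cases "evr X 0 \<le> evr Y 0")
    case True
    from mono'(2)[OF b True eq[symmetric]] True show ?thesis by (rule antisym[rotated])
  next
    case False
    then have le: "evr Y 0 \<le> evr X 0" by simp
    from mono'(2)[OF b(2,1) le eq] le show ?thesis by (rule antisym)
  qed
  then have e: "evr y 0 = 0" by (simp add: y_def evr_diff)
  have yc: "y = Re (cf y 0) *\<^sub>R 1"
    using y0 wlat_cf_0_real[OF yw] by (intro wa_eqI) (auto simp: cf_one scaleR_conv_of_real[where 'a=complex])
  have "evr y 0 = Re (cf y 0)" by (subst yc) (simp only: evr_scaleR evr_one mult_1_right)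
  with e have "Re (cf y 0) = 0" by simp
  with yc have "y = 0" by simp
  then show ?thesis by (simp add: y_def)
qed

subsection \<open>Compactness\<close>

lemma finite_rlat_ball:
  assumes "s > 0"
  shows "finite {\<nu> \<in> rlat s. fnorm \<nu> \<le> P}"
proof (rule finite_subset)
  let ?N = "\<lceil>P / s\<rceil>"
  show "{\<nu> \<in> rlat s. fnorm \<nu> \<le> P} \<subseteq> (\<lambda>(j, k). (s * of_int j, s * of_int k)) ` ({- ?N..?N} \<times> {- ?N..?N})"
  proof clarify
    fix x y assume "(x, y) \<in> rlat s" and le: "fnorm (x, y) \<le> P"
    then obtain j k where jk: "x = s * of_int j" "y = s * of_int k" by (auto simp: rlat_iff)
    then have "s * (\<bar>of_int j\<bar> + \<bar>of_int k\<bar>) \<le> P" using le assms by (simp add: fnorm_def abs_mult distrib_left)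
    then have "\<bar>real_of_int j\<bar> + \<bar>real_of_int k\<bar> \<le> P / s" using assms by (simp add: field_simps)
    then have "\<bar>real_of_int j\<bar> \<le> real_of_int ?N" "\<bar>real_of_int k\<bar> \<le> real_of_int ?N"
      using le_of_int_ceiling[of "P / s"] by linarith+
    then have "\<bar>j\<bar> \<le> ?N" "\<bar>k\<bar> \<le> ?N" by (simp_all only: of_int_abs[symmetric] of_int_le_iff)
    then show "(x, y) \<in> (\<lambda>(j, k). (s * of_int j, s * of_int k)) ` ({- ?N..?N} \<times> {- ?N..?N})"
      by (intro image_eqI[of _ _ "(j, k)"]) (auto simp: jk abs_le_iff)
  qed
qed simp

text \<open>Beyond \<open>P\<close> the dilation gains \<open>exp (- ((l - 1) * P))\<close>
  uniformly in \<open>k\<close>; up to \<open>P\<close> there are finitely many lattice points,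
  where coefficientwise convergence suffices.\<close>

lemma dil_tendsto_0:
  fixes x :: "nat \<Rightarrow> wa"
  assumes s: "s > 0" and l: "l > 1" and x: "\<And>k. x k \<in> wlat s" "\<And>k. norm (x k) \<le> R"
    and lim: "\<And>\<nu>. (\<lambda>k. cf (x k) \<nu>) \<longlonglongrightarrow> 0"
  shows "(\<lambda>k. dil l (x k)) \<longlonglongrightarrow> 0"
proof -
  have l1: "l \<ge> 1" "l \<noteq> 0" using l by auto
  have R0: "R \<ge> 0" using x(2)[of 0] norm_ge_zero order_trans by blast
  have bound: "norm (dil l (x k)) \<le> (\<Sum>\<nu>\<in>{\<nu> \<in> rlat (s / l). fnorm \<nu> \<le> P}. norm (cf (x k) (l *\<^sub>R \<nu>)) * wt \<nu>) + exp (- ((l - 1) * P)) * R"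
    for k P
  proof -
    let ?T = "{\<nu> \<in> rlat (s / l). fnorm \<nu> \<le> P}"
    have fT: "finite ?T" using s l by (intro finite_rlat_ball) simp
    have "(\<Sum>\<nu>\<in>S. norm (cf (dil l (x k)) \<nu>) * wt \<nu>) \<le> (\<Sum>\<nu>\<in>?T. norm (cf (x k) (l *\<^sub>R \<nu>)) * wt \<nu>) + exp (- ((l - 1) * P)) * R"
      if S: "finite S" for S
    proof -
      have "(\<Sum>\<nu>\<in>S. norm (cf (dil l (x k)) \<nu>) * wt \<nu>) = (\<Sum>\<nu>\<in>S \<inter> ?T. norm (cf (x k) (l *\<^sub>R \<nu>)) * wt \<nu>)
          + (\<Sum>\<nu>\<in>S - ?T. norm (cf (x k) (l *\<^sub>R \<nu>)) * wt \<nu>)"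
        using l1 by (subst sum.Int_Diff[OF S, of _ ?T]) simp
      also have "(\<Sum>\<nu>\<in>S \<inter> ?T. norm (cf (x k) (l *\<^sub>R \<nu>)) * wt \<nu>) \<le> (\<Sum>\<nu>\<in>?T. norm (cf (x k) (l *\<^sub>R \<nu>)) * wt \<nu>)"
        by (rule sum_mono2[OF fT]) auto
      also have "(\<Sum>\<nu>\<in>S - ?T. norm (cf (x k) (l *\<^sub>R \<nu>)) * wt \<nu>)
          \<le> (\<Sum>\<nu>\<in>S - ?T. exp (- ((l - 1) * P)) * (norm (cf (x k) (l *\<^sub>R \<nu>)) * wt (l *\<^sub>R \<nu>)))"
      proof (rule sum_mono)
        fix \<nu> assume \<nu>: "\<nu> \<in> S - ?T"
        show "norm (cf (x k) (l *\<^sub>R \<nu>)) * wt \<nu> \<le> exp (- ((l - 1) * P)) * (norm (cf (x k) (l *\<^sub>R \<nu>)) * wt (l *\<^sub>R \<nu>))"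
        proof (cases "\<nu> \<in> rlat (s / l)")
          case True
          with \<nu> have "P \<le> fnorm \<nu>" by auto
          then have "(l - 1) * P \<le> (l - 1) * fnorm \<nu>" using l by (intro mult_left_mono) auto
          then have "wt \<nu> \<le> exp (- ((l - 1) * P)) * wt (l *\<^sub>R \<nu>)"
            using l by (simp add: wt_def algebra_simps flip: exp_add)
          then show ?thesis by (simp add: mult_left_mono mult.left_commute)
        next
          case False
          then have "l *\<^sub>R \<nu> \<notin> rlat s" using rlat_scaleR[OF l1(2), of \<nu> "s / l"] l1 by simp
          then show ?thesis using wlat_notin[OF x(1)] by simp
        qed
      qed
      also have "\<dots> = exp (- ((l - 1) * P)) * (\<Sum>\<nu>\<in>(\<lambda>\<nu>. l *\<^sub>R \<nu>) ` (S - ?T). norm (cf (x k) \<nu>) * wt \<nu>)"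
        using l1 by (subst sum.reindex) (auto simp: inj_on_def sum_distrib_left)
      also have "\<dots> \<le> exp (- ((l - 1) * P)) * R"
        using S by (intro mult_left_mono order_trans[OF finite_sum_le_norm x(2)]) auto
      finally show ?thesis by simp
    qed
    from cf_Wa(2)[OF this] show ?thesis by (simp add: cf_inverse)
  qed
  show ?thesis
  proof (rule LIMSEQ_I)
    fix e :: real assume e: "e > 0"
    have "((\<lambda>P. exp (- ((l - 1) * P)) * R) \<longlongrightarrow> 0 * R) at_top"
      using l by (intro tendsto_mult_right filterlim_compose[OF exp_at_bot] filterlim_uminus_at_bot_at_top[THEN filterlim_compose]
          filterlim_tendsto_pos_mult_at_top[OF tendsto_const] filterlim_ident) auto
    then have "eventually (\<lambda>P. exp (- ((l - 1) * P)) * R < e / 2) at_top"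
      using e by (auto dest!: order_tendstoD(2)[where a="e/2"])
    then obtain P where P: "exp (- ((l - 1) * P)) * R < e / 2" by (metis eventually_at_top_linorder order_refl)
    let ?T = "{\<nu> \<in> rlat (s / l). fnorm \<nu> \<le> P}"
    have "(\<lambda>k. \<Sum>\<nu>\<in>?T. norm (cf (x k) (l *\<^sub>R \<nu>)) * wt \<nu>) \<longlonglongrightarrow> (\<Sum>\<nu>\<in>?T. norm (0::complex) * wt \<nu>)"
      by (intro tendsto_intros lim)
    then have "eventually (\<lambda>k. (\<Sum>\<nu>\<in>?T. norm (cf (x k) (l *\<^sub>R \<nu>)) * wt \<nu>) < e / 2) sequentially"
      using e by (auto dest!: order_tendstoD(2)[where a="e/2"])
    then obtain N where N: "\<And>k. k \<ge> N \<Longrightarrow> (\<Sum>\<nu>\<in>?T. norm (cf (x k) (l *\<^sub>R \<nu>)) * wt \<nu>) < e / 2"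
      by (auto simp: eventually_sequentially)
    have "norm (dil l (x k) - 0) < e" if "k \<ge> N" for k
      using bound[of k P] N[OF that] P by simp
    then show "\<exists>no. \<forall>k\<ge>no. norm (dil l (x k) - 0) < e" by blast
  qed
qed

text \<open>A form of Montel's theorem: a diagonal subsequence over the countable lattice converges
  coefficientwise, and any loss of width \<open>l > 1\<close> improves this to convergence in
  norm.\<close>

lemma compact_wlat:
  fixes x :: "nat \<Rightarrow> wa"
  assumes s: "s > 0" and x: "\<And>k. x k \<in> wlat s" "\<And>k. norm (x k) \<le> R"
  obtains r y where "strict_mono r" "y \<in> wlat s" "norm y \<le> R" "\<And>\<nu>. (\<lambda>k. cf (x (r k)) \<nu>) \<longlonglongrightarrow> cf y \<nu>"
    "\<And>l. l > 1 \<Longrightarrow> (\<lambda>k. dil l (x (r k))) \<longlonglongrightarrow> dil l y"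
proof -
  have "countable (rlat s)" unfolding rlat_def by auto
  moreover have "norm (cf (x k) \<nu>) \<le> R" for k \<nu> using norm_cf_le x(2) order_trans by blast
  ultimately obtain r where r: "strict_mono (r::nat\<Rightarrow>nat)"
    and L: "\<And>\<nu>. \<nu> \<in> rlat s \<Longrightarrow> \<exists>l. (\<lambda>k. cf (x (r k)) \<nu>) \<longlonglongrightarrow> l"
    using function_convergent_subsequence[of "rlat s" "\<lambda>k. cf (x k)" R] by metis
  have "\<exists>l. (\<lambda>k. cf (x (r k)) \<nu>) \<longlonglongrightarrow> l" for \<nu>
    using L[of \<nu>] wlat_notin[OF x(1), of \<nu>] tendsto_const by (cases "\<nu> \<in> rlat s") auto
  then obtain u where u: "\<And>\<nu>. (\<lambda>k. cf (x (r k)) \<nu>) \<longlonglongrightarrow> u \<nu>" by metis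
  define y where "y = Wa u"
  have y: "cf y = u" "norm y \<le> R" unfolding y_def by (rule pointwise_limit_norm_le[OF u x(2)])+
  have yw: "y \<in> wlat s"
  proof (rule wlatI)
    fix \<nu>
    have "(\<lambda>k. cf (x (r k)) (- \<nu>)) \<longlonglongrightarrow> cnj (u \<nu>)"
      using tendsto_cnj[OF u[of \<nu>]] by (simp add: wlat_minus[OF x(1)])
    then show "cf y (- \<nu>) = cnj (cf y \<nu>)" unfolding y using u LIMSEQ_unique by blast
    assume "\<nu> \<notin> rlat s"
    then have "(\<lambda>k. cf (x (r k)) \<nu>) \<longlonglongrightarrow> 0" by (simp add: wlat_notin[OF x(1)])
    then show "cf y \<nu> = 0" unfolding y using u LIMSEQ_unique by blast
  qed
  have "(\<lambda>k. dil l (x (r k))) \<longlonglongrightarrow> dil l y" if l: "l > 1" for l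
  proof -
    have "(\<lambda>k. dil l (x (r k) - y)) \<longlonglongrightarrow> 0"
    proof (rule dil_tendsto_0[OF s l])
      show "x (r k) - y \<in> wlat s" for k using x yw by auto
      show "norm (x (r k) - y) \<le> 2 * R" for k
        using norm_triangle_ineq4[of "x (r k)" y] x(2)[of "r k"] y(2) by linarith
      show "(\<lambda>k. cf (x (r k) - y) \<nu>) \<longlonglongrightarrow> 0" for \<nu>
        using tendsto_diff[OF u[of \<nu>] tendsto_const[of "u \<nu>"]] by (simp add: y)
    qed
    then have "(\<lambda>k. dil l (x (r k)) - dil l y) \<longlonglongrightarrow> 0" using l by (simp add: dil_diff)
    then show ?thesis by (rule LIM_zero_cancel)
  qed
  then show thesis using that r yw y u by auto
qed

text \<open>If continuity failed, a subsequence would stay away from \<open>S \<epsilon>0\<close>;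
  by compactness it has a limit point, which solves the equation at \<open>\<epsilon>0\<close> and
  is therefore \<open>S \<epsilon>0\<close> itself.\<close>

lemma solution_continuous:
  assumes g: "gcoeffs a n \<rho> C" and s: "s > 0" and R: "R \<le> \<rho>"
    and S: "\<And>\<epsilon>. \<epsilon> \<in> J \<Longrightarrow> S \<epsilon> \<in> wlat s" "\<And>\<epsilon>. \<epsilon> \<in> J \<Longrightarrow> norm (S \<epsilon>) \<le> R" "\<And>\<epsilon>. \<epsilon> \<in> J \<Longrightarrow> approx_ode \<alpha> s a f \<epsilon> (S \<epsilon>)"
    and uniq: "\<And>Y. Y \<in> wlat s \<Longrightarrow> norm Y \<le> R \<Longrightarrow> approx_ode \<alpha> s a f \<epsilon>0 Y \<Longrightarrow> Y = S \<epsilon>0"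
    and l: "l > 1"
  shows "((\<lambda>\<epsilon>. dil l (S \<epsilon>)) \<longlongrightarrow> dil l (S \<epsilon>0)) (at \<epsilon>0 within J)"
  unfolding tendsto_at_iff_sequentially comp_def
proof (intro allI impI)
  fix e :: "nat \<Rightarrow> real" assume eJ: "\<forall>i. e i \<in> J - {\<epsilon>0}" and e: "e \<longlonglongrightarrow> \<epsilon>0"
  have eJ': "e i \<in> J" for i using eJ by auto
  show "(\<lambda>i. dil l (S (e i))) \<longlonglongrightarrow> dil l (S \<epsilon>0)"
  proof (rule ccontr)
    assume "\<not> ?thesis"
    then obtain c where c: "c > 0" "\<not> eventually (\<lambda>i. dist (dil l (S (e i))) (dil l (S \<epsilon>0)) < c) sequentially"
      by (auto simp: tendsto_iff)
    then obtain t where t: "strict_mono (t::nat\<Rightarrow>nat)" "\<And>i. \<not> dist (dil l (S (e (t i)))) (dil l (S \<epsilon>0)) < c"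
      using not_eventually_sequentiallyD by blast
    obtain r Y where r: "strict_mono r" and Y: "Y \<in> wlat s" "norm Y \<le> R"
      and pw: "\<And>\<nu>. (\<lambda>k. cf (S (e (t (r k)))) \<nu>) \<longlonglongrightarrow> cf Y \<nu>"
      and dl: "\<And>l. l > 1 \<Longrightarrow> (\<lambda>k. dil l (S (e (t (r k))))) \<longlonglongrightarrow> dil l Y"
      using compact_wlat[OF s, of "\<lambda>k. S (e (t k))" R] S eJ' by blast
    have ek: "(\<lambda>k. e (t (r k))) \<longlonglongrightarrow> \<epsilon>0"
      using LIMSEQ_subseq_LIMSEQ[OF LIMSEQ_subseq_LIMSEQ[OF e t(1)] r] by (simp add: comp_def)
    have "approx_ode \<alpha> s a f \<epsilon>0 Y"
      unfolding approx_ode_def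
    proof
      fix \<nu>
      \<comment> \<open>The factor 2 is just some \<open>l > 1\<close>: it provides convergence in
        norm, for which \<open>gser a\<close> is continuous. As dilation commutes with
        \<open>gser a\<close>, the coefficient at \<nu> is then read off at half of \<nu>.\<close>
      have lim: "(\<lambda>k. gser a (dil 2 (S (e (t (r k)))))) \<longlonglongrightarrow> gser a (dil 2 Y)"
      proof (rule Lim_transform_bound[where g="\<lambda>k. (C * \<rho> ^ (n - 1)) *\<^sub>R norm (dil 2 (S (e (t (r k)))) - dil 2 Y)", THEN LIM_zero_cancel])
        have b: "norm (dil 2 u) \<le> \<rho>" if "norm u \<le> R" for u using norm_dil[of 2 u] that R by simp
        show "eventually (\<lambda>k. norm (gser a (dil 2 (S (e (t (r k))))) - gser a (dil 2 Y)) \<le>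
            norm ((C * \<rho> ^ (n - 1)) *\<^sub>R norm (dil 2 (S (e (t (r k)))) - dil 2 Y))) sequentially"
          using gser_lipschitz[OF g b[OF S(2)[OF eJ']] b[OF Y(2)]] C_nonneg[OF g] \<rho>_pos[OF g]
          by (intro always_eventually) (simp add: abs_mult mult.assoc)
        have "(\<lambda>k. dil 2 (S (e (t (r k)))) - dil 2 Y) \<longlonglongrightarrow> 0" using dl[of 2] by (simp add: LIM_zero)
        then have "(\<lambda>k. (C * \<rho> ^ (n - 1)) *\<^sub>R norm (dil 2 (S (e (t (r k)))) - dil 2 Y)) \<longlonglongrightarrow> (C * \<rho> ^ (n - 1)) *\<^sub>R norm (0::wa)"
          by (intro tendsto_intros)
        then show "(\<lambda>k. (C * \<rho> ^ (n - 1)) *\<^sub>R norm (dil 2 (S (e (t (r k)))) - dil 2 Y)) \<longlonglongrightarrow> 0" by simp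
      qed
      have hom: "cf (gser a (dil 2 u)) ((1/2) *\<^sub>R \<nu>) = cf (gser a u) \<nu>" if "norm u \<le> R" for u
      proof -
        have "dil 2 (gser a u) = gser a (dil 2 u)"
          using gser_hom(1)[OF g bounded_linear_dil dil_mult dil_one, of 2 u] that R by simp
        moreover have "cf (dil 2 (gser a u)) ((1/2) *\<^sub>R \<nu>) = cf (gser a u) \<nu>" by simp
        ultimately show ?thesis by simp
      qed
      have "(\<lambda>k. cf (gser a (dil 2 (S (e (t (r k)))))) ((1/2) *\<^sub>R \<nu>)) \<longlonglongrightarrow> cf (gser a (dil 2 Y)) ((1/2) *\<^sub>R \<nu>)"
        by (rule bounded_linear.tendsto[OF bounded_linear_cf lim])
      then have lim2: "(\<lambda>k. cf (gser a (S (e (t (r k))))) \<nu>) \<longlonglongrightarrow> cf (gser a Y) \<nu>"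
        using hom Y S(2)[OF eJ'] by simp
      have "(\<lambda>k. sym_L \<alpha> s (e (t (r k))) \<nu> * cf (S (e (t (r k)))) \<nu> + of_real (e (t (r k))) * cf (gser a (S (e (t (r k))))) \<nu>)
         \<longlonglongrightarrow> sym_L \<alpha> s \<epsilon>0 \<nu> * cf Y \<nu> + of_real \<epsilon>0 * cf (gser a Y) \<nu>"
        unfolding sym_L_def by (intro tendsto_intros ek pw lim2)
      moreover have "(\<lambda>k. sym_L \<alpha> s (e (t (r k))) \<nu> * cf (S (e (t (r k)))) \<nu> + of_real (e (t (r k))) * cf (gser a (S (e (t (r k))))) \<nu>)
         \<longlonglongrightarrow> of_real \<epsilon>0 * cf f \<nu>"
        using S(3)[OF eJ', unfolded approx_ode_def] by (simp add: ek tendsto_intros)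
      ultimately show "sym_L \<alpha> s \<epsilon>0 \<nu> * cf Y \<nu> + of_real \<epsilon>0 * cf (gser a Y) \<nu> = of_real \<epsilon>0 * cf f \<nu>"
        by (rule LIMSEQ_unique)
    qed
    with uniq Y have "Y = S \<epsilon>0" by blast
    with dl[OF l] have "eventually (\<lambda>k. dist (dil l (S (e (t (r k))))) (dil l (S \<epsilon>0)) < c) sequentially"
      using c(1) by (auto simp: tendsto_iff)
    then show False using t(2) by (auto simp: eventually_sequentially)
  qed
qed

section \<open>Fourier expansion of analytic functions on the torus\<close>

lemma summable_exp_abs_int:
  fixes s :: real
  assumes "s > 0"
  shows "(\<lambda>k::int. exp (- s * \<bar>of_int k\<bar>)) summable_on UNIV"
proof -
  have "summable (\<lambda>n. exp (- s) ^ n)" using assms by (intro summable_geometric) auto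
  then have nat: "(\<lambda>n::nat. exp (- s * real n)) summable_on UNIV"
    by (intro summable_nonneg_imp_summable_on) (auto simp: exp_of_nat_mult[symmetric] mult.commute)
  have "(\<lambda>k::int. exp (- s * \<bar>of_int k\<bar>)) summable_on range int"
    using nat by (subst summable_on_reindex) (auto simp: o_def)
  moreover have "(\<lambda>k::int. exp (- s * \<bar>of_int k\<bar>)) summable_on range (\<lambda>n. - int n)"
    using nat by (subst summable_on_reindex) (auto simp: o_def inj_on_def)
  ultimately have "(\<lambda>k::int. exp (- s * \<bar>of_int k\<bar>)) summable_on (range int \<union> range (\<lambda>n. - int n))"
    by (rule summable_on_union)
  moreover have "range int \<union> range (\<lambda>n. - int n) = UNIV"
  proof -
    have "k \<in> range int \<union> range (\<lambda>n. - int n)" for k by (cases k rule: int_cases2) auto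
    then show ?thesis by blast
  qed
  ultimately show ?thesis by simp
qed

text \<open>The line of integration is shifted through a primitive \<open>G\<close> on
  \<open>S\<close>: \<open>G(z + 2 pi) - G(z)\<close> has derivative 0 on the convex set
  \<open>T\<close>, hence is the same for all starting points. The finite set \<open>K\<close>
  admits a removable singularity.\<close>

lemma period_integral:
  fixes P :: "complex \<Rightarrow> complex"
  assumes S: "convex S" "finite K" "continuous_on S P" "\<And>z. z \<in> interior S - K \<Longrightarrow> P field_differentiable at z"
    and T: "convex T" "T \<subseteq> S" "\<And>z t. z \<in> T \<Longrightarrow> t \<in> {0..2 * pi} \<Longrightarrow> z + of_real t \<in> S"
    and per: "\<And>z. z \<in> T \<Longrightarrow> P (z + of_real (2 * pi)) = P z"
  shows "\<exists>I. \<forall>z\<in>T. ((\<lambda>t. P (z + of_real t)) has_integral I) {0..2 * pi}"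
proof -
  obtain G where G: "\<And>z. z \<in> S \<Longrightarrow> (G has_field_derivative P z) (at z within S)"
    using holomorphic_convex_primitive[OF S] by metis
  have "((\<lambda>z. G (z + of_real (2 * pi)) - G z) has_field_derivative 0) (at z within T)" if z: "z \<in> T" for z
  proof -
    have zS: "z + of_real (2 * pi) \<in> S" using T(3)[OF z, of "2 * pi"] by simp
    have sub: "(\<lambda>z. z + of_real (2 * pi)) ` T \<subseteq> S"
      by (rule image_subsetI) (rule T(3), auto)
    have 1: "(G has_field_derivative P z) (at (z + of_real (2 * pi)) within (\<lambda>z. z + of_real (2 * pi)) ` T)"
      using DERIV_subset[OF G[OF zS] sub] unfolding per[OF z] .
    have "((\<lambda>z. z + of_real (2 * pi)) has_field_derivative 1) (at z within T)"
      by (auto intro!: derivative_eq_intros)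
    from DERIV_image_chain[OF 1 this] have "((\<lambda>z. G (z + of_real (2 * pi))) has_field_derivative P z) (at z within T)"
      by (simp add: o_def)
    moreover have "(G has_field_derivative P z) (at z within T)"
      by (rule DERIV_subset[OF G T(2)]) (use z T(2) in auto)
    ultimately have "((\<lambda>z. G (z + of_real (2 * pi)) - G z) has_field_derivative P z - P z) (at z within T)"
      by (rule DERIV_diff)
    then show ?thesis by simp
  qed
  from has_field_derivative_zero_constant[OF T(1) this]
  obtain I where I: "\<And>z. z \<in> T \<Longrightarrow> G (z + of_real (2 * pi)) - G z = I"
    by blast
  have "((\<lambda>t. P (z + of_real t)) has_integral I) {0..2 * pi}" if z: "z \<in> T" for z
  proof -
    have "((\<lambda>t. P (z + of_real t)) has_integral (G (z + of_real (2 * pi)) - G (z + of_real 0))) {0..2 * pi}"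
    proof (rule fundamental_theorem_of_calculus)
      fix t :: real assume t: "t \<in> {0..2 * pi}"
      have 1: "(G has_field_derivative P (z + of_real t)) (at (z + of_real t) within (\<lambda>t. z + of_real t) ` {0..2 * pi})"
          by (rule DERIV_subset[OF G[OF T(3)[OF z t]]]) (use T(3)[OF z] in blast)
      have 2: "((\<lambda>t. z + of_real t) has_vector_derivative 1) (at t within {0..2 * pi})"
        by (auto intro!: derivative_eq_intros simp: has_vector_derivative_def scaleR_conv_of_real)
      show "((\<lambda>t. G (z + of_real t)) has_vector_derivative P (z + of_real t)) (at t within {0..2 * pi})"
        using field_vector_diff_chain_within[OF 2 1] by (simp add: o_def)
    qed simp
    then show ?thesis using I[OF z] by simp
  qed
  then show ?thesis by blast
qed

text \<open>The decay is read off at height \<open>- s\<close> for \<open>k \<ge> 0\<close> and at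
  height \<open>s\<close> for \<open>k < 0\<close>. There are two sets \<open>S\<close> and
  \<open>T\<close> because the lemma is applied to a whole strip and also to a rectangle of one
  period, with its left edge as \<open>T\<close>.\<close>

lemma period_integral_exp:
  fixes \<phi> :: "complex \<Rightarrow> complex" and k :: int
  assumes S: "convex S" "finite K" "continuous_on S \<phi>" "\<And>z. z \<in> interior S - K \<Longrightarrow> \<phi> field_differentiable at z"
    and T: "convex T" "T \<subseteq> S" "\<And>z t. z \<in> T \<Longrightarrow> t \<in> {0..2 * pi} \<Longrightarrow> z + of_real t \<in> S"
    and per: "\<And>z. z \<in> T \<Longrightarrow> \<phi> (z + of_real (2 * pi)) = \<phi> z"
    and M: "\<And>z. z \<in> S \<Longrightarrow> norm (\<phi> z) \<le> M" and b: "Complex b s \<in> T" "Complex b (- s) \<in> T"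
  shows "\<exists>I. (\<forall>z\<in>T. ((\<lambda>t. \<phi> (z + of_real t) * exp (- \<i> * of_int k * (z + of_real t))) has_integral I) {0..2 * pi})
    \<and> norm I \<le> 2 * pi * (M * exp (- s * \<bar>of_int k\<bar>))"
proof -
  define P where "P = (\<lambda>z. \<phi> z * exp (- \<i> * of_int k * z))"
  have "\<exists>I. \<forall>z\<in>T. ((\<lambda>t. P (z + of_real t)) has_integral I) {0..2 * pi}"
  proof (rule period_integral[OF S(1,2) _ _ T])
    show "continuous_on S P" unfolding P_def by (intro continuous_intros S)
    show "P field_differentiable at z" if "z \<in> interior S - K" for z
    proof -
      have "((\<lambda>z. exp (- \<i> * of_int k * z)) has_field_derivative exp (- \<i> * of_int k * z) * (- \<i> * of_int k)) (at z)"
        by (auto intro!: derivative_eq_intros)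
      then have "(\<lambda>z. exp (- \<i> * of_int k * z)) field_differentiable at z" by (auto simp: field_differentiable_def)
      then show ?thesis unfolding P_def by (intro field_differentiable_mult S that)
    qed
    show "P (z + of_real (2 * pi)) = P z" if "z \<in> T" for z
    proof -
      have "exp (- \<i> * of_int k * (z + of_real (2 * pi))) = exp (- \<i> * of_int k * z) * exp (2 * of_real pi * \<i> * of_int (- k))"
        by (simp add: algebra_simps flip: exp_add)
      also have "exp (2 * of_real pi * \<i> * of_int (- k)) = 1"
        using exp_integer_2pi[of "of_int (- k)"] by (simp add: mult_ac)
      finally show ?thesis using per[OF that] by (simp add: P_def)
    qed
  qed
  then obtain I where I: "\<And>z. z \<in> T \<Longrightarrow> ((\<lambda>t. P (z + of_real t)) has_integral I) {0..2 * pi}" by blast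
  have bound: "norm I \<le> 2 * pi * (M * exp (of_int k * \<sigma>))" if \<sigma>: "Complex b \<sigma> \<in> T" for \<sigma>
  proof -
    have M0: "M \<ge> 0" using M[of "Complex b \<sigma>"] \<sigma> T(2) norm_ge_zero order_trans by blast
    have "norm I \<le> (M * exp (of_int k * \<sigma>)) * measure lborel {0..2 * pi}"
    proof (rule has_integral_bound_real[OF _ finite.emptyI I[OF \<sigma>]])
      show "norm (P (Complex b \<sigma> + of_real t)) \<le> M * exp (of_int k * \<sigma>)" if t: "t \<in> {0..2 * pi} - {}" for t
        using M[OF T(3)[OF \<sigma>, of t]] t M0 by (simp add: P_def norm_mult mult_mono)
    qed (use M0 in auto)
    then show ?thesis by (simp add: mult.commute)
  qed
  have "norm I \<le> 2 * pi * (M * exp (- s * \<bar>of_int k\<bar>))"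
  proof (cases "k \<ge> 0")
    case True
    then have "- s * \<bar>of_int k\<bar> = of_int k * (- s)" by simp
    then show ?thesis using bound[OF b(2)] by (simp only:)
  next
    case False
    then have "- s * \<bar>of_int k\<bar> = of_int k * s" by simp
    then show ?thesis using bound[OF b(1)] by (simp only:)
  qed
  then show ?thesis using I unfolding P_def by blast
qed

definition fourier_coeff :: "(complex \<Rightarrow> complex) \<Rightarrow> int \<Rightarrow> complex" where
  "fourier_coeff h k = integral {0..2 * pi} (\<lambda>t. h (of_real t) * exp (- \<i> * of_int k * of_real t)) / (2 * of_real pi)"

definition cstrip :: "real \<Rightarrow> complex set" where
  "cstrip s = {z. \<bar>Im z\<bar> \<le> s}"

lemma interior_Im_less:
  assumes "z \<in> interior S" "\<And>z. z \<in> S \<Longrightarrow> \<bar>Im z\<bar> \<le> s"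
  shows "\<bar>Im z\<bar> < s"
proof -
  obtain e where e: "e > 0" "cball z e \<subseteq> S" using assms(1) by (meson mem_interior_cball)
  have "z + Complex 0 e \<in> cball z e" "z - Complex 0 e \<in> cball z e" using e(1) by (auto simp: dist_norm norm_complex_def)
  then have "z + Complex 0 e \<in> S" "z - Complex 0 e \<in> S" using e(2) by blast+
  from this[THEN assms(2)] have "\<bar>Im z + e\<bar> \<le> s" "\<bar>Im z - e\<bar> \<le> s" by simp_all
  then show ?thesis using e(1) by linarith
qed

lemma convex_cstrip: "convex (cstrip s)"
proof -
  have "cstrip s = {z. Im z \<le> s} \<inter> {z. Im z \<ge> - s}" by (auto simp: cstrip_def)
  then show ?thesis by (simp add: convex_Int convex_halfspace_Im_le convex_halfspace_Im_ge)
qed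

lemma diff_quotient_continuous:
  fixes h :: "complex \<Rightarrow> complex"
  assumes "continuous_on S h" "(h has_field_derivative D) (at x)"
  shows "continuous_on S (\<lambda>z. if z = x then D else (h z - h x) / (z - x))"
  unfolding continuous_on_def
proof
  fix z assume z: "z \<in> S"
  show "((\<lambda>z. if z = x then D else (h z - h x) / (z - x)) \<longlongrightarrow> (if z = x then D else (h z - h x) / (z - x))) (at z within S)"
  proof (cases "z = x")
    case True
    have 1: "((\<lambda>z. (h z - h x) / (z - x)) \<longlongrightarrow> D) (at x within S)"
      using DERIV_subset[OF assms(2), of S] by (simp add: has_field_derivative_iff)
    have ev: "eventually (\<lambda>z. (h z - h x) / (z - x) = (if z = x then D else (h z - h x) / (z - x))) (at x within S)"
      by (auto simp: eventually_at_filter)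
    from Lim_transform_eventually[OF 1 ev] show ?thesis unfolding True by simp
  next
    case False
    have 1: "((\<lambda>z. (h z - h x) / (z - x)) \<longlongrightarrow> (h z - h x) / (z - x)) (at z within S)"
      using assms(1) z False unfolding continuous_on_def by (intro tendsto_intros) auto
    have "((\<lambda>z. if z = x then D else (h z - h x) / (z - x)) \<longlongrightarrow> (h z - h x) / (z - x)) (at z within S)"
      by (rule Lim_transform_away_within[OF False _ 1]) auto
    then show ?thesis using False by simp
  qed
qed

text \<open>Continuity up to the edge of the strip gives the decay with the full exponent
  \<open>s\<close>; the line of integration may be moved all the way to the edge.\<close>

lemma fourier_1d:
  fixes h :: "complex \<Rightarrow> complex"
  assumes s: "s > 0" and cont: "continuous_on (cstrip s) h"
    and diff: "\<And>z. \<bar>Im z\<bar> < s \<Longrightarrow> h field_differentiable at z"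
    and per: "\<And>z. z \<in> cstrip s \<Longrightarrow> h (z + of_real (2 * pi)) = h z"
    and M: "\<And>z. z \<in> cstrip s \<Longrightarrow> norm (h z) \<le> M"
  shows "norm (fourier_coeff h k) \<le> M * exp (- s * \<bar>of_int k\<bar>)"
    and "((\<lambda>k. fourier_coeff h k * exp (\<i> * of_int k * of_real x)) has_sum h (of_real x)) UNIV"
proof -
  have ex: "\<exists>I. (\<forall>z\<in>cstrip s. ((\<lambda>t. h (z + of_real t) * exp (- \<i> * of_int k * (z + of_real t))) has_integral I) {0..2 * pi})
    \<and> norm I \<le> 2 * pi * (M * exp (- s * \<bar>of_int k\<bar>))" for k
  proof (rule period_integral_exp[where b=0 and K="{}"])
    show "h field_differentiable at z" if "z \<in> interior (cstrip s) - {}" for z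
      using that by (intro diff interior_Im_less[of z "cstrip s"]) (auto simp: cstrip_def)
    show "h (z + of_real (2 * pi)) = h z" "norm (h z) \<le> M" if "z \<in> cstrip s" for z
      using per M that by auto
  qed (use s cont convex_cstrip in \<open>auto simp: cstrip_def\<close>)
  have base: "((\<lambda>t. h (of_real a + of_real t) * exp (- \<i> * of_int k * (of_real a + of_real t))) has_integral 2 * of_real pi * fourier_coeff h k) {0..2 * pi}"
    and bnd: "norm (fourier_coeff h k) \<le> M * exp (- s * \<bar>of_int k\<bar>)" for a k
  proof -
    obtain I where I: "\<And>z. z \<in> cstrip s \<Longrightarrow> ((\<lambda>t. h (z + of_real t) * exp (- \<i> * of_int k * (z + of_real t))) has_integral I) {0..2 * pi}"
      and n: "norm I \<le> 2 * pi * (M * exp (- s * \<bar>of_int k\<bar>))" using ex[of k] by blast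
    have mem: "of_real a \<in> cstrip s" for a using s by (simp add: cstrip_def)
    from I[OF mem[of 0]] have "I = integral {0..2 * pi} (\<lambda>t. h (of_real t) * exp (- \<i> * of_int k * of_real t))"
      by (simp add: has_integral_iff)
    then have Ieq: "I = 2 * of_real pi * fourier_coeff h k" by (simp add: fourier_coeff_def)
    show "((\<lambda>t. h (of_real a + of_real t) * exp (- \<i> * of_int k * (of_real a + of_real t))) has_integral 2 * of_real pi * fourier_coeff h k) {0..2 * pi}"
      using I[OF mem[of a]] unfolding Ieq .
    show "norm (fourier_coeff h k) \<le> M * exp (- s * \<bar>of_int k\<bar>)" using n by (simp add: Ieq norm_mult)
  qed
  show "norm (fourier_coeff h k) \<le> M * exp (- s * \<bar>of_int k\<bar>)" by (rule bnd)

  \<comment> \<open>Dividing \<open>h - h x\<close> by \<open>1 - exp (i (x - z))\<close> turns the Fourier series at \<open>x\<close> into a telescoping sum.\<close>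
  define X where "X = complex_of_real x"
  define D where "D = deriv h X"
  have hD: "(h has_field_derivative D) (at X)"
    unfolding D_def by (rule DERIV_deriv_iff_field_differentiable[THEN iffD2]) (rule diff, use s in \<open>simp add: X_def\<close>)
  define E where "E = (\<lambda>z. 1 - exp (\<i> * (X - z)))"
  have ED: "(E has_field_derivative \<i>) (at X)" unfolding E_def by (auto intro!: derivative_eq_intros)
  have EX: "E X = 0" by (simp add: E_def)
  define \<phi> where "\<phi> = (\<lambda>z. if z = X then D / \<i> else (h z - h X) / E z)"
  \<comment> \<open>A rectangle of exactly one period centred at \<open>x\<close>, so that
    \<open>X\<close> is the only zero of \<open>E\<close> in it; \<open>T\<close> is its left
    edge.\<close>
  define S where "S = {z. \<bar>Re z - x\<bar> \<le> pi \<and> \<bar>Im z\<bar> \<le> s}"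
  define T where "T = {z. Re z = x - pi \<and> \<bar>Im z\<bar> \<le> s}"
  have S_eq: "S = cbox (Complex (x - pi) (- s)) (Complex (x + pi) s)"
    by (auto simp: S_def in_cbox_complex_iff abs_le_iff)
  have E0: "z = X" if "z \<in> S" "E z = 0" for z
  proof -
    have "exp (\<i> * (X - z)) = 1" using that(2) by (simp add: E_def)
    then obtain n where n: "Im z = 0" "x - Re z = of_int (2 * n) * pi"
      by (auto simp: exp_eq_1 X_def)
    have "\<bar>of_int (2 * n) * pi\<bar> \<le> pi" using that(1) n(2) by (auto simp: S_def)
    then have "\<bar>real_of_int (2 * n)\<bar> \<le> 1" by (simp add: abs_mult)
    then have "n = 0" by linarith
    with n show ?thesis by (simp add: X_def complex_eq_iff)
  qed
  have Sc: "S \<subseteq> cstrip s" by (auto simp: S_def cstrip_def)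
  have cS: "continuous_on S \<phi>"
  proof -
    \<comment> \<open>The quotient \<phi> is a quotient of two continuous difference quotients, and
      the denominator takes the value \<open>\<i>\<close> at \<open>X\<close>; this removes the
      singularity.\<close>
    let ?F = "\<lambda>z. if z = X then D else (h z - h X) / (z - X)" and ?G = "\<lambda>z. if z = X then \<i> else (E z - E X) / (z - X)"
    have "continuous_on S (\<lambda>z. ?F z / ?G z)"
    proof (intro continuous_on_divide diff_quotient_continuous hD ED)
      show "continuous_on S h" by (rule continuous_on_subset[OF cont Sc])
      show "continuous_on S E" unfolding E_def by (intro continuous_intros)
      show "\<forall>z\<in>S. ?G z \<noteq> 0" using E0 EX by auto
    qed
    then show ?thesis by (rule continuous_on_eq) (auto simp: \<phi>_def EX)
  qed
  have "bounded (\<phi> ` S)" using cS S_eq by (intro compact_imp_bounded compact_continuous_image) auto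
  then obtain M' where M': "\<And>z. z \<in> S \<Longrightarrow> norm (\<phi> z) \<le> M'" by (auto simp: bounded_iff)
  have "\<exists>I. (\<forall>z\<in>T. ((\<lambda>t. \<phi> (z + of_real t) * exp (- \<i> * of_int k * (z + of_real t))) has_integral I) {0..2 * pi})
    \<and> norm I \<le> 2 * pi * (M' * exp (- s * \<bar>of_int k\<bar>))" for k
  proof (rule period_integral_exp[OF _ _ cS _ _ _ _ _ M', of "{X}" T "x - pi"])
    show "convex S" unfolding S_eq by (rule convex_box)
    show "convex T"
    proof -
      have "T = cbox (Complex (x - pi) (- s)) (Complex (x - pi) s)"
        by (auto simp: T_def in_cbox_complex_iff abs_le_iff)
      then show ?thesis by (simp only: convex_box)
    qed
    show "T \<subseteq> S" "\<And>z t. z \<in> T \<Longrightarrow> t \<in> {0..2 * pi} \<Longrightarrow> z + of_real t \<in> S" by (auto simp: T_def S_def)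
    show "Complex (x - pi) s \<in> T" "Complex (x - pi) (- s) \<in> T" using s by (auto simp: T_def)
    show "\<phi> (z + of_real (2 * pi)) = \<phi> z" if z: "z \<in> T" for z
    proof -
      have ne: "z \<noteq> X" "z + of_real (2 * pi) \<noteq> X" using z pi_gt_zero by (auto simp: T_def X_def complex_eq_iff)
      have "exp (\<i> * (X - (z + of_real (2 * pi)))) = exp (\<i> * (X - z)) * exp (- (2 * of_real pi * \<i>))"
        by (simp add: algebra_simps flip: exp_add)
      then have "E (z + of_real (2 * pi)) = E z" by (simp add: E_def exp_minus)
      then show ?thesis using ne per[of z] z by (simp add: \<phi>_def T_def cstrip_def)
    qed
    show "\<phi> field_differentiable at z" if z: "z \<in> interior S - {X}" for z
    proof -
      have "(E has_field_derivative \<i> * exp (\<i> * (X - z))) (at z)"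
        unfolding E_def by (auto intro!: derivative_eq_intros)
      then have E_diff: "E field_differentiable at z" by (auto simp: field_differentiable_def)
      have "\<bar>Im z\<bar> < s" using z by (intro interior_Im_less[of _ S]) (auto simp: S_def)
      moreover have "E z \<noteq> 0" using E0[of z] z interior_subset by auto
      ultimately have "(\<lambda>z. (h z - h X) / E z) field_differentiable at z"
        using E_diff by (intro field_differentiable_divide field_differentiable_diff field_differentiable_const diff) auto
      then obtain d where "((\<lambda>z. (h z - h X) / E z) has_field_derivative d) (at z)" by (auto simp: field_differentiable_def)
      then have "(\<phi> has_field_derivative d) (at z)"
        by (rule has_field_derivative_transform_within_open[where S="- {X}"]) (use z in \<open>auto simp: \<phi>_def\<close>)
      then show ?thesis by (auto simp: field_differentiable_def)
    qed
  qed simp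
  then have "\<exists>I. \<forall>k. (\<forall>z\<in>T. ((\<lambda>t. \<phi> (z + of_real t) * exp (- \<i> * of_int k * (z + of_real t))) has_integral I k) {0..2 * pi})
    \<and> norm (I k) \<le> 2 * pi * (M' * exp (- s * \<bar>of_int k\<bar>))"
    by (intro choice allI)
  then obtain I where I: "\<And>k z. z \<in> T \<Longrightarrow> ((\<lambda>t. \<phi> (z + of_real t) * exp (- \<i> * of_int k * (z + of_real t))) has_integral I k) {0..2 * pi}"
    and nI: "\<And>k. norm (I k) \<le> 2 * pi * (M' * exp (- s * \<bar>of_int k\<bar>))" by blast
  define z0 where "z0 = complex_of_real (x - pi)"
  have z0: "z0 \<in> T" using s by (simp add: z0_def T_def)
  \<comment> \<open>The integrals \<open>I k\<close> of \<phi> enter through a two-term relation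
    because \<open>E\<close> has just two Fourier modes. Multiplied by
    \<open>exp (\<i> * k * X)\<close>, the right side becomes a difference of consecutive
    terms.\<close>
  have rel: "2 * of_real pi * fourier_coeff h k - (if k = 0 then 2 * of_real pi * h X else 0) = I k - exp (\<i> * X) * I (k + 1)" for k
  proof -
    have e: "((\<lambda>t. h X * exp (- \<i> * of_int k * (z0 + of_real t))) has_integral (if k = 0 then 2 * of_real pi * h X else 0)) {0..2 * pi}"
    proof -
      have "((\<lambda>t. (h X * exp (- \<i> * of_int k * z0)) * exp (\<i> * (of_int (- k) * complex_of_real t))) has_integral
         (h X * exp (- \<i> * of_int k * z0)) * (if - k = 0 then 2 * of_real pi else 0)) {0..2 * pi}"
        by (rule has_integral_mult_right[OF has_integral_exp_int])
      moreover have "(\<lambda>t. (h X * exp (- \<i> * of_int k * z0)) * exp (\<i> * (of_int (- k) * complex_of_real t)))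
        = (\<lambda>t. h X * exp (- \<i> * of_int k * (z0 + of_real t)))"
        by (rule ext) (simp add: algebra_simps flip: exp_add)
      moreover have "(h X * exp (- \<i> * of_int k * z0)) * (if - k = 0 then 2 * of_real pi else 0) = (if k = 0 then 2 * of_real pi * h X else 0)"
        by simp
      ultimately show ?thesis by (simp only:)
    qed
    have A: "((\<lambda>t. h (z0 + of_real t) * exp (- \<i> * of_int k * (z0 + of_real t)) - h X * exp (- \<i> * of_int k * (z0 + of_real t)))
       has_integral 2 * of_real pi * fourier_coeff h k - (if k = 0 then 2 * of_real pi * h X else 0)) {0..2 * pi}"
      using base[of "x - pi" k] e unfolding z0_def by (intro has_integral_diff)
    have B: "((\<lambda>t. \<phi> (z0 + of_real t) * exp (- \<i> * of_int k * (z0 + of_real t)) - exp (\<i> * X) * (\<phi> (z0 + of_real t) * exp (- \<i> * of_int (k + 1) * (z0 + of_real t))))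
       has_integral I k - exp (\<i> * X) * I (k + 1)) {0..2 * pi}"
      by (intro has_integral_diff has_integral_mult_right I z0)
    have eq: "h (z0 + of_real t) * exp (- \<i> * of_int k * (z0 + of_real t)) - h X * exp (- \<i> * of_int k * (z0 + of_real t))
       = \<phi> (z0 + of_real t) * exp (- \<i> * of_int k * (z0 + of_real t)) - exp (\<i> * X) * (\<phi> (z0 + of_real t) * exp (- \<i> * of_int (k + 1) * (z0 + of_real t)))"
      if "t \<in> {0..2 * pi}" for t
    proof -
      define z where "z = z0 + of_real t"
      have zS: "z \<in> S" using that s by (auto simp: z_def z0_def S_def)
      have 1: "h z - h X = E z * \<phi> z"
      proof (cases "z = X")
        case False
        then have "E z \<noteq> 0" using E0[OF zS] by blast
        then show ?thesis using False by (simp add: \<phi>_def)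
      qed (simp add: EX)
      have 2: "exp (\<i> * X) * exp (- \<i> * of_int (k + 1) * z) = exp (\<i> * (X - z)) * exp (- \<i> * of_int k * z)"
        by (simp add: algebra_simps flip: exp_add)
      have "h z * exp (- \<i> * of_int k * z) - h X * exp (- \<i> * of_int k * z) = E z * \<phi> z * exp (- \<i> * of_int k * z)"
        by (simp add: 1[symmetric] left_diff_distrib)
      also have "\<dots> = \<phi> z * exp (- \<i> * of_int k * z) - \<phi> z * (exp (\<i> * (X - z)) * exp (- \<i> * of_int k * z))"
        by (simp add: E_def algebra_simps)
      also have "\<phi> z * (exp (\<i> * (X - z)) * exp (- \<i> * of_int k * z)) = exp (\<i> * X) * (\<phi> z * exp (- \<i> * of_int (k + 1) * z))"
        unfolding 2[symmetric] by (rule mult.left_commute)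
      finally show ?thesis unfolding z_def .
    qed
    show ?thesis
    proof (rule has_integral_unique[OF has_integral_eq[OF _ A] B])
    qed (rule eq)
  qed
  define D' where "D' = (\<lambda>k::int. I k * exp (\<i> * of_int k * X) / (2 * of_real pi))"
  have nD': "norm (D' k) \<le> M' * exp (- s * \<bar>of_int k\<bar>)" for k
    using nI[of k] by (simp add: D'_def norm_mult norm_divide X_def divide_le_eq mult.commute)
  have "(\<lambda>k. norm (D' k)) summable_on UNIV"
    by (rule Infinite_Sum.abs_summable_on_comparison_test'[OF summable_on_cmult_right[OF summable_exp_abs_int[OF s]] nD'])
  then have "D' summable_on UNIV" by (rule abs_summable_summable)
  then obtain \<Sigma> where \<Sigma>: "(D' has_sum \<Sigma>) UNIV" by (auto simp: summable_on_def)
  have bij: "bij_betw (\<lambda>k::int. k + 1) UNIV UNIV" by (rule bij_betwI[of _ _ _ "\<lambda>k. k - 1"]) auto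
  have "((\<lambda>k. D' (k + 1)) has_sum \<Sigma>) UNIV"
    using \<Sigma> unfolding has_sum_reindex_bij_betw[OF bij, of D'] .
  then have neg: "((\<lambda>k. - D' (k + 1)) has_sum - \<Sigma>) UNIV" by (simp add: has_sum_uminus)
  have "((\<lambda>k. if k = 0 then h X else 0) has_sum h X) (UNIV :: int set)"
    by (rule has_sum_finite_neutralI[of "{0}"]) auto
  from has_sum_add[OF has_sum_add[OF \<Sigma> neg] this]
  have "((\<lambda>k. D' k - D' (k + 1) + (if k = 0 then h X else 0)) has_sum h X) UNIV" by simp
  moreover have "D' k - D' (k + 1) + (if k = 0 then h X else 0) = fourier_coeff h k * exp (\<i> * of_int k * of_real x)" for k
  proof -
    have e: "exp (\<i> * of_int (k + 1) * X) = exp (\<i> * X) * exp (\<i> * of_int k * X)"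
      by (simp add: algebra_simps flip: exp_add)
    have "D' k - D' (k + 1) = (I k - exp (\<i> * X) * I (k + 1)) * exp (\<i> * of_int k * X) / (2 * of_real pi)"
      unfolding D'_def e by (simp add: algebra_simps diff_divide_distrib)
    also have "\<dots> = fourier_coeff h k * exp (\<i> * of_int k * X) - (if k = 0 then h X else 0)"
      unfolding rel[symmetric] by (simp add: field_simps)
    finally show ?thesis by (simp add: X_def)
  qed
  ultimately show "((\<lambda>k. fourier_coeff h k * exp (\<i> * of_int k * of_real x)) has_sum h (of_real x)) UNIV"
    by (simp add: X_def)
qed

section \<open>Fourier series in two variables\<close>

text \<open>Morera's theorem: the integral over a triangle is exchanged with the integral over the
  parameter, and the inner triangle integrals vanish by Cauchy's theorem.\<close>

lemma holomorphic_integral_param: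
  fixes f :: "complex \<Rightarrow> real \<Rightarrow> complex"
  assumes U: "open U" and cont: "continuous_on (U \<times> cbox a b) (\<lambda>(z, t). f z t)"
    and hol: "\<And>t. t \<in> cbox a b \<Longrightarrow> (\<lambda>z. f z t) holomorphic_on U"
  shows "(\<lambda>z. integral (cbox a b) (f z)) holomorphic_on U"
proof (rule analytic_imp_holomorphic, rule Morera_triangle[OF integral_continuous_on_param[OF cont] U], rule impI)
  fix p q r assume hull: "convex hull {p, q, r} \<subseteq> U"
  define J where "J = (\<lambda>p q t. contour_integral (linepath p q) (\<lambda>z. f z t))"
  have edge: "contour_integral (linepath p q) (\<lambda>z. integral (cbox a b) (f z)) = integral (cbox a b) (J p q)"
    "J p q integrable_on cbox a b" if "closed_segment p q \<subseteq> U" for p q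
  proof -
    have J: "J p q = (\<lambda>t. integral (cbox 0 1) (\<lambda>x. f (linepath p q x) t * (q - p)))"
      by (rule ext) (simp add: J_def contour_integral_integral)
    have lp: "linepath p q x \<in> U" if "x \<in> cbox 0 1" for x
      using \<open>closed_segment p q \<subseteq> U\<close> that by (auto simp: linepath_image_01[symmetric])
    have c0: "continuous_on (cbox 0 1 \<times> cbox a b) (\<lambda>z. (\<lambda>(z, t). f z t) (linepath p q (fst z), snd z))"
    proof (rule continuous_on_compose2[OF cont])
      show "continuous_on (cbox 0 1 \<times> cbox a b) (\<lambda>z. (linepath p q (fst z), snd z))"
        unfolding linepath_def by (intro continuous_intros)
    qed (use lp in auto)
    then have c1: "continuous_on (cbox (0, a) (1, b)) (\<lambda>(x, t). f (linepath p q x) t * (q - p))"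
      unfolding cbox_Pair_eq case_prod_unfold by (intro continuous_intros) simp
    have "contour_integral (linepath p q) (\<lambda>z. integral (cbox a b) (f z))
      = integral (cbox 0 1) (\<lambda>x. integral (cbox a b) (\<lambda>t. f (linepath p q x) t * (q - p)))"
      by (simp add: contour_integral_integral integral_mult_left)
    also have "\<dots> = integral (cbox a b) (\<lambda>t. integral (cbox 0 1) (\<lambda>x. f (linepath p q x) t * (q - p)))"
      by (rule integral_swap_continuous[OF c1])
    finally show "contour_integral (linepath p q) (\<lambda>z. integral (cbox a b) (f z)) = integral (cbox a b) (J p q)"
      unfolding J .
    have "continuous_on (cbox a b) (\<lambda>t. integral (cbox 0 1) (\<lambda>x. f (linepath p q x) t * (q - p)))"
    proof (rule integral_continuous_on_param)
      have "continuous_on (cbox a b \<times> cbox 0 1) (\<lambda>z. (\<lambda>z. (\<lambda>(z, t). f z t) (linepath p q (fst z), snd z)) (snd z, fst z))"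
        by (rule continuous_on_compose2[OF c0]) (auto intro!: continuous_intros)
      then show "continuous_on (cbox a b \<times> cbox 0 1) (\<lambda>(t, x). f (linepath p q x) t * (q - p))"
        unfolding case_prod_unfold by (intro continuous_intros) simp
    qed
    then show "J p q integrable_on cbox a b" unfolding J by (rule integrable_continuous)
  qed
  have seg: "closed_segment p q \<subseteq> U" "closed_segment q r \<subseteq> U" "closed_segment r p \<subseteq> U"
    by (rule order_trans[OF segments_subset_convex_hull(1) hull] order_trans[OF segments_subset_convex_hull(3) hull]
      order_trans[OF segments_subset_convex_hull(5) hull])+
  have zero: "J p q t + J q r t + J r p t = 0" if t: "t \<in> cbox a b" for t
  proof -
    have "((\<lambda>z. f z t) has_contour_integral 0) (linepath p q +++ linepath q r +++ linepath r p)"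
      by (rule Cauchy_theorem_triangle[OF holomorphic_on_subset[OF hol[OF t] hull]])
    then show ?thesis unfolding J_def by (rule has_chain_integral_chain_integral3)
  qed
  have "integral (cbox a b) (J p q) + integral (cbox a b) (J q r) + integral (cbox a b) (J r p)
    = integral (cbox a b) (\<lambda>t. J p q t + J q r t + J r p t)"
    using edge(2)[OF seg(1)] edge(2)[OF seg(2)] edge(2)[OF seg(3)]
    by (simp add: integral_add integrable_add)
  also have "\<dots> = integral (cbox a b) (\<lambda>t. 0)" by (rule integral_cong) (rule zero)
  finally show "contour_integral (linepath p q) (\<lambda>z. integral (cbox a b) (f z)) +
       contour_integral (linepath q r) (\<lambda>z. integral (cbox a b) (f z)) +
       contour_integral (linepath r p) (\<lambda>z. integral (cbox a b) (f z)) = 0"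
    unfolding edge(1)[OF seg(1)] edge(1)[OF seg(2)] edge(1)[OF seg(3)] by simp
qed

text \<open>The series converges at a point with both offsets equal to \<rho>, and summable complex
  families are absolutely summable; its terms at that point dominate the series on the whole closed
  polydisc of radius \<rho>. Uniform limits of polynomials inherit continuity and separate
  holomorphy.\<close>

lemma analytic2_on_local:
  fixes F :: "complex \<times> complex \<Rightarrow> complex"
  assumes "analytic2_on F S" "(w1, w2) \<in> S"
  shows "\<exists>\<rho>>0. continuous_on (cball w1 \<rho> \<times> cball w2 \<rho>) F \<and>
    (\<forall>z2\<in>cball w2 \<rho>. (\<lambda>z1. F (z1, z2)) holomorphic_on ball w1 \<rho>) \<and>
    (\<forall>z1\<in>cball w1 \<rho>. (\<lambda>z2. F (z1, z2)) holomorphic_on ball w2 \<rho>)"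
proof -
  obtain r a where r: "r > 0" and hs: "\<And>z1 z2. norm (z1 - w1) < r \<Longrightarrow> norm (z2 - w2) < r \<Longrightarrow>
      ((\<lambda>(j::nat, k::nat). a j k * (z1 - w1) ^ j * (z2 - w2) ^ k) has_sum F (z1, z2)) (UNIV :: (nat \<times> nat) set)"
    using assms unfolding analytic2_on_def by fast
  define \<rho> where "\<rho> = r / 2"
  have \<rho>: "\<rho> > 0" "\<rho> < r" using r by (auto simp: \<rho>_def)
  define t where "t = (\<lambda>z (j::nat, k::nat). a j k * (fst z - w1) ^ j * (snd z - w2) ^ k)"
  let ?B = "cball w1 \<rho> \<times> cball w2 \<rho>"
  have inr: "norm (z1 - w1) < r" "norm (z1 - w1) \<le> \<rho>" if "z1 \<in> cball w1 \<rho>" for z1 w1 :: complex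
    using that \<rho> by (auto simp: dist_norm norm_minus_commute)
  have "((\<lambda>(j::nat, k::nat). a j k * of_real \<rho> ^ j * of_real \<rho> ^ k) has_sum F (w1 + of_real \<rho>, w2 + of_real \<rho>)) UNIV"
    using hs[of "w1 + of_real \<rho>" "w2 + of_real \<rho>"] \<rho> by simp
  then have "(\<lambda>(j::nat, k::nat). a j k * of_real \<rho> ^ j * of_real \<rho> ^ k) summable_on UNIV" by (auto simp: summable_on_def)
  then have M: "(\<lambda>x. norm ((\<lambda>(j::nat, k::nat). a j k * of_real \<rho> ^ j * of_real \<rho> ^ k) x)) summable_on UNIV"
    by (simp only: summable_on_iff_abs_summable_on_complex)
  have ulim: "uniform_limit ?B (\<lambda>X z. \<Sum>x\<in>X. t z x) F (finite_subsets_at_top UNIV)"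
  proof (rule Weierstrass_m_test_general'[OF _ _ M])
    fix x :: "nat \<times> nat" and z assume z: "z \<in> ?B"
    obtain j k where x: "x = (j, k)" by (cases x)
    have "norm (a j k) * (norm (fst z - w1) ^ j * norm (snd z - w2) ^ k) \<le> norm (a j k) * (\<rho> ^ j * \<rho> ^ k)"
      using z inr(2) \<rho> by (intro mult_left_mono mult_mono power_mono) auto
    then show "norm (t z x) \<le> norm ((\<lambda>(j::nat, k::nat). a j k * of_real \<rho> ^ j * of_real \<rho> ^ k) x)"
      using \<rho> by (simp add: t_def x norm_mult norm_power mult.assoc)
  next
    fix z assume z: "z \<in> ?B"
    then show "(t z has_sum F z) UNIV"
      using hs[of "fst z" "snd z"] inr(1)[of "fst z" w1] inr(1)[of "snd z" w2] by (auto simp: t_def)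
  qed
  have nb: "finite_subsets_at_top (UNIV :: (nat \<times> nat) set) \<noteq> bot" by simp
  have c: "continuous_on ?B F"
  proof (rule uniform_limit_theorem[OF _ ulim nb], rule always_eventually, rule allI)
    show "continuous_on ?B (\<lambda>z. \<Sum>x\<in>X. t z x)" for X
      unfolding t_def case_prod_unfold by (intro continuous_intros)
  qed
  have h1: "(\<lambda>z1. F (z1, z2)) holomorphic_on ball w1 \<rho>" if z2: "z2 \<in> cball w2 \<rho>" for z2
  proof -
    have ul: "uniform_limit (cball w1 \<rho>) (\<lambda>X z1. \<Sum>x\<in>X. t (z1, z2) x) (\<lambda>z1. F (z1, z2)) (finite_subsets_at_top UNIV)"
      using ulim z2 unfolding uniform_limit_iff by (fast elim!: eventually_mono)
    have "continuous_on (cball w1 \<rho>) (\<lambda>z1. \<Sum>x\<in>X. t (z1, z2) x)"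
      "(\<lambda>z1. \<Sum>x\<in>X. t (z1, z2) x) holomorphic_on ball w1 \<rho>" for X
      unfolding t_def case_prod_unfold fst_conv snd_conv
      by (intro continuous_intros, intro holomorphic_intros)
    then have ev: "eventually (\<lambda>X. continuous_on (cball w1 \<rho>) (\<lambda>z1. \<Sum>x\<in>X. t (z1, z2) x)
      \<and> (\<lambda>z1. \<Sum>x\<in>X. t (z1, z2) x) holomorphic_on ball w1 \<rho>) (finite_subsets_at_top UNIV)"
      by (intro always_eventually allI conjI)
    show ?thesis by (rule holomorphic_uniform_limit[OF ev ul nb])
  qed
  have h2: "(\<lambda>z2. F (z1, z2)) holomorphic_on ball w2 \<rho>" if z1: "z1 \<in> cball w1 \<rho>" for z1
  proof -
    have ul: "uniform_limit (cball w2 \<rho>) (\<lambda>X z2. \<Sum>x\<in>X. t (z1, z2) x) (\<lambda>z2. F (z1, z2)) (finite_subsets_at_top UNIV)"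
      using ulim z1 unfolding uniform_limit_iff by (fast elim!: eventually_mono)
    have "continuous_on (cball w2 \<rho>) (\<lambda>z2. \<Sum>x\<in>X. t (z1, z2) x)"
      "(\<lambda>z2. \<Sum>x\<in>X. t (z1, z2) x) holomorphic_on ball w2 \<rho>" for X
      unfolding t_def case_prod_unfold fst_conv snd_conv
      by (intro continuous_intros, intro holomorphic_intros)
    then have ev: "eventually (\<lambda>X. continuous_on (cball w2 \<rho>) (\<lambda>z2. \<Sum>x\<in>X. t (z1, z2) x)
      \<and> (\<lambda>z2. \<Sum>x\<in>X. t (z1, z2) x) holomorphic_on ball w2 \<rho>) (finite_subsets_at_top UNIV)"
      by (intro always_eventually allI conjI)
    show ?thesis by (rule holomorphic_uniform_limit[OF ev ul nb])
  qed
  show ?thesis using \<rho> c h1 h2 by blast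
qed

lemma
  assumes F: "analytic2_on F (cstrip \<xi> \<times> cstrip \<xi>)"
  shows analytic2_on_continuous: "continuous_on (cstrip \<xi> \<times> cstrip \<xi>) F"
    and analytic2_on_diff1: "z1 \<in> cstrip \<xi> \<Longrightarrow> z2 \<in> cstrip \<xi> \<Longrightarrow> (\<lambda>z1. F (z1, z2)) field_differentiable at z1"
    and analytic2_on_diff2: "z1 \<in> cstrip \<xi> \<Longrightarrow> z2 \<in> cstrip \<xi> \<Longrightarrow> (\<lambda>z2. F (z1, z2)) field_differentiable at z2"
proof -
  have "continuous (at w) F" if w: "w \<in> cstrip \<xi> \<times> cstrip \<xi>" for w
  proof -
    obtain w1 w2 where ww: "w = (w1, w2)" by (cases w)
    obtain \<rho> where \<rho>: "\<rho> > 0" "continuous_on (cball w1 \<rho> \<times> cball w2 \<rho>) F"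
      using analytic2_on_local[OF F, of w1 w2] w ww by auto
    have "w \<in> interior (cball w1 \<rho> \<times> cball w2 \<rho>)" using \<rho>(1) by (simp add: ww interior_Times)
    then show ?thesis using \<rho>(2) continuous_on_interior by blast
  qed
  then show "continuous_on (cstrip \<xi> \<times> cstrip \<xi>) F" by (auto intro!: continuous_at_imp_continuous_on)
  assume z: "z1 \<in> cstrip \<xi>" "z2 \<in> cstrip \<xi>"
  obtain \<rho> where \<rho>: "\<rho> > 0" "(\<lambda>z1. F (z1, z2)) holomorphic_on ball z1 \<rho>" "(\<lambda>z2. F (z1, z2)) holomorphic_on ball z2 \<rho>"
    using analytic2_on_local[OF F, of z1 z2] z by auto
  show "(\<lambda>z1. F (z1, z2)) field_differentiable at z1" "(\<lambda>z2. F (z1, z2)) field_differentiable at z2"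
    using \<rho> by (auto intro!: holomorphic_on_imp_differentiable_at[OF _ open_ball])
qed

lemma periodic_int:
  fixes h :: "complex \<Rightarrow> complex"
  assumes per: "\<And>z. z \<in> cstrip s \<Longrightarrow> h (z + of_real (2 * pi)) = h z" and z: "z \<in> cstrip s"
  shows "h (z + of_real (2 * pi * of_int m)) = h z"
proof (induction m rule: int_induct[where k=0])
  case (step1 i)
  have "z + of_real (2 * pi * of_int i) \<in> cstrip s" using z by (simp add: cstrip_def)
  from per[OF this] step1 show ?case by (simp add: algebra_simps)
next
  case (step2 i)
  have "z + of_real (2 * pi * of_int (i - 1)) \<in> cstrip s" using z by (simp add: cstrip_def)
  from per[OF this] step2 show ?case by (simp add: algebra_simps)
qed simp

lemma reduce_to_period: "\<exists>m::int. 0 \<le> Re (z + of_real (2 * pi * of_int m)) \<and> Re (z + of_real (2 * pi * of_int m)) \<le> 2 * pi"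
proof -
  define m where "m = \<lfloor>Re z / (2 * pi)\<rfloor>"
  have "of_int m \<le> Re z / (2 * pi)" "Re z / (2 * pi) \<le> of_int m + 1"
    unfolding m_def by linarith+
  then have "2 * pi * of_int m \<le> Re z" "Re z \<le> 2 * pi * of_int m + 2 * pi"
    by (simp_all add: field_simps)
  then show ?thesis by (intro exI[of _ "- m"]) simp
qed

lemma fourier_coeff_cnj:
  assumes "\<And>t. g (complex_of_real t) = cnj (h (of_real t))"
  shows "fourier_coeff g (- k) = cnj (fourier_coeff h k)"
  unfolding fourier_coeff_def by (simp add: integral_cnj assms exp_cnj)

text \<open>The one-variable result is applied in \<open>z2\<close> with \<open>z1\<close> as a
  parameter, then in \<open>z1\<close> to each coefficient \<open>C k\<close>. The decay of
  \<open>C k\<close> in \<open>k\<close> is the supremum bound of the second application, so that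
  the two exponentials multiply.\<close>

lemma fourier_2d:
  fixes F :: "complex \<times> complex \<Rightarrow> complex"
  assumes \<xi>: "\<xi> > 0" and F: "analytic2_on F (cstrip \<xi> \<times> cstrip \<xi>)"
    and per: "\<And>z1 z2. z1 \<in> cstrip \<xi> \<Longrightarrow> z2 \<in> cstrip \<xi> \<Longrightarrow> F (z1 + of_real (2 * pi), z2) = F (z1, z2)"
      "\<And>z1 z2. z1 \<in> cstrip \<xi> \<Longrightarrow> z2 \<in> cstrip \<xi> \<Longrightarrow> F (z1, z2 + of_real (2 * pi)) = F (z1, z2)"
    and real: "\<And>x y::real. cnj (F (of_real x, of_real y)) = F (of_real x, of_real y)"
  shows "\<exists>a M. (\<forall>j k. norm (a j k) \<le> M * exp (- \<xi> * (\<bar>of_int j\<bar> + \<bar>of_int k\<bar>))) \<and>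
    (\<forall>j k. a (- j) (- k) = cnj (a j k)) \<and>
    (\<forall>x y. ((\<lambda>(j, k). a j k * exp (\<i> * (of_int j * of_real x + of_int k * of_real y))) has_sum F (of_real x, of_real y)) (UNIV :: (int \<times> int) set))"
proof -
  note cF = analytic2_on_continuous[OF F]
  let ?Q = "cbox (Complex 0 (- \<xi>)) (Complex (2 * pi) \<xi>)"
  have Qs: "?Q \<subseteq> cstrip \<xi>" by (auto simp: in_cbox_complex_iff cstrip_def abs_le_iff)
  have "compact (F ` (?Q \<times> ?Q))"
    using Qs by (intro compact_continuous_image continuous_on_subset[OF cF] compact_Times compact_cbox) auto
  from compact_imp_bounded[OF this] obtain M where "\<forall>y\<in>F ` (?Q \<times> ?Q). norm y \<le> M"
    unfolding bounded_iff by blast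
  then have M: "\<And>z. z \<in> ?Q \<times> ?Q \<Longrightarrow> norm (F z) \<le> M" by blast
  \<comment> \<open>Periodicity reduces the bound on the unbounded strips to a compact cell.\<close>
  have bF: "norm (F (z1, z2)) \<le> M" if z: "z1 \<in> cstrip \<xi>" "z2 \<in> cstrip \<xi>" for z1 z2
  proof -
    obtain m1 where m1: "0 \<le> Re (z1 + of_real (2 * pi * of_int m1))" "Re (z1 + of_real (2 * pi * of_int m1)) \<le> 2 * pi"
      using reduce_to_period by blast
    obtain m2 where m2: "0 \<le> Re (z2 + of_real (2 * pi * of_int m2))" "Re (z2 + of_real (2 * pi * of_int m2)) \<le> 2 * pi"
      using reduce_to_period by blast
    have z1': "z1 + of_real (2 * pi * of_int m1) \<in> cstrip \<xi>" using z by (simp add: cstrip_def)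
    have "F (z1 + of_real (2 * pi * of_int m1), z2 + of_real (2 * pi * of_int m2)) = F (z1 + of_real (2 * pi * of_int m1), z2)"
      by (rule periodic_int[of \<xi> "\<lambda>z2. F (z1 + of_real (2 * pi * of_int m1), z2)", OF per(2)[OF z1'] z(2)])
    also have "\<dots> = F (z1, z2)"
      by (rule periodic_int[of \<xi> "\<lambda>z1. F (z1, z2)", OF per(1)[OF _ z(2)] z(1)])
    finally have e: "F (z1 + of_real (2 * pi * of_int m1), z2 + of_real (2 * pi * of_int m2)) = F (z1, z2)" .
    have "(z1 + of_real (2 * pi * of_int m1), z2 + of_real (2 * pi * of_int m2)) \<in> ?Q \<times> ?Q"
      using m1 m2 z by (auto simp: in_cbox_complex_iff cstrip_def abs_le_iff)
    from M[OF this] show ?thesis unfolding e .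
  qed
  have realc: "of_real t \<in> cstrip \<xi>" for t using \<xi> by (simp add: cstrip_def)
  define C where "C = (\<lambda>k z1. fourier_coeff (\<lambda>z2. F (z1, z2)) k)"
  have slice: "norm (C k z1) \<le> M * exp (- \<xi> * \<bar>of_int k\<bar>)"
    "((\<lambda>k. C k z1 * exp (\<i> * of_int k * of_real y)) has_sum F (z1, of_real y)) UNIV"
    if z1: "z1 \<in> cstrip \<xi>" for z1 k y
  proof -
    have c: "continuous_on (cstrip \<xi>) (\<lambda>z2. F (z1, z2))"
    proof (rule continuous_on_compose2[OF cF])
      show "continuous_on (cstrip \<xi>) (\<lambda>z2. (z1, z2))" by (intro continuous_intros)
    qed (use z1 in auto)
    have d: "(\<lambda>z2. F (z1, z2)) field_differentiable at z" if "\<bar>Im z\<bar> < \<xi>" for z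
      using analytic2_on_diff2[OF F z1, of z] that by (simp add: cstrip_def)
    note * = fourier_1d[where h="\<lambda>z2. F (z1, z2)", OF \<xi> c d per(2)[OF z1] bF[OF z1]]
    show "norm (C k z1) \<le> M * exp (- \<xi> * \<bar>of_int k\<bar>)" unfolding C_def by (rule *(1))
    show "((\<lambda>k. C k z1 * exp (\<i> * of_int k * of_real y)) has_sum F (z1, of_real y)) UNIV" unfolding C_def by (rule *(2))
  qed
  define p where "p = (\<lambda>k z t. F (z, complex_of_real t) * exp (- \<i> * of_int k * of_real t))"
  have cp: "continuous_on (cstrip \<xi> \<times> cbox 0 (2 * pi)) (\<lambda>(z, t). p k z t)" for k
  proof -
    have "continuous_on (cstrip \<xi> \<times> cbox 0 (2 * pi)) (\<lambda>x. F (fst x, complex_of_real (snd x)))"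
    proof (rule continuous_on_compose2[OF cF])
      show "continuous_on (cstrip \<xi> \<times> cbox 0 (2 * pi)) (\<lambda>x. (fst x, complex_of_real (snd x)))"
        by (intro continuous_intros)
    qed (use realc in auto)
    then show ?thesis unfolding p_def case_prod_unfold by (intro continuous_on_mult continuous_intros)
  qed
  have Ceq: "C k = (\<lambda>z. integral (cbox 0 (2 * pi)) (p k z) / (2 * of_real pi))" for k
    by (rule ext) (simp add: C_def fourier_coeff_def p_def)
  have cC: "continuous_on (cstrip \<xi>) (C k)" for k
    unfolding Ceq by (intro continuous_intros integral_continuous_on_param[OF cp]) simp
  have dC: "C k field_differentiable at z" if "\<bar>Im z\<bar> < \<xi>" for k z
  proof -
    let ?U = "{z. \<bar>Im z\<bar> < \<xi>}"
    have oU: "open ?U" by (intro open_Collect_less continuous_intros)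
    have Us: "?U \<subseteq> cstrip \<xi>" by (auto simp: cstrip_def)
    have "(\<lambda>z. integral (cbox 0 (2 * pi)) (p k z)) holomorphic_on ?U"
    proof (rule holomorphic_integral_param[OF oU])
      show "continuous_on (?U \<times> cbox 0 (2 * pi)) (\<lambda>(z, t). p k z t)"
        by (rule continuous_on_subset[OF cp]) (use Us in auto)
      fix t :: real
      have "(\<lambda>z. F (z, of_real t)) holomorphic_on ?U"
        unfolding holomorphic_on_def
      proof
        fix w assume "w \<in> ?U"
        then have w: "w \<in> cstrip \<xi>" using Us by blast
        show "(\<lambda>z. F (z, of_real t)) field_differentiable at w within ?U"
          by (rule field_differentiable_at_within[OF analytic2_on_diff1[OF F w realc]])
      qed
      then show "(\<lambda>z. p k z t) holomorphic_on ?U" unfolding p_def by (intro holomorphic_intros)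
    qed
    then have "C k holomorphic_on ?U" unfolding Ceq by (intro holomorphic_intros) auto
    then show ?thesis using holomorphic_on_imp_differentiable_at[OF _ oU] that by blast
  qed
  have pC: "C k (z + of_real (2 * pi)) = C k z" if "z \<in> cstrip \<xi>" for k z
    unfolding C_def fourier_coeff_def by (simp only: per(1)[OF that realc])
  define a where "a = (\<lambda>j k. fourier_coeff (C k) j)"
  note aC = fourier_1d[where h="C k" for k, OF \<xi> cC dC pC slice(1)]
  have na: "norm (a j k) \<le> M * exp (- \<xi> * (\<bar>of_int j\<bar> + \<bar>of_int k\<bar>))" for j k
  proof -
    have "exp (- \<xi> * (\<bar>of_int j\<bar> + \<bar>of_int k\<bar>)) = exp (- \<xi> * \<bar>of_int k\<bar>) * exp (- \<xi> * \<bar>of_int j\<bar>)"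
      by (simp add: algebra_simps flip: exp_add)
    then show ?thesis using aC(1)[of k j] by (simp only: a_def mult.assoc)
  qed
  have sa: "((\<lambda>j. a j k * exp (\<i> * of_int j * of_real x)) has_sum C k (of_real x)) UNIV" for k x
    unfolding a_def by (rule aC(2))
  have ca: "a (- j) (- k) = cnj (a j k)" for j k
    unfolding a_def C_def by (intro fourier_coeff_cnj) (simp add: real)
  have "((\<lambda>(j, k). a j k * exp (\<i> * (of_int j * of_real x + of_int k * of_real y))) has_sum F (of_real x, of_real y)) (UNIV :: (int \<times> int) set)" for x y
  proof -
    let ?f = "\<lambda>(k, j). a j k * exp (\<i> * (of_int j * of_real x + of_int k * of_real y))"
    have "(?f has_sum F (of_real x, of_real y)) (UNIV \<times> UNIV)"
    proof (rule has_sum_SigmaI)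
      fix k :: int
      have "((\<lambda>j. a j k * exp (\<i> * of_int j * of_real x) * exp (\<i> * of_int k * of_real y)) has_sum C k (of_real x) * exp (\<i> * of_int k * of_real y)) UNIV"
        by (rule has_sum_cmult_left[OF sa])
      then show "((\<lambda>j. ?f (k, j)) has_sum C k (of_real x) * exp (\<i> * of_int k * of_real y)) UNIV"
        by (simp add: distrib_left mult.assoc exp_add)
    next
      show "((\<lambda>k. C k (of_real x) * exp (\<i> * of_int k * of_real y)) has_sum F (of_real x, of_real y)) UNIV"
        by (rule slice(2)[OF realc])
      have M0: "M \<ge> 0" using bF[OF realc[of 0] realc[of 0]] norm_ge_zero order_trans by blast
      note se = summable_exp_abs_int[OF \<xi>]
      have n: "norm (?f (k, j)) \<le> M * (exp (- \<xi> * \<bar>of_int k\<bar>) * exp (- \<xi> * \<bar>of_int j\<bar>))" for k j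
      proof -
        have "exp (- \<xi> * (\<bar>of_int j\<bar> + \<bar>of_int k\<bar>)) = exp (- \<xi> * \<bar>of_int k\<bar>) * exp (- \<xi> * \<bar>of_int j\<bar>)"
          by (simp add: algebra_simps flip: exp_add)
        then show ?thesis using na[of j k] by (simp add: norm_mult)
      qed
      have sj: "(\<lambda>j. norm (?f (k, j))) summable_on UNIV" for k
        by (rule Infinite_Sum.abs_summable_on_comparison_test'[OF summable_on_cmult_right[OF summable_on_cmult_right[OF se]] n])
      have "?f abs_summable_on UNIV \<times> UNIV"
        unfolding Infinite_Sum.abs_summable_on_Sigma_iff
      proof (intro conjI ballI sj)
        have le: "(\<Sum>\<^sub>\<infinity>j. norm (?f (k, j))) \<le> M * (exp (- \<xi> * \<bar>of_int k\<bar>) * (\<Sum>\<^sub>\<infinity>j::int. exp (- \<xi> * \<bar>of_int j\<bar>)))" for k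
          unfolding infsum_cmult_right'[symmetric]
          by (rule infsum_mono[OF sj summable_on_cmult_right[OF summable_on_cmult_right[OF se]] n])
        show "(\<lambda>k. \<Sum>\<^sub>\<infinity>j. norm (?f (k, j))) abs_summable_on UNIV"
          by (rule Infinite_Sum.abs_summable_on_comparison_test'[OF summable_on_cmult_right[OF summable_on_cmult_left[OF se]]])
            (use le in \<open>simp add: infsum_nonneg\<close>)
      qed
      then show "?f summable_on UNIV \<times> UNIV" by (rule abs_summable_summable)
    qed
    then show ?thesis by (subst (asm) has_sum_swap) simp
  qed
  then show ?thesis
    by (intro exI[of _ a] exI[of _ M] conjI allI na ca)
qed

section \<open>Periodic analytic functions as elements of the algebra\<close>

lemma summable_wa_lattice:
  assumes s: "0 < s" "s < \<xi>" and a: "\<And>j k. norm (a j k) \<le> M * exp (- \<xi> * (\<bar>of_int j\<bar> + \<bar>of_int k\<bar>))"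
    and sym: "\<And>j k. a (- j) (- k) = cnj (a j k)"
  shows "\<exists>u\<in>wlat s. \<forall>j k. cf u (s * of_int j, s * of_int k) = a j k"
proof -
  \<comment> \<open>The floor merely inverts the indexing of the lattice, on which
    \<open>fst \<nu> / s\<close> and \<open>snd \<nu> / s\<close> are integers.\<close>
  define u where "u = (\<lambda>\<nu>. if \<nu> \<in> rlat s then a \<lfloor>fst \<nu> / s\<rfloor> \<lfloor>snd \<nu> / s\<rfloor> else 0)"
  \<comment> \<open>The part of the decay that is left after the weight has been paid; it makes the
    double series converge.\<close>
  define c where "c = \<xi> - s"
  have c: "c > 0" using s by (simp add: c_def)
  have u_lat: "u (s * of_int j, s * of_int k) = a j k" for j k
    using s by (auto simp: u_def rlat_iff)
  let ?h = "\<lambda>(j::int, k::int). (s * of_int j, s * of_int k)"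
  have inj: "inj ?h" using s by (auto simp: inj_on_def)
  note se = summable_exp_abs_int[OF c]
  have n: "norm (u (?h (j, k))) * wt (?h (j, k)) \<le> M * (exp (- c * \<bar>of_int j\<bar>) * exp (- c * \<bar>of_int k\<bar>))" for j k
  proof -
    have "norm (u (?h (j, k))) * wt (?h (j, k)) \<le> M * exp (- \<xi> * (\<bar>of_int j\<bar> + \<bar>of_int k\<bar>)) * wt (?h (j, k))"
      using a[of j k] by (simp add: u_lat mult_right_mono)
    also have "\<dots> = M * (exp (- c * \<bar>of_int j\<bar>) * exp (- c * \<bar>of_int k\<bar>))"
      using s by (simp add: wt_def fnorm_def abs_mult c_def mult.assoc algebra_simps flip: exp_add)
    finally show ?thesis .
  qed
  let ?f = "\<lambda>x. norm (u (?h x)) * wt (?h x)"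
  have sj: "(\<lambda>k. norm (?f (j, k))) summable_on UNIV" for j
    by (rule Infinite_Sum.abs_summable_on_comparison_test'[OF summable_on_cmult_right[OF summable_on_cmult_right[OF se]]])
      (use n[of j] in simp)
  have "?f abs_summable_on UNIV \<times> UNIV"
    unfolding Infinite_Sum.abs_summable_on_Sigma_iff
  proof (intro conjI ballI sj)
    have le: "(\<Sum>\<^sub>\<infinity>k. norm (?f (j, k))) \<le> M * (exp (- c * \<bar>of_int j\<bar>) * (\<Sum>\<^sub>\<infinity>k::int. exp (- c * \<bar>of_int k\<bar>)))" for j
      unfolding infsum_cmult_right'[symmetric]
      by (rule infsum_mono[OF sj summable_on_cmult_right[OF summable_on_cmult_right[OF se]]]) (use n[of j] in simp)
    show "(\<lambda>j. \<Sum>\<^sub>\<infinity>k. norm (?f (j, k))) abs_summable_on UNIV"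
      by (rule Infinite_Sum.abs_summable_on_comparison_test'[OF summable_on_cmult_right[OF summable_on_cmult_left[OF se]]])
        (use le in \<open>simp add: infsum_nonneg\<close>)
  qed
  then have "?f summable_on UNIV" using abs_summable_summable[of ?f UNIV] by simp
  then have "(\<lambda>\<nu>. norm (u \<nu>) * wt \<nu>) summable_on range ?h"
    by (subst summable_on_reindex[OF inj]) (simp add: o_def)
  then have "(\<lambda>\<nu>. norm (u \<nu>) * wt \<nu>) summable_on UNIV"
    by (subst (asm) summable_on_cong_neutral[where T=UNIV and g="\<lambda>\<nu>. norm (u \<nu>) * wt \<nu>"]) (auto simp: u_def rlat_def)
  then have cf: "cf (Wa u) = u" by (simp add: Wa_inverse)
  have "Wa u \<in> wlat s"
  proof (rule wlatI)
    fix \<nu>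
    show "cf (Wa u) (- \<nu>) = cnj (cf (Wa u) \<nu>)"
    proof (cases "\<nu> \<in> rlat s")
      case True
      then obtain j k where "\<nu> = (s * of_int j, s * of_int k)" by (auto simp: rlat_iff)
      then show ?thesis using u_lat[of "- j" "- k"] u_lat[of j k] sym[of j k] by (simp add: cf)
    qed (unfold cf, simp add: u_def)
    show "\<nu> \<notin> rlat s \<Longrightarrow> cf (Wa u) \<nu> = 0" unfolding cf by (simp add: u_def)
  qed
  then show ?thesis by (rule bexI[rotated]) (simp add: cf u_lat)
qed

lemma ev_lattice:
  assumes s: "s > 0" and u: "u \<in> wlat s"
  shows "ev u (z1 / of_real s, z2 / of_real s) = (\<Sum>\<^sub>\<infinity>(j, k). cf u (s * of_int j, s * of_int k) * exp (\<i> * (of_int j * z1 + of_int k * z2)))"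
proof -
  let ?h = "\<lambda>(j::int, k::int). (s * of_int j, s * of_int k)"
  have inj: "inj ?h" using s by (auto simp: inj_on_def)
  have "ev u (z1 / of_real s, z2 / of_real s) = (\<Sum>\<^sub>\<infinity>\<nu>\<in>range ?h. cf u \<nu> * chr (z1 / of_real s, z2 / of_real s) \<nu>)"
    unfolding ev_def by (rule infsum_cong_neutral) (use wlat_notin[OF u] in \<open>auto simp: rlat_def\<close>)
  also have "\<dots> = (\<Sum>\<^sub>\<infinity>x. cf u (?h x) * chr (z1 / of_real s, z2 / of_real s) (?h x))"
    by (subst infsum_reindex[OF inj]) (simp add: o_def)
  also have "\<dots> = (\<Sum>\<^sub>\<infinity>(j, k). cf u (s * of_int j, s * of_int k) * exp (\<i> * (of_int j * z1 + of_int k * z2)))"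
    using s by (intro infsum_cong) (auto simp: chr_def)
  finally show ?thesis .
qed

lemma fourier_wa:
  assumes s: "0 < s" "s < \<xi>" and F: "analytic_extension_to_strip f \<xi> F"
  shows "\<exists>u\<in>wlat s. \<forall>x y. ev u (of_real (x / s), of_real (y / s)) = of_real (f (x, y))"
proof -
  have st: "strip \<xi> = cstrip \<xi> \<times> cstrip \<xi>" by (auto simp: strip_def cstrip_def)
  have an: "analytic2_on F (cstrip \<xi> \<times> cstrip \<xi>)" and per: "torus_periodic_on (cstrip \<xi> \<times> cstrip \<xi>) F"
    and re: "\<And>x y. F (of_real x, of_real y) = of_real (f (x, y))"
    using F unfolding analytic_extension_to_strip_def st by auto
  have "\<xi> > 0" using s by simp
  have p1: "F (z1 + of_real (2 * pi), z2) = F (z1, z2)" and p2: "F (z1, z2 + of_real (2 * pi)) = F (z1, z2)"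
    if "z1 \<in> cstrip \<xi>" "z2 \<in> cstrip \<xi>" for z1 z2
    using bspec[OF per[unfolded torus_periodic_on_def], of "(z1, z2)"] that by simp_all
  have re': "cnj (F (of_real x, of_real y)) = F (of_real x, of_real y)" for x y by (simp add: re)
  obtain a M where a: "\<And>j k. norm (a j k) \<le> M * exp (- \<xi> * (\<bar>of_int j\<bar> + \<bar>of_int k\<bar>))"
    "\<And>j k. a (- j) (- k) = cnj (a j k)"
    "\<And>x y. ((\<lambda>(j, k). a j k * exp (\<i> * (of_int j * of_real x + of_int k * of_real y))) has_sum F (of_real x, of_real y)) (UNIV :: (int \<times> int) set)"
    using fourier_2d[OF \<open>\<xi> > 0\<close> an p1 p2 re'] by blast
  obtain u where u: "u \<in> wlat s" "\<And>j k. cf u (s * of_int j, s * of_int k) = a j k"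
    using summable_wa_lattice[OF s a(1,2)] by blast
  have "ev u (of_real (x / s), of_real (y / s)) = of_real (f (x, y))" for x y
    using ev_lattice[OF s(1) u(1), of "of_real x" "of_real y"] infsumI[OF a(3)[of x y]] by (simp add: u(2) re)
  with u(1) show ?thesis by blast
qed

section \<open>From Fourier coefficients to solutions\<close>

lemma exp_ix_remainder: "norm (exp (\<i> * of_real x) - 1 - \<i> * of_real x) \<le> x\<^sup>2"
  using Taylor_exp[of "\<i> * of_real x" 1] by (simp add: norm_mult diff_diff_eq power2_eq_square)

text \<open>The quadratic remainder of the exponential is summed against the coefficients, so the
  error of the linear approximation is bounded by the second moment times
  \<open>\<bar>y - t\<bar> ^ 2\<close>.\<close>

lemma has_vector_derivative_trig_series:
  fixes c :: "'i \<Rightarrow> complex" and w :: "'i \<Rightarrow> real"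
  assumes s0: "(\<lambda>\<nu>. norm (c \<nu>)) summable_on UNIV" and s1: "(\<lambda>\<nu>. norm (c \<nu>) * \<bar>w \<nu>\<bar>) summable_on UNIV"
    and s2: "(\<lambda>\<nu>. norm (c \<nu>) * \<bar>w \<nu>\<bar> ^ 2) summable_on UNIV"
  shows "((\<lambda>t. \<Sum>\<^sub>\<infinity>\<nu>. c \<nu> * exp (\<i> * of_real (w \<nu> * t))) has_vector_derivative
    (\<Sum>\<^sub>\<infinity>\<nu>. \<i> * of_real (w \<nu>) * c \<nu> * exp (\<i> * of_real (w \<nu> * t)))) (at t)"
proof -
  define \<phi> where "\<phi> = (\<lambda>t. \<Sum>\<^sub>\<infinity>\<nu>. c \<nu> * exp (\<i> * of_real (w \<nu> * t)))"
  define \<psi> where "\<psi> = (\<lambda>t. \<Sum>\<^sub>\<infinity>\<nu>. \<i> * of_real (w \<nu>) * c \<nu> * exp (\<i> * of_real (w \<nu> * t)))"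
  define K where "K = (\<Sum>\<^sub>\<infinity>\<nu>. norm (c \<nu>) * \<bar>w \<nu>\<bar> ^ 2)"
  have S0: "(\<lambda>\<nu>. c \<nu> * exp (\<i> * of_real (w \<nu> * t))) summable_on UNIV" for t
    by (rule abs_summable_summable) (use s0 in \<open>simp add: norm_mult\<close>)
  have S1: "(\<lambda>\<nu>. \<i> * of_real (w \<nu>) * c \<nu> * exp (\<i> * of_real (w \<nu> * t))) summable_on UNIV" for t
    by (rule abs_summable_summable) (use s1 in \<open>simp add: norm_mult mult.commute\<close>)
  have rem: "norm (\<phi> y - (\<phi> t + (y - t) *\<^sub>R \<psi> t)) \<le> K * \<bar>y - t\<bar> ^ 2" for y
  proof -
    let ?r = "\<lambda>\<nu>. c \<nu> * exp (\<i> * of_real (w \<nu> * t)) * (exp (\<i> * of_real (w \<nu> * (y - t))) - 1 - \<i> * of_real (w \<nu> * (y - t)))"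
    have H: "((\<lambda>\<nu>. c \<nu> * exp (\<i> * of_real (w \<nu> * y)) + (- (c \<nu> * exp (\<i> * of_real (w \<nu> * t)))
        + (- of_real (y - t)) * (\<i> * of_real (w \<nu>) * c \<nu> * exp (\<i> * of_real (w \<nu> * t))))) has_sum
        \<phi> y + (- \<phi> t + (- of_real (y - t)) * \<psi> t)) UNIV"
      unfolding \<phi>_def \<psi>_def
      by (intro has_sum_add has_sum_cmult_right has_sum_infsum[OF S0] has_sum_infsum[OF S1])
        (rule has_sum_uminus[THEN iffD2], unfold minus_minus, rule has_sum_infsum[OF S0])
    have e: "exp (\<i> * of_real (w \<nu> * y)) = exp (\<i> * of_real (w \<nu> * t)) * exp (\<i> * of_real (w \<nu> * (y - t)))" for \<nu>
      by (simp add: algebra_simps flip: exp_add)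
    have "(?r has_sum \<phi> y - (\<phi> t + (y - t) *\<^sub>R \<psi> t)) UNIV"
      using H unfolding e by (simp add: algebra_simps scaleR_conv_of_real)
    moreover have "((\<lambda>\<nu>. norm (c \<nu>) * \<bar>w \<nu>\<bar> ^ 2 * \<bar>y - t\<bar> ^ 2) has_sum K * \<bar>y - t\<bar> ^ 2) UNIV"
      unfolding K_def by (intro has_sum_cmult_left has_sum_infsum s2)
    ultimately show ?thesis
    proof (rule norm_infsum_le)
      fix \<nu>
      have "norm (?r \<nu>) \<le> norm (c \<nu>) * (w \<nu> * (y - t))\<^sup>2"
        using exp_ix_remainder[of "w \<nu> * (y - t)"] by (simp add: norm_mult mult_left_mono)
      then show "norm (?r \<nu>) \<le> norm (c \<nu>) * \<bar>w \<nu>\<bar> ^ 2 * \<bar>y - t\<bar> ^ 2" by (simp add: power_mult_distrib mult.assoc)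
    qed
  qed
  have "((\<lambda>y. (1 / norm (y - t)) *\<^sub>R (\<phi> y - (\<phi> t + (y - t) *\<^sub>R \<psi> t))) \<longlongrightarrow> 0) (at t)"
  proof (rule Lim_null_comparison)
    show "((\<lambda>y. K * \<bar>y - t\<bar>) \<longlongrightarrow> 0) (at t)" by (auto intro!: tendsto_eq_intros)
    have "norm ((1 / norm (y - t)) *\<^sub>R (\<phi> y - (\<phi> t + (y - t) *\<^sub>R \<psi> t))) \<le> K * \<bar>y - t\<bar>" if "y \<noteq> t" for y
      using rem[of y] that by (simp add: pos_divide_le_eq power2_eq_square mult.assoc)
    then show "eventually (\<lambda>y. norm ((1 / norm (y - t)) *\<^sub>R (\<phi> y - (\<phi> t + (y - t) *\<^sub>R \<psi> t))) \<le> K * \<bar>y - t\<bar>) (at t)"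
      by (auto simp: eventually_at_filter)
  qed
  then have "(\<phi> has_vector_derivative \<psi> t) (at t)"
    unfolding has_vector_derivative_def has_derivative_within by (simp add: bounded_linear_scaleR_left)
  then show ?thesis unfolding \<phi>_def \<psi>_def .
qed

text \<open>The exponential weight absorbs every power: \<open>x ^ m \<le> m ^ m * exp x\<close>
  follows from \<open>(1 + x / m) ^ m \<le> exp x\<close>.\<close>

lemma cf_fr_summable:
  assumes s: "s > 0"
  shows "(\<lambda>\<nu>. norm (cf u \<nu>) * \<bar>fr \<alpha> s \<nu>\<bar> ^ m) summable_on UNIV"
proof -
  define W where "W = (1 + \<bar>\<alpha>\<bar>) / s"
  have W: "W \<ge> 0" using s by (simp add: W_def)
  have le: "\<bar>fr \<alpha> s \<nu>\<bar> ^ m \<le> (W * real m) ^ m * wt \<nu>" for \<nu>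
  proof (cases "m = 0")
    case True
    then show ?thesis using wt_ge_1[of \<nu>] by simp
  next
    case False
    have "(fnorm \<nu> / real m) ^ m \<le> (1 + fnorm \<nu> / real m) ^ m" by (intro power_mono) auto
    also have "\<dots> \<le> exp (fnorm \<nu>)" by (rule exp_ge_one_plus_x_over_n_power_n) (use False order_trans[OF _ fnorm_nonneg[of \<nu>]] in auto)
    finally have f: "fnorm \<nu> ^ m \<le> real m ^ m * wt \<nu>"
      using False by (simp add: power_divide wt_def pos_divide_le_eq mult.commute)
    have "\<bar>fr \<alpha> s \<nu>\<bar> \<le> W * fnorm \<nu>" using abs_fr_le[OF s, of \<alpha> \<nu>] by (simp add: W_def)
    then have "\<bar>fr \<alpha> s \<nu>\<bar> ^ m \<le> (W * fnorm \<nu>) ^ m" by (intro power_mono) auto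
    also have "\<dots> \<le> W ^ m * (real m ^ m * wt \<nu>)" using f W by (simp add: power_mult_distrib mult_left_mono)
    finally show ?thesis by (simp add: power_mult_distrib)
  qed
  show ?thesis
  proof (rule summable_on_comparison_test[OF summable_on_cmult_right[OF cf_summable[of u], of "(W * real m) ^ m"]])
    show "norm (cf u \<nu>) * \<bar>fr \<alpha> s \<nu>\<bar> ^ m \<le> (W * real m) ^ m * (norm (cf u \<nu>) * wt \<nu>)" for \<nu>
      using mult_left_mono[OF le[of \<nu>], of "norm (cf u \<nu>)"] by (simp add: mult_ac)
  qed simp
qed

lemma chr_flow:
  assumes "s > 0"
  shows "chr (of_real (t / s), of_real (\<alpha> * t / s)) \<nu> = exp (\<i> * of_real (fr \<alpha> s \<nu> * t))"
  using assms by (simp add: chr_def fr_def field_simps)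

text \<open>Two termwise differentiations call for moments up to the third, which are finite for
  elements of \<open>wa\<close>. After that the differential equation holds term by term in the
  series along the flow.\<close>

lemma ode_of_approx:
  assumes s: "s > 0" and X: "X \<in> wlat s" and ode: "approx_ode \<alpha> s a f \<epsilon> X"
  shows "\<exists>x' x''. \<forall>t. ((\<lambda>t. evr X (t / s, \<alpha> * t / s)) has_real_derivative x' t) (at t) \<and> (x' has_real_derivative x'' t) (at t) \<and>
    \<epsilon> * x'' t + x' t + \<epsilon> * evr (gser a X) (t / s, \<alpha> * t / s) = \<epsilon> * evr f (t / s, \<alpha> * t / s)"
proof -
  let ?w = "fr \<alpha> s" and ?e = "\<lambda>\<nu> t. exp (\<i> * of_real (fr \<alpha> s \<nu> * t))"
  let ?c1 = "\<lambda>\<nu>. \<i> * of_real (?w \<nu>) * cf X \<nu>"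
  let ?c2 = "\<lambda>\<nu>. \<i> * of_real (?w \<nu>) * ?c1 \<nu>"
  have ev_eq: "ev u (of_real (t / s), of_real (\<alpha> * t / s)) = (\<Sum>\<^sub>\<infinity>\<nu>. cf u \<nu> * ?e \<nu> t)" for u t
    unfolding ev_def chr_flow[OF s] ..
  define \<phi> \<phi>1 \<phi>2 where "\<phi> = (\<lambda>t. \<Sum>\<^sub>\<infinity>\<nu>. cf X \<nu> * ?e \<nu> t)" and "\<phi>1 = (\<lambda>t. \<Sum>\<^sub>\<infinity>\<nu>. ?c1 \<nu> * ?e \<nu> t)"
    and "\<phi>2 = (\<lambda>t. \<Sum>\<^sub>\<infinity>\<nu>. ?c2 \<nu> * ?e \<nu> t)"
  note sm = cf_fr_summable[OF s, of X \<alpha>]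
  have n1: "norm (?c1 \<nu>) = norm (cf X \<nu>) * \<bar>?w \<nu>\<bar> ^ 1" for \<nu> by (simp add: norm_mult)
  have n2: "norm (?c1 \<nu>) * \<bar>?w \<nu>\<bar> = norm (cf X \<nu>) * \<bar>?w \<nu>\<bar> ^ 2" for \<nu> by (simp add: norm_mult power2_eq_square)
  have n3: "norm (?c1 \<nu>) * \<bar>?w \<nu>\<bar> ^ 2 = norm (cf X \<nu>) * \<bar>?w \<nu>\<bar> ^ 3" for \<nu> by (simp add: norm_mult power2_eq_square power3_eq_cube)
  have d1: "(\<phi> has_vector_derivative \<phi>1 t) (at t)" for t
    unfolding \<phi>_def \<phi>1_def
    by (rule has_vector_derivative_trig_series) (use sm[of 0] sm[of 1] sm[of 2] in simp_all)
  have d2: "(\<phi>1 has_vector_derivative \<phi>2 t) (at t)" for t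
    unfolding \<phi>1_def \<phi>2_def
    by (rule has_vector_derivative_trig_series, unfold n2 n3, unfold n1) (rule sm)+
  have c1s: "(\<lambda>\<nu>. ?c1 \<nu> * ?e \<nu> t) summable_on UNIV" for t
    by (rule abs_summable_summable) (use sm[of 1] in \<open>simp add: norm_mult mult.commute\<close>)
  have c2s: "(\<lambda>\<nu>. ?c2 \<nu> * ?e \<nu> t) summable_on UNIV" for t
    by (rule abs_summable_summable) (use sm[of 2] in \<open>simp add: norm_mult power2_eq_square mult_ac\<close>)
  have us: "(\<lambda>\<nu>. cf u \<nu> * ?e \<nu> t) summable_on UNIV" for u t
    by (rule abs_summable_summable) (use cf_abs_summable[of u] in \<open>simp add: norm_mult\<close>)
  have eq: "of_real \<epsilon> * \<phi>2 t + \<phi>1 t + of_real \<epsilon> * ev (gser a X) (of_real (t / s), of_real (\<alpha> * t / s))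
      = of_real \<epsilon> * ev f (of_real (t / s), of_real (\<alpha> * t / s))" for t
  proof -
    have "((\<lambda>\<nu>. of_real \<epsilon> * (?c2 \<nu> * ?e \<nu> t) + ?c1 \<nu> * ?e \<nu> t + of_real \<epsilon> * (cf (gser a X) \<nu> * ?e \<nu> t))
       has_sum of_real \<epsilon> * \<phi>2 t + \<phi>1 t + of_real \<epsilon> * ev (gser a X) (of_real (t / s), of_real (\<alpha> * t / s))) UNIV"
      unfolding \<phi>2_def \<phi>1_def ev_eq by (intro has_sum_add has_sum_cmult_right has_sum_infsum c1s c2s us)
    moreover have "of_real \<epsilon> * (?c2 \<nu> * ?e \<nu> t) + ?c1 \<nu> * ?e \<nu> t + of_real \<epsilon> * (cf (gser a X) \<nu> * ?e \<nu> t) = of_real \<epsilon> * (cf f \<nu> * ?e \<nu> t)" for \<nu>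
    proof -
      have "of_real \<epsilon> * (?c2 \<nu> * ?e \<nu> t) + ?c1 \<nu> * ?e \<nu> t + of_real \<epsilon> * (cf (gser a X) \<nu> * ?e \<nu> t)
         = (sym_L \<alpha> s \<epsilon> \<nu> * cf X \<nu> + of_real \<epsilon> * cf (gser a X) \<nu>) * ?e \<nu> t"
        by (simp add: sym_L_def algebra_simps power2_eq_square)
      then show ?thesis using ode unfolding approx_ode_def by simp
    qed
    ultimately have "((\<lambda>\<nu>. of_real \<epsilon> * (cf f \<nu> * ?e \<nu> t))
       has_sum of_real \<epsilon> * \<phi>2 t + \<phi>1 t + of_real \<epsilon> * ev (gser a X) (of_real (t / s), of_real (\<alpha> * t / s))) UNIV" by simp
    moreover have "((\<lambda>\<nu>. of_real \<epsilon> * (cf f \<nu> * ?e \<nu> t)) has_sum of_real \<epsilon> * ev f (of_real (t / s), of_real (\<alpha> * t / s))) UNIV"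
      unfolding ev_eq by (intro has_sum_cmult_right has_sum_infsum us)
    ultimately show ?thesis by (rule has_sum_unique)
  qed
  have r0: "(\<lambda>t. evr X (t / s, \<alpha> * t / s)) = (\<lambda>t. Re (\<phi> t))"
    by (rule ext) (simp only: evr_def fst_conv snd_conv ev_eq \<phi>_def)
  have "((\<lambda>t. evr X (t / s, \<alpha> * t / s)) has_real_derivative Re (\<phi>1 t)) (at t)" for t
    unfolding r0 has_real_derivative_iff_has_vector_derivative
    by (rule bounded_linear.has_vector_derivative[OF bounded_linear_Re d1])
  moreover have "((\<lambda>t. Re (\<phi>1 t)) has_real_derivative Re (\<phi>2 t)) (at t)" for t
    unfolding has_real_derivative_iff_has_vector_derivative
    by (rule bounded_linear.has_vector_derivative[OF bounded_linear_Re d2])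
  moreover have "\<epsilon> * Re (\<phi>2 t) + Re (\<phi>1 t) + \<epsilon> * evr (gser a X) (t / s, \<alpha> * t / s) = \<epsilon> * evr f (t / s, \<alpha> * t / s)" for t
    using arg_cong[OF eq[of t], of Re] by (simp add: evr_def)
  ultimately show ?thesis
    by (intro exI[of _ "\<lambda>t. Re (\<phi>1 t)"] exI[of _ "\<lambda>t. Re (\<phi>2 t)"] allI conjI)
qed

section \<open>Joint analyticity of the sum of the series\<close>

lemma exp_has_sum:
  fixes y :: "'a::{real_normed_field,banach}"
  shows "((\<lambda>j. y ^ j / fact j) has_sum exp y) UNIV" and "((\<lambda>j. norm (y ^ j / fact j)) has_sum exp (norm y)) UNIV"
proof -
  have "summable (\<lambda>j. norm (y ^ j / fact j))"
    using summable_norm_exp[of y] by (simp add: norm_divide norm_power scaleR_conv_of_real divide_inverse mult.commute norm_mult)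
  moreover have "(\<lambda>j. y ^ j / fact j) sums exp y"
    using exp_converges[of y] by (simp add: scaleR_conv_of_real divide_inverse mult.commute)
  ultimately show "((\<lambda>j. y ^ j / fact j) has_sum exp y) UNIV" by (rule norm_summable_imp_has_sum)
  have "(\<lambda>j. norm y ^ j / fact j) sums exp (norm y)"
    using exp_converges[of "norm y"] by (simp add: divide_inverse mult.commute)
  from sums_nonneg_imp_has_sum[OF this] show "((\<lambda>j. norm (y ^ j / fact j)) has_sum exp (norm y)) UNIV"
    by (simp add: norm_divide norm_power)
qed

lemma exp_pair_has_sum:
  fixes y1 y2 :: complex
  defines "e \<equiv> \<lambda>(j::nat, k::nat). y1 ^ j / fact j * (y2 ^ k / fact k)"
  shows "(e has_sum exp y1 * exp y2) UNIV" and "((\<lambda>x. norm (e x)) has_sum exp (norm y1) * exp (norm y2)) UNIV"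
proof -
  have in1: "((\<lambda>k. norm (e (j, k))) has_sum norm (y1 ^ j / fact j) * exp (norm y2)) UNIV" for j
    unfolding e_def prod.case norm_mult by (rule has_sum_cmult_right[OF exp_has_sum(2)])
  have out1: "((\<lambda>j. norm (y1 ^ j / fact j) * exp (norm y2)) has_sum exp (norm y1) * exp (norm y2)) UNIV"
    by (rule has_sum_cmult_left[OF exp_has_sum(2)])
  have sn: "(\<lambda>x. norm (e x)) summable_on UNIV \<times> UNIV"
    by (rule summable_on_SigmaI[OF in1]) (use out1 in \<open>auto simp: summable_on_def\<close>)
  from has_sum_SigmaI[OF in1 out1 sn] show "((\<lambda>x. norm (e x)) has_sum exp (norm y1) * exp (norm y2)) UNIV" by simp
  have in2: "((\<lambda>k. e (j, k)) has_sum y1 ^ j / fact j * exp y2) UNIV" for j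
    using has_sum_cmult_right[OF exp_has_sum(1)[of y2], of "y1 ^ j / fact j"] by (simp add: e_def)
  have out2: "((\<lambda>j. y1 ^ j / fact j * exp y2) has_sum exp y1 * exp y2) UNIV"
    by (rule has_sum_cmult_left[OF exp_has_sum(1)])
  from has_sum_SigmaI[OF in2 out2 abs_summable_summable[OF sn]] show "(e has_sum exp y1 * exp y2) UNIV" by simp
qed

text \<open>Each character is expanded at the centre. Its modulus there uses up the width \<xi>, and
  the two exponential series use up at most the remaining \<open>s - \<xi>\<close>; so the sum over
  \<nu>, \<open>j\<close> and \<open>k\<close> is dominated by
  \<open>norm (cf u \<nu>) * wt \<nu>\<close> and may be rearranged into a double power
  series.\<close>

lemma ev_analytic2:
  assumes s: "s > 0" and \<xi>: "\<xi> < s"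
  shows "analytic2_on (\<lambda>\<psi>. ev u (fst \<psi> / of_real s, snd \<psi> / of_real s)) (strip \<xi>)"
  unfolding analytic2_on_def
proof clarify
  fix w1 w2 assume w: "(w1, w2) \<in> strip \<xi>"
  define g where "g = (\<lambda>\<nu>. cf u \<nu> * chr (w1 / of_real s, w2 / of_real s) \<nu>)"
  define m where "m = (\<lambda>\<nu> (j, k). (\<i> * of_real (fst \<nu>) / of_real s) ^ j / fact j * ((\<i> * of_real (snd \<nu>) / of_real s) ^ k / fact k))"
  define A where "A = (\<lambda>j k. \<Sum>\<^sub>\<infinity>\<nu>. g \<nu> * m \<nu> (j, k))"
  have "((\<lambda>(j, k). A j k * (z1 - w1) ^ j * (z2 - w2) ^ k) has_sum ev u (z1 / of_real s, z2 / of_real s)) UNIV"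
    if z: "norm (z1 - w1) < s - \<xi>" "norm (z2 - w2) < s - \<xi>" for z1 z2
  proof -
    define y1 y2 where "y1 = (\<lambda>\<nu>::freq. \<i> * of_real (fst \<nu>) / of_real s * (z1 - w1))" and "y2 = (\<lambda>\<nu>::freq. \<i> * of_real (snd \<nu>) / of_real s * (z2 - w2))"
    define T where "T = (\<lambda>(\<nu>, jk). g \<nu> * (case jk of (j::nat, k::nat) \<Rightarrow> y1 \<nu> ^ j / fact j * (y2 \<nu> ^ k / fact k)))"
    have T1: "((\<lambda>jk. T (\<nu>, jk)) has_sum g \<nu> * (exp (y1 \<nu>) * exp (y2 \<nu>))) UNIV" for \<nu>
      unfolding T_def prod.case by (rule has_sum_cmult_right[OF exp_pair_has_sum(1)])
    have T2: "((\<lambda>jk. norm (T (\<nu>, jk))) has_sum norm (g \<nu>) * (exp (norm (y1 \<nu>)) * exp (norm (y2 \<nu>)))) UNIV" for \<nu>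
      unfolding T_def prod.case norm_mult[of "g \<nu>"] by (rule has_sum_cmult_right[OF exp_pair_has_sum(2)])
    have bound: "norm (g \<nu>) * (exp (norm (y1 \<nu>)) * exp (norm (y2 \<nu>))) \<le> norm (cf u \<nu>) * wt \<nu>" for \<nu>
    proof -
      have "norm (chr (w1 / of_real s, w2 / of_real s) \<nu>) \<le> exp (\<xi> / s * fnorm \<nu>)"
        using w s by (intro norm_chr_le) (simp_all add: strip_def divide_right_mono)
      moreover have "exp (norm (y1 \<nu>)) * exp (norm (y2 \<nu>)) \<le> exp ((s - \<xi>) / s * fnorm \<nu>)"
      proof -
        have "norm (y1 \<nu>) \<le> \<bar>fst \<nu>\<bar> / s * (s - \<xi>)" "norm (y2 \<nu>) \<le> \<bar>snd \<nu>\<bar> / s * (s - \<xi>)"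
        proof -
          have "norm (y1 \<nu>) = \<bar>fst \<nu>\<bar> / s * norm (z1 - w1)" "norm (y2 \<nu>) = \<bar>snd \<nu>\<bar> / s * norm (z2 - w2)"
            using s unfolding y1_def y2_def norm_mult norm_divide by simp_all
          then show "norm (y1 \<nu>) \<le> \<bar>fst \<nu>\<bar> / s * (s - \<xi>)" "norm (y2 \<nu>) \<le> \<bar>snd \<nu>\<bar> / s * (s - \<xi>)"
            using z s mult_left_mono[of "norm (z1 - w1)" "s - \<xi>" "\<bar>fst \<nu>\<bar> / s"]
              mult_left_mono[of "norm (z2 - w2)" "s - \<xi>" "\<bar>snd \<nu>\<bar> / s"] by simp_all
        qed
        then have "norm (y1 \<nu>) + norm (y2 \<nu>) \<le> \<bar>fst \<nu>\<bar> / s * (s - \<xi>) + \<bar>snd \<nu>\<bar> / s * (s - \<xi>)"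
          by (rule add_mono)
        also have "\<dots> = (s - \<xi>) / s * fnorm \<nu>"
          using s by (simp add: fnorm_def field_simps)
        finally show ?thesis by (simp flip: exp_add)
      qed
      ultimately have "norm (chr (w1 / of_real s, w2 / of_real s) \<nu>) * (exp (norm (y1 \<nu>)) * exp (norm (y2 \<nu>)))
          \<le> exp (\<xi> / s * fnorm \<nu>) * exp ((s - \<xi>) / s * fnorm \<nu>)"
        by (intro mult_mono) auto
      also have "\<dots> = wt \<nu>"
      proof -
        have "\<xi> / s * fnorm \<nu> + (s - \<xi>) / s * fnorm \<nu> = fnorm \<nu>" using s by (simp add: field_simps)
        then show ?thesis by (simp add: wt_def flip: exp_add)
      qed
      finally show ?thesis unfolding g_def norm_mult mult.assoc by (rule mult_left_mono) simp
    qed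
    have Tn: "(\<lambda>x. norm (T x)) summable_on UNIV \<times> UNIV"
    proof (rule summable_on_SigmaI[OF T2])
      show "(\<lambda>\<nu>. norm (g \<nu>) * (exp (norm (y1 \<nu>)) * exp (norm (y2 \<nu>)))) summable_on UNIV"
        by (rule summable_on_comparison_test[OF cf_summable[of u] bound]) simp
    qed simp
    have ev: "ev u (z1 / of_real s, z2 / of_real s) = (\<Sum>\<^sub>\<infinity>\<nu>. g \<nu> * (exp (y1 \<nu>) * exp (y2 \<nu>)))"
      unfolding ev_def
    proof (rule infsum_cong)
      fix \<nu>
      have "chr (z1 / of_real s, z2 / of_real s) \<nu> = chr (w1 / of_real s, w2 / of_real s) \<nu> * (exp (y1 \<nu>) * exp (y2 \<nu>))"
        unfolding chr_def y1_def y2_def exp_add[symmetric] using s by (intro arg_cong[where f=exp]) (simp add: field_simps)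
      then show "cf u \<nu> * chr (z1 / of_real s, z2 / of_real s) \<nu> = g \<nu> * (exp (y1 \<nu>) * exp (y2 \<nu>))" by (simp add: g_def)
    qed
    obtain tot where tot: "(T has_sum tot) (UNIV \<times> UNIV)"
      using abs_summable_summable[OF Tn] by (auto simp: summable_on_def)
    have "((\<lambda>\<nu>. g \<nu> * (exp (y1 \<nu>) * exp (y2 \<nu>))) has_sum tot) UNIV"
      by (rule has_sum_SigmaD[OF tot T1])
    then have tot_ev: "tot = ev u (z1 / of_real s, z2 / of_real s)" unfolding ev by (simp add: infsumI)
    have sw: "((\<lambda>(jk, \<nu>). T (\<nu>, jk)) has_sum tot) (UNIV \<times> UNIV)"
      using tot by (subst (asm) has_sum_swap)
    have sn: "(\<lambda>(jk, \<nu>). T (\<nu>, jk)) abs_summable_on UNIV \<times> UNIV"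
      using Tn by (subst (asm) summable_on_swap) (simp add: case_prod_unfold)
    have "((\<lambda>\<nu>. T (\<nu>, jk)) has_sum (\<Sum>\<^sub>\<infinity>\<nu>. T (\<nu>, jk))) UNIV" for jk
    proof (rule has_sum_infsum, rule abs_summable_summable)
      show "(\<lambda>\<nu>. T (\<nu>, jk)) abs_summable_on UNIV"
        using sn unfolding Infinite_Sum.abs_summable_on_Sigma_iff by (cases jk) simp
    qed
    then have hs: "((\<lambda>jk. \<Sum>\<^sub>\<infinity>\<nu>. T (\<nu>, jk)) has_sum tot) UNIV"
      by (intro has_sum_SigmaD[OF sw]) simp
    have AT: "(\<Sum>\<^sub>\<infinity>\<nu>. T (\<nu>, (j, k))) = A j k * (z1 - w1) ^ j * (z2 - w2) ^ k" for j k
    proof -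
      have y: "y1 \<nu> ^ j = (\<i> * of_real (fst \<nu>) / of_real s) ^ j * (z1 - w1) ^ j"
        "y2 \<nu> ^ k = (\<i> * of_real (snd \<nu>) / of_real s) ^ k * (z2 - w2) ^ k" for \<nu>
        unfolding y1_def y2_def by (rule power_mult_distrib)+
      have "T (\<nu>, (j, k)) = g \<nu> * m \<nu> (j, k) * ((z1 - w1) ^ j * (z2 - w2) ^ k)" for \<nu>
        by (simp only: T_def m_def y prod.case times_divide_eq_left times_divide_eq_right mult_ac)
      then have "(\<Sum>\<^sub>\<infinity>\<nu>. T (\<nu>, (j, k))) = (\<Sum>\<^sub>\<infinity>\<nu>. g \<nu> * m \<nu> (j, k) * ((z1 - w1) ^ j * (z2 - w2) ^ k))" by (simp only:)
      then show ?thesis unfolding A_def by (simp only: infsum_cmult_left' mult.assoc[of "infsum _ _"])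
    qed
    have "(\<lambda>jk. \<Sum>\<^sub>\<infinity>\<nu>. T (\<nu>, jk)) = (\<lambda>(j, k). A j k * (z1 - w1) ^ j * (z2 - w2) ^ k)"
    proof
      fix jk :: "nat \<times> nat"
      obtain j k where "jk = (j, k)" by (cases jk)
      then show "(\<Sum>\<^sub>\<infinity>\<nu>. T (\<nu>, jk)) = (case jk of (j, k) \<Rightarrow> A j k * (z1 - w1) ^ j * (z2 - w2) ^ k)"
        by (simp only: AT prod.case)
    qed
    with hs have "((\<lambda>(j, k). A j k * (z1 - w1) ^ j * (z2 - w2) ^ k) has_sum tot) UNIV" by (simp only:)
    then show ?thesis unfolding tot_ev .
  qed
  then show "\<exists>r>0. \<exists>a. \<forall>z1 z2. norm (z1 - w1) < r \<longrightarrow> norm (z2 - w2) < r \<longrightarrow>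
      ((\<lambda>(j, k). a j k * (z1 - w1) ^ j * (z2 - w2) ^ k) has_sum
        ev u (fst (z1, z2) / of_real s, snd (z1, z2) / of_real s)) UNIV"
    using \<xi> by (intro exI[of _ "s - \<xi>"] conjI exI[of _ A] allI impI) (simp_all only: fst_conv snd_conv diff_gt_0_iff_gt)
qed

section \<open>Small divisors\<close>

abbreviation cq :: "real \<Rightarrow> nat \<Rightarrow> real" where "cq \<equiv> cf_complete_quotient"

text \<open>The numerators of the convergents, introduced because the approximation errors depend on
  them although the theorem speaks of denominators.\<close>

fun cf_numer :: "real \<Rightarrow> nat \<Rightarrow> int" where
  "cf_numer \<alpha> 0 = cf_partial_quotient \<alpha> 0"
| "cf_numer \<alpha> (Suc 0) = cf_partial_quotient \<alpha> 1 * cf_partial_quotient \<alpha> 0 + 1"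
| "cf_numer \<alpha> (Suc (Suc k)) = cf_partial_quotient \<alpha> (Suc (Suc k)) * cf_numer \<alpha> (Suc k) + cf_numer \<alpha> k"

lemma cf_complete_quotient_irrational:
  assumes "\<alpha> \<notin> \<rat>"
  shows "cf_complete_quotient \<alpha> k \<notin> \<rat>"
proof (induction k)
  case (Suc k)
  have "frac (cq \<alpha> k) \<in> \<rat>" if "1 / frac (cq \<alpha> k) \<in> \<rat>" using Rats_divide[OF Rats_1 that] by simp
  moreover have "cq \<alpha> k \<in> \<rat>" if "frac (cq \<alpha> k) \<in> \<rat>"
    using Rats_add[OF that Rats_of_int[of "\<lfloor>cq \<alpha> k\<rfloor>"]] by (simp add: frac_def)
  ultimately show ?case using Suc by auto
qed (use assms in simp)

lemma frac_cf_complete_quotient: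
  assumes "\<alpha> \<notin> \<rat>"
  shows "0 < frac (cf_complete_quotient \<alpha> k)" "frac (cf_complete_quotient \<alpha> k) < 1"
proof -
  have "cq \<alpha> k \<notin> \<int>" using cf_complete_quotient_irrational[OF assms, of k] Ints_subset_Rats by blast
  then show "0 < frac (cq \<alpha> k)" by (simp add: frac_gt_0_iff)
qed (simp add: frac_lt_1)

lemma cf_partial_quotient_ge_1:
  assumes "\<alpha> \<notin> \<rat>"
  shows "cf_partial_quotient \<alpha> (Suc k) \<ge> 1"
proof -
  have "1 \<le> 1 / frac (cq \<alpha> k)" using frac_cf_complete_quotient[OF assms, of k] by simp
  then show ?thesis unfolding cf_partial_quotient_def cf_complete_quotient.simps by (simp only: le_floor_iff of_int_1)
qed

lemma cf_denom_bounds: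
  assumes "\<alpha> \<notin> \<rat>"
  shows "cf_denom \<alpha> k \<ge> 1 \<and> cf_denom \<alpha> (Suc k) \<ge> cf_denom \<alpha> k \<and> cf_denom \<alpha> (Suc k) \<ge> int (Suc k)"
proof (induction k)
  case 0
  then show ?case using cf_partial_quotient_ge_1[OF assms, of 0] by simp
next
  case (Suc k)
  have "1 * cf_denom \<alpha> (Suc k) \<le> cf_partial_quotient \<alpha> (Suc (Suc k)) * cf_denom \<alpha> (Suc k)"
    by (rule mult_right_mono[OF cf_partial_quotient_ge_1[OF assms]]) (use Suc in linarith)
  moreover from Suc have "1 \<le> cf_denom \<alpha> k" "cf_denom \<alpha> k \<le> cf_denom \<alpha> (Suc k)" "int (Suc k) \<le> cf_denom \<alpha> (Suc k)"
    by blast+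
  ultimately show ?case unfolding cf_denom.simps of_nat_Suc by (intro conjI) linarith+
qed

lemma cf_denom_ge_1: "\<alpha> \<notin> \<rat> \<Longrightarrow> cf_denom \<alpha> k \<ge> 1"
  and cf_denom_mono_Suc: "\<alpha> \<notin> \<rat> \<Longrightarrow> cf_denom \<alpha> k \<le> cf_denom \<alpha> (Suc k)"
  using cf_denom_bounds by blast+

lemma cf_denom_mono: "\<alpha> \<notin> \<rat> \<Longrightarrow> i \<le> j \<Longrightarrow> cf_denom \<alpha> i \<le> cf_denom \<alpha> j"
  by (rule lift_Suc_mono_le[of "cf_denom \<alpha>"]) (rule cf_denom_mono_Suc)

lemma cf_denom_ge_self: "\<alpha> \<notin> \<rat> \<Longrightarrow> cf_denom \<alpha> k \<ge> int k"
  by (cases k) (use cf_denom_bounds in auto)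

lemma cf_denom_numer_det:
  "\<bar>cf_denom \<alpha> (Suc k) * cf_numer \<alpha> k - cf_denom \<alpha> k * cf_numer \<alpha> (Suc k)\<bar> = 1"
proof (induction k)
  case (Suc k)
  have "cf_denom \<alpha> (Suc (Suc k)) * cf_numer \<alpha> (Suc k) - cf_denom \<alpha> (Suc k) * cf_numer \<alpha> (Suc (Suc k))
    = - (cf_denom \<alpha> (Suc k) * cf_numer \<alpha> k - cf_denom \<alpha> k * cf_numer \<alpha> (Suc k))"
    by (simp add: algebra_simps)
  then show ?case using Suc by simp
qed simp

definition cf_error :: "real \<Rightarrow> nat \<Rightarrow> real" where
  "cf_error \<alpha> k = of_int (cf_denom \<alpha> k) * \<alpha> - of_int (cf_numer \<alpha> k)"

text \<open>By the induction hypothesis the preceding error is the current one times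
  \<open>- 1 / \<phi>\<close>, and \<open>1 / \<phi>\<close> minus its integer part is the next
  fractional part. Thus the errors alternate in sign and shrink.\<close>

lemma cf_error_Suc:
  assumes "\<alpha> \<notin> \<rat>"
  shows "cf_error \<alpha> (Suc k) = - cf_error \<alpha> k * frac (cf_complete_quotient \<alpha> (Suc k))"
proof (induction k)
  case 0
  define \<phi> where "\<phi> = frac \<alpha>"
  have f: "\<phi> > 0" unfolding \<phi>_def using frac_cf_complete_quotient[OF assms, of 0] by simp
  have \<alpha>: "\<alpha> - of_int \<lfloor>\<alpha>\<rfloor> = \<phi>" by (simp add: \<phi>_def frac_def)
  have "cf_error \<alpha> (Suc 0) = of_int \<lfloor>1 / \<phi>\<rfloor> * (\<alpha> - of_int \<lfloor>\<alpha>\<rfloor>) - 1"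
    by (simp add: cf_error_def cf_partial_quotient_def \<phi>_def algebra_simps)
  also have "\<dots> = - \<phi> * (1 / \<phi> - of_int \<lfloor>1 / \<phi>\<rfloor>)" unfolding \<alpha> using f by (simp add: algebra_simps)
  also have "\<dots> = - cf_error \<alpha> 0 * frac (cq \<alpha> (Suc 0))"
    by (simp add: cf_error_def cf_partial_quotient_def \<phi>_def frac_def)
  finally show ?case .
next
  case (Suc k)
  define \<phi> where "\<phi> = frac (cq \<alpha> (Suc k))"
  have f: "\<phi> > 0" unfolding \<phi>_def using frac_cf_complete_quotient[OF assms, of "Suc k"] by simp
  have fr: "frac (cq \<alpha> (Suc (Suc k))) = 1 / \<phi> - of_int (cf_partial_quotient \<alpha> (Suc (Suc k)))"
    by (simp add: \<phi>_def frac_def cf_partial_quotient_def)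
  have "cf_error \<alpha> (Suc (Suc k)) = of_int (cf_partial_quotient \<alpha> (Suc (Suc k))) * cf_error \<alpha> (Suc k) + cf_error \<alpha> k"
    by (simp add: cf_error_def algebra_simps)
  also have "cf_error \<alpha> k = - cf_error \<alpha> (Suc k) * (1 / \<phi>)"
    using Suc f unfolding \<phi>_def[symmetric] by (simp add: field_simps)
  finally show ?case unfolding fr by (simp add: algebra_simps)
qed

text \<open>Expressing the determinant of two consecutive convergents through the errors gives
  \<open>\<bar>cf_error \<alpha> k\<bar> * (q' + q * \<phi>) = 1\<close>, and the second factor is
  at most \<open>2 * q'\<close>.\<close>

lemma abs_cf_error_ge:
  assumes "\<alpha> \<notin> \<rat>"
  shows "1 / (2 * of_int (cf_denom \<alpha> (Suc k))) \<le> \<bar>cf_error \<alpha> k\<bar>"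
proof -
  define q q' p p' where "q = real_of_int (cf_denom \<alpha> k)" and "q' = real_of_int (cf_denom \<alpha> (Suc k))"
    and "p = real_of_int (cf_numer \<alpha> k)" and "p' = real_of_int (cf_numer \<alpha> (Suc k))"
  define \<phi> where "\<phi> = frac (cq \<alpha> (Suc k))"
  have \<phi>: "0 < \<phi>" "\<phi> < 1" unfolding \<phi>_def using frac_cf_complete_quotient[OF assms, of "Suc k"] by simp_all
  have q: "1 \<le> q" "q \<le> q'" unfolding q_def q'_def using cf_denom_ge_1[OF assms, of k] cf_denom_mono_Suc[OF assms, of k] by simp_all
  have e: "q' * \<alpha> - p' = - (q * \<alpha> - p) * \<phi>"
    using cf_error_Suc[OF assms, of k] by (simp add: cf_error_def q_def q'_def p_def p'_def \<phi>_def)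
  have det: "\<bar>q' * p - q * p'\<bar> = 1"
    using cf_denom_numer_det[of \<alpha> k, THEN arg_cong[where f=real_of_int]] by (simp add: q_def q'_def p_def p'_def)
  have "q' * p - q * p' = q * (q' * \<alpha> - p') - q' * (q * \<alpha> - p)" by (simp add: algebra_simps)
  also have "\<dots> = - (q * \<alpha> - p) * (q' + q * \<phi>)" unfolding e by (simp add: algebra_simps)
  finally have "\<bar>q * \<alpha> - p\<bar> * \<bar>q' + q * \<phi>\<bar> = 1" using det by (simp only: abs_mult abs_minus_cancel)
  moreover have "q * \<phi> \<le> q * 1" using q \<phi> by (intro mult_left_mono) auto
  then have "q * \<phi> \<le> q'" using q by linarith
  moreover have "0 \<le> q * \<phi>" using q \<phi> by simp
  ultimately have "1 \<le> \<bar>q * \<alpha> - p\<bar> * (2 * q')"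
    using mult_left_mono[of "q' + q * \<phi>" "2 * q'" "\<bar>q * \<alpha> - p\<bar>"] q by simp
  then show ?thesis
    using q unfolding cf_error_def q_def[symmetric] q'_def[symmetric] p_def[symmetric] by (simp add: pos_divide_le_eq)
qed

text \<open>In the unimodular basis \<open>(p\<^sub>k\<^sub>+\<^sub>1, q\<^sub>k\<^sub>+\<^sub>1)\<close>, \<open>(p\<^sub>k, q\<^sub>k)\<close> a vector with second entry below
  \<open>q\<^sub>k\<^sub>+\<^sub>1\<close> has coordinates of opposite signs, and the two errors alternate in sign.\<close>

lemma cf_denom_best_approximation:
  fixes j K :: int
  assumes \<alpha>: "\<alpha> \<notin> \<rat>" and nz: "(j, K) \<noteq> (0, 0)" and K: "\<bar>K\<bar> < cf_denom \<alpha> (Suc k)"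
  shows "\<bar>cf_error \<alpha> k\<bar> \<le> \<bar>of_int j + \<alpha> * of_int K\<bar>"
proof -
  define q q' p p' D where "q = cf_denom \<alpha> k" and "q' = cf_denom \<alpha> (Suc k)"
    and "p = cf_numer \<alpha> k" and "p' = cf_numer \<alpha> (Suc k)" and "D = q' * p - q * p'"
  define \<phi> where "\<phi> = frac (cq \<alpha> (Suc k))"
  have \<phi>: "0 < \<phi>" unfolding \<phi>_def using frac_cf_complete_quotient[OF \<alpha>, of "Suc k"] by simp
  have q: "1 \<le> q" "q \<le> q'" unfolding q_def q'_def using cf_denom_ge_1[OF \<alpha>] cf_denom_mono_Suc[OF \<alpha>] by simp_all
  have "\<bar>D\<bar> = 1" using cf_denom_numer_det[of \<alpha> k] by (simp add: D_def q_def q'_def p_def p'_def)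
  then have DD: "D * D = 1" by (metis abs_mult_self_eq mult_1)
  \<comment> \<open>Cramer's rule in the basis of the two convergents; the determinant
    \<open>D\<close> is its own inverse because \<open>D * D = 1\<close>.\<close>
  define x y where "x = D * (K * p + j * q)" and "y = D * (- j * q' - K * p')"
  have "x * q' + y * q = D * D * K" unfolding x_def y_def by (simp add: D_def algebra_simps)
  then have Kxy: "x * q' + y * q = K" by (simp add: DD)
  have "x * p' + y * p = - (D * D * j)" unfolding x_def y_def by (simp add: D_def algebra_simps)
  then have jxy: "x * p' + y * p = - j" by (simp add: DD)
  have e: "cf_error \<alpha> (Suc k) = - cf_error \<alpha> k * \<phi>" using cf_error_Suc[OF \<alpha>, of k] by (simp add: \<phi>_def)
  have Kr: "real_of_int K = of_int x * of_int q' + of_int y * of_int q" by (simp flip: Kxy)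
  have jr: "real_of_int j = - (of_int x * of_int p' + of_int y * of_int p)"
    using arg_cong[OF jxy, of real_of_int] by simp
  have "of_int j + \<alpha> * of_int K = of_int x * cf_error \<alpha> (Suc k) + of_int y * cf_error \<alpha> k"
    unfolding Kr jr cf_error_def q_def[symmetric] q'_def[symmetric] p_def[symmetric] p'_def[symmetric]
    by (simp add: algebra_simps)
  also have "\<dots> = cf_error \<alpha> k * (of_int y - of_int x * \<phi>)" unfolding e by (simp add: algebra_simps)
  finally have eq: "\<bar>of_int j + \<alpha> * of_int K\<bar> = \<bar>cf_error \<alpha> k\<bar> * \<bar>of_int y - of_int x * \<phi>\<bar>" by (simp add: abs_mult)
  have y0: "y \<noteq> 0"
  proof
    assume "y = 0"
    then have Kx: "K = x * q'" using Kxy by simp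
    have "x = 0"
    proof (rule ccontr)
      assume "x \<noteq> 0"
      then have "1 * q' \<le> \<bar>x\<bar> * q'" using q by (intro mult_right_mono) auto
      then show False using K q by (simp add: Kx abs_mult q'_def[symmetric])
    qed
    then show False using \<open>y = 0\<close> Kxy jxy nz by simp
  qed
  have sg: "x * y \<le> 0"
  proof (rule ccontr)
    assume "\<not> x * y \<le> 0"
    then have xy: "x * y > 0" by simp
    then consider "x > 0" "y > 0" | "x < 0" "y < 0" by (auto simp: zero_less_mult_iff)
    then show False
    proof cases
      case 1
      then have "1 * q' \<le> x * q'" "0 \<le> y * q" using q by (auto intro!: mult_right_mono)
      then show False using K Kxy by (simp add: q'_def[symmetric])
    next
      case 2
      have "1 * q' \<le> (- x) * q'" by (rule mult_right_mono) (use 2 q in auto)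
      moreover have "0 \<le> (- y) * q" by (rule mult_nonneg_nonneg) (use 2 q in auto)
      ultimately show False using K Kxy by (simp add: q'_def[symmetric])
    qed
  qed
  have "1 \<le> \<bar>of_int y - of_int x * \<phi>\<bar>"
  proof (cases "y > 0")
    case True
    then have "x \<le> 0" using sg by (simp add: mult_le_0_iff)
    then have "of_int x * \<phi> \<le> 0" using \<phi> by (simp add: mult_nonpos_nonneg)
    moreover have "1 \<le> real_of_int y" using True by simp
    ultimately show ?thesis by linarith
  next
    case False
    then have y: "y \<le> -1" using y0 by simp
    then have "x \<ge> 0" using sg by (simp add: mult_le_0_iff)
    then have "of_int x * \<phi> \<ge> 0" using \<phi> by simp
    moreover have "real_of_int y \<le> -1" using y by linarith
    ultimately show ?thesis by linarith
  qed
  then show ?thesis unfolding eq using mult_left_mono[of 1 _ "\<bar>cf_error \<alpha> k\<bar>"] by simp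
qed

text \<open>A nonzero vector below the denominator of index \<open>Suc k\<close> does no better than
  the convergent of index \<open>k\<close>, whose error is at least half the reciprocal of that
  denominator.\<close>

lemma nonresonant_cf_denom:
  assumes \<alpha>: "\<alpha> \<notin> \<rat>"
  shows "nonresonant \<alpha> (of_int (cf_denom \<alpha> m))"
  unfolding nonresonant_def
proof (intro allI impI)
  fix j K :: int
  assume nz: "(j, K) \<noteq> (0, 0)" and lt: "real_of_int (\<bar>j\<bar> + \<bar>K\<bar>) < of_int (cf_denom \<alpha> m)"
  have lt': "\<bar>j\<bar> + \<bar>K\<bar> < cf_denom \<alpha> m" using lt by (simp only: of_int_less_iff)
  have "\<bar>j\<bar> + \<bar>K\<bar> \<ge> 1" using nz by (cases "j = 0") auto
  \<comment> \<open>Index 0 is excluded: its denominator is 1, which leaves no room for a nonzero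
    vector.\<close>
  with lt' obtain k where m: "m = Suc k" by (cases m) auto
  have "1 / (2 * of_int (cf_denom \<alpha> m)) \<le> \<bar>cf_error \<alpha> k\<bar>" unfolding m by (rule abs_cf_error_ge[OF \<alpha>])
  also have "\<dots> \<le> \<bar>of_int j + \<alpha> * of_int K\<bar>"
    by (rule cf_denom_best_approximation[OF \<alpha> nz]) (use lt' m in simp)
  finally show "1 / (2 * of_int (cf_denom \<alpha> m)) \<le> \<bar>of_int j + \<alpha> * of_int K\<bar>" .
qed

section \<open>Reduction to the algebra\<close>

lemma higher_deriv_has_fps_expansion:
  fixes g :: "real \<Rightarrow> real"
  assumes "(\<lambda>h. g (c + h)) has_fps_expansion G"
  shows "(\<lambda>h. (deriv ^^ k) g (c + h)) has_fps_expansion (fps_deriv ^^ k) G"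
proof (induction k)
  case (Suc k)
  have "deriv (\<lambda>h. (deriv ^^ k) g (c + h)) = (\<lambda>h. deriv ((deriv ^^ k) g) (c + h))"
    unfolding deriv_def by (rule ext) (simp add: DERIV_shift[symmetric] add.commute[of c])
  then show ?case using has_fps_expansion_deriv[OF Suc] by simp
qed (use assms in simp)

text \<open>The order of a zero is stated with iterated \<open>deriv\<close>; here those derivatives
  are identified with the coefficients of the local power series.\<close>

lemma higher_deriv_fps_nth:
  fixes g :: "real \<Rightarrow> real"
  assumes "(\<lambda>h. g (c + h)) has_fps_expansion G"
  shows "(deriv ^^ k) g c = fact k * fps_nth G k"
proof -
  have "eventually (\<lambda>h. eval_fps ((fps_deriv ^^ k) G) h = (deriv ^^ k) g (c + h)) (nhds 0)"
    using higher_deriv_has_fps_expansion[OF assms, of k] unfolding has_fps_expansion_def by blast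
  from eventually_nhds_x_imp_x[OF this] show ?thesis
    by (simp add: eval_fps_at_0 fps_0th_higher_deriv)
qed

lemma gcoeffs_of_zero:
  assumes g: "real_analytic_on g A" and A: "open A" and c: "c \<in> A" "zero_of_order g f0 c n" and n: "n \<ge> 2"
  obtains a \<rho> C where "gcoeffs a n \<rho> C" "a n \<noteq> 0"
    "\<And>x. \<bar>x\<bar> \<le> \<rho> \<Longrightarrow> c + x \<in> A" "\<And>x. \<bar>x\<bar> \<le> \<rho> \<Longrightarrow> g (c + x) = f0 + gser a x"
proof -
  from g c(1) obtain G where G: "(\<lambda>h. g (c + h)) has_fps_expansion G" unfolding real_analytic_on_def by blast
  note D = higher_deriv_fps_nth[OF G]
  have G0: "fps_nth G 0 = f0" using D[of 0] c(2) by (simp add: zero_of_order_def)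
  have Gk: "fps_nth G k = 0" if "1 \<le> k" "k < n" for k
  proof -
    have "(deriv ^^ k) g c = 0" using c(2) that unfolding zero_of_order_def by auto
    then show ?thesis using D[of k] by simp
  qed
  have Gn: "fps_nth G n \<noteq> 0" using D[of n] c(2) by (simp add: zero_of_order_def)
  have cr: "fps_conv_radius G > 0" and ev: "eventually (\<lambda>h. eval_fps G h = g (c + h)) (nhds 0)"
    using G unfolding has_fps_expansion_def by blast+
  obtain r1 where r1: "0 < r1" "\<And>h. \<bar>h\<bar> < r1 \<Longrightarrow> eval_fps G h = g (c + h)"
    using ev unfolding eventually_nhds_metric by (auto simp: dist_real_def)
  obtain r2 where r2: "0 < r2" "ball c r2 \<subseteq> A" using A c(1) openE by blast
  obtain r3 where r3: "0 < r3" "ereal r3 < fps_conv_radius G"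
    using ereal_dense2[OF cr] by (auto simp: zero_ereal_def)
  define \<rho> where "\<rho> = min (min r1 r2) r3 / 2"
  have \<rho>: "0 < \<rho>" "\<rho> < r1" "\<rho> < r2" "\<rho> < r3" using r1 r2 r3 by (auto simp: \<rho>_def)
  \<comment> \<open>Cutting off the coefficients below \<open>n\<close> subtracts exactly
    \<open>f0\<close>, since those of index 1 to \<open>n - 1\<close> vanish by the order of the
    zero.\<close>
  define a where "a = (\<lambda>k. if k < n then 0 else fps_nth G k)"
  \<comment> \<open>The Euler operator, applied twice, multiplies the coefficient of index
    \<open>k\<close> by the square of \<open>k\<close> without reducing the radius of convergence;
    this is the weight in \<open>gcoeffs\<close>.\<close>
  define F where "F = fps_X * fps_deriv (fps_X * fps_deriv G)"
  have Fk: "fps_nth F k = (real k)\<^sup>2 * fps_nth G k" for k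
  proof (cases k)
    case (Suc m)
    have "fps_nth (fps_X * fps_deriv G) (Suc m) = real (Suc m) * fps_nth G (Suc m)"
      by (simp only: fps_X_mult_nth fps_deriv_nth Suc_eq_plus1 add_diff_cancel_right' if_False add_eq_0_iff_both_eq_0 one_neq_zero simp_thms)
    then have "fps_nth F (Suc m) = real (Suc m) * (real (Suc m) * fps_nth G (Suc m))"
      by (simp only: F_def fps_X_mult_nth[of "fps_deriv (fps_X * fps_deriv G)"] fps_deriv_nth[of "fps_X * fps_deriv G"] Suc_eq_plus1 add_diff_cancel_right' if_False add_eq_0_iff_both_eq_0 one_neq_zero simp_thms)
    then show ?thesis unfolding Suc by (simp only: power2_eq_square mult.assoc)
  qed (simp add: F_def)
  have "fps_conv_radius G \<le> fps_conv_radius (fps_X * fps_deriv G)"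
    using fps_conv_radius_mult[of fps_X "fps_deriv G"] fps_conv_radius_deriv[of G]
    by (simp add: min_def)
  also have "\<dots> \<le> fps_conv_radius F"
    unfolding F_def using fps_conv_radius_mult[of fps_X "fps_deriv (fps_X * fps_deriv G)"] fps_conv_radius_deriv[of "fps_X * fps_deriv G"]
    by (simp add: min_def)
  finally have crF: "ereal \<rho> < fps_conv_radius F"
    using less_trans[OF _ r3(2), of "ereal \<rho>"] \<rho>(4) by (simp add: less_le_trans)
  have sF: "summable (\<lambda>k. norm (fps_nth F k * \<rho> ^ k))"
    by (rule abs_summable_in_conv_radius) (use crF \<rho> in \<open>simp add: fps_conv_radius_def\<close>)
  have sg: "summable (\<lambda>k. \<bar>a k\<bar> * (real k)\<^sup>2 * \<rho> ^ (k - n))"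
  proof (rule summable_comparison_test'[OF summable_mult[OF sF, of "1 / \<rho> ^ n"], of 0])
    fix k
    show "norm (\<bar>a k\<bar> * (real k)\<^sup>2 * \<rho> ^ (k - n)) \<le> 1 / \<rho> ^ n * norm (fps_nth F k * \<rho> ^ k)"
      using \<rho>(1) by (cases "k < n") (simp_all add: a_def Fk abs_mult power_diff mult_ac)
  qed
  have "gcoeffs a n \<rho> (\<Sum>k. \<bar>a k\<bar> * (real k)\<^sup>2 * \<rho> ^ (k - n))"
    unfolding gcoeffs_def using n \<rho> sg by (simp add: a_def)
  moreover have "a n \<noteq> 0" using Gn by (simp add: a_def)
  moreover have "c + x \<in> A" if "\<bar>x\<bar> \<le> \<rho>" for x
    using that \<rho> r2 by (auto simp: dist_real_def subset_iff)
  moreover have "g (c + x) = f0 + gser a x" if x: "\<bar>x\<bar> \<le> \<rho>" for x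
  proof -
    have "ereal (norm x) < ereal r3" using x \<rho>(4) by simp
    then have "ereal (norm x) < fps_conv_radius G" using r3(2) by (rule less_trans)
    then have "(\<lambda>k. fps_nth G k * x ^ k) sums eval_fps G x" by (rule sums_eval_fps)
    then have "(\<lambda>k. fps_nth G k * x ^ k - (if k = 0 then f0 else 0)) sums (eval_fps G x - f0)"
      by (rule sums_diff) (rule sums_single)
    moreover have "fps_nth G k * x ^ k - (if k = 0 then f0 else 0) = a k *\<^sub>R x ^ k" for k
      using n G0 Gk[of k] by (cases "k = 0") (auto simp: a_def)
    ultimately have "(\<lambda>k. a k *\<^sub>R x ^ k) sums (eval_fps G x - f0)" by simp
    then have "gser a x = eval_fps G x - f0" unfolding gser_def by (simp add: sums_iff)
    then show ?thesis using r1(2)[of x] x \<rho> by simp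
  qed
  ultimately show thesis by (rule that)
qed

lemma wlat_average:
  assumes s: "s > 0" and u: "u \<in> wlat s"
    and f: "\<And>x y. ev u (of_real (x / s), of_real (y / s)) = of_real (f (x, y))"
  shows "cf u 0 = of_real (torus_average f)"
proof -
  have "(f has_integral Re ((2 * of_real pi)\<^sup>2 * cf u 0)) (cbox (0, 0) (2 * pi, 2 * pi))"
    using has_integral_linear[OF has_integral_ev[OF s u] bounded_linear_Re] unfolding o_def f prod.collapse Re_complex_of_real .
  moreover have "Re ((2 * of_real pi)\<^sup>2 * cf u 0) = (2 * pi)\<^sup>2 * Re (cf u 0)"
    by (simp add: power2_eq_square)
  ultimately have "torus_average f = Re (cf u 0)"
    unfolding torus_average_def by (simp add: integral_unique)
  then show ?thesis using wlat_cf_0_real[OF u] by simp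
qed

lemma forcing_element:
  assumes s: "s > 0" "3 * s < \<xi>" and F: "analytic_extension_to_strip f \<xi> F"
  obtains u where "u \<in> wlat (3 * s)" "cf u 0 = 0"
    "\<And>\<psi>. evr (dil 3 u) (fst \<psi> / s, snd \<psi> / s) = f \<psi> - torus_average f"
proof -
  obtain v where v: "v \<in> wlat (3 * s)" and vf: "\<And>x y. ev v (of_real (x / (3 * s)), of_real (y / (3 * s))) = of_real (f (x, y))"
    using fourier_wa[OF _ s(2) F] s(1) by auto
  have v0: "cf v 0 = of_real (torus_average f)" by (rule wlat_average[OF _ v vf]) (use s in simp)
  define u where "u = v - torus_average f *\<^sub>R 1"
  have "u \<in> wlat (3 * s)" unfolding u_def using v by blast
  moreover have "cf u 0 = 0" by (simp add: u_def v0 cf_one scaleR_conv_of_real[where ?'a=complex])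
  moreover have "evr (dil 3 u) (fst \<psi> / s, snd \<psi> / s) = f \<psi> - torus_average f" for \<psi>
  proof -
    have e: "complex_of_real (x / s) / of_real 3 = of_real (x / (3 * s))" for x by simp
    have "ev (dil 3 u) (of_real (fst \<psi> / s), of_real (snd \<psi> / s)) = ev u (of_real (fst \<psi> / (3 * s)), of_real (snd \<psi> / (3 * s)))"
    proof -
      have "(1::real) \<le> 3" by simp
      from ev_dil[OF this, of u "(of_real (fst \<psi> / s), of_real (snd \<psi> / s))"] show ?thesis
        by (simp only: fst_conv snd_conv e)
    qed
    also have "\<dots> = of_real (f \<psi>) - of_real (torus_average f)"
      unfolding u_def ev_diff[OF ustrip_real] ev_scaleR ev_one vf prod.collapse by (simp only: of_real_def)
    finally show ?thesis by (simp add: evr_def)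
  qed
  ultimately show thesis by (rule that)
qed

text \<open>\<theta> is fixed before \<open>J\<close>, since in the theorem \<open>J\<close> itself
  depends on \<theta>. The point 0 may belong to \<open>J\<close>; there the equation degenerates to
  \<open>D X = 0\<close>, and the value 0 is chosen because the solutions tend to it.\<close>

lemma solution_family:
  assumes g: "gcoeffs a n \<rho> C" and n: "odd n" and an: "a n \<noteq> 0" and s: "s > 0" and \<alpha>: "\<alpha> \<notin> \<rat>"
    and f: "f \<in> wlat (3 * s)" "cf f 0 = 0"
  shows "\<exists>\<theta>>0. \<forall>J. (\<forall>\<epsilon>\<in>J. \<epsilon> = 0 \<or> (\<exists>q. 0 < \<epsilon> \<and> q \<ge> 1 \<and> nonresonant \<alpha> q \<and> \<epsilon> * q ^ n \<le> \<theta> \<and>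
      exp (- 2 * s * q) \<le> \<theta> * \<epsilon> ^ (n + 1))) \<longrightarrow>
    (\<exists>S. S 0 = 0 \<and> (\<forall>\<epsilon>\<in>J. S \<epsilon> \<in> wlat s \<and> norm (S \<epsilon>) \<le> \<rho> \<and> approx_ode \<alpha> s a (dil 3 f) \<epsilon> (S \<epsilon>)) \<and>
      (\<forall>l>1. \<forall>\<epsilon>0\<in>insert 0 J. ((\<lambda>\<epsilon>. dil l (S \<epsilon>)) \<longlongrightarrow> dil l (S \<epsilon>0)) (at \<epsilon>0 within J)))"
proof -
  have n2: "n \<ge> 2" and \<rho>: "\<rho> > 0" and C: "C \<ge> 0" and a0: "a 0 = 0"
    using n2[OF g] \<rho>_pos[OF g] C_nonneg[OF g] g by (auto simp: gcoeffs_def)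
  have gser0: "gser a (0::wa) = 0"
  proof -
    have "(\<lambda>k. a k *\<^sub>R (0::wa) ^ k) = (\<lambda>_. 0)"
    proof
      show "a k *\<^sub>R (0::wa) ^ k = 0" for k using a0 by (cases k) auto
    qed
    then show ?thesis unfolding gser_def by (simp only: suminf_zero)
  qed
  have wz: "(0::wa) \<in> wlat s" by (rule wlatI) simp_all
  have cf0: "cf 0 \<nu> = 0" for \<nu> by simp
  show ?thesis
  proof (cases "f = 0")
    \<comment> \<open>Without a nonzero mode of the forcing there is no lower bound for \<beta>, but
      then 0 solves the equation for every \<epsilon>.\<close>
    case True
    then have d0: "dil 3 f = 0" using dil_diff[of 3 0 0] by simp
    have "approx_ode \<alpha> s a (dil 3 f) \<epsilon> 0" for \<epsilon> unfolding approx_ode_def d0 by (simp add: gser0)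
    then show ?thesis using wz \<rho>
      by (intro exI[of _ 1] conjI allI impI exI[of _ "\<lambda>_. 0"] ballI) simp_all
  next
    case False
    have "\<exists>\<nu>0. cf f \<nu>0 \<noteq> 0"
    proof (rule ccontr)
      assume "\<not> ?thesis"
      have "cf f = cf 0"
      proof
        show "cf f \<nu> = cf 0 \<nu>" for \<nu> unfolding cf0 using \<open>\<not> (\<exists>\<nu>0. cf f \<nu>0 \<noteq> 0)\<close> by blast
      qed
      then have "f = 0" by (simp only: cf_inject)
      then show False using False by blast
    qed
    then obtain \<nu>0 where \<nu>0: "cf f \<nu>0 \<noteq> 0" by blast
    obtain \<rho>0 where \<rho>0: "0 < \<rho>0" "\<rho>0 < \<rho>" and mono: "\<And>x y::real. \<bar>x\<bar> \<le> \<rho>0 \<Longrightarrow> \<bar>y\<bar> \<le> \<rho>0 \<Longrightarrow> x \<le> y \<Longrightarrow>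
       sgn (a n) * (gser a y - gser a x) \<ge> \<bar>a n\<bar> / 2 * (y ^ n - x ^ n)"
      using gser_real_sign[OF g n an] by metis
    obtain \<theta>0 M where \<theta>0: "\<theta>0 > 0" and ex: "\<And>\<epsilon> q. 0 < \<epsilon> \<Longrightarrow> q \<ge> 1 \<Longrightarrow> nonresonant \<alpha> q \<Longrightarrow> \<epsilon> * q ^ n \<le> \<theta>0 \<Longrightarrow>
       exp (- 2 * s * q) \<le> \<theta>0 * \<epsilon> ^ (n + 1) \<Longrightarrow>
       (\<exists>X\<in>wlat s. norm X \<le> \<rho>0 \<and> norm X \<le> M * (\<epsilon> * q) \<and> approx_ode \<alpha> s a (dil 3 f) \<epsilon> X)"
      using existence[OF g n an s f \<nu>0 \<rho>0(1), of \<alpha>] by blast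
    \<comment> \<open>The last entry gives
      \<open>C * \<rho> ^ (n - 1) * \<epsilon>\<^sup>2 < 1\<close> for
      \<open>\<epsilon> \<le> \<theta>\<close>, the condition under which solutions are
      unique.\<close>
    define \<theta> where "\<theta> = min \<theta>0 (min 1 (1 / (C * \<rho> ^ (n - 1) + 1)))"
    have Cp: "0 \<le> C * \<rho> ^ (n - 1)" using C \<rho> by simp
    have \<theta>: "0 < \<theta>" "\<theta> \<le> \<theta>0" "\<theta> \<le> 1" "\<theta> \<le> 1 / (C * \<rho> ^ (n - 1) + 1)"
      unfolding \<theta>_def using \<theta>0 Cp by (simp_all only: min.cobounded1 min.coboundedI2 min.cobounded2 min_less_iff_conj, simp)
    have small: "C * \<rho> ^ (n - 1) * \<epsilon>\<^sup>2 < 1" if "0 < \<epsilon>" "\<epsilon> \<le> \<theta>" for \<epsilon>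
    proof -
      have "\<epsilon>\<^sup>2 \<le> \<epsilon> * 1" unfolding power2_eq_square using that \<theta> by (intro mult_left_mono) auto
      also have "\<dots> \<le> 1 / (C * \<rho> ^ (n - 1) + 1)" using that \<theta> by simp
      finally have "C * \<rho> ^ (n - 1) * \<epsilon>\<^sup>2 \<le> C * \<rho> ^ (n - 1) * (1 / (C * \<rho> ^ (n - 1) + 1))"
        using Cp by (rule mult_left_mono)
      also have "\<dots> < 1" using Cp by simp
      finally show ?thesis .
    qed
    show ?thesis
    proof (intro exI[of _ \<theta>] conjI allI impI)
      show "0 < \<theta>" by (rule \<theta>)
      fix J assume J: "\<forall>\<epsilon>\<in>J. \<epsilon> = 0 \<or> (\<exists>q. 0 < \<epsilon> \<and> q \<ge> 1 \<and> nonresonant \<alpha> q \<and> \<epsilon> * q ^ n \<le> \<theta> \<and>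
        exp (- 2 * s * q) \<le> \<theta> * \<epsilon> ^ (n + 1))"
      have "\<exists>X. \<epsilon> \<in> J \<longrightarrow> X \<in> wlat s \<and> norm X \<le> \<rho>0 \<and> approx_ode \<alpha> s a (dil 3 f) \<epsilon> X \<and> (\<epsilon> = 0 \<longrightarrow> X = 0) \<and>
         (\<epsilon> \<noteq> 0 \<longrightarrow> 0 < \<epsilon> \<and> \<epsilon> \<le> \<theta> \<and> norm X \<le> \<bar>M\<bar> * root n (\<theta> * \<epsilon> ^ (n - 1)))" for \<epsilon>
      proof (cases "\<epsilon> \<in> J \<and> \<epsilon> \<noteq> 0")
        case True
        with J obtain q where q: "0 < \<epsilon>" "q \<ge> 1" "nonresonant \<alpha> q" "\<epsilon> * q ^ n \<le> \<theta>" "exp (- 2 * s * q) \<le> \<theta> * \<epsilon> ^ (n + 1)"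
          by auto
        have "\<theta> * \<epsilon> ^ (n + 1) \<le> \<theta>0 * \<epsilon> ^ (n + 1)" using \<theta> q by (intro mult_right_mono) auto
        then obtain X where X: "X \<in> wlat s" "norm X \<le> \<rho>0" "norm X \<le> M * (\<epsilon> * q)" "approx_ode \<alpha> s a (dil 3 f) \<epsilon> X"
          using ex[OF q(1-3)] q(4,5) \<theta>(2) by (meson order_trans)
        have "\<epsilon> * 1 \<le> \<epsilon> * q ^ n" using q by (intro mult_left_mono one_le_power) auto
        then have le: "\<epsilon> \<le> \<theta>" using q(4) by simp
        \<comment> \<open>The frequency \<open>q\<close> may grow as \<epsilon> tends to 0. The
          constraint \<open>\<epsilon> * q ^ n \<le> \<theta>\<close> converts the bound by
          \<open>\<epsilon> * q\<close> into one by \<epsilon> alone that still tends to 0, because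
          \<open>n > 1\<close>.\<close>
        have "(\<epsilon> * q) ^ n = \<epsilon> ^ (n - 1) * (\<epsilon> * q ^ n)"
          using n2 by (cases n) (simp_all add: power_mult_distrib)
        also have "\<dots> \<le> \<epsilon> ^ (n - 1) * \<theta>" using q by (intro mult_left_mono) auto
        finally have "root n ((\<epsilon> * q) ^ n) \<le> root n (\<theta> * \<epsilon> ^ (n - 1))" using n2 by (simp add: mult.commute)
        moreover have "root n ((\<epsilon> * q) ^ n) = \<epsilon> * q" using n2 q by (intro real_root_power_cancel) auto
        ultimately have "\<bar>M\<bar> * (\<epsilon> * q) \<le> \<bar>M\<bar> * root n (\<theta> * \<epsilon> ^ (n - 1))" by (intro mult_left_mono) auto
        moreover have "M * (\<epsilon> * q) \<le> \<bar>M\<bar> * (\<epsilon> * q)" using q by (intro mult_right_mono) auto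
        ultimately have "norm X \<le> \<bar>M\<bar> * root n (\<theta> * \<epsilon> ^ (n - 1))" using X(3) by linarith
        then show ?thesis using X q le True by blast
      next
        case False
        have "approx_ode \<alpha> s a (dil 3 f) 0 0" unfolding approx_ode_def by simp
        then show ?thesis using False wz \<rho>0 by (intro exI[of _ 0]) auto
      qed
      then obtain S0 where S0: "\<And>\<epsilon>. \<epsilon> \<in> J \<Longrightarrow> S0 \<epsilon> \<in> wlat s \<and> norm (S0 \<epsilon>) \<le> \<rho>0 \<and> approx_ode \<alpha> s a (dil 3 f) \<epsilon> (S0 \<epsilon>) \<and> (\<epsilon> = 0 \<longrightarrow> S0 \<epsilon> = 0) \<and>
         (\<epsilon> \<noteq> 0 \<longrightarrow> 0 < \<epsilon> \<and> \<epsilon> \<le> \<theta> \<and> norm (S0 \<epsilon>) \<le> \<bar>M\<bar> * root n (\<theta> * \<epsilon> ^ (n - 1)))"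
        by metis
      \<comment> \<open>The value at 0 is fixed whether or not 0 belongs to \<open>J\<close>, so
        that the limit at 0 can be stated in the same way as the others.\<close>
      define S where "S = (\<lambda>\<epsilon>. if \<epsilon> = 0 then 0 else S0 \<epsilon>)"
      have SS0: "S \<epsilon> = S0 \<epsilon>" if "\<epsilon> \<in> J" for \<epsilon> using S0[OF that] by (auto simp: S_def)
      have S: "S \<epsilon> \<in> wlat s" "norm (S \<epsilon>) \<le> \<rho>0" "approx_ode \<alpha> s a (dil 3 f) \<epsilon> (S \<epsilon>)" if "\<epsilon> \<in> J" for \<epsilon>
        using S0[OF that] SS0[OF that] by auto
      have S_small: "norm (S \<epsilon>) \<le> \<bar>M\<bar> * root n (\<theta> * \<epsilon> ^ (n - 1))" "0 < \<epsilon>" "\<epsilon> \<le> \<theta>" if "\<epsilon> \<in> J" "\<epsilon> \<noteq> 0" for \<epsilon>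
        using S0[OF that(1)] SS0[OF that(1)] that(2) by auto
      have lim0: "((\<lambda>\<epsilon>. dil l (S \<epsilon>)) \<longlongrightarrow> dil l (S 0)) (at 0 within J)" if l: "l > 1" for l
      proof -
        have d0: "dil l (S 0) = 0" using dil_diff[of l 0 0] l by (simp add: S_def)
        have "((\<lambda>\<epsilon>. \<bar>M\<bar> * root n (\<theta> * \<epsilon> ^ (n - 1))) \<longlongrightarrow> \<bar>M\<bar> * root n (\<theta> * 0 ^ (n - 1))) (at 0 within J)"
          by (intro tendsto_intros)
        then have lim: "((\<lambda>\<epsilon>. \<bar>M\<bar> * root n (\<theta> * \<epsilon> ^ (n - 1))) \<longlongrightarrow> 0) (at 0 within J)"
          using n2 by (simp add: power_0_left)
        have "norm (dil l (S \<epsilon>)) \<le> \<bar>M\<bar> * root n (\<theta> * \<epsilon> ^ (n - 1))" if "\<epsilon> \<in> J" "\<epsilon> \<noteq> 0" for \<epsilon>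
          using norm_dil[of l "S \<epsilon>"] l S_small(1)[OF that] by simp
        then have "eventually (\<lambda>\<epsilon>. norm (dil l (S \<epsilon>)) \<le> \<bar>M\<bar> * root n (\<theta> * \<epsilon> ^ (n - 1))) (at 0 within J)"
          by (simp add: eventually_at_filter)
        from Lim_null_comparison[OF this lim] show ?thesis unfolding d0 .
      qed
      have cont: "((\<lambda>\<epsilon>. dil l (S \<epsilon>)) \<longlongrightarrow> dil l (S \<epsilon>0)) (at \<epsilon>0 within J)" if l: "l > 1" and \<epsilon>0: "\<epsilon>0 \<in> insert 0 J" for l \<epsilon>0
      proof (cases "\<epsilon>0 = 0")
        case True
        then show ?thesis using lim0[OF l] by simp
      next
        case False
        then have e: "\<epsilon>0 \<in> J" using \<epsilon>0 by simp
        show ?thesis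
        proof (rule solution_continuous[OF g s less_imp_le[OF \<rho>0(2)] S _ l])
          fix Y assume Y: "Y \<in> wlat s" "norm Y \<le> \<rho>0" "approx_ode \<alpha> s a (dil 3 f) \<epsilon>0 Y"
          show "Y = S \<epsilon>0"
            by (rule uniqueness[OF g n an s \<alpha> less_imp_le[OF \<rho>0(2)] mono Y S[OF e] S_small(2)[OF e False] small[OF S_small(2,3)[OF e False]]])
        qed
      qed
      show "\<exists>S. S 0 = 0 \<and> (\<forall>\<epsilon>\<in>J. S \<epsilon> \<in> wlat s \<and> norm (S \<epsilon>) \<le> \<rho> \<and> approx_ode \<alpha> s a (dil 3 f) \<epsilon> (S \<epsilon>)) \<and>
        (\<forall>l>1. \<forall>\<epsilon>0\<in>insert 0 J. ((\<lambda>\<epsilon>. dil l (S \<epsilon>)) \<longlongrightarrow> dil l (S \<epsilon>0)) (at \<epsilon>0 within J))"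
      proof (intro exI[of _ S] conjI ballI allI impI)
        fix \<epsilon> assume "\<epsilon> \<in> J"
        note S = S[OF this]
        show "S \<epsilon> \<in> wlat s" "approx_ode \<alpha> s a (dil 3 f) \<epsilon> (S \<epsilon>)" by (rule S)+
        show "norm (S \<epsilon>) \<le> \<rho>" using S(2) \<rho>0(2) by linarith
      next
        show "S 0 = 0" by (simp add: S_def)
      qed (rule cont)
    qed
  qed
qed

section \<open>The admissible parameters\<close>

text \<open>Since \<open>u\<close> tends to 0, only finitely many intervals reach above
  \<open>\<epsilon> / 2\<close> for a given \<open>\<epsilon> > 0\<close>, and a finite union of
  closed intervals is closed. The closure adds at most the point 0.\<close>

lemma closure_UN_intervals:
  fixes l u :: "nat \<Rightarrow> real"
  assumes l: "\<And>n. 0 \<le> l n" and u: "u \<longlonglongrightarrow> 0" and \<epsilon>: "\<epsilon> \<in> closure (\<Union>n. {l n..u n})"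
  shows "\<epsilon> = 0 \<or> (\<exists>n. \<epsilon> \<in> {l n..u n})"
proof (cases "\<epsilon> > 0")
  case True
  then have "eventually (\<lambda>n. u n < \<epsilon> / 2) sequentially" using order_tendstoD(2)[OF u, of "\<epsilon> / 2"] by simp
  then obtain m where m: "\<And>n. n \<ge> m \<Longrightarrow> u n < \<epsilon> / 2" unfolding eventually_sequentially by blast
  have "(\<Union>n. {l n..u n}) \<subseteq> (\<Union>n<m. {l n..u n}) \<union> {..\<epsilon> / 2}"
  proof
    fix x assume "x \<in> (\<Union>n. {l n..u n})"
    then obtain k where "x \<in> {l k..u k}" by blast
    then show "x \<in> (\<Union>n<m. {l n..u n}) \<union> {..\<epsilon> / 2}" using m[of k] by (cases "k < m") auto
  qed
  then have "closure (\<Union>n. {l n..u n}) \<subseteq> (\<Union>n<m. {l n..u n}) \<union> {..\<epsilon> / 2}"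
    by (rule closure_minimal) (intro closed_Un closed_UN, auto)
  then have "\<epsilon> \<in> (\<Union>n<m. {l n..u n}) \<union> {..\<epsilon> / 2}" using \<epsilon> by (rule subsetD)
  then show ?thesis using True by auto
next
  case False
  have "closure (\<Union>n. {l n..u n}) \<subseteq> {0..}" by (rule closure_minimal) (use l in \<open>auto intro: order_trans[OF l]\<close>)
  then show ?thesis using False \<epsilon> by auto
qed

text \<open>The inequality between \<open>C0\<close> and \<xi> that is needed amounts to
  \<open>2 * (n + 1) * (n + 2) \<le> 4 * (n\<^sup>2 + 2 * n - 1)\<close>, which holds for
  \<open>n \<ge> 2\<close>. The single factor not compared with \<epsilon> is at most
  \<open>a0\<close> because \<open>q \<ge> 1\<close>.\<close>

lemma exponent_condition:
  fixes n :: nat and q \<epsilon> a0 \<xi> C0 :: real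
  assumes n: "n \<ge> 2" and C0: "C0 = (real n + 1) / (4 * (real n ^ 2 + 2 * real n - 1)) * \<xi>" and \<xi>: "\<xi> > 0"
    and q: "q \<ge> 1" and a0: "a0 > 0" and 1: "exp (- C0 * q) \<le> a0 / q ^ n" and 2: "exp (- C0 * q) \<le> \<epsilon>"
  shows "exp (- 2 * (\<xi> / 4) * q) \<le> a0 * \<epsilon> ^ (n + 1)"
proof -
  have nn: "real n \<ge> 2" using n by simp
  have sq: "2 * real n \<le> real n ^ 2" using nn by (simp add: power2_eq_square mult_right_mono)
  define d where "d = 4 * (real n ^ 2 + 2 * real n - 1)"
  have d: "d > 0" using sq nn by (simp add: d_def)
  have "2 * ((real n + 1) * (real n + 2)) \<le> d"
  proof -
    have *: "r \<ge> 2 \<Longrightarrow> 2 * r \<le> r\<^sup>2 \<Longrightarrow> 2 * r\<^sup>2 + 6 * r + 4 \<le> 4 * (r\<^sup>2 + 2 * r - 1)" for r :: real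
      by simp
    have "2 * ((real n + 1) * (real n + 2)) = 2 * real n ^ 2 + 6 * real n + 4"
      by (simp add: algebra_simps power2_eq_square)
    then show ?thesis unfolding d_def using *[OF nn sq] by simp
  qed
  then have "(real n + 1) / d * (real n + 2) \<le> 1 / 2" using d by (simp add: pos_divide_le_eq)
  then have "\<xi> * ((real n + 1) / d * (real n + 2)) \<le> \<xi> * (1 / 2)" using \<xi> by (intro mult_left_mono) auto
  then have "C0 * (real n + 2) \<le> \<xi> / 2" unfolding C0 d_def[symmetric] by (simp add: mult_ac)
  then have "C0 * (real n + 2) * q \<le> \<xi> / 2 * q" using q by (intro mult_right_mono) auto
  then have "exp (- 2 * (\<xi> / 4) * q) \<le> exp (- C0 * q + real (n + 1) * (- C0 * q))" by (simp add: algebra_simps)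
  also have "\<dots> = exp (- C0 * q) * exp (- C0 * q) ^ (n + 1)" by (simp only: exp_add exp_of_nat_mult)
  also have "\<dots> \<le> a0 * \<epsilon> ^ (n + 1)"
  proof (intro mult_mono power_mono 2)
    have "a0 / q ^ n \<le> a0 / 1" using a0 q by (intro divide_left_mono) auto
    then show "exp (- C0 * q) \<le> a0" using 1 by simp
  qed (use a0 in auto)
  finally show ?thesis .
qed

section \<open>Return to functions on strips\<close>

text \<open>Dilation by \<open>s / \<xi>'\<close> rescales the strip of width \<open>\<xi>'\<close>
  to the unit strip, on which the norm dominates the supremum.\<close>

lemma strip_bound_dil:
  assumes \<xi>: "0 < \<xi>'" "\<xi>' < s" and \<psi>: "\<psi> \<in> strip \<xi>'"
  shows "norm (ev u (fst \<psi> / of_real s, snd \<psi> / of_real s) - ev v (fst \<psi> / of_real s, snd \<psi> / of_real s))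
    \<le> norm (dil (s / \<xi>') u - dil (s / \<xi>') v)"
proof -
  define l where "l = s / \<xi>'"
  have l: "l \<ge> 1" using \<xi> by (simp add: l_def)
  define z where "z = (fst \<psi> / of_real \<xi>', snd \<psi> / of_real \<xi>')"
  have z: "z \<in> ustrip" using \<psi> \<xi>(1) by (auto simp: z_def ustrip_def strip_def)
  have "(fst z / of_real l, snd z / of_real l) = (fst \<psi> / of_real s, snd \<psi> / of_real s)"
    using \<xi> by (simp add: z_def l_def)
  then have e: "ev (dil l w) z = ev w (fst \<psi> / of_real s, snd \<psi> / of_real s)" for w
    using ev_dil[OF l, of w z] by simp
  show ?thesis unfolding e[symmetric] l_def[symmetric] ev_diff[OF z, symmetric] by (rule norm_ev[OF z])
qed

lemma uniform_limit_strip: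
  assumes \<xi>: "0 < \<xi>'" "\<xi>' < s" and S: "((\<lambda>\<epsilon>. dil (s / \<xi>') (S \<epsilon>)) \<longlongrightarrow> dil (s / \<xi>') v) F"
  shows "uniform_limit (strip \<xi>') (\<lambda>\<epsilon> \<psi>. ev (S \<epsilon>) (fst \<psi> / of_real s, snd \<psi> / of_real s))
    (\<lambda>\<psi>. ev v (fst \<psi> / of_real s, snd \<psi> / of_real s)) F"
  unfolding uniform_limit_iff
proof (intro allI impI)
  fix e :: real assume "e > 0"
  from tendstoD[OF S this] show "\<forall>\<^sub>F \<epsilon> in F. \<forall>\<psi>\<in>strip \<xi>'.
    dist (ev (S \<epsilon>) (fst \<psi> / of_real s, snd \<psi> / of_real s)) (ev v (fst \<psi> / of_real s, snd \<psi> / of_real s)) < e"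
  proof (rule eventually_mono, intro ballI)
    fix \<epsilon> \<psi> assume d: "dist (dil (s / \<xi>') (S \<epsilon>)) (dil (s / \<xi>') v) < e" and \<psi>: "\<psi> \<in> strip \<xi>'"
    show "dist (ev (S \<epsilon>) (fst \<psi> / of_real s, snd \<psi> / of_real s)) (ev v (fst \<psi> / of_real s, snd \<psi> / of_real s)) < e"
      unfolding dist_norm by (rule le_less_trans[OF strip_bound_dil[OF \<xi> \<psi>] d[unfolded dist_norm]])
  qed
qed

lemma ev_torus_periodic:
  assumes s: "s > 0" and u: "u \<in> wlat s"
  shows "torus_periodic_on S (\<lambda>\<psi>. ev u (fst \<psi> / of_real s, snd \<psi> / of_real s))"
proof -
  have e: "exp (\<i> * (of_int j * (z1 + of_real (2 * pi)) + of_int k * z2)) = exp (\<i> * (of_int j * z1 + of_int k * z2))"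
    "exp (\<i> * (of_int j * z1 + of_int k * (z2 + of_real (2 * pi)))) = exp (\<i> * (of_int j * z1 + of_int k * z2))" for j k :: int and z1 z2
  proof -
    show "exp (\<i> * (of_int j * (z1 + of_real (2 * pi)) + of_int k * z2)) = exp (\<i> * (of_int j * z1 + of_int k * z2))"
      unfolding exp_eq by (intro exI[of _ j]) (simp add: algebra_simps)
    show "exp (\<i> * (of_int j * z1 + of_int k * (z2 + of_real (2 * pi)))) = exp (\<i> * (of_int j * z1 + of_int k * z2))"
      unfolding exp_eq by (intro exI[of _ k]) (simp add: algebra_simps)
  qed
  show ?thesis
    unfolding torus_periodic_on_def fst_conv snd_conv ev_lattice[OF s u] e by simp
qed

lemma ev_div_real: "u \<in> wlat s \<Longrightarrow> ev u (of_real x / of_real r, of_real y / of_real r) = of_real (evr u (x / r, y / r))"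
  using ev_real[of u s "x / r" "y / r"] by simp

lemma evr_torus_periodic:
  assumes s: "s > 0" and u: "u \<in> wlat s"
  shows "torus_periodic_on UNIV (\<lambda>\<psi>. evr u (fst \<psi> / s, snd \<psi> / s))"
proof -
  note P = ev_torus_periodic[OF assms, of UNIV, unfolded torus_periodic_on_def fst_conv snd_conv]
  have "evr u ((x + 2 * pi) / s, y / s) = evr u (x / s, y / s) \<and> evr u (x / s, (y + 2 * pi) / s) = evr u (x / s, y / s)" for x y
  proof -
    have "ev u ((of_real x + of_real (2 * pi)) / of_real s, of_real y / of_real s) = ev u (of_real x / of_real s, of_real y / of_real s)"
      "ev u (of_real x / of_real s, (of_real y + of_real (2 * pi)) / of_real s) = ev u (of_real x / of_real s, of_real y / of_real s)"
      using bspec[OF P, of "(of_real x, of_real y)"] by blast+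
    then show ?thesis unfolding of_real_add[symmetric] ev_div_real[OF u] of_real_eq_iff by blast
  qed
  then show ?thesis unfolding torus_periodic_on_def by simp
qed

lemma evr_analytic_extension:
  assumes s: "s > 0" and \<xi>: "\<xi> < s" and u: "u \<in> wlat s"
  shows "analytic_extension_to_strip (\<lambda>\<psi>. evr u (fst \<psi> / s, snd \<psi> / s)) \<xi>
    (\<lambda>\<psi>. ev u (fst \<psi> / of_real s, snd \<psi> / of_real s))"
  unfolding analytic_extension_to_strip_def
  using ev_torus_periodic[OF s u] ev_analytic2[OF s \<xi>] ev_div_real[OF u] by (intro conjI allI) (simp_all only: fst_conv snd_conv)

text \<open>The bound \<rho> on the norm acts twice: it keeps the solution inside \<open>A\<close>,
  and it keeps it where \<open>g\<close> is given by the power series.\<close>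

lemma approx_ode_solution:
  assumes s: "s > 0" and gc: "gcoeffs a n \<rho> C" and A: "\<And>x. \<bar>x\<bar> \<le> \<rho> \<Longrightarrow> c + x \<in> A"
    and g: "\<And>x. \<bar>x\<bar> \<le> \<rho> \<Longrightarrow> g (c + x) = f0 + gser a x"
    and u: "\<And>\<psi>. evr u (fst \<psi> / s, snd \<psi> / s) = f \<psi> - f0"
    and X: "X \<in> wlat s" "norm X \<le> \<rho>" "approx_ode \<alpha> s a u \<epsilon> X"
  shows "ode_solution g A f (1, \<alpha>) \<epsilon> (\<lambda>t. c + evr X (fst (t *\<^sub>R (1, \<alpha>)) / s, snd (t *\<^sub>R (1, \<alpha>)) / s))"
proof -
  have t: "fst (t *\<^sub>R (1, \<alpha>)) = t" "snd (t *\<^sub>R (1, \<alpha>)) = \<alpha> * t" for t by simp_all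
  obtain x' x'' where d: "\<And>t. ((\<lambda>t. evr X (t / s, \<alpha> * t / s)) has_real_derivative x' t) (at t)"
    "\<And>t. (x' has_real_derivative x'' t) (at t)"
    and eq: "\<And>t. \<epsilon> * x'' t + x' t + \<epsilon> * evr (gser a X) (t / s, \<alpha> * t / s) = \<epsilon> * evr u (t / s, \<alpha> * t / s)"
    using ode_of_approx[OF s X(1,3)] by blast
  show ?thesis unfolding ode_solution_def t
  proof (rule exI[of _ x'], rule exI[of _ x''], intro allI conjI d)
    fix t
    have le: "\<bar>evr X (t / s, \<alpha> * t / s)\<bar> \<le> \<rho>" using abs_evr X(2) by (rule order_trans)
    show "c + evr X (t / s, \<alpha> * t / s) \<in> A" by (rule A[OF le])
    show "((\<lambda>t. c + evr X (t / s, \<alpha> * t / s)) has_real_derivative x' t) (at t)"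
      using DERIV_add[OF DERIV_const d(1)] by simp
    have ft: "f (t *\<^sub>R (1, \<alpha>)) = f0 + evr u (t / s, \<alpha> * t / s)" using u[of "t *\<^sub>R (1, \<alpha>)"] unfolding t by linarith
    show "\<epsilon> * x'' t + x' t + \<epsilon> * g (c + evr X (t / s, \<alpha> * t / s)) = \<epsilon> * f (t *\<^sub>R (1, \<alpha>))"
      using eq[of t] unfolding g[OF le] evr_gser(1)[OF gc X(1,2)] ft distrib_left by linarith
  qed
qed

text \<open>One extension \<open>Xc\<close> serves for all widths below \<open>\<xi> / 4\<close>.
  Continuity in \<epsilon> on the closed set \<open>J\<close> is expressed as uniform convergence of
  this extension on each strip, which is stronger than continuity at every single point of the
  strip.\<close>

theorem theorem2:
  fixes \<alpha> \<xi> c f0 C0 :: real and \<omega> :: "real \<times> real" and A :: "real set"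
    and g :: "real \<Rightarrow> real" and f :: "real \<times> real \<Rightarrow> real" and \<nn> :: nat
  assumes alpha: "\<alpha> \<notin> \<rat>"
    and omega: "\<omega> = (1, \<alpha>)"
    and A: "open A"
    and g: "real_analytic_on g A"
    and f: "torus_periodic_on UNIV f" "analytic2_on f UNIV"
    and xi: "\<xi> > 0" "\<exists>F. analytic_extension_to_strip f \<xi> F"
    and f0: "f0 = torus_average f"
    and c: "c \<in> A" "zero_of_order g f0 c \<nn>"
    and order: "odd \<nn>" "\<nn> > 1"
    and C0: "C0 = (real \<nn> + 1) / (4 * (real \<nn> ^ 2 + 2 * real \<nn> - 1)) * \<xi>"
  shows "\<exists>\<eta>0>0. \<forall>a0 N I J.
    a0 = \<eta>0 powr (1 / (real \<nn> + 1)) \<longrightarrow>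
    (\<forall>x::real. x \<ge> cf_denom \<alpha> N \<longrightarrow> exp (- C0 * x) \<le> a0 / x ^ \<nn>) \<longrightarrow>
    I = (\<lambda>n. {exp (- C0 * cf_denom \<alpha> (N + n)) .. a0 / cf_denom \<alpha> (N + n) ^ \<nn>}) \<longrightarrow>
    J = closure (\<Union>n. I n) \<longrightarrow>
    (\<exists>(X :: real \<times> real \<Rightarrow> real \<Rightarrow> real) (Xc :: complex \<times> complex \<Rightarrow> real \<Rightarrow> complex).
      (\<forall>\<epsilon>\<in>J. torus_periodic_on UNIV (\<lambda>\<psi>. X \<psi> \<epsilon>) \<and>
              ode_solution g A f \<omega> \<epsilon> (\<lambda>t. c + X (t *\<^sub>R \<omega>) \<epsilon>)) \<and>
      (\<forall>\<xi>'. 0 < \<xi>' \<and> \<xi>' < \<xi> / 4 \<longrightarrow>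
        (\<forall>\<epsilon>\<in>J. analytic_extension_to_strip (\<lambda>\<psi>. X \<psi> \<epsilon>) \<xi>' (\<lambda>\<psi>. Xc \<psi> \<epsilon>)) \<and>
        (\<forall>\<epsilon>0\<in>J. uniform_limit (strip \<xi>') (\<lambda>\<epsilon> \<psi>. Xc \<psi> \<epsilon>) (\<lambda>\<psi>. Xc \<psi> \<epsilon>0) (at \<epsilon>0 within J)) \<and>
        uniform_limit (strip \<xi>') (\<lambda>\<epsilon> \<psi>. Xc \<psi> \<epsilon>) (\<lambda>_. 0) (at 0 within J)))"
proof -
  \<comment> \<open>A quarter of \<xi>: then \<open>3 * s < \<xi>\<close> leaves room for the
    Fourier series of \<open>f\<close> to converge absolutely, and the gain \<open>2 * s\<close>
    between the two widths is the \<open>\<xi> / 2\<close> against which \<open>C0\<close> is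
    measured.\<close>
  define s where "s = \<xi> / 4"
  have s: "s > 0" "3 * s < \<xi>" using xi by (simp_all add: s_def)
  have nn2: "\<nn> \<ge> 2" using order by simp
  obtain a \<rho> C where gc: "gcoeffs a \<nn> \<rho> C" and an: "a \<nn> \<noteq> 0"
    and gA: "\<And>x. \<bar>x\<bar> \<le> \<rho> \<Longrightarrow> c + x \<in> A" and ga: "\<And>x. \<bar>x\<bar> \<le> \<rho> \<Longrightarrow> g (c + x) = f0 + gser a x"
    using gcoeffs_of_zero[OF g A c nn2] by metis
  obtain F where F: "analytic_extension_to_strip f \<xi> F" using xi by blast
  obtain u where u: "u \<in> wlat (3 * s)" "cf u 0 = 0"
    and uf: "\<And>\<psi>. evr (dil 3 u) (fst \<psi> / s, snd \<psi> / s) = f \<psi> - f0"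
    using forcing_element[OF s F] unfolding f0 by metis
  obtain \<theta> where \<theta>: "\<theta> > 0" and fam: "\<And>J. (\<forall>\<epsilon>\<in>J. \<epsilon> = 0 \<or> (\<exists>q. 0 < \<epsilon> \<and> q \<ge> 1 \<and> nonresonant \<alpha> q \<and> \<epsilon> * q ^ \<nn> \<le> \<theta> \<and>
      exp (- 2 * s * q) \<le> \<theta> * \<epsilon> ^ (\<nn> + 1))) \<Longrightarrow>
    (\<exists>S. S 0 = 0 \<and> (\<forall>\<epsilon>\<in>J. S \<epsilon> \<in> wlat s \<and> norm (S \<epsilon>) \<le> \<rho> \<and> approx_ode \<alpha> s a (dil 3 u) \<epsilon> (S \<epsilon>)) \<and>
      (\<forall>l>1. \<forall>\<epsilon>0\<in>insert 0 J. ((\<lambda>\<epsilon>. dil l (S \<epsilon>)) \<longlongrightarrow> dil l (S \<epsilon>0)) (at \<epsilon>0 within J)))"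
    using solution_family[OF gc order(1) an s(1) alpha u] by blast
  show ?thesis
  \<comment> \<open>An \<open>(n + 1)\<close>-st power, so that the prescribed root returns
    \<open>a0 = \<theta>\<close>.\<close>
  proof (rule exI[of _ "\<theta> ^ (\<nn> + 1)"], intro conjI allI impI)
    show "0 < \<theta> ^ (\<nn> + 1)" using \<theta> by (rule zero_less_power)
  next
    fix a0 :: real and N :: nat and I :: "nat \<Rightarrow> real set" and J :: "real set"
    assume a0: "a0 = (\<theta> ^ (\<nn> + 1)) powr (1 / (real \<nn> + 1))"
      and N: "\<forall>x::real. x \<ge> cf_denom \<alpha> N \<longrightarrow> exp (- C0 * x) \<le> a0 / x ^ \<nn>"
      and I: "I = (\<lambda>n. {exp (- C0 * cf_denom \<alpha> (N + n)) .. a0 / cf_denom \<alpha> (N + n) ^ \<nn>})"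
      and J: "J = closure (\<Union>n. I n)"
    have a0\<theta>: "a0 = \<theta>"
    proof -
      have "a0 = (\<theta> powr real (\<nn> + 1)) powr (1 / (real \<nn> + 1))" unfolding a0 using \<theta> by (simp only: powr_realpow)
      also have "\<dots> = \<theta> powr (real (\<nn> + 1) * (1 / (real \<nn> + 1)))" by (rule powr_powr)
      also have "real (\<nn> + 1) * (1 / (real \<nn> + 1)) = 1" by simp
      finally show ?thesis using \<theta> by simp
    qed
    define q where "q = (\<lambda>k. real_of_int (cf_denom \<alpha> (N + k)))"
    have q1: "q k \<ge> 1" and qk: "q k \<ge> real k" and qN: "q k \<ge> cf_denom \<alpha> N" for k
      using cf_denom_ge_1[OF alpha, of "N + k"] cf_denom_ge_self[OF alpha, of "N + k"] cf_denom_mono[OF alpha, of N "N + k"]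
      unfolding q_def by linarith+
    \<comment> \<open>The denominators grow at least linearly, so the upper ends of the intervals
      tend to 0, as the description of the closure requires.\<close>
    have lim: "(\<lambda>k. \<theta> / q k ^ \<nn>) \<longlonglongrightarrow> 0"
    proof (rule tendsto_sandwich[OF _ _ tendsto_const])
      have "\<theta> / q (Suc k) ^ \<nn> \<le> \<theta> / real (Suc k)" for k
      proof (rule divide_left_mono)
        have "q (Suc k) ^ 1 \<le> q (Suc k) ^ \<nn>" using q1 order by (intro power_increasing) auto
        then show "real (Suc k) \<le> q (Suc k) ^ \<nn>" using qk[of "Suc k"] by simp
        show "0 < q (Suc k) ^ \<nn> * real (Suc k)"
          by (intro mult_pos_pos zero_less_power less_le_trans[OF zero_less_one q1]) simp
      qed (use \<theta> in simp)
      then have "\<theta> / q k ^ \<nn> \<le> \<theta> / real k" if "k > 0" for k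
        using that by (metis Suc_pred)
      then show "\<forall>\<^sub>F k in sequentially. \<theta> / q k ^ \<nn> \<le> \<theta> / real k"
        unfolding eventually_sequentially by (intro exI[of _ 1]) auto
      show "(\<lambda>k. \<theta> / real k) \<longlonglongrightarrow> 0" by (rule lim_const_over_n)
      have "0 \<le> \<theta> / q k ^ \<nn>" for k
        by (intro divide_nonneg_nonneg zero_le_power order_trans[OF zero_le_one q1] less_imp_le[OF \<theta>])
      then show "\<forall>\<^sub>F k in sequentially. 0 \<le> \<theta> / q k ^ \<nn>" by simp
    qed
    have "\<forall>\<epsilon>\<in>J. \<epsilon> = 0 \<or> (\<exists>q. 0 < \<epsilon> \<and> q \<ge> 1 \<and> nonresonant \<alpha> q \<and> \<epsilon> * q ^ \<nn> \<le> \<theta> \<and>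
      exp (- 2 * s * q) \<le> \<theta> * \<epsilon> ^ (\<nn> + 1))"
    proof
      fix \<epsilon> assume "\<epsilon> \<in> J"
      then have "\<epsilon> \<in> closure (\<Union>n. {exp (- C0 * q n)..\<theta> / q n ^ \<nn>})" unfolding J I q_def a0\<theta> of_int_power .
      from closure_UN_intervals[OF _ lim this]
      have "\<epsilon> = 0 \<or> (\<exists>n. \<epsilon> \<in> {exp (- C0 * q n)..\<theta> / q n ^ \<nn>})" by simp
      then show "\<epsilon> = 0 \<or> (\<exists>q. 0 < \<epsilon> \<and> q \<ge> 1 \<and> nonresonant \<alpha> q \<and> \<epsilon> * q ^ \<nn> \<le> \<theta> \<and>
        exp (- 2 * s * q) \<le> \<theta> * \<epsilon> ^ (\<nn> + 1))"
      proof
        assume "\<exists>n. \<epsilon> \<in> {exp (- C0 * q n)..\<theta> / q n ^ \<nn>}"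
        then obtain n where n: "exp (- C0 * q n) \<le> \<epsilon>" "\<epsilon> \<le> \<theta> / q n ^ \<nn>" by auto
        \<comment> \<open>The property of \<open>N\<close> is used at \<open>q n\<close>, which is
          at least the denominator of index \<open>N\<close>; it supplies the bound of one factor of
          the exponential by \<theta>.\<close>
        have "exp (- C0 * q n) \<le> \<theta> / q n ^ \<nn>" using N qN[of n] unfolding a0\<theta> by blast
        from exponent_condition[OF nn2 C0 xi(1) q1 \<theta> this n(1)]
        have "exp (- 2 * s * q n) \<le> \<theta> * \<epsilon> ^ (\<nn> + 1)" unfolding s_def .
        moreover have "0 < \<epsilon>" using n(1) exp_gt_zero[of "- C0 * q n"] by linarith
        moreover have "\<epsilon> * q n ^ \<nn> \<le> \<theta>"
        proof -
          have "0 < q n ^ \<nn>" by (rule zero_less_power) (use q1[of n] in linarith)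
          then show ?thesis using n(2) by (simp add: pos_le_divide_eq)
        qed
        moreover have "nonresonant \<alpha> (q n)" unfolding q_def by (rule nonresonant_cf_denom[OF alpha])
        ultimately show ?thesis using q1[of n] by blast
      qed simp
    qed
    from fam[OF this] obtain S where S0: "S 0 = 0" and S: "\<And>\<epsilon>. \<epsilon> \<in> J \<Longrightarrow> S \<epsilon> \<in> wlat s"
      "\<And>\<epsilon>. \<epsilon> \<in> J \<Longrightarrow> norm (S \<epsilon>) \<le> \<rho>" "\<And>\<epsilon>. \<epsilon> \<in> J \<Longrightarrow> approx_ode \<alpha> s a (dil 3 u) \<epsilon> (S \<epsilon>)"
      and Slim: "\<And>l \<epsilon>0. l > 1 \<Longrightarrow> \<epsilon>0 \<in> insert 0 J \<Longrightarrow> ((\<lambda>\<epsilon>. dil l (S \<epsilon>)) \<longlongrightarrow> dil l (S \<epsilon>0)) (at \<epsilon>0 within J)"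
      by blast
    have lim: "uniform_limit (strip \<xi>') (\<lambda>\<epsilon> \<psi>. ev (S \<epsilon>) (fst \<psi> / of_real s, snd \<psi> / of_real s))
        (\<lambda>\<psi>. ev (S \<epsilon>0) (fst \<psi> / of_real s, snd \<psi> / of_real s)) (at \<epsilon>0 within J)"
      if "0 < \<xi>'" "\<xi>' < s" "\<epsilon>0 \<in> insert 0 J" for \<xi>' \<epsilon>0
      by (rule uniform_limit_strip[OF that(1,2) Slim[OF _ that(3)]]) (use that in simp)
    show "\<exists>(X :: real \<times> real \<Rightarrow> real \<Rightarrow> real) (Xc :: complex \<times> complex \<Rightarrow> real \<Rightarrow> complex).
      (\<forall>\<epsilon>\<in>J. torus_periodic_on UNIV (\<lambda>\<psi>. X \<psi> \<epsilon>) \<and>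
              ode_solution g A f \<omega> \<epsilon> (\<lambda>t. c + X (t *\<^sub>R \<omega>) \<epsilon>)) \<and>
      (\<forall>\<xi>'. 0 < \<xi>' \<and> \<xi>' < \<xi> / 4 \<longrightarrow>
        (\<forall>\<epsilon>\<in>J. analytic_extension_to_strip (\<lambda>\<psi>. X \<psi> \<epsilon>) \<xi>' (\<lambda>\<psi>. Xc \<psi> \<epsilon>)) \<and>
        (\<forall>\<epsilon>0\<in>J. uniform_limit (strip \<xi>') (\<lambda>\<epsilon> \<psi>. Xc \<psi> \<epsilon>) (\<lambda>\<psi>. Xc \<psi> \<epsilon>0) (at \<epsilon>0 within J)) \<and>
        uniform_limit (strip \<xi>') (\<lambda>\<epsilon> \<psi>. Xc \<psi> \<epsilon>) (\<lambda>_. 0) (at 0 within J))"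
    proof (rule exI[of _ "\<lambda>\<psi> \<epsilon>. evr (S \<epsilon>) (fst \<psi> / s, snd \<psi> / s)"],
        rule exI[of _ "\<lambda>\<psi> \<epsilon>. ev (S \<epsilon>) (fst \<psi> / of_real s, snd \<psi> / of_real s)"],
        unfold omega s_def[symmetric], intro conjI ballI allI impI)
      fix \<epsilon> assume e: "\<epsilon> \<in> J"
      show "torus_periodic_on UNIV (\<lambda>\<psi>. evr (S \<epsilon>) (fst \<psi> / s, snd \<psi> / s))"
        by (rule evr_torus_periodic[OF s(1) S(1)[OF e]])
      show "ode_solution g A f (1, \<alpha>) \<epsilon> (\<lambda>t. c + evr (S \<epsilon>) (fst (t *\<^sub>R (1, \<alpha>)) / s, snd (t *\<^sub>R (1, \<alpha>)) / s))"
        by (rule approx_ode_solution[OF s(1) gc gA ga uf S[OF e]])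
    next
      fix \<xi>' \<epsilon> assume "0 < \<xi>' \<and> \<xi>' < s" "\<epsilon> \<in> J"
      then show "analytic_extension_to_strip (\<lambda>\<psi>. evr (S \<epsilon>) (fst \<psi> / s, snd \<psi> / s)) \<xi>'
         (\<lambda>\<psi>. ev (S \<epsilon>) (fst \<psi> / of_real s, snd \<psi> / of_real s))"
        by (intro evr_analytic_extension[OF s(1) _ S(1)]) auto
    next
      fix \<xi>' \<epsilon>0 assume "0 < \<xi>' \<and> \<xi>' < s" "\<epsilon>0 \<in> J"
      then show "uniform_limit (strip \<xi>') (\<lambda>\<epsilon> \<psi>. ev (S \<epsilon>) (fst \<psi> / of_real s, snd \<psi> / of_real s))
        (\<lambda>\<psi>. ev (S \<epsilon>0) (fst \<psi> / of_real s, snd \<psi> / of_real s)) (at \<epsilon>0 within J)"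
        by (intro lim) auto
    next
      fix \<xi>' assume x: "0 < \<xi>' \<and> \<xi>' < s"
      have "ev (0::wa) z = 0" for z using ev_scaleR[of 0 0 z] by simp
      then show "uniform_limit (strip \<xi>') (\<lambda>\<epsilon> \<psi>. ev (S \<epsilon>) (fst \<psi> / of_real s, snd \<psi> / of_real s)) (\<lambda>_. 0) (at 0 within J)"
        using lim[of \<xi>' 0] x by (simp add: S0)
    qed
  qed
qed

end
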